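(* For every $\varepsilon > 0$ there exists $\lambda > 0$ such that the following holds. For every $n\in\mathbb{N}$ and every $m$ with $n^{4/3}(\log n)^4 \le m \le \lambda n^2$, there exists a collection $\mathcal{C}$ of $\varepsilon$-almost split pregraphs on $n$ vertices with $|\mathcal{C}| = e^{o(m)}$ such that all but at most $e^{-\lambda m}\cdot|\mathcal{F}^{\mathrm{ind}}_{n,m}(C_4)|$ of the graphs in $\mathcal{F}^{\mathrm{ind}}_{n,m}(C_4)$ are contained in some $\mathcal{P}\in\mathcal{C}$.
   Context: $\mathcal{F}^{\mathrm{ind}}_{n,m}(C_4)$ is the family of graphs on $\{1,\dots,n\}$ with exactly $m$ edges and no induced $4$-cycle. A pregraph on $n$ vertices is a pair $\mathcal{P}=(M,E)$ of disjoint subsets of $E(K_n)$; a graph $G$ on $\{1,\dots,n\}$ is contained in $\mathcal{P}$ if $E\subseteq E(G)\subseteq E\cup M$. $\mathcal{P}$ is an $\varepsilon$-almost split pregraph if there is a partition $V(K_n) = U\cup W$ with $|E| \le \binom{|U|}{2}$, $e_E(U) \ge (1-\varepsilon)\binom{|U|}{2}$ and $e_M(W) \le 7\sqrt{\varepsilon}\,|U| n$, where $e_X(S)$ is the number of elements of $X$ with both endpoints in $S$. The notation $o(m)$ refers to $n \to \infty$. *)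

theory Defs
  imports Complex_Main
begin

text \<open>A graph on \<open>{1..n}\<close> is identified with its edge set, a subset of \<open>complete_edges n\<close>.\<close>

definition complete_edges :: "nat \<Rightarrow> nat set set" where
  "complete_edges n = {e. e \<subseteq> {1..n} \<and> card e = 2}"

definition edges_within :: "nat set set \<Rightarrow> nat set \<Rightarrow> nat set set" where
  "edges_within X S = {e \<in> X. e \<subseteq> S}"

definition has_induced_C4 :: "nat \<Rightarrow> nat set set \<Rightarrow> bool" where
  "has_induced_C4 n G \<longleftrightarrow>
     (\<exists>a b c d. distinct [a, b, c, d] \<and> {a, b, c, d} \<subseteq> {1..n} \<and>
        edges_within G {a, b, c, d} = {{a, b}, {b, c}, {c, d}, {d, a}})"

definition ind_C4_free_graphs :: "nat \<Rightarrow> nat \<Rightarrow> nat set set set" where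
  "ind_C4_free_graphs n m =
     {G. G \<subseteq> complete_edges n \<and> card G = m \<and> \<not> has_induced_C4 n G}"

text \<open>The first component \<open>M\<close> holds the undecided (``mixed'') pairs, the second
  component \<open>E\<close> the pairs that are edges of every contained graph.\<close>

type_synonym pregraph = "nat set set \<times> nat set set"

definition is_pregraph :: "nat \<Rightarrow> pregraph \<Rightarrow> bool" where
  "is_pregraph n P \<longleftrightarrow>
     (case P of (M, E) \<Rightarrow>
        M \<subseteq> complete_edges n \<and> E \<subseteq> complete_edges n \<and> M \<inter> E = {})"

definition contained_in :: "nat set set \<Rightarrow> pregraph \<Rightarrow> bool" where
  "contained_in G P \<longleftrightarrow> (case P of (M, E) \<Rightarrow> E \<subseteq> G \<and> G \<subseteq> E \<union> M)"

text \<open>The parts \<open>U\<close> and \<open>W\<close> are allowed to be empty.\<close>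

definition almost_split :: "nat \<Rightarrow> real \<Rightarrow> pregraph \<Rightarrow> bool" where
  "almost_split n \<epsilon> P \<longleftrightarrow>
     is_pregraph n P \<and>
     (case P of (M, E) \<Rightarrow>
        \<exists>U W. U \<union> W = {1..n} \<and> U \<inter> W = {} \<and>
          card E \<le> card U choose 2 \<and>
          real (card (edges_within E U)) \<ge> (1 - \<epsilon>) * real (card U choose 2) \<and>
          real (card (edges_within M W)) \<le> 7 * sqrt \<epsilon> * real (card U) * real n)"

definition admissible :: "real \<Rightarrow> nat \<Rightarrow> nat \<Rightarrow> bool" where
  "admissible lam n m \<longleftrightarrow>
     real n powr (4 / 3) * ln (real n) ^ 4 \<le> real m \<and> real m \<le> lam * real n ^ 2"

text \<open>A quantity \<open>h n m\<close> is \<open>o(m)\<close> as \<open>n \<rightarrow> \<infinity>\<close>, uniformly over all \<open>m\<close> in the admissible range.\<close>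

definition little_o_m :: "real \<Rightarrow> (nat \<Rightarrow> nat \<Rightarrow> real) \<Rightarrow> bool" where
  "little_o_m lam h \<longleftrightarrow>
     (\<forall>c>0. \<forall>\<^sub>F n in sequentially. \<forall>m. admissible lam n m \<longrightarrow> \<bar>h n m\<bar> \<le> c * real m)"

end

theory Submission
  imports Defs
begin

text \<open>An induced 4-cycle is a 6-tuple of pairs, two of which (the diagonals) must be non-edges and
  four of which must be edges. An asymmetric container lemma shows: whenever a pregraph carries a
  sufficiently spread weighting of its potential induced 4-cycles, a small set of queries to a graph
  without induced 4-cycles either removes a constant fraction of the mixed pairs or adds many edges.
  Iterating this, one is left with pregraphs without a spread weighting. If such a pregraph has
  \<open>k n\<close> mixed pairs and about \<open>k\<^sup>2 / 2\<close> edges, then nearly all mixed pairs meet vertices of linear degree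
  (hubs), the hub neighbourhoods of most vertices are nearly cliques, and the neighbourhood of an
  average vertex gives the clique side of an almost split partition. Pregraphs with too few mixed
  pairs or too many edges contain a negligible fraction of all graphs, by comparison with split
  graphs whose clique side has the right size.\<close>

section \<open>Asymmetric containers for weighted tuples\<close>

text \<open>The six coordinates of a potential cycle are not alike, since nearly every pair is a
  non-edge of a graph with \<open>m\<close> edges. For a diagonal the queries may stop with much
  weight left on values that are individually light; then about \<open>m / b\<close> colours are
  used, and some heavy colour class meets the graph in at most \<open>b\<close> pairs, few enough to
  be listed. The exponent \<open>4 / 3\<close> comes from single cycles: they have weight about
  \<open>1 / k ^ 4\<close>, which the container lemma tolerates when \<open>b ^ 5\<close> exceeds a
  multiple of \<open>m\<^sup>2 * n ^ 4\<close>. For \<open>b\<close> slightly below \<open>m\<close>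
  this says that \<open>m ^ 3\<close> beats \<open>n ^ 4\<close>, and the powers of the logarithm
  pay for the gap between \<open>b\<close> and \<open>m\<close>. The absence of a spread weighting
  is exploited by stability: the numbers of hub neighbours have mean about \<open>k\<close> and,
  because \<open>E\<close> has hardly more than \<open>k\<^sup>2 / 2\<close> edges, mean square
  about \<open>k\<^sup>2\<close>, so that Cauchy-Schwarz is nearly an equality.\<close>

text \<open>A uniformly random colouring attains the bound in expectation. The induction
  derandomises this: a new point gets the colour of least total weight towards the points already
  coloured, which is at most the average over the \<open>q\<close> colours.\<close>

lemma colouring_exists:
  fixes W :: "'v \<Rightarrow> 'v \<Rightarrow> real" and q :: nat
  assumes "finite V" "q \<ge> 1" and W: "\<And>u v. W u v \<ge> 0"
  shows "\<exists>c. (\<forall>v. c v < q) \<and>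
    (\<Sum>u\<in>V. \<Sum>v\<in>V-{u}. if c u = c v then W u v else 0)
      \<le> (\<Sum>u\<in>V. \<Sum>v\<in>V-{u}. W u v) / real q"
  using assms(1)
proof (induction V rule: finite_induct)
  case empty
  show ?case using assms(2) by (intro exI[of _ "\<lambda>_. 0"]) auto
next
  case (insert x V)
  then obtain c where c: "\<And>v. c v < q"
    "(\<Sum>u\<in>V. \<Sum>v\<in>V-{u}. if c u = c v then W u v else 0)
      \<le> (\<Sum>u\<in>V. \<Sum>v\<in>V-{u}. W u v) / real q" by blast
  \<comment> \<open>\<open>g j\<close> is the monochromatic weight created by giving
    \<open>x\<close> the colour \<open>j\<close>; both orders of a pair count.\<close>
  define g where "g j = (\<Sum>v\<in>V. if c v = j then W x v + W v x else 0)" for j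
  have gs: "(\<Sum>j<q. g j) = (\<Sum>v\<in>V. W x v + W v x)"
  proof -
    have "(\<Sum>j<q. g j) = (\<Sum>v\<in>V. \<Sum>j<q. if c v = j then W x v + W v x else 0)"
      unfolding g_def by (rule sum.swap)
    also have "\<dots> = (\<Sum>v\<in>V. W x v + W v x)"
      using c(1) by (intro sum.cong refl) (simp add: sum.delta')
    finally show ?thesis .
  qed
  obtain j where j: "j < q" "g j \<le> (\<Sum>v\<in>V. W x v + W v x) / real q"
  proof (rule ccontr)
    assume "\<not> thesis"
    then have "\<And>j. j < q \<Longrightarrow> (\<Sum>v\<in>V. W x v + W v x) / real q < g j"
      using that by force
    then have "(\<Sum>j<q. (\<Sum>v\<in>V. W x v + W v x) / real q) < (\<Sum>j<q. g j)"
      using assms(2) by (intro sum_strict_mono) (auto simp: lessThan_empty_iff)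
    then show False using gs assms(2) by simp
  qed
  define c' where "c' = c(x := j)"
  have split: "(\<Sum>u\<in>insert x V. \<Sum>v\<in>insert x V-{u}. f u v) =
     (\<Sum>u\<in>V. \<Sum>v\<in>V-{u}. f u v) + (\<Sum>v\<in>V. f x v + f v x)" for f :: "'v \<Rightarrow> 'v \<Rightarrow> real"
  proof -
    have "(\<Sum>u\<in>insert x V. \<Sum>v\<in>insert x V-{u}. f u v) = (\<Sum>v\<in>V. f x v) + (\<Sum>u\<in>V. \<Sum>v\<in>insert x V-{u}. f u v)"
      using insert by (simp add: insert_Diff_if)
    also have "(\<Sum>u\<in>V. \<Sum>v\<in>insert x V-{u}. f u v) = (\<Sum>u\<in>V. f u x + (\<Sum>v\<in>V-{u}. f u v))"
    proof (intro sum.cong refl)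
      fix u assume "u \<in> V"
      then have "insert x V - {u} = insert x (V - {u})" "x \<notin> V - {u}" using insert by auto
      then show "(\<Sum>v\<in>insert x V-{u}. f u v) = f u x + (\<Sum>v\<in>V-{u}. f u v)"
        using insert by simp
    qed
    finally show ?thesis by (simp add: sum.distrib)
  qed
  have "(\<Sum>u\<in>insert x V. \<Sum>v\<in>insert x V-{u}. if c' u = c' v then W u v else 0)
      = (\<Sum>u\<in>V. \<Sum>v\<in>V-{u}. if c' u = c' v then W u v else 0)
        + (\<Sum>v\<in>V. (if c' x = c' v then W x v else 0) + (if c' v = c' x then W v x else 0))"
    by (rule split)
  also have "(\<Sum>u\<in>V. \<Sum>v\<in>V-{u}. if c' u = c' v then W u v else 0)
      = (\<Sum>u\<in>V. \<Sum>v\<in>V-{u}. if c u = c v then W u v else 0)"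
    using insert unfolding c'_def by (intro sum.cong refl) auto
  also have "(\<Sum>v\<in>V. (if c' x = c' v then W x v else 0) + (if c' v = c' x then W v x else 0)) = g j"
    unfolding g_def c'_def using insert by (intro sum.cong refl) auto
  finally have "(\<Sum>u\<in>insert x V. \<Sum>v\<in>insert x V-{u}. if c' u = c' v then W u v else 0)
     \<le> (\<Sum>u\<in>V. \<Sum>v\<in>V-{u}. W u v) / real q + (\<Sum>v\<in>V. W x v + W v x) / real q"
    using c(2) j(2) by linarith
  also have "\<dots> = (\<Sum>u\<in>insert x V. \<Sum>v\<in>insert x V-{u}. W u v) / real q"
    by (simp add: split add_divide_distrib)
  finally show ?case using c(1) j(1) by (intro exI[of _ c']) (auto simp: c'_def)
qed

text \<open>Each such set arises from \<open>b\<close> choices, each an element of \<open>F\<close>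
  or nothing, whence the base \<open>card F + 1\<close>.\<close>

lemma card_bounded_subsets_le:
  assumes "finite F"
  shows "finite {Y. Y \<subseteq> F \<and> card Y \<le> b} \<and> card {Y. Y \<subseteq> F \<and> card Y \<le> b} \<le> (card F + 1) ^ b"
proof (induction b)
  case 0
  have "{Y. Y \<subseteq> F \<and> card Y \<le> 0} = {{}}" using assms by (auto dest: finite_subset)
  then show ?case by simp
next
  case (Suc b)
  define O' where "O' = insert None (Some ` F)"
  define f where "f = (\<lambda>(Y, x). case x of None \<Rightarrow> Y | Some v \<Rightarrow> insert (v::'a) Y)"
  let ?S = "{Y. Y \<subseteq> F \<and> card Y \<le> b}"
  have cO: "finite O'" "card O' = card F + 1" using assms by (auto simp: O'_def card_image)
  have sub: "{Y. Y \<subseteq> F \<and> card Y \<le> Suc b} \<subseteq> f ` (?S \<times> O')"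
  proof
    fix Y assume Y: "Y \<in> {Y. Y \<subseteq> F \<and> card Y \<le> Suc b}"
    show "Y \<in> f ` (?S \<times> O')"
    proof (cases "card Y \<le> b")
      case True
      then show ?thesis using Y by (intro image_eqI[of _ _ "(Y, None)"]) (auto simp: f_def O'_def)
    next
      case False
      then have "Y \<noteq> {}" by auto
      then obtain v where v: "v \<in> Y" by blast
      have "finite Y" using Y assms finite_subset by blast
      then have "card (Y - {v}) \<le> b" using Y v by (auto simp: card_Diff_singleton)
      then show ?thesis using Y v
        by (intro image_eqI[of _ _ "(Y - {v}, Some v)"]) (auto simp: f_def O'_def)
    qed
  qed
  have fin: "finite (f ` (?S \<times> O'))" using Suc cO by blast
  have "card (f ` (?S \<times> O')) \<le> card (?S \<times> O')" using Suc cO by (intro card_image_le) blast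
  also have "\<dots> = card ?S * (card F + 1)" by (simp add: card_cartesian_product cO)
  also have "\<dots> \<le> (card F + 1) ^ b * (card F + 1)" using Suc by (intro mult_right_mono) auto
  also have "\<dots> = (card F + 1) ^ Suc b" by simp
  finally have "card (f ` (?S \<times> O')) \<le> (card F + 1) ^ Suc b" .
  then show ?case using card_mono[OF fin sub] finite_subset[OF sub fin] by linarith
qed

section \<open>Weighted tuples, fibres and decision trees\<close>

locale weighted_tuples =
  fixes Om :: "'w set" and mu :: "'w \<Rightarrow> real" and p :: "nat \<Rightarrow> 'w \<Rightarrow> 'v"
  assumes fin: "finite Om" and nonneg: "\<And>x. 0 \<le> mu x"
begin

abbreviation mass :: "'w set \<Rightarrow> real" where "mass \<equiv> sum mu"

text \<open>The point \<open>x\<close> only names values on the coordinates \<open>J\<close> and may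
  lie outside \<open>A\<close>. For \<open>J = {}\<close> the fibre is all of
  \<open>A\<close>.\<close>

definition fib :: "nat set \<Rightarrow> 'w \<Rightarrow> 'w set \<Rightarrow> 'w set" where
  "fib J x A = {y \<in> A. \<forall>i\<in>J. p i y = p i x}"

text \<open>The weighted form of the degree and codegree conditions for hypergraph containers;
  \<open>K\<close> collects the coordinates that are still to be processed.\<close>

definition spread :: "nat set \<Rightarrow> (nat set \<Rightarrow> real) \<Rightarrow> 'w set \<Rightarrow> bool" where
  "spread K D A \<longleftrightarrow> (\<forall>J x. J \<subseteq> K \<longrightarrow> J \<noteq> {} \<longrightarrow> mass (fib J x A) \<le> D J)"

lemma mass_mono: "A \<subseteq> B \<Longrightarrow> B \<subseteq> Om \<Longrightarrow> mass A \<le> mass B"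
  by (rule sum_mono2) (auto intro: finite_subset[OF _ fin] nonneg)

lemma mass_Un_le: "A \<subseteq> Om \<Longrightarrow> B \<subseteq> Om \<Longrightarrow> mass (A \<union> B) \<le> mass A + mass B"
proof -
  assume sub: "A \<subseteq> Om" "B \<subseteq> Om"
  then have "finite A" "finite B" using fin finite_subset by blast+
  then have "mass (A \<union> B) = mass A + mass B - mass (A \<inter> B)" by (rule sum_Un)
  then show ?thesis using sum_nonneg[of "A \<inter> B" mu] nonneg by simp
qed

lemma mass_UN_le:
  assumes "finite I" "\<And>i. i \<in> I \<Longrightarrow> F i \<subseteq> Om"
  shows "mass (\<Union>i\<in>I. F i) \<le> (\<Sum>i\<in>I. mass (F i))"
  using assms
proof (induction I rule: finite_induct)
  case (insert i I)
  have "mass (F i \<union> (\<Union>i\<in>I. F i)) \<le> mass (F i) + mass (\<Union>i\<in>I. F i)"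
    using insert.prems by (intro mass_Un_le) auto
  then show ?case using insert by fastforce
qed simp

lemma fib_subset: "fib J x A \<subseteq> A"
  by (auto simp: fib_def)

lemma fib_mono: "A \<subseteq> B \<Longrightarrow> fib J x A \<subseteq> fib J x B"
  by (auto simp: fib_def)

text \<open>Both sides are the total weight of the pairs in \<open>A \<times> B\<close> that agree
  on \<open>J\<close>.\<close>

lemma mass_fib_swap:
  assumes "A \<subseteq> Om" "B \<subseteq> Om"
  shows "(\<Sum>x\<in>A. mu x * mass (fib J x B)) = (\<Sum>y\<in>B. mu y * mass (fib J y A))"
proof -
  have fA: "finite A" "finite B" using assms fin finite_subset by blast+
  have e: "mass (fib J x C) = (\<Sum>y\<in>C. if \<forall>i\<in>J. p i y = p i x then mu y else 0)"
    if "finite C" for C x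
    unfolding fib_def using that by (rule sum.inter_filter)
  have "(\<Sum>x\<in>A. mu x * mass (fib J x B)) =
      (\<Sum>x\<in>A. \<Sum>y\<in>B. if \<forall>i\<in>J. p i y = p i x then mu x * mu y else 0)"
    using e[OF fA(2)] by (simp add: sum_distrib_left if_distrib cong: if_cong)
  also have "\<dots> = (\<Sum>y\<in>B. \<Sum>x\<in>A. if \<forall>i\<in>J. p i y = p i x then mu x * mu y else 0)"
    by (rule sum.swap)
  also have "\<dots> = (\<Sum>y\<in>B. mu y * mass (fib J y A))"
  proof (rule sum.cong[OF refl])
    fix y
    have "mass (fib J y A) = (\<Sum>x\<in>A. if \<forall>i\<in>J. p i y = p i x then mu x else 0)"
      by (subst e[OF fA(1)]) (auto intro!: sum.cong simp: eq_commute)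
    then show "(\<Sum>x\<in>A. if \<forall>i\<in>J. p i y = p i x then mu x * mu y else 0) = mu y * mass (fib J y A)"
      by (simp add: sum_distrib_left if_distrib mult.commute cong: if_cong)
  qed
  finally show ?thesis .
qed

text \<open>Markov's inequality for the number of agreeing pairs: exchanging \<open>A\<close> and
  \<open>B\<close> replaces fibres of \<open>B\<close> by fibres of \<open>A\<close>, which weigh at
  most \<open>d\<close>. Later \<open>B\<close> is a light collected part, so few tuples of
  \<open>A\<close> sit over its saturated fibres.\<close>

lemma saturated_mass_le:
  assumes "A \<subseteq> Om" "B \<subseteq> Om" "t > 0" "\<And>x. mass (fib J x A) \<le> d"
  shows "mass {x\<in>A. t \<le> mass (fib J x B)} \<le> d * mass B / t"
proof -
  have fA: "finite A" "finite B" using assms fin finite_subset by blast+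
  have "t * mass {x\<in>A. t \<le> mass (fib J x B)} = (\<Sum>x\<in>{x\<in>A. t \<le> mass (fib J x B)}. mu x * t)"
    by (simp add: sum_distrib_left mult.commute)
  also have "\<dots> \<le> (\<Sum>x\<in>{x\<in>A. t \<le> mass (fib J x B)}. mu x * mass (fib J x B))"
    by (intro sum_mono mult_left_mono nonneg) auto
  also have "\<dots> \<le> (\<Sum>x\<in>A. mu x * mass (fib J x B))"
    using fA by (intro sum_mono2) (auto intro!: mult_nonneg_nonneg nonneg sum_nonneg)
  also have "\<dots> = (\<Sum>y\<in>B. mu y * mass (fib J y A))" by (rule mass_fib_swap[OF assms(1,2)])
  also have "\<dots> \<le> (\<Sum>y\<in>B. mu y * d)"
    by (intro sum_mono mult_left_mono nonneg assms)
  also have "\<dots> = d * mass B" by (simp add: sum_distrib_left mult.commute)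
  finally show ?thesis using assms(3) by (simp add: field_simps)
qed

lemma mass_values_le:
  assumes "A \<subseteq> Om" "finite Z" "\<And>x. mass (fib {i} x A) \<le> d" "d \<ge> 0"
  shows "mass {x\<in>A. p i x \<in> Z} \<le> real (card Z) * d"
proof -
  have fA: "finite A" using assms fin finite_subset by blast
  have "mass {x\<in>A. p i x \<in> Z} = (\<Sum>z\<in>Z. mass {x\<in>{x\<in>A. p i x \<in> Z}. p i x = z})"
    using fA assms(2) by (intro sum.group[symmetric]) auto
  also have "\<dots> \<le> (\<Sum>z\<in>Z. d)"
  proof (rule sum_mono)
    fix z assume "z \<in> Z"
    show "mass {x\<in>{x\<in>A. p i x \<in> Z}. p i x = z} \<le> d"
    proof (cases "\<exists>x\<in>A. p i x = z")
      case True
      then obtain x where "x \<in> A" "p i x = z" by blast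
      then have "{x\<in>{x\<in>A. p i x \<in> Z}. p i x = z} \<subseteq> fib {i} x A" by (auto simp: fib_def)
      then show ?thesis using mass_mono[of _ "fib {i} x A"] assms(1) assms(3)[of x] fib_subset[of "{i}" x A]
        by (meson order_trans)
    next
      case False
      then have "{x\<in>{x\<in>A. p i x \<in> Z}. p i x = z} = {}" by auto
      then show ?thesis using assms(4) by (metis sum.empty)
    qed
  qed
  finally show ?thesis by simp
qed

text \<open>A state of the query process on coordinate \<open>i\<close>: \<open>Y\<close> and \<open>Z\<close> are the values found inside and
  outside the unknown set, \<open>B\<close> is the part of \<open>A\<close> collected over \<open>Y\<close>.\<close>

definition avail :: "nat set \<Rightarrow> (nat set \<Rightarrow> real) \<Rightarrow> nat \<Rightarrow> 'w set \<Rightarrow> 'v set \<Rightarrow> 'v set \<Rightarrow> 'w set \<Rightarrow> 'w set" where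
  "avail K t i A Y Z B =
     {x\<in>A. p i x \<notin> Y \<union> Z \<and> (\<forall>J\<subseteq>K. J \<noteq> {} \<longrightarrow> mass (fib J x B) < t J)}"

text \<open>The invariant of the process. Every value in \<open>Y\<close> brought mass at least
  \<open>h\<close> into \<open>B\<close>, so \<open>b\<close> hits suffice for mass
  \<open>b * h\<close>. A fibre of \<open>B\<close> overshoots the threshold \<open>t J\<close> only
  by its last enlargement, which lies over one value of coordinate \<open>i\<close> and hence weighs
  at most \<open>D (insert i J)\<close>.\<close>

definition query_state where
  "query_state K t D i A h b Y Z B \<longleftrightarrow>
     B \<subseteq> A \<and> p i ` B \<subseteq> Y \<and> Y \<subseteq> p i ` A \<and> Z \<subseteq> p i ` A \<and> real (card Y) * h \<le> mass B \<and> card Y \<le> b \<and>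
     (\<forall>J x. J \<subseteq> K \<longrightarrow> J \<noteq> {} \<longrightarrow> mass (fib J x B) \<le> t J + D (insert i J))"

lemma query_stateD:
  assumes "query_state K t D i A h b Y Z B"
  shows "B \<subseteq> A" "p i ` B \<subseteq> Y" "Y \<subseteq> p i ` A" "real (card Y) * h \<le> mass B" "card Y \<le> b"
    "Z \<subseteq> p i ` A" "J \<subseteq> K \<Longrightarrow> J \<noteq> {} \<Longrightarrow> mass (fib J x B) \<le> t J + D (insert i J)"
proof -
  note c = assms[unfolded query_state_def]
  from c show "B \<subseteq> A" by (elim conjE)
  from c show "p i ` B \<subseteq> Y" by (elim conjE)
  from c show "Y \<subseteq> p i ` A" by (elim conjE)
  from c show "real (card Y) * h \<le> mass B" by (elim conjE)
  from c show "card Y \<le> b" by (elim conjE)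
  from c show "Z \<subseteq> p i ` A" by (elim conjE)
  from c have "\<forall>J x. J \<subseteq> K \<longrightarrow> J \<noteq> {} \<longrightarrow> mass (fib J x B) \<le> t J + D (insert i J)" by (elim conjE)
  then show "J \<subseteq> K \<Longrightarrow> J \<noteq> {} \<Longrightarrow> mass (fib J x B) \<le> t J + D (insert i J)" by blast
qed

lemma query_state_finite: "A \<subseteq> Om \<Longrightarrow> query_state K t D i A h b Y Z B \<Longrightarrow> finite Y"
  using query_stateD(3) fin by (meson finite_imageI finite_subset)

text \<open>The slice over \<open>v\<close> consists of tuples whose fibres in \<open>B\<close> are
  still below threshold, so a fibre that grows starts below \<open>t J\<close>. The added part
  agrees on \<open>J\<close> and on coordinate \<open>i\<close>, which gives the second term of the
  bound.\<close>

lemma query_state_hit: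
  assumes A: "A \<subseteq> Om" and D: "spread (insert i K) D A" and D0: "\<And>J. 0 \<le> D J"
    and st: "query_state K t D i A h b Y Z B" and h: "h > 0" and lt: "mass B < real b * h"
    and v: "h \<le> mass {x \<in> avail K t i A Y Z B. p i x = v}"
  shows "query_state K t D i A h b (insert v Y) Z (B \<union> {x \<in> avail K t i A Y Z B. p i x = v})"
    and "v \<in> p i ` A - (Y \<union> Z)"
proof -
  define N where "N = {x \<in> avail K t i A Y Z B. p i x = v}"
  have BA: "B \<subseteq> A" "p i ` B \<subseteq> Y" "Y \<subseteq> p i ` A" "real (card Y) * h \<le> mass B" "card Y \<le> b"
    "Z \<subseteq> p i ` A"
    and fb: "\<And>J x. J \<subseteq> K \<Longrightarrow> J \<noteq> {} \<Longrightarrow> mass (fib J x B) \<le> t J + D (insert i J)"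
    by (rule query_stateD[OF st]; assumption)+
  have Nav: "y \<in> A" "p i y = v" "v \<notin> Y \<union> Z" "J \<subseteq> K \<Longrightarrow> J \<noteq> {} \<Longrightarrow> mass (fib J y B) < t J"
    if "y \<in> N" for y J
    using that unfolding N_def avail_def by auto
  have NA: "N \<subseteq> A" using Nav(1) by blast
  have vN: "h \<le> mass N" using v unfolding N_def .
  have "N \<noteq> {}" using vN h by auto
  then have vW': "v \<in> p i ` A - (Y \<union> Z)" using Nav by blast
  then show "v \<in> p i ` A - (Y \<union> Z)" .
  have fA: "finite A" using A fin finite_subset by blast
  have finY: "finite Y" using BA(3) fA finite_surj by blast
  have disj: "B \<inter> N = {}" using BA(2) Nav(2,3) by blast
  have mB: "mass (B \<union> N) = mass B + mass N"
    using disj BA(1) NA fA by (intro sum.union_disjoint) (auto intro: finite_subset)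
  have "real (card Y) * h < real b * h" using BA(4) lt by linarith
  then have cY: "card Y < b" using h by simp
  have 3: "real (card (insert v Y)) * h \<le> mass (B \<union> N)"
    using vW' finY mB vN BA(4) by (simp add: distrib_right)
  have 4: "mass (fib J x (B \<union> N)) \<le> t J + D (insert i J)" if J: "J \<subseteq> K" "J \<noteq> {}" for J x
  proof -
    have un: "fib J x (B \<union> N) = fib J x B \<union> fib J x N" by (auto simp: fib_def)
    show ?thesis
    proof (cases "fib J x N = {}")
      case True
      then show ?thesis using fb[OF J, of x] un by simp
    next
      case False
      then obtain y where y: "y \<in> N" "\<forall>j\<in>J. p j y = p j x" unfolding fib_def by blast
      have "fib J x B = fib J y B" using y(2) by (auto simp: fib_def)
      then have 1: "mass (fib J x B) < t J" using Nav(4)[OF y(1) J] by simp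
      have "fib J x N \<subseteq> fib (insert i J) y A" using y Nav(1,2) unfolding fib_def by auto
      then have "mass (fib J x N) \<le> mass (fib (insert i J) y A)"
        by (rule mass_mono) (use fib_subset[of "insert i J" y A] A in blast)
      also have "\<dots> \<le> D (insert i J)"
        using D[unfolded spread_def, rule_format, of "insert i J" y] J(1) by auto
      finally have 2: "mass (fib J x N) \<le> D (insert i J)" .
      have "fib J x B \<subseteq> Om" "fib J x N \<subseteq> Om"
        using fib_subset[of J x B] fib_subset[of J x N] BA(1) NA A by blast+
      then have "mass (fib J x (B \<union> N)) \<le> mass (fib J x B) + mass (fib J x N)"
        unfolding un by (rule mass_Un_le)
      then show ?thesis using 1 2 by linarith
    qed
  qed
  have 5: "B \<union> N \<subseteq> A" "p i ` (B \<union> N) \<subseteq> insert v Y" "insert v Y \<subseteq> p i ` A"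
    using BA(1,2,3) NA Nav(2) vW' by blast+
  have 6: "card (insert v Y) \<le> b" using cY finY by (simp add: card_insert_if)
  show "query_state K t D i A h b (insert v Y) Z (B \<union> {x \<in> avail K t i A Y Z B. p i x = v})"
    unfolding N_def[symmetric] query_state_def by (intro conjI allI impI 3 4 5 6 BA(6))
qed

definition query_leaves where
  "query_leaves K t D i A h b T \<longleftrightarrow> (\<forall>(Y, Z, B)\<in>T. query_state K t D i A h b Y Z B \<and>
     (mass B < real b * h \<longrightarrow> (\<forall>v. mass {x \<in> avail K t i A Y Z B. p i x = v} < h)))"

text \<open>While some value has available mass \<open>h\<close>, ask whether it belongs to
  \<open>I\<close>: a yes moves it to \<open>Y\<close> and collects its slice, a no moves it to
  \<open>Z\<close>. Only \<open>b - card Y\<close> further yes answers are possible, so the exponent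
  in the number of leaves counts hits only, however many misses occur.\<close>

lemma query_tree:
  assumes A: "A \<subseteq> Om" and D: "spread (insert i K) D A" and D0: "\<And>J. 0 \<le> D J" and h: "h > 0"
    and st: "query_state K t D i A h b Y Z B"
  shows "\<exists>T. finite T \<and> card T \<le> (card (p i ` A - (Y \<union> Z)) + 1) ^ (b - card Y) \<and>
    query_leaves K t D i A h b T \<and>
    (\<forall>I. Y \<subseteq> I \<longrightarrow> Z \<inter> I = {} \<longrightarrow> (\<exists>(Y', Z', B')\<in>T. Y' \<subseteq> I \<and> Z' \<inter> I = {}))"
  using st
proof (induction "card (p i ` A - (Y \<union> Z))" arbitrary: Y Z B rule: less_induct)
  case less
  show ?case
  proof (cases "mass B < real b * h \<longrightarrow> (\<forall>v. mass {x \<in> avail K t i A Y Z B. p i x = v} < h)")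
    case True
    then have "query_leaves K t D i A h b {(Y, Z, B)}"
      using less.prems unfolding query_leaves_def by simp
    then show ?thesis by (intro exI[of _ "{(Y, Z, B)}"]) auto
  next
    case False
    then obtain v where lt: "mass B < real b * h" and "\<not> mass {x \<in> avail K t i A Y Z B. p i x = v} < h"
      by blast
    then have v: "h \<le> mass {x \<in> avail K t i A Y Z B. p i x = v}" by linarith
    define B1 where "B1 = B \<union> {x \<in> avail K t i A Y Z B. p i x = v}"
    have st1: "query_state K t D i A h b (insert v Y) Z B1"
      unfolding B1_def by (rule query_state_hit[OF A D D0 less.prems h lt v])
    have vW: "v \<in> p i ` A - (Y \<union> Z)" by (rule query_state_hit(2)[OF A D D0 less.prems h lt v])
    have st2: "query_state K t D i A h b Y (insert v Z) B"
      unfolding query_state_def using query_stateD[OF less.prems] vW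
      by (intro conjI allI impI) auto
    have fA: "finite A" using A fin finite_subset by blast
    define N where "N = card (p i ` A - (Y \<union> Z))"
    have fW: "finite (p i ` A - (Y \<union> Z))" using fA by blast
    have W1: "p i ` A - (insert v Y \<union> Z) = (p i ` A - (Y \<union> Z)) - {v}"
      and W2: "p i ` A - (Y \<union> insert v Z) = (p i ` A - (Y \<union> Z)) - {v}" by auto
    have N1: "N = Suc (card ((p i ` A - (Y \<union> Z)) - {v}))"
      unfolding N_def using vW fW by (metis card.remove)
    have c1: "card (p i ` A - (insert v Y \<union> Z)) + 1 = N" "card (p i ` A - (Y \<union> insert v Z)) + 1 = N"
      unfolding W1 W2 N1 by simp_all
    have lt1: "card (p i ` A - (insert v Y \<union> Z)) < card (p i ` A - (Y \<union> Z))"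
      "card (p i ` A - (Y \<union> insert v Z)) < card (p i ` A - (Y \<union> Z))"
      using c1 N_def by linarith+
    obtain T1 where T1: "finite T1" "card T1 \<le> N ^ (b - card (insert v Y))"
      "query_leaves K t D i A h b T1"
      "\<forall>I. insert v Y \<subseteq> I \<longrightarrow> Z \<inter> I = {} \<longrightarrow> (\<exists>(Y', Z', B')\<in>T1. Y' \<subseteq> I \<and> Z' \<inter> I = {})"
      using less.hyps[OF lt1(1) st1] unfolding c1 by blast
    obtain T2 where T2: "finite T2" "card T2 \<le> N ^ (b - card Y)"
      "query_leaves K t D i A h b T2"
      "\<forall>I. Y \<subseteq> I \<longrightarrow> insert v Z \<inter> I = {} \<longrightarrow> (\<exists>(Y', Z', B')\<in>T2. Y' \<subseteq> I \<and> Z' \<inter> I = {})"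
      using less.hyps[OF lt1(2) st2] unfolding c1 by blast
    have "finite Y" by (rule query_state_finite[OF A less.prems])
    moreover have "card (insert v Y) \<le> b" by (rule query_stateD(5)[OF st1])
    \<comment> \<open>The yes branch has one hit fewer to spend, so the two bounds add up as
      \<open>N ^ c + N ^ (c + 1) = N ^ c * (N + 1)\<close>.\<close>
    ultimately have cY: "b - card Y = Suc (b - card (insert v Y))" using vW by auto
    have "card (T1 \<union> T2) \<le> N ^ (b - card (insert v Y)) + N ^ (b - card Y)"
      using card_Un_le[of T1 T2] T1(2) T2(2) by linarith
    also have "\<dots> = N ^ (b - card (insert v Y)) * (N + 1)" by (simp add: cY)
    also have "\<dots> \<le> (N + 1) ^ (b - card (insert v Y)) * (N + 1)"
      by (intro mult_right_mono power_mono) auto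
    also have "\<dots> = (N + 1) ^ (b - card Y)" by (simp add: cY)
    finally have cT: "card (T1 \<union> T2) \<le> (N + 1) ^ (b - card Y)" .
    have cov: "\<forall>I. Y \<subseteq> I \<longrightarrow> Z \<inter> I = {} \<longrightarrow> (\<exists>(Y', Z', B')\<in>T1 \<union> T2. Y' \<subseteq> I \<and> Z' \<inter> I = {})"
    proof (intro allI impI)
      fix I assume I: "Y \<subseteq> I" "Z \<inter> I = {}"
      show "\<exists>(Y', Z', B')\<in>T1 \<union> T2. Y' \<subseteq> I \<and> Z' \<inter> I = {}"
      proof (cases "v \<in> I")
        case True
        then have "insert v Y \<subseteq> I" using I by blast
        from T1(4)[rule_format, OF this I(2)] show ?thesis by (rule bexE) (erule bexI, erule UnI1)
      next
        case False
        then have "insert v Z \<inter> I = {}" using I by blast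
        from T2(4)[rule_format, OF I(1) this] show ?thesis by (rule bexE) (erule bexI, erule UnI2)
      qed
    qed
    have "query_leaves K t D i A h b (T1 \<union> T2)"
      using T1(3) T2(3) unfolding query_leaves_def by (rule ball_Un[THEN iffD2, OF conjI])
    then show ?thesis using T1(1) T2(1) cT cov unfolding N_def
      by (intro exI[of _ "T1 \<union> T2"]) simp
  qed
qed

text \<open>A tuple of \<open>A\<close> lies over \<open>Y\<close>, over \<open>Z\<close>, over a
  saturated fibre of \<open>B\<close>, or is available. The first kind weighs at most
  \<open>b * D {i}\<close> and the third little because \<open>B\<close> is light, so three quarters
  of the mass remain for the other two.\<close>

lemma query_stop_mass:
  assumes A: "A \<subseteq> Om" and K: "finite K" "card K \<le> 6" and D: "spread (insert i K) D A"
    and Dpos: "\<And>J. J \<noteq> {} \<Longrightarrow> 0 < D J" and a: "a = mass A" "a > 0" and x: "x > 0"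
    and t: "\<And>J. t J = 512 * x * D J / a" and hit: "real b * D {i} \<le> a / 8"
    and st: "query_state K t D i A h b Y Z B" and stop: "mass B < x"
  shows "3 / 4 * a \<le> mass {y\<in>A. p i y \<in> Z} + mass (avail K t i A Y Z B)"
proof -
  note s = query_stateD(1,3,5)[OF st]
  have fY: "finite Y" by (rule query_state_finite[OF A st])
  have Di: "mass (fib {i} y A) \<le> D {i}" for y using D unfolding spread_def by blast
  have mY: "mass {y\<in>A. p i y \<in> Y} \<le> a / 8"
  proof -
    have "mass {y\<in>A. p i y \<in> Y} \<le> real (card Y) * D {i}"
      using Dpos[of "{i}"] by (intro mass_values_le[OF A fY Di]) simp
    also have "\<dots> \<le> real b * D {i}" using s(3) Dpos[of "{i}"] by (intro mult_right_mono) auto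
    finally show ?thesis using hit by linarith
  qed
  \<comment> \<open>At most \<open>2 ^ 6\<close> coordinate sets occur; the factor
    \<open>512 = 8 * 64\<close> in \<open>t\<close> makes their saturated tuples weigh at most
    \<open>a / 8\<close> together.\<close>
  define Js where "Js = {J. J \<subseteq> K \<and> J \<noteq> {}}"
  have fJs: "finite Js" using K(1) unfolding Js_def by simp
  have "card Js \<le> card (Pow K)" using K(1) unfolding Js_def by (intro card_mono) auto
  also have "\<dots> \<le> 2 ^ 6" unfolding card_Pow[OF K(1)] by (rule power_increasing[OF K(2)]) simp
  finally have cJs: "card Js \<le> 64" by simp
  define Pr where "Pr J = {y\<in>A. t J \<le> mass (fib J y B)}" for J
  have mPr: "mass (Pr J) \<le> a / 512" if "J \<in> Js" for J
  proof -
    have J: "J \<subseteq> K" "J \<noteq> {}" using that unfolding Js_def by auto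
    have DJ: "D J > 0" by (rule Dpos[OF J(2)])
    have tJ: "t J > 0" using DJ x a by (simp add: t)
    have BO: "B \<subseteq> Om" using s(1) A by blast
    have fD: "mass (fib J y A) \<le> D J" for y
      using D[unfolded spread_def, rule_format, of J y] J by auto
    have "mass (Pr J) \<le> D J * mass B / t J"
      unfolding Pr_def by (rule saturated_mass_le[OF A BO tJ fD])
    also have "\<dots> \<le> D J * x / t J" using DJ tJ stop by (intro divide_right_mono mult_left_mono) auto
    also have "\<dots> = a / 512" using DJ x a by (simp add: t field_simps)
    finally show ?thesis .
  qed
  have "mass (\<Union>J\<in>Js. Pr J) \<le> (\<Sum>J\<in>Js. mass (Pr J))"
    using fJs A unfolding Pr_def by (intro mass_UN_le) auto
  also have "\<dots> \<le> (\<Sum>J\<in>Js. a / 512)" by (intro sum_mono mPr)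
  also have "\<dots> = real (card Js) * (a / 512)" by simp
  also have "\<dots> \<le> 64 * (a / 512)" using cJs a by (intro mult_right_mono) auto
  finally have mU: "mass (\<Union>J\<in>Js. Pr J) \<le> a / 8" by simp
  let ?U = "\<Union>J\<in>Js. Pr J"
  have cover: "A \<subseteq> ({y\<in>A. p i y \<in> Y} \<union> ?U) \<union> ({y\<in>A. p i y \<in> Z} \<union> avail K t i A Y Z B)"
  proof
    fix x assume x: "x \<in> A"
    show "x \<in> ({y\<in>A. p i y \<in> Y} \<union> ?U) \<union> ({y\<in>A. p i y \<in> Z} \<union> avail K t i A Y Z B)"
    proof (cases "p i x \<in> Y \<or> p i x \<in> Z \<or> x \<in> ?U")
      case True
      then show ?thesis using x by blast
    next
      case False
      have "mass (fib J x B) < t J" if "J \<subseteq> K" "J \<noteq> {}" for J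
      proof (rule ccontr)
        assume "\<not> mass (fib J x B) < t J"
        then have "x \<in> Pr J" using x unfolding Pr_def by simp
        moreover have "J \<in> Js" using that unfolding Js_def by simp
        ultimately show False using False by blast
      qed
      then have "x \<in> avail K t i A Y Z B" using x False unfolding avail_def by simp
      then show ?thesis by blast
    qed
  qed
  have sub: "{y\<in>A. p i y \<in> Y} \<subseteq> Om" "?U \<subseteq> Om" "{y\<in>A. p i y \<in> Z} \<subseteq> Om" "avail K t i A Y Z B \<subseteq> Om"
    using A unfolding Pr_def avail_def by auto
  have "a \<le> mass (({y\<in>A. p i y \<in> Y} \<union> ?U) \<union> ({y\<in>A. p i y \<in> Z} \<union> avail K t i A Y Z B))"
    unfolding a(1) using sub by (intro mass_mono[OF cover]) auto
  also have "\<dots> \<le> mass {y\<in>A. p i y \<in> Y} + mass ?U + (mass {y\<in>A. p i y \<in> Z} + mass (avail K t i A Y Z B))"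
    using mass_Un_le[OF sub(1,2)] mass_Un_le[OF sub(3,4)]
      mass_Un_le[OF Un_least[OF sub(1,2)] Un_least[OF sub(3,4)]] by linarith
  finally show ?thesis using mY mU by linarith
qed


lemma double_sum_group:
  fixes F :: "'w \<Rightarrow> 'w \<Rightarrow> real" and c :: "'v \<Rightarrow> nat"
  assumes fA: "finite A"
  shows "(\<Sum>x\<in>A. \<Sum>y\<in>A. if c (f x) = c (f y) then F x y else 0) =
    (\<Sum>u\<in>f ` A. \<Sum>v\<in>f ` A. if c u = c v then \<Sum>x\<in>{x\<in>A. f x = u}. \<Sum>y\<in>{y\<in>A. f y = v}. F x y else 0)"
proof -
  define H where "H x y = (if c (f x) = c (f y) then F x y else 0)" for x y
  have "(\<Sum>u\<in>f ` A. \<Sum>v\<in>f ` A. if c u = c v then \<Sum>x\<in>{x\<in>A. f x = u}. \<Sum>y\<in>{y\<in>A. f y = v}. F x y else 0)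
     = (\<Sum>u\<in>f ` A. \<Sum>v\<in>f ` A. \<Sum>x\<in>{x\<in>A. f x = u}. \<Sum>y\<in>{y\<in>A. f y = v}. H x y)"
    unfolding H_def by (intro sum.cong refl) auto
  also have "\<dots> = (\<Sum>u\<in>f ` A. \<Sum>x\<in>{x\<in>A. f x = u}. \<Sum>v\<in>f ` A. \<Sum>y\<in>{y\<in>A. f y = v}. H x y)"
    by (intro sum.cong refl sum.swap)
  also have "\<dots> = (\<Sum>u\<in>f ` A. \<Sum>x\<in>{x\<in>A. f x = u}. \<Sum>y\<in>A. H x y)"
    by (intro sum.cong refl sum.group) (use fA in auto)
  also have "\<dots> = (\<Sum>x\<in>A. \<Sum>y\<in>A. H x y)"
    by (intro sum.group) (use fA in auto)
  finally show ?thesis unfolding H_def by simp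
qed

text \<open>Give two values the weight of the pairs of tuples over them that agree on
  \<open>J\<close>, scaled by \<open>1 / t J\<close> and summed over \<open>J\<close>, and apply the
  colouring lemma. Off the diagonal this gains the factor \<open>1 / q\<close>; on the diagonal the
  tuples share the value at \<open>i\<close>, which \<open>D (insert i J)\<close> controls. These
  are the two terms of \<open>t J\<close>. A tuple with too large a fibre in its class contributes
  at least its own weight to the total. The set \<open>J = {}\<close> takes part and bounds the mass
  of a class.\<close>

lemma colour_classes:
  assumes A: "A \<subseteq> Om" and K: "finite K" "card K \<le> 6" and D: "spread (insert i K) D A"
    and Dpos: "\<And>J. J \<noteq> {} \<Longrightarrow> 0 < D J" and a: "a = mass A" "a > 0" and A2: "A2 \<subseteq> A"
    and q: "q \<ge> (1::nat)"
    and t: "\<And>J. t J = 512 * ((if J = {} then a else D J) / real q + D (insert i J))"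
  obtains c :: "'v \<Rightarrow> nat" where "\<And>v. c v < q"
    "mass {x\<in>A2. \<exists>J\<subseteq>K. t J < mass (fib J x {y\<in>A2. c (p i y) = c (p i x)})} \<le> a / 8"
proof -
  have fA2: "finite A2" using A A2 fin by (meson finite_subset)
  define DD where "DD J = (if J = {} then a else D J)" for J
  have DDpos: "DD J > 0" for J using Dpos a unfolding DD_def by auto
  have tpos: "t J > 0" for J unfolding t DD_def[symmetric]
    using DDpos[of J] Dpos[of "insert i J"] q by (simp add: add_pos_pos)
  have f1: "mass (fib J x A2) \<le> DD J" if "J \<subseteq> K" for J x
  proof -
    have "mass (fib J x A2) \<le> mass (fib J x A)"
      using fib_mono[OF A2] fib_subset[of J x A] A by (intro mass_mono) auto
    also have "\<dots> \<le> DD J"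
    proof (cases "J = {}")
      case True
      then show ?thesis unfolding DD_def a(1) using A by (intro order_trans[OF mass_mono[OF fib_subset]]) auto
    next
      case False
      then show ?thesis unfolding DD_def using D[unfolded spread_def, rule_format, of J x] that by auto
    qed
    finally show ?thesis .
  qed
  have f2: "mass (fib (insert i J) x A2) \<le> D (insert i J)" if "J \<subseteq> K" for J x
  proof -
    have "mass (fib (insert i J) x A2) \<le> mass (fib (insert i J) x A)"
      using fib_mono[OF A2] fib_subset[of "insert i J" x A] A by (intro mass_mono) auto
    also have "\<dots> \<le> D (insert i J)" using D[unfolded spread_def, rule_format, of "insert i J" x] that by auto
    finally show ?thesis .
  qed
  have mA2: "mass A2 \<le> a" unfolding a(1) by (rule mass_mono[OF A2 A])
  \<comment> \<open>Summing over all \<open>J\<close> in one weight makes a single colouring serve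
    every \<open>J\<close> at once.\<close>
  define F where "F x y = (\<Sum>J\<in>Pow K. (if \<forall>k\<in>J. p k y = p k x then mu x * mu y else 0) / t J)" for x y
  have F0: "F x y \<ge> 0" for x y
    unfolding F_def by (intro sum_nonneg divide_nonneg_nonneg) (auto intro: nonneg less_imp_le tpos mult_nonneg_nonneg)
  define W where "W u v = (\<Sum>x\<in>{x\<in>A2. p i x = u}. \<Sum>y\<in>{y\<in>A2. p i y = v}. F x y)" for u v
  define V where "V = p i ` A2"
  have fV: "finite V" unfolding V_def using fA2 by blast
  have W0: "W u v \<ge> 0" for u v unfolding W_def by (intro sum_nonneg F0)
  obtain c where c: "\<And>v. c v < q"
    "(\<Sum>u\<in>V. \<Sum>v\<in>V-{u}. if c u = c v then W u v else 0) \<le> (\<Sum>u\<in>V. \<Sum>v\<in>V-{u}. W u v) / real q"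
    using colouring_exists[OF fV q, of W] W0 by blast
  have inner: "(\<Sum>y\<in>C. F x y) = (\<Sum>J\<in>Pow K. mu x * mass (fib J x C) / t J)" if "finite C" for C x
  proof -
    have "(\<Sum>y\<in>C. F x y) = (\<Sum>J\<in>Pow K. \<Sum>y\<in>C. (if \<forall>k\<in>J. p k y = p k x then mu x * mu y else 0) / t J)"
      unfolding F_def by (rule sum.swap)
    also have "\<dots> = (\<Sum>J\<in>Pow K. mu x * mass (fib J x C) / t J)"
    proof (intro sum.cong refl)
      fix J
      have "mass (fib J x C) = (\<Sum>y\<in>C. if \<forall>k\<in>J. p k y = p k x then mu y else 0)"
        unfolding fib_def using that by (rule sum.inter_filter)
      then show "(\<Sum>y\<in>C. (if \<forall>k\<in>J. p k y = p k x then mu x * mu y else 0) / t J) = mu x * mass (fib J x C) / t J"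
        by (simp add: sum_distrib_left sum_divide_distrib if_distrib cong: if_cong)
    qed
    finally show ?thesis .
  qed
  have cls: "(\<Sum>y\<in>A2. if c (p i x) = c (p i y) then F x y else 0) = (\<Sum>y\<in>{y\<in>A2. c (p i y) = c (p i x)}. F x y)" for x
    using fA2 by (subst sum.inter_filter) (auto intro!: sum.cong)
  define bad where "bad = {x\<in>A2. \<exists>J\<subseteq>K. t J < mass (fib J x {y\<in>A2. c (p i y) = c (p i x)})}"
  have "mass bad \<le> (\<Sum>x\<in>bad. \<Sum>y\<in>{y\<in>A2. c (p i y) = c (p i x)}. F x y)"
  proof (rule sum_mono)
    fix x assume "x \<in> bad"
    then obtain J where J: "J \<subseteq> K" "t J < mass (fib J x {y\<in>A2. c (p i y) = c (p i x)})" (is "_ < ?m J")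
      unfolding bad_def by blast
    have "mu x = mu x * 1" by simp
    also have "\<dots> \<le> mu x * (?m J / t J)" using J(2) tpos[of J]
      by (intro mult_left_mono nonneg) (simp add: field_simps)
    also have "\<dots> = mu x * ?m J / t J" by simp
    also have "\<dots> \<le> (\<Sum>J\<in>Pow K. mu x * ?m J / t J)"
      using K J(1) tpos by (intro member_le_sum)
        (auto intro!: divide_nonneg_nonneg mult_nonneg_nonneg nonneg sum_nonneg less_imp_le[OF tpos])
    also have "\<dots> = (\<Sum>y\<in>{y\<in>A2. c (p i y) = c (p i x)}. F x y)" using fA2 by (subst inner) auto
    finally show "mu x \<le> (\<Sum>y\<in>{y\<in>A2. c (p i y) = c (p i x)}. F x y)" .
  qed
  also have "\<dots> \<le> (\<Sum>x\<in>A2. \<Sum>y\<in>{y\<in>A2. c (p i y) = c (p i x)}. F x y)"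
    using fA2 unfolding bad_def by (intro sum_mono2) (auto intro: sum_nonneg F0)
  also have "\<dots> = (\<Sum>x\<in>A2. \<Sum>y\<in>A2. if c (p i x) = c (p i y) then F x y else 0)" by (simp only: cls)
  also have "\<dots> = (\<Sum>u\<in>V. \<Sum>v\<in>V. if c u = c v then W u v else 0)"
    unfolding V_def W_def by (rule double_sum_group[OF fA2])
  also have "\<dots> = (\<Sum>u\<in>V. W u u + (\<Sum>v\<in>V-{u}. if c u = c v then W u v else 0))"
    using fV by (intro sum.cong refl) (subst sum.remove, auto)
  also have "\<dots> = (\<Sum>u\<in>V. W u u) + (\<Sum>u\<in>V. \<Sum>v\<in>V-{u}. if c u = c v then W u v else 0)"
    by (rule sum.distrib)
  also have "\<dots> \<le> (\<Sum>u\<in>V. W u u) + (\<Sum>u\<in>V. \<Sum>v\<in>V. W u v) / real q"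
  proof -
    have "(\<Sum>u\<in>V. \<Sum>v\<in>V-{u}. W u v) \<le> (\<Sum>u\<in>V. \<Sum>v\<in>V. W u v)"
      using fV W0 by (intro sum_mono sum_mono2) auto
    then have "(\<Sum>u\<in>V. \<Sum>v\<in>V-{u}. W u v) / real q \<le> (\<Sum>u\<in>V. \<Sum>v\<in>V. W u v) / real q"
      by (rule divide_right_mono) simp
    then show ?thesis using c(2) by linarith
  qed
  also have "(\<Sum>u\<in>V. \<Sum>v\<in>V. W u v) = (\<Sum>x\<in>A2. \<Sum>y\<in>A2. F x y)"
    using double_sum_group[OF fA2, of "\<lambda>_. 0" "p i" F] unfolding V_def W_def by simp
  also have "(\<Sum>u\<in>V. W u u) = (\<Sum>x\<in>A2. \<Sum>y\<in>{y\<in>A2. p i y = p i x}. F x y)"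
  proof -
    have "(\<Sum>u\<in>V. W u u) = (\<Sum>u\<in>V. \<Sum>x\<in>{x\<in>A2. p i x = u}. \<Sum>y\<in>{y\<in>A2. p i y = p i x}. F x y)"
      unfolding W_def by (intro sum.cong refl) auto
    also have "\<dots> = (\<Sum>x\<in>A2. \<Sum>y\<in>{y\<in>A2. p i y = p i x}. F x y)"
      unfolding V_def by (intro sum.group) (use fA2 in auto)
    finally show ?thesis .
  qed
  also have "(\<Sum>x\<in>A2. \<Sum>y\<in>{y\<in>A2. p i y = p i x}. F x y) \<le> (\<Sum>J\<in>Pow K. a * D (insert i J) / t J)"
  proof -
    have e: "fib J x {y\<in>A2. p i y = p i x} = fib (insert i J) x A2" for J x by (auto simp: fib_def)
    have "(\<Sum>x\<in>A2. \<Sum>y\<in>{y\<in>A2. p i y = p i x}. F x y)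
        = (\<Sum>x\<in>A2. \<Sum>J\<in>Pow K. mu x * mass (fib (insert i J) x A2) / t J)"
      using fA2 by (subst inner) (auto simp: e)
    also have "\<dots> = (\<Sum>J\<in>Pow K. \<Sum>x\<in>A2. mu x * mass (fib (insert i J) x A2) / t J)" by (rule sum.swap)
    also have "\<dots> \<le> (\<Sum>J\<in>Pow K. \<Sum>x\<in>A2. mu x * D (insert i J) / t J)"
      by (intro sum_mono divide_right_mono mult_left_mono nonneg less_imp_le[OF tpos] f2) auto
    also have "\<dots> = (\<Sum>J\<in>Pow K. mass A2 * D (insert i J) / t J)"
      by (simp add: sum_distrib_right sum_divide_distrib)
    also have "\<dots> \<le> (\<Sum>J\<in>Pow K. a * D (insert i J) / t J)"
      by (intro sum_mono divide_right_mono mult_right_mono mA2 less_imp_le[OF tpos] less_imp_le[OF Dpos]) auto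
    finally show ?thesis .
  qed
  also have "(\<Sum>x\<in>A2. \<Sum>y\<in>A2. F x y) \<le> (\<Sum>J\<in>Pow K. a * DD J / t J)"
  proof -
    have "(\<Sum>x\<in>A2. \<Sum>y\<in>A2. F x y) = (\<Sum>x\<in>A2. \<Sum>J\<in>Pow K. mu x * mass (fib J x A2) / t J)"
      using fA2 by (subst inner) auto
    also have "\<dots> = (\<Sum>J\<in>Pow K. \<Sum>x\<in>A2. mu x * mass (fib J x A2) / t J)" by (rule sum.swap)
    also have "\<dots> \<le> (\<Sum>J\<in>Pow K. \<Sum>x\<in>A2. mu x * DD J / t J)"
      by (intro sum_mono divide_right_mono mult_left_mono nonneg less_imp_le[OF tpos] f1) auto
    also have "\<dots> = (\<Sum>J\<in>Pow K. mass A2 * DD J / t J)"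
      by (simp add: sum_distrib_right sum_divide_distrib)
    also have "\<dots> \<le> (\<Sum>J\<in>Pow K. a * DD J / t J)"
      by (intro sum_mono divide_right_mono mult_right_mono mA2 less_imp_le[OF tpos] less_imp_le[OF DDpos])
    finally show ?thesis .
  qed
  \<comment> \<open>By the choice of \<open>t\<close> each \<open>J\<close> contributes exactly
    \<open>a / 512\<close>, and there are at most 64 of them.\<close>
  also have "(\<Sum>J\<in>Pow K. a * D (insert i J) / t J) + (\<Sum>J\<in>Pow K. a * DD J / t J) / real q
      = (\<Sum>J\<in>Pow K. a / 512)"
  proof -
    have "a * D (insert i J) / t J + a * DD J / t J / real q = a / 512" for J
    proof -
      have e: "D (insert i J) + DD J / real q = t J / 512" unfolding t DD_def by simp
      have "a * (D (insert i J) + DD J / real q) / t J = a * (t J / 512) / t J" by (simp only: e)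
      also have "\<dots> = a / 512" using tpos[of J] by (simp only: field_simps) simp
      finally have "a * (D (insert i J) + DD J / real q) / t J = a / 512" .
      then show ?thesis using tpos[of J] q by (simp add: field_simps)
    qed
    then show ?thesis by (simp only: sum_divide_distrib flip: sum.distrib)
  qed
  also have "\<dots> \<le> a / 8"
  proof -
    have "card (Pow K) \<le> 2 ^ 6" unfolding card_Pow[OF K(1)] by (rule power_increasing[OF K(2)]) simp
    then have "real (card (Pow K)) * (a / 512) \<le> 64 * (a / 512)" using a by (intro mult_right_mono) auto
    then show ?thesis by simp
  qed
  finally have "mass bad \<le> a / 8" by (simp add: divide_right_mono)
  then show ?thesis using that c(1) unfolding bad_def by blast
qed


text \<open>Colour the values with \<open>q\<close> colours so that the fibres inside a colour class shrink by a factor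
  \<open>q\<close>. Some class contains at most \<open>b\<close> elements of \<open>G\<close>, and \<open>T\<close> enumerates the possible
  intersections.\<close>

lemma low_phase:
  assumes A: "A \<subseteq> Om" and K: "finite K" "card K \<le> 6" and D: "spread (insert i K) D A"
    and Dpos: "\<And>J. J \<noteq> {} \<Longrightarrow> 0 < D J" and a: "a = mass A" "a > 0"
    and A2: "A2 \<subseteq> A" "a / 2 \<le> mass A2" and q: "q \<ge> (1::nat)" and m: "m \<ge> (1::nat)"
    and deg: "\<And>v. mass {x\<in>A2. p i x = v} \<le> a / (8 * real m)"
    and Di: "D {i} \<le> a / real q" and qb: "8192 * real m \<le> real q * real b"
  shows "\<exists>T. finite T \<and> card T \<le> q * (card (p i ` A) + 1) ^ b \<and>
    (\<forall>B\<in>T. B \<subseteq> A \<and> a / (8 * real q) \<le> mass B \<and>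
       (\<forall>J x. J \<subseteq> K \<longrightarrow> J \<noteq> {} \<longrightarrow> mass (fib J x B) \<le> 512 * (D J / real q + D (insert i J)))) \<and>
    (\<forall>G. finite G \<longrightarrow> card G \<le> m \<longrightarrow> (\<exists>B\<in>T. p i ` B \<inter> G = {}))"
proof -
  define t where "t J = 512 * ((if J = {} then a else D J) / real q + D (insert i J))" for J
  obtain c :: "'v \<Rightarrow> nat" where c: "\<And>v. c v < q"
    "mass {x\<in>A2. \<exists>J\<subseteq>K. t J < mass (fib J x {y\<in>A2. c (p i y) = c (p i x)})} \<le> a / 8"
    using colour_classes[OF A K D Dpos a A2(1) q t_def] by blast
  define Cl where "Cl j = {y\<in>A2. c (p i y) = j}" for j
  define Bc where "Bc j = {x\<in>Cl j. \<forall>J\<subseteq>K. mass (fib J x (Cl j)) \<le> t J}" for j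
  have fA: "finite A" "finite A2" using A A2 fin by (meson finite_subset)+
  have A2Om: "A2 \<subseteq> Om" using A A2 by blast
  have BcA2: "Bc j \<subseteq> A2" "Bc j \<subseteq> Cl j" "Cl j \<subseteq> A2" for j unfolding Bc_def Cl_def by auto
  have tpos: "t J > 0" for J unfolding t_def using Dpos[of J] Dpos[of "insert i J"] a(2) q by (simp add: add_pos_pos)
  define FY where "FY = {Y. Y \<subseteq> p i ` A \<and> card Y \<le> b}"
  have FY: "finite FY" "card FY \<le> (card (p i ` A) + 1) ^ b"
    using card_bounded_subsets_le[of "p i ` A" b] fA unfolding FY_def by auto
  \<comment> \<open>A candidate is a colour class without its tuples of large fibres and without the
    tuples over a guessed set \<open>Y\<close> of at most \<open>b\<close> values; light candidates
    are dropped.\<close>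
  define T where "T = {B \<in> (\<lambda>(j, Y). {x\<in>Bc j. p i x \<notin> Y}) ` ({..<q} \<times> FY). a / (8 * real q) \<le> mass B}"
  have "card T \<le> card ((\<lambda>(j, Y). {x\<in>Bc j. p i x \<notin> Y}) ` ({..<q} \<times> FY))"
    unfolding T_def using FY by (intro card_mono) auto
  also have "\<dots> \<le> card ({..<q} \<times> FY)" using FY by (intro card_image_le) auto
  also have "\<dots> \<le> q * (card (p i ` A) + 1) ^ b" using FY by (simp add: card_cartesian_product)
  finally have cT: "card T \<le> q * (card (p i ` A) + 1) ^ b" .
  have fT: "finite T" unfolding T_def using FY by auto
  have props: "B \<subseteq> A \<and> a / (8 * real q) \<le> mass B \<and>
       (\<forall>J x. J \<subseteq> K \<longrightarrow> J \<noteq> {} \<longrightarrow> mass (fib J x B) \<le> 512 * (D J / real q + D (insert i J)))" if BT: "B \<in> T" for B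
  proof -
    obtain j Y where jY: "B = {x\<in>Bc j. p i x \<notin> Y}" using BT unfolding T_def by auto
    have BB: "B \<subseteq> Bc j" using jY by auto
    have "mass (fib J x B) \<le> t J" if J: "J \<subseteq> K" for J x
    proof (cases "fib J x B = {}")
      case True
      then show ?thesis using tpos[of J] by (simp only: sum.empty less_imp_le)
    next
      case False
      then obtain y where y: "y \<in> B" "\<forall>k\<in>J. p k y = p k x" unfolding fib_def by blast
      have "fib J x B \<subseteq> fib J y (Cl j)" using y(2) BB BcA2(2)[of j] unfolding fib_def by auto
      then have "mass (fib J x B) \<le> mass (fib J y (Cl j))"
        using A2Om BcA2(3)[of j] fib_subset[of J y "Cl j"] by (intro mass_mono) auto
      also have "\<dots> \<le> t J" using y(1) BB J unfolding Bc_def by auto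
      finally show ?thesis .
    qed
    moreover have "B \<subseteq> A" using BB BcA2(1)[of j] A2(1) by blast
    ultimately have "mass (fib J x B) \<le> t J" "B \<subseteq> A" if "J \<subseteq> K" for J x using that by blast+
    moreover have "t J = 512 * (D J / real q + D (insert i J))" if "J \<noteq> {}" for J
      using that unfolding t_def by simp
    ultimately have "mass (fib J x B) \<le> 512 * (D J / real q + D (insert i J))"
      if "J \<subseteq> K" "J \<noteq> {}" for J x using that by metis
    then show ?thesis using BT \<open>B \<subseteq> A\<close> unfolding T_def by blast
  qed
  have cov: "\<exists>B\<in>T. p i ` B \<inter> G = {}" if G: "finite G" "card G \<le> m" for G
  proof -
    have cjq: "(\<Sum>j<q. mass {x\<in>X. c (p i x) = j}) = mass X" if "X \<subseteq> A2" for X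
      using that fA c(1) by (intro sum.group) (auto intro: finite_subset)
    define good where "good = {x\<in>A2. \<not> (\<exists>J\<subseteq>K. t J < mass (fib J x {y\<in>A2. c (p i y) = c (p i x)}))}"
    have Bcg: "Bc j = {x\<in>good. c (p i x) = j}" for j unfolding Bc_def good_def Cl_def by (auto simp: not_less)
    \<comment> \<open>Of the mass \<open>a / 2\<close> the ill-spread tuples take at most
      \<open>a / 8\<close>, and the at most \<open>m\<close> values in \<open>G\<close>, each of
      mass at most \<open>a / (8 * m)\<close>, take at most another \<open>a / 8\<close>.\<close>
    have m1: "mass (good - {x\<in>A2. p i x \<in> G}) \<ge> a / 4"
    proof -
      have "mass {x\<in>A2. p i x \<in> G} \<le> real (card G) * (a / (8 * real m))"
        using deg a by (intro mass_values_le[OF A2Om G(1)]) (auto simp: fib_def)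
      also have "\<dots> \<le> real m * (a / (8 * real m))" using G a by (intro mult_right_mono) auto
      also have "\<dots> = a / 8" using m by simp
      finally have 1: "mass {x\<in>A2. p i x \<in> G} \<le> a / 8" .
      let ?bad = "{x\<in>A2. \<exists>J\<subseteq>K. t J < mass (fib J x {y\<in>A2. c (p i y) = c (p i x)})}"
      have sub: "?bad \<subseteq> Om" "{x\<in>A2. p i x \<in> G} \<subseteq> Om" "good - {x\<in>A2. p i x \<in> G} \<subseteq> Om"
        using A2Om unfolding good_def by auto
      have cover: "A2 \<subseteq> (?bad \<union> {x\<in>A2. p i x \<in> G}) \<union> (good - {x\<in>A2. p i x \<in> G})" unfolding good_def by blast
      have "mass A2 \<le> mass ((?bad \<union> {x\<in>A2. p i x \<in> G}) \<union> (good - {x\<in>A2. p i x \<in> G}))"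
        using sub by (intro mass_mono[OF cover]) blast
      also have "\<dots> \<le> mass (?bad \<union> {x\<in>A2. p i x \<in> G}) + mass (good - {x\<in>A2. p i x \<in> G})"
        using sub by (intro mass_Un_le) blast+
      finally show ?thesis using 1 c(2) A2(2) mass_Un_le[OF sub(1,2)] by linarith
    qed
    define H where "H j = {x\<in>Bc j. p i x \<notin> G}" for j
    define gj where "gj j = card {v\<in>G. c v = j}" for j
    have sH: "(\<Sum>j<q. mass (H j)) \<ge> a / 4"
    proof -
      have gs: "good \<subseteq> A2" unfolding good_def by blast
      then have He: "H j = {x\<in>good - {x\<in>A2. p i x \<in> G}. c (p i x) = j}" for j
        unfolding H_def Bcg by blast
      have "good - {x\<in>A2. p i x \<in> G} \<subseteq> A2" using gs by blast
      then have "(\<Sum>j<q. mass (H j)) = mass (good - {x\<in>A2. p i x \<in> G})"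
        unfolding He by (rule cjq)
      then show ?thesis using m1 by simp
    qed
    have sg: "(\<Sum>j<q. gj j) = card G"
      using sum.group[of G "{..<q}" c "\<lambda>_. 1::nat"] G(1) c(1) unfolding gj_def by auto
    \<comment> \<open>Averaging of the mass of a class off \<open>G\<close> minus a charge of
      \<open>a / (8 * m)\<close> for each element of \<open>G\<close> of that colour. A class above
      the average is heavy; moreover its charge is at most its mass, hence at most
      \<open>1024 * (a / q)\<close>, so it contains at most \<open>8192 * m / q\<close>, and thus at
      most \<open>b\<close>, elements of \<open>G\<close>.\<close>
    obtain j where j: "j < q" "mass (H j) - a / (8 * real m) * real (gj j) \<ge> a / (8 * real q)"
    proof (rule ccontr)
      assume "\<not> thesis"
      then have "\<And>j. j < q \<Longrightarrow> mass (H j) - a / (8 * real m) * real (gj j) < a / (8 * real q)"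
        using that by force
      then have "(\<Sum>j<q. mass (H j) - a / (8 * real m) * real (gj j)) < (\<Sum>j<q. a / (8 * real q))"
        using q by (intro sum_strict_mono) (auto simp: lessThan_empty_iff)
      also have "\<dots> = a / 8" using q by simp
      also have "(\<Sum>j<q. mass (H j) - a / (8 * real m) * real (gj j))
          = (\<Sum>j<q. mass (H j)) - a / (8 * real m) * real (card G)"
        by (simp only: sum_subtractf sum_distrib_left[symmetric] of_nat_sum[symmetric] sg)
      finally have "a / 4 - a / (8 * real m) * real (card G) < a / 8" using sH by linarith
      moreover have "a / (8 * real m) * real (card G) \<le> a / (8 * real m) * real m"
        using a G by (intro mult_left_mono) auto
      moreover have "a / (8 * real m) * real m = a / 8" using m by simp
      ultimately show False by linarith
    qed
    define Y where "Y = G \<inter> p i ` Bc j"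
    have HY: "H j = {x\<in>Bc j. p i x \<notin> Y}" unfolding H_def Y_def by auto
    have "a / (8 * real m) * real (gj j) \<ge> 0" using a by simp
    then have mH: "mass (H j) \<ge> a / (8 * real q)" using j(2) by linarith
    have "H j \<noteq> {}"
    proof
      assume "H j = {}"
      then have "mass (H j) = 0" by simp
      moreover have "a / (8 * real q) > 0" using a q by simp
      ultimately show False using mH by linarith
    qed
    then obtain x0 where "x0 \<in> Bc j" unfolding H_def by blast
    then have "mass (fib {} x0 (Cl j)) \<le> t {}" unfolding Bc_def by blast
    then have "mass (Cl j) \<le> t {}" by (simp add: fib_def)
    moreover have "mass (H j) \<le> mass (Cl j)"
      using BcA2(2,3)[of j] A2Om unfolding H_def by (intro mass_mono) auto
    moreover have "t {} \<le> 1024 * (a / real q)" using Di unfolding t_def by simp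
    moreover have "a / (8 * real m) * real (gj j) \<le> mass (H j)"
    proof -
      have "a / (8 * real q) \<ge> 0" using a by simp
      then show ?thesis using j(2) by linarith
    qed
    ultimately have "a / (8 * real m) * real (gj j) \<le> 1024 * (a / real q)" by linarith
    then have "real (gj j) * real q \<le> 8192 * real m" using a q m by (simp add: field_simps)
    also have "\<dots> \<le> real b * real q" using qb by (simp add: mult.commute)
    finally have gb: "gj j \<le> b" using q by simp
    have "Y \<subseteq> {v\<in>G. c v = j}" using BcA2(2)[of j] unfolding Y_def Cl_def by auto
    then have "card Y \<le> gj j" unfolding gj_def using G by (intro card_mono) auto
    then have "Y \<in> FY" using gb BcA2(1)[of j] A2(1) unfolding FY_def Y_def by auto
    then have "H j \<in> T" unfolding T_def HY using j(1) mH[unfolded HY] by auto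
    then show ?thesis unfolding H_def by (intro bexI[of _ "H j"]) (auto simp: H_def)
  qed
  show ?thesis using fT cT props cov by blast
qed


text \<open>Spread relative to the mass of \<open>A\<close> itself: the profile \<open>w\<close> is
  fixed for the whole process and \<open>R\<close> records the losses so far, so the notion can be
  handed on to subsets of much smaller mass.\<close>

definition balanced :: "nat set \<Rightarrow> (nat set \<Rightarrow> real) \<Rightarrow> real \<Rightarrow> 'w set \<Rightarrow> bool" where
  "balanced K w R A \<longleftrightarrow> A \<subseteq> Om \<and> 0 < mass A \<and> spread K (\<lambda>J. R * w J * mass A) A"

section \<open>Processing a single coordinate\<close>

lemma query_state_empty:
  "(\<And>J. 0 \<le> t J) \<Longrightarrow> (\<And>J. 0 \<le> D J) \<Longrightarrow> query_state K t D i A h b {} {} {}"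
  unfolding query_state_def by (auto simp: fib_def add_nonneg_nonneg)

text \<open>For a coordinate whose value must belong to \<open>G\<close>. There are at most
  \<open>v\<close> values and a hit has mass \<open>h = a / (4 * v)\<close>, so once no heavy value
  is left the available mass is at most \<open>a / 4\<close>. Then half of the mass lies over the
  misses \<open>Z\<close>, and \<open>D {i}\<close> forces \<open>Z\<close> to be large. Otherwise
  the collected part is passed on; its loss \<open>516\<close> is \<open>512\<close> from the
  threshold plus \<open>4\<close> from the overshoot.\<close>

lemma step_one:
  assumes bal: "balanced (insert i K) w R A" and K: "finite K" "card K \<le> 6" and R: "R \<ge> 1"
    and w: "\<And>J. 0 < w J" and wi: "w {i} = 1 / real v"
    and wJ: "\<And>J. J \<subseteq> K \<Longrightarrow> J \<noteq> {} \<Longrightarrow> w (insert i J) \<le> real b / real v * w J"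
    and v: "card (p i ` A) \<le> v" "v > 0" and b: "b > 0" "8 * real b * R \<le> real v"
  shows "\<exists>T Q. finite T \<and> finite Q \<and> card T \<le> (v + 1) ^ b \<and> card Q \<le> (v + 1) ^ b \<and>
    (\<forall>B\<in>T. B \<subseteq> A \<and> balanced K w (516 * R) B) \<and>
    (\<forall>Z\<in>Q. Z \<subseteq> p i ` A \<and> real v / (2 * R) \<le> real (card Z)) \<and>
    (\<forall>G. (\<exists>B\<in>T. p i ` B \<subseteq> G) \<or> (\<exists>Z\<in>Q. Z \<inter> G = {}))"
proof -
  define a where "a = mass A"
  define D where "D J = R * w J * a" for J
  define h where "h = a / (4 * real v)"
  define x where "x = real b * h"
  define t where "t J = 512 * x * D J / a" for J
  have A: "A \<subseteq> Om" and a0: "a > 0" and sp: "spread (insert i K) D A"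
    using bal unfolding balanced_def a_def D_def by auto
  have fA: "finite A" using A fin finite_subset by blast
  have Dpos: "D J > 0" for J unfolding D_def using R w[of J] a0 by simp
  have h0: "h > 0" unfolding h_def using a0 v by simp
  have x0: "x > 0" unfolding x_def using h0 b by simp
  have tpos: "t J > 0" for J unfolding t_def using x0 Dpos[of J] a0 by simp
  have hit: "real b * D {i} \<le> a / 8"
  proof -
    have "real b * D {i} = (8 * real b * R) * a / (8 * real v)" unfolding D_def wi by simp
    also have "\<dots> \<le> real v * a / (8 * real v)" using b a0 by (intro divide_right_mono mult_right_mono) auto
    also have "\<dots> = a / 8" using v by simp
    finally show ?thesis .
  qed
  have st: "query_state K t D i A h b {} {} {}"
    by (rule query_state_empty) (auto intro: less_imp_le tpos Dpos)
  obtain T where T: "finite T" "card T \<le> (card (p i ` A - ({} \<union> {})) + 1) ^ (b - card ({}::'v set))"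
    "query_leaves K t D i A h b T"
    "\<forall>I. {} \<subseteq> I \<longrightarrow> {} \<inter> I = {} \<longrightarrow> (\<exists>(Y', Z', B')\<in>T. Y' \<subseteq> I \<and> Z' \<inter> I = {})"
    using query_tree[OF A sp less_imp_le[OF Dpos] h0 st] by blast
  define T1 where "T1 = (\<lambda>(Y, Z, B). B) ` {(Y, Z, B)\<in>T. x \<le> mass B}"
  define Q where "Q = (\<lambda>(Y, Z, B). Z) ` {(Y, Z, B)\<in>T. mass B < x}"
  have "card T \<le> (card (p i ` A) + 1) ^ b" using T(2) by simp
  also have "\<dots> \<le> (v + 1) ^ b" using v by (intro power_mono) auto
  finally have cT: "card T \<le> (v + 1) ^ b" .
  have cT1: "card T1 \<le> (v + 1) ^ b" and cQ: "card Q \<le> (v + 1) ^ b"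
  proof -
    have sub: "{(Y, Z, B)\<in>T. x \<le> mass B} \<subseteq> T" "{(Y, Z, B)\<in>T. mass B < x} \<subseteq> T" by auto
    have "card T1 \<le> card {(Y, Z, B)\<in>T. x \<le> mass B}" unfolding T1_def
      by (rule card_image_le[OF finite_subset[OF sub(1) T(1)]])
    also have "\<dots> \<le> card T" by (rule card_mono[OF T(1) sub(1)])
    finally show "card T1 \<le> (v + 1) ^ b" using cT by linarith
    have "card Q \<le> card {(Y, Z, B)\<in>T. mass B < x}" unfolding Q_def
      by (rule card_image_le[OF finite_subset[OF sub(2) T(1)]])
    also have "\<dots> \<le> card T" by (rule card_mono[OF T(1) sub(2)])
    finally show "card Q \<le> (v + 1) ^ b" using cT by linarith
  qed
  have fin1: "finite T1" "finite Q" unfolding T1_def Q_def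
    by (rule finite_imageI, rule finite_subset[OF _ T(1)], auto)+
  have leaf: "query_state K t D i A h b Y Z B"
    "mass B < x \<Longrightarrow> mass {y \<in> avail K t i A Y Z B. p i y = u} < h" if "(Y, Z, B) \<in> T" for Y Z B u
    using T(3) that unfolding query_leaves_def x_def by auto
  have g1: "B \<subseteq> A \<and> balanced K w (516 * R) B" if "B \<in> T1" for B
  proof -
    obtain Y Z where TB: "(Y, Z, B) \<in> T" "x \<le> mass B" using \<open>B \<in> T1\<close> unfolding T1_def by auto
    note qs = query_stateD[OF leaf(1)[OF TB(1)]]
    have "mass (fib J y B) \<le> 516 * R * w J * mass B" if J: "J \<subseteq> K" "J \<noteq> {}" for J y
    proof -
      have "t J = 512 * R * w J * x" unfolding t_def D_def using a0 by simp
      moreover have "D (insert i J) \<le> 4 * R * w J * x"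
      proof -
        have "D (insert i J) \<le> R * (real b / real v * w J) * a"
          unfolding D_def using wJ[OF J] R a0 by (intro mult_right_mono mult_left_mono) auto
        also have "\<dots> = 4 * R * w J * x" unfolding x_def h_def by simp
        finally show ?thesis .
      qed
      ultimately have "mass (fib J y B) \<le> 516 * R * w J * x" using qs(7)[OF J, of y] by linarith
      also have "\<dots> \<le> 516 * R * w J * mass B" using TB(2) R w[of J] by (intro mult_left_mono) auto
      finally show ?thesis .
    qed
    then have "spread K (\<lambda>J. 516 * R * w J * mass B) B" unfolding spread_def by blast
    moreover have "B \<subseteq> Om" using qs(1) A by blast
    ultimately show ?thesis unfolding balanced_def using qs(1) TB(2) x0 by auto
  qed
  have g2: "Z \<subseteq> p i ` A \<and> real v / (2 * R) \<le> real (card Z)" if "Z \<in> Q" for Z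
  proof -
    obtain Y B where TB: "(Y, Z, B) \<in> T" "mass B < x" using \<open>Z \<in> Q\<close> unfolding Q_def by auto
    note qs = query_stateD[OF leaf(1)[OF TB(1)]]
    have Zs: "Z \<subseteq> p i ` A" by (rule qs(6))
    then have fZ: "finite Z" using fA finite_surj by blast
    have fa: "mass (avail K t i A Y Z B) \<le> a / 4"
    proof -
      let ?V = "avail K t i A Y Z B"
      have VA: "?V \<subseteq> A" unfolding avail_def by auto
      have "?V = {y\<in>?V. p i y \<in> p i ` A}" using VA by auto
      then have "mass ?V = mass {y\<in>?V. p i y \<in> p i ` A}" by simp
      also have "\<dots> \<le> real (card (p i ` A)) * h"
        using VA A fA h0 less_imp_le[OF leaf(2)[OF TB]]
        by (intro mass_values_le) (auto simp: fib_def)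
      also have "\<dots> \<le> real v * h" using v h0 by (intro mult_right_mono) auto
      also have "\<dots> = a / 4" unfolding h_def using v by simp
      finally show ?thesis .
    qed
    have "3 / 4 * a \<le> mass {y\<in>A. p i y \<in> Z} + mass (avail K t i A Y Z B)"
      by (rule query_stop_mass[OF A K sp Dpos a_def a0 x0 t_def hit leaf(1)[OF TB(1)] TB(2)])
    then have "a / 2 \<le> mass {y\<in>A. p i y \<in> Z}" using fa by linarith
    also have "\<dots> \<le> real (card Z) * D {i}"
      using sp[unfolded spread_def, rule_format, of "{i}"] less_imp_le[OF Dpos]
      by (intro mass_values_le[OF A fZ]) auto
    also have "\<dots> = a * (real (card Z) * R / real v)" unfolding D_def wi by simp
    finally have "a * (1 / 2) \<le> a * (real (card Z) * R / real v)" by simp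
    then have "1 / 2 \<le> real (card Z) * R / real v" using a0 by (rule mult_left_le_imp_le)
    then have "real v / (2 * R) \<le> real (card Z)" using v R by (simp add: field_simps)
    then show ?thesis using Zs by blast
  qed
  have g3: "(\<exists>B\<in>T1. p i ` B \<subseteq> G) \<or> (\<exists>Z\<in>Q. Z \<inter> G = {})" for G
  proof -
    obtain Y Z B where TB: "(Y, Z, B) \<in> T" "Y \<subseteq> G" "Z \<inter> G = {}" using T(4)[rule_format, of G] by auto
    show ?thesis
    proof (cases "x \<le> mass B")
      case True
      then have "B \<in> T1" using TB(1) unfolding T1_def by force
      moreover have "p i ` B \<subseteq> G" using query_stateD(2)[OF leaf(1)[OF TB(1)]] TB(2) by blast
      ultimately show ?thesis by blast
    next
      case False
      then have "Z \<in> Q" using TB(1) unfolding Q_def by force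
      then show ?thesis using TB(3) by blast
    qed
  qed
  show ?thesis
    by (rule exI[of _ T1], rule exI[of _ Q])
      (intro conjI ballI allI fin1 cT1 cQ conjunct1[OF g1] conjunct2[OF g1] conjunct1[OF g2] conjunct2[OF g2] g3)
qed

text \<open>For a coordinate whose value must avoid \<open>G\<close> the tree is run against the
  complement of \<open>G\<close>, so \<open>Y\<close> avoids \<open>G\<close> and \<open>Z\<close>
  lies inside it. There may be far more than \<open>m\<close> values, so stopping no longer makes
  the available mass small. If the misses carry a quarter of the mass, \<open>Z\<close> is a large
  subset of \<open>G\<close>; if not, half of the mass is available over values lighter than
  \<open>a / (8 * m)\<close>, and the colouring phase takes over.\<close>

lemma step_zero:
  assumes bal: "balanced (insert i K) w R A" and K: "finite K" "card K \<le> 6" and R: "R \<ge> 1"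
    and w: "\<And>J. 0 < w J" and wi: "w {i} = 1 / r" and r: "r > 0"
    and wJ: "\<And>J. J \<subseteq> K \<Longrightarrow> J \<noteq> {} \<Longrightarrow> w (insert i J) \<le> real b / real m * w J"
    and N: "card (p i ` A) \<le> N" and b: "b > 0" "8 * real b * R \<le> r" "b \<le> m"
    and rb: "8193 * R * real m \<le> r * real b"
  shows "\<exists>T Q. finite T \<and> finite Q \<and>
    card T \<le> (8194 * m + 1) * (N + 1) ^ (2 * b) \<and> card Q \<le> (8194 * m + 1) * (N + 1) ^ (2 * b) \<and>
    (\<forall>B\<in>T. B \<subseteq> A \<and> balanced K w (2 ^ 26 * R) B) \<and>
    (\<forall>Z\<in>Q. Z \<subseteq> p i ` A \<and> r / (4 * R) \<le> real (card Z)) \<and>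
    (\<forall>G. finite G \<longrightarrow> card G \<le> m \<longrightarrow> (\<exists>B\<in>T. p i ` B \<inter> G = {}) \<or> (\<exists>Z\<in>Q. Z \<subseteq> G))"
proof -
  define a where "a = mass A"
  define D where "D J = R * w J * a" for J
  define h where "h = a / (8 * real m)"
  define x where "x = real b * h"
  define t where "t J = 512 * x * D J / a" for J
  have m0: "m > 0" using b by linarith
  have A: "A \<subseteq> Om" and a0: "a > 0" and sp: "spread (insert i K) D A"
    using bal unfolding balanced_def a_def D_def by auto
  have fA: "finite A" using A fin finite_subset by blast
  have Dpos: "D J > 0" for J unfolding D_def using R w[of J] a0 by simp
  have h0: "h > 0" unfolding h_def using a0 m0 by simp
  have x0: "x > 0" unfolding x_def using h0 b by simp
  have tpos: "t J > 0" for J unfolding t_def using x0 Dpos[of J] a0 by simp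
  have hit: "real b * D {i} \<le> a / 8"
  proof -
    have "real b * D {i} = (8 * real b * R) * a / (8 * r)" unfolding D_def wi by simp
    also have "\<dots> \<le> r * a / (8 * r)" using b a0 r by (intro divide_right_mono mult_right_mono) auto
    also have "\<dots> = a / 8" using r by simp
    finally show ?thesis .
  qed
  \<comment> \<open>The number of colours is chosen with \<open>q * b\<close> between
    \<open>8192 * m\<close> and \<open>8193 * m\<close>: the lower bound limits the elements of
    \<open>G\<close> in the selected class to \<open>b\<close>, the upper one keeps the loss
    \<open>512 * 8194 * 8\<close> below \<open>2 ^ 26\<close>.\<close>
  define q where "q = 8193 * m div b"
  have bm8: "8192 * m \<le> q * b" and qb: "q * b \<le> 8193 * m"
  proof -
    have e: "q * b + 8193 * m mod b = 8193 * m" unfolding q_def by (rule div_mult_mod_eq)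
    moreover have "8193 * m mod b < b" using b by simp
    ultimately show "8192 * m \<le> q * b" "q * b \<le> 8193 * m" using b by linarith+
  qed
  have qr: "8192 * real m \<le> real q * real b" "real q * real b \<le> 8193 * real m"
    using bm8 qb by (metis of_nat_mult of_nat_le_iff of_nat_numeral)+
  have q1: "q \<ge> 1" using bm8 m0 by (cases q) auto
  have "q \<le> q * b" using b by simp
  then have q8: "q \<le> 8193 * m" using qb by linarith
  have Di: "D {i} \<le> a / real q"
  proof -
    have "R * real q * real b \<le> R * (8193 * real m)" using qr R by (simp add: mult.assoc mult_left_mono)
    also have "\<dots> \<le> r * real b" using rb by (simp add: mult.left_commute)
    finally have "R * real q \<le> r" using b by simp
    then have "R / r \<le> 1 / real q" using r q1 by (simp add: field_simps)
    then have "a * (R / r) \<le> a * (1 / real q)" using a0 by (intro mult_left_mono) auto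
    then show ?thesis unfolding D_def wi by (simp add: mult.commute)
  qed
  have st: "query_state K t D i A h b {} {} {}"
    by (rule query_state_empty) (auto intro: less_imp_le tpos Dpos)
  obtain T where T: "finite T" "card T \<le> (card (p i ` A - ({} \<union> {})) + 1) ^ (b - card ({}::'v set))"
    "query_leaves K t D i A h b T"
    "\<forall>I. {} \<subseteq> I \<longrightarrow> {} \<inter> I = {} \<longrightarrow> (\<exists>(Y', Z', B')\<in>T. Y' \<subseteq> I \<and> Z' \<inter> I = {})"
    using query_tree[OF A sp less_imp_le[OF Dpos] h0 st] by blast
  have cT: "card T \<le> (N + 1) ^ b"
  proof -
    have "card T \<le> (card (p i ` A) + 1) ^ b" using T(2) by simp
    also have "\<dots> \<le> (N + 1) ^ b" using N by (intro power_mono) auto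
    finally show ?thesis .
  qed
  have leaf: "query_state K t D i A h b Y Z B"
    "mass B < x \<Longrightarrow> mass {y \<in> avail K t i A Y Z B. p i y = u} < h" if "(Y, Z, B) \<in> T" for Y Z B u
    using T(3) that unfolding query_leaves_def x_def by auto
  define lowT where "lowT = {(Y, Z, B)\<in>T. mass B < x \<and> mass {y\<in>A. p i y \<in> Z} < a / 4}"
  have lowT: "lowT \<subseteq> T" unfolding lowT_def by auto
  define ok where "ok L \<longleftrightarrow> finite L \<and> card L \<le> q * (card (p i ` A) + 1) ^ b \<and>
    (\<forall>B\<in>L. B \<subseteq> A \<and> a / (8 * real q) \<le> mass B \<and>
       (\<forall>J x. J \<subseteq> K \<longrightarrow> J \<noteq> {} \<longrightarrow> mass (fib J x B) \<le> 512 * (D J / real q + D (insert i J)))) \<and>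
    (\<forall>G. finite G \<longrightarrow> card G \<le> m \<longrightarrow> (\<exists>B\<in>L. p i ` B \<inter> G = {}))" for L
  have "\<exists>L. ok L" if "l \<in> lowT" for l
  proof -
    obtain Y Z B where l: "(Y, Z, B) \<in> T" "mass B < x" "mass {y\<in>A. p i y \<in> Z} < a / 4"
      using \<open>l \<in> lowT\<close> unfolding lowT_def by blast
    have "3 / 4 * a \<le> mass {y\<in>A. p i y \<in> Z} + mass (avail K t i A Y Z B)"
      by (rule query_stop_mass[OF A K sp Dpos a_def a0 x0 t_def hit leaf(1)[OF l(1)] l(2)])
    then have m2: "a / 2 \<le> mass (avail K t i A Y Z B)" using l(3) by linarith
    have "avail K t i A Y Z B \<subseteq> A" unfolding avail_def by auto
    moreover have "mass {y \<in> avail K t i A Y Z B. p i y = u} \<le> a / (8 * real m)" for u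
      using leaf(2)[OF l(1,2), of u] unfolding h_def by simp
    ultimately show ?thesis unfolding ok_def
      using m0 by (intro low_phase[OF A K sp Dpos a_def a0 _ m2 q1 _ _ Di qr(1)]) auto
  qed
  then have "\<forall>l\<in>lowT. \<exists>L. ok L" by blast
  from bchoice[OF this] obtain L where okL: "\<forall>l\<in>lowT. ok (L l)" ..
  note L = okL[rule_format, unfolded ok_def]
  define T1 where "T1 = (\<lambda>(Y, Z, B). B) ` {(Y, Z, B)\<in>T. x \<le> mass B}"
  define T2 where "T2 = (\<Union>l\<in>lowT. L l)"
  define Q where "Q = (\<lambda>(Y, Z, B). Z) ` {(Y, Z, B)\<in>T. mass B < x \<and> a / 4 \<le> mass {y\<in>A. p i y \<in> Z}}"
  have f1: "finite {(Y, Z, B)\<in>T. x \<le> mass B}"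
    "finite {(Y, Z, B)\<in>T. mass B < x \<and> a / 4 \<le> mass {y\<in>A. p i y \<in> Z}}"
    by (rule finite_subset[OF _ T(1)], auto)+
  have finl: "finite lowT" by (rule finite_subset[OF lowT T(1)])
  have c1: "card T1 \<le> (N + 1) ^ b" "card Q \<le> (N + 1) ^ b"
  proof -
    have "card T1 \<le> card {(Y, Z, B)\<in>T. x \<le> mass B}" unfolding T1_def by (rule card_image_le[OF f1(1)])
    also have "\<dots> \<le> card T" by (rule card_mono[OF T(1)]) auto
    finally show "card T1 \<le> (N + 1) ^ b" using cT by linarith
    have "card Q \<le> card {(Y, Z, B)\<in>T. mass B < x \<and> a / 4 \<le> mass {y\<in>A. p i y \<in> Z}}"
      unfolding Q_def by (rule card_image_le[OF f1(2)])
    also have "\<dots> \<le> card T" by (rule card_mono[OF T(1)]) auto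
    finally show "card Q \<le> (N + 1) ^ b" using cT by linarith
  qed
  have c2: "card T2 \<le> (8193 * m) * (N + 1) ^ (2 * b)"
  proof -
    have "card T2 \<le> (\<Sum>l\<in>lowT. card (L l))" unfolding T2_def by (rule card_UN_le[OF finl])
    also have "\<dots> \<le> (\<Sum>l\<in>lowT. q * (card (p i ` A) + 1) ^ b)" using L by (intro sum_mono) blast
    also have "\<dots> \<le> card T * (q * (N + 1) ^ b)"
      using card_mono[OF T(1) lowT] N by (simp add: mult_mono power_mono)
    also have "\<dots> \<le> (N + 1) ^ b * ((8193 * m) * (N + 1) ^ b)"
      using cT q8 by (intro mult_mono) auto
    also have "\<dots> = (8193 * m) * (N + 1) ^ (2 * b)" by (simp add: mult_2 power_add)
    finally show ?thesis .
  qed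
  have pow: "(N + 1) ^ b \<le> (N + 1) ^ (2 * b)" by (rule power_increasing) auto
  have cards: "card (T1 \<union> T2) \<le> (8194 * m + 1) * (N + 1) ^ (2 * b)"
    "card Q \<le> (8194 * m + 1) * (N + 1) ^ (2 * b)"
  proof -
    have "card (T1 \<union> T2) \<le> (N + 1) ^ (2 * b) + (8193 * m) * (N + 1) ^ (2 * b)"
      using card_Un_le[of T1 T2] c1 c2 pow by linarith
    also have "\<dots> = (8193 * m + 1) * (N + 1) ^ (2 * b)" by (simp add: distrib_right)
    also have "\<dots> \<le> (8194 * m + 1) * (N + 1) ^ (2 * b)" by (intro mult_right_mono) auto
    finally show "card (T1 \<union> T2) \<le> (8194 * m + 1) * (N + 1) ^ (2 * b)" .
    have "card Q \<le> 1 * (N + 1) ^ (2 * b)" using c1 pow by linarith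
    also have "\<dots> \<le> (8194 * m + 1) * (N + 1) ^ (2 * b)" by (intro mult_right_mono) auto
    finally show "card Q \<le> (8194 * m + 1) * (N + 1) ^ (2 * b)" .
  qed
  have fins: "finite (T1 \<union> T2)" "finite Q" unfolding T1_def T2_def Q_def using f1 finl L by auto
  have g1: "B \<subseteq> A \<and> balanced K w (2 ^ 26 * R) B" if "B \<in> T1" for B
  proof -
    obtain Y Z where TB: "(Y, Z, B) \<in> T" "x \<le> mass B" using \<open>B \<in> T1\<close> unfolding T1_def by auto
    note qs = query_stateD[OF leaf(1)[OF TB(1)]]
    have "mass (fib J y B) \<le> 2 ^ 26 * R * w J * mass B" if J: "J \<subseteq> K" "J \<noteq> {}" for J y
    proof -
      have "t J = 512 * (R * w J * x)" unfolding t_def D_def using a0 by simp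
      moreover have "D (insert i J) \<le> 8 * (R * w J * x)"
      proof -
        have "D (insert i J) \<le> R * (real b / real m * w J) * a"
          unfolding D_def using wJ[OF J] R a0 by (intro mult_right_mono mult_left_mono) auto
        also have "\<dots> = 8 * (R * w J * x)" unfolding x_def h_def by simp
        finally show ?thesis .
      qed
      moreover have "0 \<le> R * w J * x" using R w[of J] x0 by simp
      ultimately have "mass (fib J y B) \<le> 2 ^ 26 * (R * w J * x)" using qs(7)[OF J, of y] by simp
      also have "\<dots> \<le> 2 ^ 26 * (R * w J * mass B)" using TB(2) R w[of J] by (intro mult_left_mono) auto
      finally show ?thesis by (simp only: mult.assoc)
    qed
    then have "spread K (\<lambda>J. 2 ^ 26 * R * w J * mass B) B" unfolding spread_def by blast
    moreover have "B \<subseteq> Om" using qs(1) A by blast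
    ultimately show ?thesis unfolding balanced_def using qs(1) TB(2) x0 by auto
  qed
  have g2: "B \<subseteq> A \<and> balanced K w (2 ^ 26 * R) B" if BT: "B \<in> T2" for B
  proof -
    have B: "B \<subseteq> A" "a / (8 * real q) \<le> mass B"
      "\<And>J x. J \<subseteq> K \<Longrightarrow> J \<noteq> {} \<Longrightarrow> mass (fib J x B) \<le> 512 * (D J / real q + D (insert i J))"
      using BT L unfolding T2_def by blast+
    have mB: "0 < a / (8 * real q)" using a0 q1 by simp
    have "mass (fib J y B) \<le> 2 ^ 26 * R * w J * mass B" if J: "J \<subseteq> K" "J \<noteq> {}" for J y
    proof -
      have "D (insert i J) \<le> R * (real b / real m * w J) * a"
        unfolding D_def using wJ[OF J] R a0 by (intro mult_right_mono mult_left_mono) auto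
      also have "\<dots> = D J / real q * (real q * real b / real m)" unfolding D_def using q1 by simp
      also have "\<dots> \<le> D J / real q * 8193"
        using qr(2) m0 less_imp_le[OF Dpos] by (intro mult_left_mono) (auto simp: field_simps)
      finally have "mass (fib J y B) \<le> 512 * (8194 * (D J / real q))" using B(3)[OF J, of y] by simp
      also have "\<dots> = (512 * 8194 * 8) * (R * w J) * (a / (8 * real q))" unfolding D_def by simp
      also have "\<dots> \<le> (512 * 8194 * 8) * (R * w J) * mass B"
        using B(2) R w[of J] by (intro mult_left_mono) auto
      also have "\<dots> \<le> 2 ^ 26 * (R * w J) * mass B"
        using B(2) mB R w[of J] by (intro mult_right_mono) auto
      finally show ?thesis by (simp only: mult.assoc)
    qed
    then have "spread K (\<lambda>J. 2 ^ 26 * R * w J * mass B) B" unfolding spread_def by blast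
    moreover have "B \<subseteq> Om" using B(1) A by blast
    ultimately show ?thesis unfolding balanced_def using B(1,2) mB by auto
  qed
  have g3: "Z \<subseteq> p i ` A \<and> r / (4 * R) \<le> real (card Z)" if "Z \<in> Q" for Z
  proof -
    obtain Y B where TB: "(Y, Z, B) \<in> T" "mass B < x" "a / 4 \<le> mass {y\<in>A. p i y \<in> Z}"
      using \<open>Z \<in> Q\<close> unfolding Q_def by auto
    have Zs: "Z \<subseteq> p i ` A" by (rule query_stateD(6)[OF leaf(1)[OF TB(1)]])
    then have fZ: "finite Z" using fA finite_surj by blast
    note TB(3)
    also have "mass {y\<in>A. p i y \<in> Z} \<le> real (card Z) * D {i}"
      using sp[unfolded spread_def, rule_format, of "{i}"] less_imp_le[OF Dpos]
      by (intro mass_values_le[OF A fZ]) auto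
    also have "\<dots> = a * (real (card Z) * R / r)" unfolding D_def wi by simp
    finally have "a * (1 / 4) \<le> a * (real (card Z) * R / r)" by simp
    then have "1 / 4 \<le> real (card Z) * R / r" using a0 by (rule mult_left_le_imp_le)
    then have "r / (4 * R) \<le> real (card Z)" using r R by (simp add: field_simps)
    then show ?thesis using Zs by blast
  qed
  have g4: "(\<exists>B\<in>T1 \<union> T2. p i ` B \<inter> G = {}) \<or> (\<exists>Z\<in>Q. Z \<subseteq> G)" if G: "finite G" "card G \<le> m" for G
  proof -
    obtain Y Z B where TB: "(Y, Z, B) \<in> T" "Y \<subseteq> - G" "Z \<inter> - G = {}" using T(4)[rule_format, of "- G"] by auto
    consider "x \<le> mass B" | "mass B < x" "a / 4 \<le> mass {y\<in>A. p i y \<in> Z}"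
      | "mass B < x" "mass {y\<in>A. p i y \<in> Z} < a / 4" by linarith
    then show ?thesis
    proof cases
      case 1
      then have "B \<in> T1" using TB(1) unfolding T1_def by force
      moreover have "p i ` B \<inter> G = {}" using query_stateD(2)[OF leaf(1)[OF TB(1)]] TB(2) by blast
      ultimately show ?thesis by blast
    next
      case 2
      then have "Z \<in> Q" using TB(1) unfolding Q_def by force
      then show ?thesis using TB(3) by blast
    next
      case 3
      then have "(Y, Z, B) \<in> lowT" using TB(1) unfolding lowT_def by simp
      note l = this
      from L[OF l] have "\<forall>G. finite G \<longrightarrow> card G \<le> m \<longrightarrow> (\<exists>B\<in>L (Y, Z, B). p i ` B \<inter> G = {})"
        by (elim conjE)
      then obtain B' where "B' \<in> L (Y, Z, B)" "p i ` B' \<inter> G = {}" using G by blast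
      then show ?thesis using l unfolding T2_def by blast
    qed
  qed
  have g12: "B \<subseteq> A \<and> balanced K w (2 ^ 26 * R) B" if "B \<in> T1 \<union> T2" for B
    using that by (rule UnE) (rule g1 g2; assumption)+
  show ?thesis
  proof (rule exI[of _ "T1 \<union> T2"], rule exI[of _ Q], intro conjI)
    show "finite (T1 \<union> T2)" "finite Q" by (rule fins)+
    show "card (T1 \<union> T2) \<le> (8194 * m + 1) * (N + 1) ^ (2 * b)"
      "card Q \<le> (8194 * m + 1) * (N + 1) ^ (2 * b)" by (rule cards)+
    show "\<forall>B\<in>T1 \<union> T2. B \<subseteq> A \<and> balanced K w (2 ^ 26 * R) B" by (rule ballI, rule g12)
    show "\<forall>Z\<in>Q. Z \<subseteq> p i ` A \<and> r / (4 * R) \<le> real (card Z)" by (rule ballI, rule g3)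
    show "\<forall>G. finite G \<longrightarrow> card G \<le> m \<longrightarrow> (\<exists>B\<in>T1 \<union> T2. p i ` B \<inter> G = {}) \<or> (\<exists>Z\<in>Q. Z \<subseteq> G)"
      by (intro allI impI, rule g4)
  qed
qed


lemma balanced_mono: "balanced K w R A \<Longrightarrow> R \<le> R' \<Longrightarrow> (\<And>J. 0 < w J) \<Longrightarrow> balanced K w R' A"
  unfolding balanced_def spread_def
proof (elim conjE, intro conjI allI impI)
  fix J x
  assume m: "0 < mass A" and le: "R \<le> R'" and w: "\<And>J. 0 < w J" and J: "J \<subseteq> K" "J \<noteq> {}"
    and sp: "\<forall>J x. J \<subseteq> K \<longrightarrow> J \<noteq> {} \<longrightarrow> mass (fib J x A) \<le> R * w J * mass A"
  have "mass (fib J x A) \<le> R * w J * mass A" using sp J by blast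
  also have "\<dots> \<le> R' * w J * mass A" using le w[of J] m by (intro mult_right_mono) auto
  finally show "mass (fib J x A) \<le> R' * w J * mass A" .
qed

end

text \<open>The scale of the weight of a fibre of the coordinates \<open>J\<close> relative to the total weight: the
  coordinates 0 and 1 are the tuple entries that avoid \<open>G\<close>, each of which may lose a factor \<open>b / m\<close>,
  the others lie in \<open>G\<close> and may lose \<open>b / v\<close>. The value at \<open>J = {}\<close> is irrelevant.\<close>

definition co_weight :: "nat \<Rightarrow> nat \<Rightarrow> nat \<Rightarrow> real \<Rightarrow> nat set \<Rightarrow> real" where
  "co_weight b m v r J = (if J \<subseteq> {0, 1} then (real b / real m) ^ (card J - 1) / r
     else (real b / real m) ^ card (J \<inter> {0, 1}) * (real b / real v) ^ (card (J - {0, 1}) - 1) / real v)"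

lemma co_weight_pos: "b > 0 \<Longrightarrow> m > 0 \<Longrightarrow> v > 0 \<Longrightarrow> r > 0 \<Longrightarrow> 0 < co_weight b m v r J"
  unfolding co_weight_def by simp

lemma co_weight_insert_zero:
  assumes "i \<in> {0, 1}" "i \<notin> J" "J \<noteq> {}" "finite J"
  shows "co_weight b m v r (insert i J) = real b / real m * co_weight b m v r J"
proof (cases "J \<subseteq> {0, 1}")
  case True
  obtain c where c: "card J = Suc c" using assms by (metis card_eq_0_iff not0_implies_Suc)
  have "insert i J \<subseteq> {0, 1}" using True assms(1) by blast
  then show ?thesis using assms True c unfolding co_weight_def by simp
next
  case False
  have "insert i J \<inter> {0, 1} = insert i (J \<inter> {0, 1})" "insert i J - {0, 1} = J - {0, 1}"
    using assms(1) by auto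
  moreover have "\<not> insert i J \<subseteq> {0, 1}" using False by blast
  ultimately show ?thesis using assms False unfolding co_weight_def by simp
qed

text \<open>The side coordinates are processed after both diagonals, so the remaining
  \<open>J\<close> contain neither 0 nor 1.\<close>

lemma co_weight_insert_one:
  assumes "i \<notin> {0, 1}" "i \<notin> J" "J \<noteq> {}" "finite J" "J \<inter> {0, 1} = {}"
  shows "co_weight b m v r (insert i J) = real b / real v * co_weight b m v r J"
proof -
  obtain c where c: "card J = Suc c" using assms by (metis card_eq_0_iff not0_implies_Suc)
  have "insert i J \<inter> {0, 1} = {}" "insert i J - {0, 1} = insert i J" "J - {0, 1} = J"
    using assms by auto
  moreover have "\<not> insert i J \<subseteq> {0, 1}" "\<not> J \<subseteq> {0, 1}" using assms by auto
  ultimately show ?thesis using assms c unfolding co_weight_def by simp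
qed

text \<open>One round of refinement for a whole family. \<open>P\<close> relates a member to its
  refinements, \<open>S\<close> describes the certificates in \<open>Q\<close>, and \<open>M\<close>
  and \<open>N\<close> say what \<open>B\<close> and \<open>Z\<close> reveal about \<open>G\<close>;
  keeping them abstract lets diagonals and sides share the argument.\<close>

lemma refine_family:
  assumes fT: "finite T"
    and ex: "\<And>A. A \<in> T \<Longrightarrow> \<exists>T' Q. finite T' \<and> finite Q \<and> card T' \<le> c \<and> card Q \<le> c \<and>
      (\<forall>B\<in>T'. P A B) \<and> (\<forall>Z\<in>Q. S Z) \<and> (\<forall>G. C G \<longrightarrow> (\<exists>B\<in>T'. M G B) \<or> (\<exists>Z\<in>Q. N G Z))"
  shows "\<exists>T' Q. finite T' \<and> finite Q \<and> card T' \<le> card T * c \<and> card Q \<le> card T * c \<and>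
    (\<forall>B\<in>T'. \<exists>A\<in>T. P A B) \<and> (\<forall>Z\<in>Q. S Z) \<and>
    (\<forall>G A. C G \<longrightarrow> A \<in> T \<longrightarrow> (\<exists>B\<in>T'. P A B \<and> M G B) \<or> (\<exists>Z\<in>Q. N G Z))"
proof -
  define ok where "ok A X \<longleftrightarrow> finite (fst X) \<and> finite (snd X) \<and> card (fst X) \<le> c \<and> card (snd X) \<le> c \<and>
      (\<forall>B\<in>fst X. P A B) \<and> (\<forall>Z\<in>snd X. S Z) \<and>
      (\<forall>G. C G \<longrightarrow> (\<exists>B\<in>fst X. M G B) \<or> (\<exists>Z\<in>snd X. N G Z))" for A X
  have "\<forall>A\<in>T. \<exists>X. ok A X"
  proof
    fix A assume "A \<in> T"
    from ex[OF this] obtain T' Q where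
      "finite T' \<and> finite Q \<and> card T' \<le> c \<and> card Q \<le> c \<and>
      (\<forall>B\<in>T'. P A B) \<and> (\<forall>Z\<in>Q. S Z) \<and> (\<forall>G. C G \<longrightarrow> (\<exists>B\<in>T'. M G B) \<or> (\<exists>Z\<in>Q. N G Z))"
      by (elim exE)
    then have "ok A (T', Q)" unfolding ok_def by simp
    then show "\<exists>X. ok A X" by blast
  qed
  from bchoice[OF this] obtain X where X: "\<forall>A\<in>T. ok A (X A)" ..
  note X' = X[rule_format, unfolded ok_def]
  have "card (\<Union>A\<in>T. fst (X A)) \<le> (\<Sum>A\<in>T. card (fst (X A)))" by (rule card_UN_le[OF fT])
  also have "\<dots> \<le> (\<Sum>A\<in>T. c)" by (rule sum_mono) (use X' in blast)
  finally have 1: "card (\<Union>A\<in>T. fst (X A)) \<le> card T * c" by simp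
  have "card (\<Union>A\<in>T. snd (X A)) \<le> (\<Sum>A\<in>T. card (snd (X A)))" by (rule card_UN_le[OF fT])
  also have "\<dots> \<le> (\<Sum>A\<in>T. c)" by (rule sum_mono) (use X' in blast)
  finally have 2: "card (\<Union>A\<in>T. snd (X A)) \<le> card T * c" by simp
  have 3: "(\<exists>B\<in>(\<Union>A\<in>T. fst (X A)). P A B \<and> M G B) \<or> (\<exists>Z\<in>(\<Union>A\<in>T. snd (X A)). N G Z)"
    if "C G" "A \<in> T" for G A
  proof -
    have "(\<exists>B\<in>fst (X A). M G B) \<or> (\<exists>Z\<in>snd (X A). N G Z)" "\<forall>B\<in>fst (X A). P A B"
      using X'[OF that(2)] that(1) by blast+
    then show ?thesis using that(2) by blast
  qed
  show ?thesis
  proof (rule exI[of _ "\<Union>A\<in>T. fst (X A)"], rule exI[of _ "\<Union>A\<in>T. snd (X A)"], intro conjI)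
    show "finite (\<Union>A\<in>T. fst (X A))" "finite (\<Union>A\<in>T. snd (X A))" using fT X' by blast+
    show "\<forall>B\<in>\<Union>A\<in>T. fst (X A). \<exists>A\<in>T. P A B" "\<forall>Z\<in>\<Union>A\<in>T. snd (X A). S Z" using X' by blast+
  qed (use 1 2 3 in blast)+
qed

context weighted_tuples
begin

text \<open>Process the coordinates one by one: either some step produces a set \<open>Z\<close>, or in the end a tuple
  survives that matches \<open>G\<close> in all six coordinates, which is excluded.\<close>

theorem asymmetric_container:
  assumes R: "R \<ge> 1" and bal: "balanced {0..<6} (co_weight b m v r) R Om"
    and v: "\<And>i. 2 \<le> i \<Longrightarrow> i < 6 \<Longrightarrow> card (p i ` Om) \<le> v" "v > 0"
    and N: "\<And>i. i < 2 \<Longrightarrow> card (p i ` Om) \<le> N" "v \<le> N"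
    and R': "R' = R * 2 ^ 130"
    and b: "b > 0" "8 * real b * R' \<le> real v" "8 * real b * R' \<le> r" "b \<le> m"
    and rb: "8193 * R' * real m \<le> r * real b"
    and c: "c = (8194 * m + 1) * (N + 1) ^ (2 * b)"
  shows "\<exists>QE QN. finite QE \<and> finite QN \<and> card QE \<le> 6 * c ^ 6 \<and> card QN \<le> 6 * c ^ 6 \<and>
    (\<forall>Z\<in>QE. \<exists>i<2. Z \<subseteq> p i ` Om \<and> r / (4 * R') \<le> real (card Z)) \<and>
    (\<forall>Z\<in>QN. \<exists>i\<in>{2..<6}. Z \<subseteq> p i ` Om \<and> real v / (2 * R') \<le> real (card Z)) \<and>
    (\<forall>G. finite G \<longrightarrow> card G \<le> m \<longrightarrow>
       \<not> (\<exists>x\<in>Om. p 0 x \<notin> G \<and> p 1 x \<notin> G \<and> (\<forall>i\<in>{2..<6}. p i x \<in> G)) \<longrightarrow>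
       (\<exists>Z\<in>QE. Z \<subseteq> G) \<or> (\<exists>Z\<in>QN. Z \<inter> G = {}))"
proof -
  define w where "w = co_weight b m v r"
  have m0: "m > 0" using b by linarith
  have "0 < 8 * real b * R'" using b R unfolding R' by simp
  then have r0: "r > 0" using b by linarith
  have w0: "0 < w J" for J unfolding w_def by (rule co_weight_pos[OF b(1) m0 v(2) r0])
  \<comment> \<open>Each of the five steps for the coordinates 0 to 4 costs at most
    \<open>2 ^ 26\<close>, in total \<open>2 ^ 130\<close>.\<close>
  define Rk where "Rk k = R * (2 ^ 26) ^ k" for k :: nat
  have Rk: "1 \<le> Rk k" for k unfolding Rk_def using mult_mono[OF R one_le_power[of "2 ^ 26 :: real" k]] R by simp
  have RkR': "Rk k \<le> R'" if "k \<le> 5" for k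
  proof -
    have "(2 ^ 26) ^ k \<le> (2 ^ 26 :: real) ^ 5" using that by (intro power_increasing) auto
    then have "Rk k \<le> R * (2 ^ 26) ^ 5" unfolding Rk_def using R by (intro mult_left_mono) auto
    then show ?thesis unfolding R' by (simp flip: power_mult)
  qed
  have "c > 0" unfolding c by simp
  then have c1: "1 \<le> c" by simp
  define matches where "matches G k x \<longleftrightarrow> (if k < 2 then p k x \<notin> G else p k x \<in> G)" for G k x
  define SE where "SE Z \<longleftrightarrow> (\<exists>i<2. Z \<subseteq> p i ` Om \<and> r / (4 * R') \<le> real (card Z))" for Z
  define SN where "SN Z \<longleftrightarrow> (\<exists>i\<in>{2..<6}. Z \<subseteq> p i ` Om \<and> real v / (2 * R') \<le> real (card Z))" for Z
  have onestep: "\<exists>T' Q. finite T' \<and> finite Q \<and> card T' \<le> c \<and> card Q \<le> c \<and>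
      (\<forall>B\<in>T'. B \<subseteq> A \<and> balanced {Suc k..<6} w (Rk (Suc k)) B) \<and>
      (\<forall>Z\<in>Q. if k < 2 then SE Z else SN Z) \<and>
      (\<forall>G. finite G \<and> card G \<le> m \<longrightarrow> (\<exists>B\<in>T'. \<forall>x\<in>B. matches G k x) \<or>
         (\<exists>Z\<in>Q. if k < 2 then Z \<subseteq> G else Z \<inter> G = {}))"
    if A: "balanced {k..<6} w (Rk k) A" and k: "k < 5" for A k
  proof -
    let ?K = "{Suc k..<6}"
    have ins: "{k..<6} = insert k ?K" using k by auto
    have cK: "finite ?K" "card ?K \<le> 6" by auto
    have AOm: "A \<subseteq> Om" using A unfolding balanced_def by blast
    have img: "p k ` A \<subseteq> p k ` Om" using AOm by blast
    have cimg: "card (p k ` A) \<le> card (p k ` Om)" using fin img by (intro card_mono) auto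
    have RR: "Rk k \<le> R'" using RkR' k by simp
    have Rk0: "0 < Rk k" using Rk[of k] by simp
    show ?thesis
    proof (cases "k < 2")
      case True
      have wi: "w {k} = 1 / r" using True unfolding w_def co_weight_def by auto
      have wJ: "w (insert k J) \<le> real b / real m * w J" if "J \<subseteq> ?K" "J \<noteq> {}" for J
      proof -
        have "k \<in> {0, 1}" "k \<notin> J" "finite J" using True that by (auto intro: finite_subset)
        then show ?thesis using that(2) unfolding w_def by (subst co_weight_insert_zero) auto
      qed
      have e1: "8 * real b * Rk k \<le> r" using b(3) mult_left_mono[OF RR, of "8 * real b"] by linarith
      have e2: "8193 * Rk k * real m \<le> r * real b"
        using rb mult_right_mono[OF RR, of "8193 * real m"] by (simp add: mult.commute mult.left_commute)
      have e3: "card (p k ` A) \<le> N" using cimg N(1)[OF True] by linarith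
      have "\<exists>T Q. finite T \<and> finite Q \<and> card T \<le> c \<and> card Q \<le> c \<and>
        (\<forall>B\<in>T. B \<subseteq> A \<and> balanced ?K w (2 ^ 26 * Rk k) B) \<and>
        (\<forall>Z\<in>Q. Z \<subseteq> p k ` A \<and> r / (4 * Rk k) \<le> real (card Z)) \<and>
        (\<forall>G. finite G \<longrightarrow> card G \<le> m \<longrightarrow> (\<exists>B\<in>T. p k ` B \<inter> G = {}) \<or> (\<exists>Z\<in>Q. Z \<subseteq> G))"
        unfolding c by (rule step_zero[OF A[unfolded ins] cK Rk w0 wi r0 wJ e3 b(1) e1 b(4) e2])
      then obtain T Q where TQ: "finite T" "finite Q" "card T \<le> c" "card Q \<le> c"
        "\<forall>B\<in>T. B \<subseteq> A \<and> balanced ?K w (2 ^ 26 * Rk k) B"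
        "\<forall>Z\<in>Q. Z \<subseteq> p k ` A \<and> r / (4 * Rk k) \<le> real (card Z)"
        "\<forall>G. finite G \<longrightarrow> card G \<le> m \<longrightarrow> (\<exists>B\<in>T. p k ` B \<inter> G = {}) \<or> (\<exists>Z\<in>Q. Z \<subseteq> G)"
        by (elim exE conjE)
      have "r / (4 * R') \<le> r / (4 * Rk k)" using RR r0 Rk0 by (intro divide_left_mono) auto
      then have SEQ: "\<forall>Z\<in>Q. SE Z"
        unfolding SE_def using TQ(6) True img by (fastforce intro!: exI[of _ k])
      have "Rk (Suc k) = 2 ^ 26 * Rk k" unfolding Rk_def by simp
      moreover have "\<forall>G. finite G \<and> card G \<le> m \<longrightarrow> (\<exists>B\<in>T. \<forall>x\<in>B. matches G k x) \<or> (\<exists>Z\<in>Q. Z \<subseteq> G)"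
        using TQ(7) True unfolding matches_def by (simp add: disjoint_iff) (meson imageI)
      ultimately show ?thesis using TQ(1-5) SEQ True
        by (intro exI[of _ T] exI[of _ Q]) simp
    next
      case False
      have wi: "w {k} = 1 / real v" using False unfolding w_def co_weight_def by auto
      have wJ: "w (insert k J) \<le> real b / real v * w J" if "J \<subseteq> ?K" "J \<noteq> {}" for J
      proof -
        have "k \<notin> {0, 1}" "k \<notin> J" "finite J" "J \<inter> {0, 1} = {}" using False that by (auto intro: finite_subset)
        then show ?thesis using that(2) unfolding w_def by (subst co_weight_insert_one) auto
      qed
      have e1: "8 * real b * Rk k \<le> real v" using b(2) mult_left_mono[OF RR, of "8 * real b"] by linarith
      have e3: "card (p k ` A) \<le> v" using cimg v(1)[of k] False k by linarith
      have "\<exists>T Q. finite T \<and> finite Q \<and> card T \<le> (v + 1) ^ b \<and> card Q \<le> (v + 1) ^ b \<and>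
        (\<forall>B\<in>T. B \<subseteq> A \<and> balanced ?K w (516 * Rk k) B) \<and>
        (\<forall>Z\<in>Q. Z \<subseteq> p k ` A \<and> real v / (2 * Rk k) \<le> real (card Z)) \<and>
        (\<forall>G. (\<exists>B\<in>T. p k ` B \<subseteq> G) \<or> (\<exists>Z\<in>Q. Z \<inter> G = {}))"
        by (rule step_one[OF A[unfolded ins] cK Rk w0 wi wJ e3 v(2) b(1) e1])
      then obtain T Q where TQ: "finite T" "finite Q" "card T \<le> (v + 1) ^ b" "card Q \<le> (v + 1) ^ b"
        "\<forall>B\<in>T. B \<subseteq> A \<and> balanced ?K w (516 * Rk k) B"
        "\<forall>Z\<in>Q. Z \<subseteq> p k ` A \<and> real v / (2 * Rk k) \<le> real (card Z)"
        "\<forall>G. (\<exists>B\<in>T. p k ` B \<subseteq> G) \<or> (\<exists>Z\<in>Q. Z \<inter> G = {})"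
        by (elim exE conjE)
      have "(v + 1) ^ b \<le> (N + 1) ^ b" using N(2) by (intro power_mono) auto
      also have "\<dots> \<le> (N + 1) ^ (2 * b)" by (intro power_increasing) auto
      also have "\<dots> \<le> c" unfolding c by simp
      finally have cc: "card T \<le> c" "card Q \<le> c" using TQ(3,4) by linarith+
      have "real v / (2 * R') \<le> real v / (2 * Rk k)" using RR Rk0 by (intro divide_left_mono) auto
      moreover have "k \<in> {2..<6}" using False k by simp
      ultimately have SNQ: "\<forall>Z\<in>Q. SN Z"
        unfolding SN_def using TQ(6) img by (fastforce intro!: bexI[of _ k])
      have le: "516 * Rk k \<le> Rk (Suc k)" unfolding Rk_def using R by simp
      have "\<forall>B\<in>T. B \<subseteq> A \<and> balanced ?K w (Rk (Suc k)) B"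
      proof
        fix B assume "B \<in> T"
        then have "B \<subseteq> A \<and> balanced ?K w (516 * Rk k) B" using TQ(5) by (rule bspec[rotated])
        then show "B \<subseteq> A \<and> balanced ?K w (Rk (Suc k)) B" using balanced_mono[OF _ le w0] by (elim conjE) simp
      qed
      moreover have "\<forall>G. finite G \<and> card G \<le> m \<longrightarrow> (\<exists>B\<in>T. \<forall>x\<in>B. matches G k x) \<or> (\<exists>Z\<in>Q. Z \<inter> G = {})"
      proof (intro allI impI)
        fix G
        have "(\<exists>B\<in>T. p k ` B \<subseteq> G) \<or> (\<exists>Z\<in>Q. Z \<inter> G = {})" using TQ(7) by (rule spec)
        then show "(\<exists>B\<in>T. \<forall>x\<in>B. matches G k x) \<or> (\<exists>Z\<in>Q. Z \<inter> G = {})"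
          using False unfolding matches_def by (simp add: image_subset_iff)
      qed
      ultimately show ?thesis using TQ(1,2) cc SNQ False
        by (intro exI[of _ T] exI[of _ Q]) simp
    qed
  qed
  have chain: "\<exists>T QE QN. finite T \<and> finite QE \<and> finite QN \<and> card T \<le> c ^ k \<and>
      card QE \<le> k * c ^ k \<and> card QN \<le> k * c ^ k \<and> (\<forall>A\<in>T. balanced {k..<6} w (Rk k) A) \<and>
      (\<forall>Z\<in>QE. SE Z) \<and> (\<forall>Z\<in>QN. SN Z) \<and>
      (\<forall>G. finite G \<and> card G \<le> m \<longrightarrow> (\<exists>A\<in>T. \<forall>x\<in>A. \<forall>j<k. matches G j x) \<or>
         (\<exists>Z\<in>QE. Z \<subseteq> G) \<or> (\<exists>Z\<in>QN. Z \<inter> G = {}))" if "k \<le> 5" for k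
    using that
  proof (induction k)
    case 0
    have "balanced {0..<6} w (Rk 0) Om" using bal unfolding w_def Rk_def by simp
    then show ?case by (intro exI[of _ "{Om}"] exI[of _ "{}"]) auto
  next
    case (Suc k)
    then have k: "k < 5" "k \<le> 5" by auto
    from Suc.IH[OF k(2)] obtain T QE QN where T: "finite T" "finite QE" "finite QN" "card T \<le> c ^ k"
      "card QE \<le> k * c ^ k" "card QN \<le> k * c ^ k" "\<forall>A\<in>T. balanced {k..<6} w (Rk k) A"
      "\<forall>Z\<in>QE. SE Z" "\<forall>Z\<in>QN. SN Z"
      "\<forall>G. finite G \<and> card G \<le> m \<longrightarrow> (\<exists>A\<in>T. \<forall>x\<in>A. \<forall>j<k. matches G j x) \<or>
         (\<exists>Z\<in>QE. Z \<subseteq> G) \<or> (\<exists>Z\<in>QN. Z \<inter> G = {})"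
      by (elim exE conjE)
    have "\<exists>T' Q. finite T' \<and> finite Q \<and> card T' \<le> card T * c \<and> card Q \<le> card T * c \<and>
      (\<forall>B\<in>T'. \<exists>A\<in>T. B \<subseteq> A \<and> balanced {Suc k..<6} w (Rk (Suc k)) B) \<and>
      (\<forall>Z\<in>Q. if k < 2 then SE Z else SN Z) \<and>
      (\<forall>G A. finite G \<and> card G \<le> m \<longrightarrow> A \<in> T \<longrightarrow>
        (\<exists>B\<in>T'. (B \<subseteq> A \<and> balanced {Suc k..<6} w (Rk (Suc k)) B) \<and> (\<forall>x\<in>B. matches G k x)) \<or>
         (\<exists>Z\<in>Q. if k < 2 then Z \<subseteq> G else Z \<inter> G = {}))"
      by (rule refine_family[OF T(1)]) (rule onestep[OF bspec[OF T(7)] k(1)])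
    then obtain T' Q where T': "finite T'" "finite Q" "card T' \<le> card T * c" "card Q \<le> card T * c"
      "\<forall>B\<in>T'. \<exists>A\<in>T. B \<subseteq> A \<and> balanced {Suc k..<6} w (Rk (Suc k)) B"
      "\<forall>Z\<in>Q. if k < 2 then SE Z else SN Z"
      "\<forall>G A. finite G \<and> card G \<le> m \<longrightarrow> A \<in> T \<longrightarrow>
        (\<exists>B\<in>T'. (B \<subseteq> A \<and> balanced {Suc k..<6} w (Rk (Suc k)) B) \<and> (\<forall>x\<in>B. matches G k x)) \<or>
         (\<exists>Z\<in>Q. if k < 2 then Z \<subseteq> G else Z \<inter> G = {})"
      by (elim exE conjE)
    define QE' where "QE' = (if k < 2 then QE \<union> Q else QE)"
    define QN' where "QN' = (if k < 2 then QN else QN \<union> Q)"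
    have cT': "card T' \<le> c ^ Suc k" "card Q \<le> c ^ Suc k"
      using T'(3,4) mult_right_mono[OF T(4), of c] by (auto simp: mult.commute intro: order_trans)
    have "c ^ k \<le> c ^ Suc k" using c1 by (intro power_increasing) auto
    then have kc: "k * c ^ k \<le> k * c ^ Suc k" by (rule mult_left_mono) simp
    have sk: "Suc k * c ^ Suc k = c ^ Suc k + k * c ^ Suc k" by simp
    then have cQ: "card QE' \<le> Suc k * c ^ Suc k" "card QN' \<le> Suc k * c ^ Suc k"
      unfolding QE'_def QN'_def sk using T(5,6) cT'(2) card_Un_le[of QE Q] card_Un_le[of QN Q] kc
      by (cases "k < 2"; simp only: if_True if_False; linarith)+
    have cov: "(\<exists>A\<in>T'. \<forall>x\<in>A. \<forall>j<Suc k. matches G j x) \<or> (\<exists>Z\<in>QE'. Z \<subseteq> G) \<or> (\<exists>Z\<in>QN'. Z \<inter> G = {})"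
      if G: "finite G \<and> card G \<le> m" for G
    proof -
      consider A where "A \<in> T" "\<forall>x\<in>A. \<forall>j<k. matches G j x" | "(\<exists>Z\<in>QE. Z \<subseteq> G) \<or> (\<exists>Z\<in>QN. Z \<inter> G = {})"
        using T(10)[rule_format, OF G] by blast
      then show ?thesis
      proof cases
        case 1
        consider B where "B \<in> T'" "B \<subseteq> A" "\<forall>x\<in>B. matches G k x"
          | Z where "Z \<in> Q" "if k < 2 then Z \<subseteq> G else Z \<inter> G = {}"
          using T'(7)[rule_format, OF G 1(1)] by blast
        then show ?thesis
        proof cases
          case (1 B)
          then have "\<forall>x\<in>B. \<forall>j<Suc k. matches G j x" using \<open>\<forall>x\<in>A. \<forall>j<k. matches G j x\<close>
            by (auto simp: less_Suc_eq)
          then show ?thesis using 1(1) by blast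
        next
          case (2 Z)
          then show ?thesis unfolding QE'_def QN'_def by (auto split: if_splits)
        qed
      next
        case 2
        then show ?thesis unfolding QE'_def QN'_def by auto
      qed
    qed
    show ?case
    proof (rule exI[of _ T'], rule exI[of _ QE'], rule exI[of _ QN'], intro conjI)
      show "finite QE'" "finite QN'" "\<forall>Z\<in>QE'. SE Z" "\<forall>Z\<in>QN'. SN Z"
        unfolding QE'_def QN'_def using T(2,3,8,9) T'(2,6) by auto
      show "\<forall>A\<in>T'. balanced {Suc k..<6} w (Rk (Suc k)) A" using T'(5) by fast
      show "\<forall>G. finite G \<and> card G \<le> m \<longrightarrow> (\<exists>A\<in>T'. \<forall>x\<in>A. \<forall>j<Suc k. matches G j x) \<or>
         (\<exists>Z\<in>QE'. Z \<subseteq> G) \<or> (\<exists>Z\<in>QN'. Z \<inter> G = {})"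
        by (intro allI impI, rule cov)
    qed (rule T'(1) cT'(1) cQ)+
  qed
  obtain T QE QN where T: "finite T" "finite QE" "finite QN" "card T \<le> c ^ 5"
      "card QE \<le> 5 * c ^ 5" "card QN \<le> 5 * c ^ 5" "\<forall>A\<in>T. balanced {5..<6} w (Rk 5) A"
      "\<forall>Z\<in>QE. SE Z" "\<forall>Z\<in>QN. SN Z"
      "\<forall>G. finite G \<and> card G \<le> m \<longrightarrow> (\<exists>A\<in>T. \<forall>x\<in>A. \<forall>j<5. matches G j x) \<or>
         (\<exists>Z\<in>QE. Z \<subseteq> G) \<or> (\<exists>Z\<in>QN. Z \<inter> G = {})"
    using chain[OF order_refl] by (elim exE conjE)
  \<comment> \<open>If all tuples of \<open>A\<close> match \<open>G\<close> in the coordinates 0 to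
    4, none can have its last entry in \<open>G\<close>. The set of last entries therefore misses
    \<open>G\<close>, and balancedness in coordinate 5 makes it large, so it is a certificate
    without any query.\<close>
  define QN' where "QN' = QN \<union> (\<lambda>A. p 5 ` A) ` T"
  have c56: "c ^ 5 \<le> c ^ 6" using c1 by (intro power_increasing) auto
  have "card ((\<lambda>A. p 5 ` A) ` T) \<le> c ^ 5" using card_image_le[OF T(1), of "\<lambda>A. p 5 ` A"] T(4) by linarith
  then have cN: "card QN' \<le> 6 * c ^ 6" "card QE \<le> 6 * c ^ 6"
    unfolding QN'_def using card_Un_le[of QN "(\<lambda>A. p 5 ` A) ` T"] T(5,6) c56 by linarith+
  have SN5: "SN (p 5 ` A)" if AT: "A \<in> T" for A
  proof -
    have A: "A \<subseteq> Om" "0 < mass A" and sp: "spread {5..<6} (\<lambda>J. Rk 5 * w J * mass A) A"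
      using T(7) AT unfolding balanced_def by auto
    have fA: "finite A" using A(1) fin finite_subset by blast
    have w5: "w {5} = 1 / real v" unfolding w_def co_weight_def by auto
    have "mass A = mass {x\<in>A. p 5 x \<in> p 5 ` A}" by (intro arg_cong[where f = mass]) auto
    also have "\<dots> \<le> real (card (p 5 ` A)) * (Rk 5 * w {5} * mass A)"
      using sp[unfolded spread_def, rule_format, of "{5}"] fA Rk[of 5] w0[of "{5}"] A(2)
      by (intro mass_values_le[OF A(1)]) auto
    also have "\<dots> = mass A * (real (card (p 5 ` A)) * Rk 5 / real v)" by (simp add: w5)
    finally have "mass A * 1 \<le> mass A * (real (card (p 5 ` A)) * Rk 5 / real v)" by simp
    then have "1 \<le> real (card (p 5 ` A)) * Rk 5 / real v" using A(2) by (rule mult_left_le_imp_le)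
    then have "real v \<le> real (card (p 5 ` A)) * Rk 5" using v(2) by (simp add: field_simps)
    also have "\<dots> \<le> real (card (p 5 ` A)) * (2 * R')" using RkR'[of 5] Rk[of 5]
      by (intro mult_left_mono) auto
    finally have "real v / (2 * R') \<le> real (card (p 5 ` A))"
      using Rk[of 5] RkR'[of 5] by (simp add: field_simps)
    moreover have "p 5 ` A \<subseteq> p 5 ` Om" using A(1) by blast
    ultimately show ?thesis unfolding SN_def by (intro bexI[of _ 5]) auto
  qed
  have cov: "(\<exists>Z\<in>QE. Z \<subseteq> G) \<or> (\<exists>Z\<in>QN'. Z \<inter> G = {})"
    if G: "finite G" "card G \<le> m"
      "\<not> (\<exists>x\<in>Om. p 0 x \<notin> G \<and> p 1 x \<notin> G \<and> (\<forall>i\<in>{2..<6}. p i x \<in> G))" for G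
  proof -
    consider A where "A \<in> T" "\<forall>x\<in>A. \<forall>j<5. matches G j x" | "(\<exists>Z\<in>QE. Z \<subseteq> G) \<or> (\<exists>Z\<in>QN. Z \<inter> G = {})"
      using T(10)[rule_format, OF conjI[OF G(1,2)]] by (elim disjE) blast+
    then show ?thesis
    proof cases
      case (1 A)
      have "p 5 x \<notin> G" if x: "x \<in> A" for x
      proof
        assume 5: "p 5 x \<in> G"
        have mt: "matches G j x" if "j < 5" for j using 1(2) x that by blast
        have "p i x \<in> G" if "i \<in> {2..<6}" for i
          using mt[of i] that 5 unfolding matches_def by (cases "i = 5") auto
        moreover have "p 0 x \<notin> G" "p 1 x \<notin> G" using mt[of 0] mt[of 1] unfolding matches_def by auto
        moreover have "x \<in> Om" using T(7) 1(1) x unfolding balanced_def by blast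
        ultimately show False using G(3) by blast
      qed
      then have "p 5 ` A \<inter> G = {}" by blast
      then show ?thesis using 1(1) unfolding QN'_def by blast
    next
      case 2
      then show ?thesis unfolding QN'_def by blast
    qed
  qed
  show ?thesis
  proof (rule exI[of _ QE], rule exI[of _ QN'], intro conjI)
    show "finite QE" "finite QN'" using T(1,2,3) unfolding QN'_def by auto
    show "card QE \<le> 6 * c ^ 6" "card QN' \<le> 6 * c ^ 6" using cN by auto
    show "\<forall>Z\<in>QE. \<exists>i<2. Z \<subseteq> p i ` Om \<and> r / (4 * R') \<le> real (card Z)"
      using T(8) unfolding SE_def .
    show "\<forall>Z\<in>QN'. \<exists>i\<in>{2..<6}. Z \<subseteq> p i ` Om \<and> real v / (2 * R') \<le> real (card Z)"
      using T(9) SN5 unfolding QN'_def SN_def by auto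
    show "\<forall>G. finite G \<longrightarrow> card G \<le> m \<longrightarrow>
       \<not> (\<exists>x\<in>Om. p 0 x \<notin> G \<and> p 1 x \<notin> G \<and> (\<forall>i\<in>{2..<6}. p i x \<in> G)) \<longrightarrow>
       (\<exists>Z\<in>QE. Z \<subseteq> G) \<or> (\<exists>Z\<in>QN'. Z \<inter> G = {})" by (intro allI impI, rule cov)
  qed
qed

end

section \<open>Potential induced 4-cycles of a pregraph\<close>

text \<open>The sides must be mixed pairs, so that finding sides absent always shrinks
  \<open>M\<close>. A diagonal is only kept out of \<open>E\<close>: if it lies in \<open>M\<close>
  it may turn out to be an edge, and outside \<open>E \<union> M\<close> it is absent from every
  contained graph.\<close>

definition c4_quads :: "nat set set \<Rightarrow> nat set set \<Rightarrow> (nat \<times> nat \<times> nat \<times> nat) set" where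
  "c4_quads M E = {(a, b, c, d). {a, b} \<in> M \<and> {b, c} \<in> M \<and> {c, d} \<in> M \<and> {d, a} \<in> M \<and>
     a \<noteq> c \<and> b \<noteq> d \<and> {a, c} \<notin> E \<and> {b, d} \<notin> E}"

text \<open>A weighting of the potential induced 4-cycles of \<open>(M, E)\<close>, of total weight at least 1, that is
  as spread out as the uniform weighting of the 4-cycles of a \<open>k\<close>-regular random-like graph.\<close>

definition spread_c4s :: "real \<Rightarrow> nat \<Rightarrow> real \<Rightarrow> nat set set \<Rightarrow> nat set set \<Rightarrow> bool" where
  "spread_c4s R n k M E \<longleftrightarrow> (\<exists>mu :: nat \<Rightarrow> nat \<Rightarrow> nat \<Rightarrow> nat \<Rightarrow> real.
     (\<forall>a b c d. 0 \<le> mu a b c d) \<and> (\<forall>a b c d. mu a b c d \<noteq> 0 \<longrightarrow> (a, b, c, d) \<in> c4_quads M E) \<and>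
     1 \<le> (\<Sum>a\<in>{1..n}. \<Sum>b\<in>{1..n}. \<Sum>c\<in>{1..n}. \<Sum>d\<in>{1..n}. mu a b c d) \<and>
     (\<forall>x y. (\<Sum>c\<in>{1..n}. \<Sum>d\<in>{1..n}. mu x y c d) \<le> R / (k * n)) \<and>
     (\<forall>x y. (\<Sum>a\<in>{1..n}. \<Sum>d\<in>{1..n}. mu a x y d) \<le> R / (k * n)) \<and>
     (\<forall>x y. (\<Sum>a\<in>{1..n}. \<Sum>b\<in>{1..n}. mu a b x y) \<le> R / (k * n)) \<and>
     (\<forall>x y. (\<Sum>b\<in>{1..n}. \<Sum>c\<in>{1..n}. mu y b c x) \<le> R / (k * n)) \<and>
     (\<forall>x y. (\<Sum>b\<in>{1..n}. \<Sum>d\<in>{1..n}. mu x b y d) \<le> R / k\<^sup>2) \<and>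
     (\<forall>x y. (\<Sum>a\<in>{1..n}. \<Sum>c\<in>{1..n}. mu a x c y) \<le> R / k\<^sup>2) \<and>
     (\<forall>x y z. (\<Sum>d\<in>{1..n}. mu x y z d) \<le> R / k ^ 3) \<and>
     (\<forall>x y z. (\<Sum>c\<in>{1..n}. mu x y c z) \<le> R / k ^ 3) \<and>
     (\<forall>x y z. (\<Sum>b\<in>{1..n}. mu x b y z) \<le> R / k ^ 3) \<and>
     (\<forall>x y z. (\<Sum>a\<in>{1..n}. mu a x y z) \<le> R / k ^ 3) \<and>
     (\<forall>a b c d. mu a b c d \<le> R / k ^ 4))"

text \<open>The entries of a tuple are ordered pairs of vertices. Each unordered pair has two
  orders, which is why the container lemma is later applied with \<open>2 * m\<close> and
  \<open>v = 2 * card M\<close>.\<close>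

definition ordered_pairs :: "nat set set \<Rightarrow> (nat \<times> nat) set" where
  "ordered_pairs X = {(x, y). {x, y} \<in> X}"

definition pair_sets :: "(nat \<times> nat) set \<Rightarrow> nat set set" where
  "pair_sets Z = (\<lambda>(x, y). {x, y}) ` Z"

lemma card_le_pair_sets: "finite Z \<Longrightarrow> card Z \<le> 2 * card (pair_sets Z)"
proof -
  assume fZ: "finite Z"
  have f2: "finite {z. (\<lambda>(x, y). {x, y}) z = e} \<and> card {z. (\<lambda>(x, y). {x, y}) z = e} \<le> 2" for e :: "nat set"
  proof (cases "\<exists>a b. e = {a, b}")
    case True
    then obtain a b where "e = {a, b}" by blast
    have sub: "{z. (\<lambda>(x, y). {x, y}) z = e} \<subseteq> {(a, b), (b, a)}"
    proof
      fix z assume "z \<in> {z. (\<lambda>(x, y). {x, y}) z = e}"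
      then have "{fst z, snd z} = {a, b}" using \<open>e = {a, b}\<close> by (simp add: case_prod_beta)
      then show "z \<in> {(a, b), (b, a)}" unfolding doubleton_eq_iff by (cases z) auto
    qed
    have "card {(a, b), (b, a)} \<le> 2" using card_length[of "[(a, b), (b, a)]"] by simp
    moreover have "finite {(a, b), (b, a)}" by simp
    ultimately show ?thesis using card_mono[OF _ sub] finite_subset[OF sub] by linarith
  next
    case False
    then have "{z. (\<lambda>(x, y). {x, y}) z = e} = {}" by auto
    then show ?thesis by (simp only: finite.emptyI card.empty) simp
  qed
  have "Z \<subseteq> (\<Union>e\<in>pair_sets Z. {z. (\<lambda>(x, y). {x, y}) z = e})" unfolding pair_sets_def by auto
  then have "card Z \<le> card (\<Union>e\<in>pair_sets Z. {z. (\<lambda>(x, y). {x, y}) z = e})"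
    using fZ f2 unfolding pair_sets_def by (intro card_mono) auto
  also have "\<dots> \<le> (\<Sum>e\<in>pair_sets Z. card {z. (\<lambda>(x, y). {x, y}) z = e})"
    using fZ unfolding pair_sets_def by (intro card_UN_le) auto
  also have "\<dots> \<le> (\<Sum>e\<in>pair_sets Z. 2)" by (intro sum_mono) (use f2 in blast)
  finally show ?thesis by simp
qed

lemma pair_sets_ordered_pairs: "pair_sets (ordered_pairs X) \<subseteq> X"
  unfolding pair_sets_def ordered_pairs_def by auto

lemma pair_sets_subset_iff: "pair_sets Z \<subseteq> X \<longleftrightarrow> Z \<subseteq> ordered_pairs X"
  unfolding pair_sets_def ordered_pairs_def by auto

lemma real_choose_two: "real (p choose 2) = real p * (real p - 1) / 2"
proof (induction p)
  case (Suc p)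
  have "Suc p choose 2 = p + (p choose 2)" by (simp add: numeral_2_eq_2)
  then have "real (Suc p choose 2) = real p + real (p choose 2)" by simp
  then show ?case unfolding Suc.IH by (simp add: field_simps)
qed simp

lemma finite_complete_edges: "finite (complete_edges n)"
  unfolding complete_edges_def by (rule finite_subset[of _ "Pow {1..n}"]) auto

lemma card_complete_edges: "card (complete_edges n) = n choose 2"
  unfolding complete_edges_def using n_subsets[of "{1..n}" 2] by simp

lemma doubleton_in_complete_edges: "{x, y} \<in> complete_edges n \<longleftrightarrow> x \<in> {1..n} \<and> y \<in> {1..n} \<and> x \<noteq> y"
  unfolding complete_edges_def by (auto simp: card_insert_if split: if_splits)

lemma ordered_pairs_subset: "X \<subseteq> complete_edges n \<Longrightarrow> ordered_pairs X \<subseteq> {1..n} \<times> {1..n}"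
proof (rule subrelI)
  fix x y assume "X \<subseteq> complete_edges n" "(x, y) \<in> ordered_pairs X"
  then have "{x, y} \<in> complete_edges n" unfolding ordered_pairs_def by blast
  then show "(x, y) \<in> {1..n} \<times> {1..n}" unfolding doubleton_in_complete_edges by simp
qed

lemma finite_ordered_pairs: "X \<subseteq> complete_edges n \<Longrightarrow> finite (ordered_pairs X)"
  by (rule finite_subset[OF ordered_pairs_subset]) auto

lemma card_ordered_pairs_le: "X \<subseteq> complete_edges n \<Longrightarrow> card (ordered_pairs X) \<le> 2 * card X"
  using card_le_pair_sets[OF finite_ordered_pairs, of X n]
    card_mono[OF finite_subset[OF _ finite_complete_edges], of X n, OF _ pair_sets_ordered_pairs]
  by linarith

lemma c4_quads_vertices:
  assumes "(a, b, c, d) \<in> c4_quads M E" "M \<subseteq> complete_edges n"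
  shows "a \<in> {1..n}" "b \<in> {1..n}" "c \<in> {1..n}" "d \<in> {1..n}" "distinct [a, b, c, d]"
proof -
  have "{a, b} \<in> complete_edges n" "{b, c} \<in> complete_edges n" "{c, d} \<in> complete_edges n"
    "{d, a} \<in> complete_edges n" "a \<noteq> c" "b \<noteq> d"
    using assms unfolding c4_quads_def by (simp_all add: subset_iff)
  note e = this[unfolded doubleton_in_complete_edges]
  from e show "a \<in> {1..n}" "b \<in> {1..n}" "c \<in> {1..n}" "d \<in> {1..n}" by blast+
  from e show "distinct [a, b, c, d]" by simp
qed

lemma c4_quads_induced:
  assumes q: "(a, b, c, d) \<in> c4_quads M E" "M \<subseteq> complete_edges n" and G: "G \<subseteq> complete_edges n"
    and "{a, b} \<in> G" "{b, c} \<in> G" "{c, d} \<in> G" "{d, a} \<in> G" "{a, c} \<notin> G" "{b, d} \<notin> G"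
  shows "has_induced_C4 n G"
proof -
  note v = c4_quads_vertices[OF q]
  have "edges_within G {a, b, c, d} = {{a, b}, {b, c}, {c, d}, {d, a}}"
  proof
    show "edges_within G {a, b, c, d} \<subseteq> {{a, b}, {b, c}, {c, d}, {d, a}}"
    proof
      fix e assume e: "e \<in> edges_within G {a, b, c, d}"
      then have "card e = 2" "e \<subseteq> {a, b, c, d}" "e \<in> G" using G unfolding edges_within_def complete_edges_def by auto
      then obtain x y where xy: "e = {x, y}" "x \<noteq> y" unfolding card_2_iff by blast
      then have "x \<in> {a, b, c, d}" "y \<in> {a, b, c, d}" using \<open>e \<subseteq> {a, b, c, d}\<close> by blast+
      moreover have "{c, a} \<notin> G" "{d, b} \<notin> G" using assms(8,9) by (simp_all add: insert_commute)
      ultimately show "e \<in> {{a, b}, {b, c}, {c, d}, {d, a}}"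
        using \<open>e \<in> G\<close> assms(8,9) xy by (elim insertE emptyE) (simp_all add: insert_commute)
    qed
  next
    show "{{a, b}, {b, c}, {c, d}, {d, a}} \<subseteq> edges_within G {a, b, c, d}"
      using assms unfolding edges_within_def by auto
  qed
  moreover have "{a, b, c, d} \<subseteq> {1..n}" using v(1-4) by blast
  ultimately show ?thesis unfolding has_induced_C4_def using v(5) by blast
qed

text \<open>The diagonals come first, as coordinates 0 and 1, then the sides in cyclic order, in
  accordance with the roles of the coordinates in \<open>co_weight\<close>.\<close>

definition quad_pair :: "nat \<Rightarrow> nat \<times> nat \<times> nat \<times> nat \<Rightarrow> nat \<times> nat" where
  "quad_pair i = (\<lambda>(a, b, c, d). [(a, c), (b, d), (a, b), (b, c), (c, d), (d, a)] ! i)"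

lemma quad_pair_simps [simp]:
  "quad_pair 0 (a, b, c, d) = (a, c)" "quad_pair (Suc 0) (a, b, c, d) = (b, d)" "quad_pair 2 (a, b, c, d) = (a, b)"
  "quad_pair 3 (a, b, c, d) = (b, c)" "quad_pair 4 (a, b, c, d) = (c, d)" "quad_pair 5 (a, b, c, d) = (d, a)"
  unfolding quad_pair_def by (simp_all add: numeral_eq_Suc)

lemma six_cases: "(i::nat) < 6 \<Longrightarrow> i = 0 \<or> i = Suc 0 \<or> i = 2 \<or> i = 3 \<or> i = 4 \<or> i = 5"
  by linarith

text \<open>The left side is the value of the profile at the full coordinate set, the least one; it
  is the scale of what a single tuple may weigh.\<close>

lemma co_weight_ge_min:
  assumes "b \<le> m" "b \<le> v" "b > 0" "r > 0" "r \<le> real v" "J \<subseteq> {0..<6}" "J \<noteq> {}"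
  shows "(real b / real m)\<^sup>2 * (real b / real v) ^ 3 / real v \<le> co_weight b m v r J"
proof -
  let ?p = "real b / real m" and ?q = "real b / real v"
  have p: "0 < ?p" "?p \<le> 1" "0 < ?q" "?q \<le> 1" using assms by auto
  have v0: "real v > 0" using assms by simp
  have c1: "card (J \<inter> {0, 1}) \<le> 2" using card_mono[of "{0, 1::nat}" "J \<inter> {0, 1}"] by auto
  have "J - {0, 1} \<subseteq> {2, 3, 4, 5}" using assms(6) by auto
  from card_mono[OF _ this] have c2: "card (J - {0, 1}) - 1 \<le> 3" by simp
  show ?thesis
  proof (cases "J \<subseteq> {0, 1}")
    case True
    then have "J \<inter> {0, 1} = J" by blast
    then have "card J - 1 \<le> 2" using c1 by simp
    then have "?p\<^sup>2 \<le> ?p ^ (card J - 1)" using p by (intro power_decreasing) auto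
    moreover have "?q ^ 3 \<le> 1" using p by (intro power_le_one) auto
    ultimately have "?p\<^sup>2 * ?q ^ 3 \<le> ?p ^ (card J - 1) * 1" using p by (intro mult_mono) auto
    then have "?p\<^sup>2 * ?q ^ 3 / real v \<le> ?p ^ (card J - 1) / r"
      using assms(4,5) p v0 by (intro frac_le) auto
    then show ?thesis using True unfolding co_weight_def by simp
  next
    case False
    have "?p\<^sup>2 \<le> ?p ^ card (J \<inter> {0, 1})" using p c1 by (intro power_decreasing) auto
    moreover have "?q ^ 3 \<le> ?q ^ (card (J - {0, 1}) - 1)" using p c2 by (intro power_decreasing) auto
    ultimately have "?p\<^sup>2 * ?q ^ 3 \<le> ?p ^ card (J \<inter> {0, 1}) * ?q ^ (card (J - {0, 1}) - 1)"
      using p by (intro mult_mono) auto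
    then show ?thesis using False v0 unfolding co_weight_def by (simp add: divide_right_mono)
  qed
qed

text \<open>The coordinates are a diagonal and the two sides that complete it to a triangle: at most
  one factor \<open>b / m\<close> and at most one factor \<open>b / v\<close> can occur.\<close>

lemma co_weight_ge_triangle:
  assumes "b \<le> m" "b \<le> v" "b > 0" "z \<in> {0, 1}" "e1 \<notin> {0, 1}" "e2 \<notin> {0, 1}"
    "J \<subseteq> {z, e1, e2}" "card J \<ge> 2"
  shows "(real b / real m) * (real b / real v) / real v \<le> co_weight b m v r J"
proof -
  let ?p = "real b / real m" and ?q = "real b / real v"
  have p: "0 < ?p" "?p \<le> 1" "0 < ?q" "?q \<le> 1" using assms by auto
  have "\<not> J \<subseteq> {0, 1}"
  proof
    assume "J \<subseteq> {0, 1}"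
    then have "J \<subseteq> {z}" using assms(5-7) by auto
    then have "card J \<le> 1" using card_mono[of "{z}" J] by simp
    then show False using assms(8) by simp
  qed
  moreover have "card (J \<inter> {0, 1}) \<le> 1"
  proof -
    have "J \<inter> {0, 1} \<subseteq> {z}" using assms(5-7) by auto
    then show ?thesis using card_mono[of "{z}" "J \<inter> {0, 1}"] by simp
  qed
  then have "?p ^ 1 \<le> ?p ^ card (J \<inter> {0, 1})" using p by (intro power_decreasing) auto
  moreover have "card (J - {0, 1}) - 1 \<le> 1"
  proof -
    have "J - {0, 1} \<subseteq> {e1, e2}" using assms(4,7) by auto
    moreover have "card {e1, e2} \<le> 2" using card_length[of "[e1, e2]"] by simp
    ultimately show ?thesis using card_mono[of "{e1, e2}" "J - {0, 1}"] by simp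
  qed
  then have "?q ^ 1 \<le> ?q ^ (card (J - {0, 1}) - 1)" using p by (intro power_decreasing) auto
  ultimately have nJ: "\<not> J \<subseteq> {0, 1}"
    and le: "?p ^ 1 \<le> ?p ^ card (J \<inter> {0, 1})" "?q ^ 1 \<le> ?q ^ (card (J - {0, 1}) - 1)" by blast+
  have "?p ^ 1 * ?q ^ 1 \<le> ?p ^ card (J \<inter> {0, 1}) * ?q ^ (card (J - {0, 1}) - 1)"
    by (rule mult_mono[OF le]) (use p in auto)
  then have "?p * ?q / real v \<le> ?p ^ card (J \<inter> {0, 1}) * ?q ^ (card (J - {0, 1}) - 1) / real v"
    by (intro divide_right_mono) simp_all
  then show ?thesis unfolding co_weight_def if_not_P[OF nJ] .
qed

lemma sum_le_image_sum:
  fixes f :: "'a \<Rightarrow> real"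
  assumes "finite X" "S \<subseteq> g ` X" "\<And>x. 0 \<le> f x"
  shows "sum f S \<le> (\<Sum>x\<in>X. f (g x))"
proof -
  have "sum f S \<le> sum f (g ` X)" using assms by (intro sum_mono2) auto
  also have "\<dots> \<le> (\<Sum>x\<in>X. f (g x))" using sum_image_le[of X f g] assms by simp
  finally show ?thesis .
qed

text \<open>A coordinate set inside a triangle with at least two elements determines three of the vertices,
  and one that lies in no triangle determines all four.\<close>

lemma spread_c4s_balanced:
  fixes mu :: "nat \<Rightarrow> nat \<Rightarrow> nat \<Rightarrow> nat \<Rightarrow> real"
  assumes mu0: "\<And>a b c d. 0 \<le> mu a b c d" and V: "V = {1..n::nat}"
    and tot: "1 \<le> (\<Sum>a\<in>V. \<Sum>b\<in>V. \<Sum>c\<in>V. \<Sum>d\<in>V. mu a b c d)"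
    and e0: "\<And>x y. (\<Sum>c\<in>V. \<Sum>d\<in>V. mu x y c d) \<le> R / real v"
    and e1: "\<And>x y. (\<Sum>a\<in>V. \<Sum>d\<in>V. mu a x y d) \<le> R / real v"
    and e2: "\<And>x y. (\<Sum>a\<in>V. \<Sum>b\<in>V. mu a b x y) \<le> R / real v"
    and e3: "\<And>x y. (\<Sum>b\<in>V. \<Sum>c\<in>V. mu y b c x) \<le> R / real v"
    and z0: "\<And>x y. (\<Sum>b\<in>V. \<Sum>d\<in>V. mu x b y d) \<le> R / r"
    and z1: "\<And>x y. (\<Sum>a\<in>V. \<Sum>c\<in>V. mu a x c y) \<le> R / r"
    and t: "\<And>x y z. (\<Sum>d\<in>V. mu x y z d) \<le> T3" "\<And>x y z. (\<Sum>c\<in>V. mu x y c z) \<le> T3"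
      "\<And>x y z. (\<Sum>b\<in>V. mu x b y z) \<le> T3" "\<And>x y z. (\<Sum>a\<in>V. mu a x y z) \<le> T3"
    and f: "\<And>a b c d. mu a b c d \<le> T4"
    and T3: "T3 \<le> R * ((real b / real m) * (real b / real v) / real v)"
    and T4: "T4 \<le> R * ((real b / real m)\<^sup>2 * (real b / real v) ^ 3 / real v)"
    and par: "R \<ge> 1" "b \<le> m" "b \<le> v" "b > 0" "r > 0" "r \<le> real v"
    and Om: "Om = {(a, b, c, d). a \<in> V \<and> b \<in> V \<and> c \<in> V \<and> d \<in> V \<and> mu a b c d \<noteq> 0}"
    and nu: "nu = (\<lambda>(a, b, c, d). mu a b c d)"
  shows "weighted_tuples Om nu" "weighted_tuples.balanced Om nu quad_pair {0..<6} (co_weight b m v r) R Om"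
proof -
  have fV: "finite V" unfolding V by simp
  have OmV: "Om \<subseteq> V \<times> V \<times> V \<times> V" unfolding Om by auto
  then have fOm: "finite Om" using fV finite_subset by blast
  show wt: "weighted_tuples Om nu" by unfold_locales (auto simp: fOm nu mu0 split: prod.split)
  interpret weighted_tuples Om nu quad_pair by (rule wt)
  have mOm: "1 \<le> mass Om"
  proof -
    have "(\<Sum>a\<in>V. \<Sum>b\<in>V. \<Sum>c\<in>V. \<Sum>d\<in>V. mu a b c d) = mass (V \<times> V \<times> V \<times> V)"
      unfolding nu by (simp add: sum.cartesian_product)
    also have "\<dots> = mass Om"
      using fV by (intro sum.mono_neutral_right) (auto simp: Om nu)
    finally show ?thesis using tot by simp
  qed
  have w0: "0 < co_weight b m v r J" for J using par by (intro co_weight_pos) auto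
  have main: "mass (fib J x Om) \<le> R * co_weight b m v r J" if J: "J \<subseteq> {0..<6}" "J \<noteq> {}" for J x
  proof -
    obtain a0 b0 c0 d0 where x: "x = (a0, b0, c0, d0)" by (cases x) auto
    have fb: "quad_pair i (a, b, c, d) = quad_pair i (a0, b0, c0, d0) \<and> a \<in> V \<and> b \<in> V \<and> c \<in> V \<and> d \<in> V"
      if "(a, b, c, d) \<in> fib J x Om" "i \<in> J" for a b c d i
      using that unfolding fib_def x Om by auto
    have two: "mass (fib J x Om) \<le> (\<Sum>s\<in>V. \<Sum>u\<in>V. nu (g (s, u)))" if "fib J x Om \<subseteq> g ` (V \<times> V)" for g
    proof -
      have "mass (fib J x Om) \<le> (\<Sum>su\<in>V \<times> V. nu (g su))"
        using fV that nonneg by (intro sum_le_image_sum) auto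
      then show ?thesis by (simp add: sum.cartesian_product)
    qed
    have one: "mass (fib J x Om) \<le> (\<Sum>s\<in>V. nu (g s))" if "fib J x Om \<subseteq> g ` V" for g
      using fV that nonneg by (intro sum_le_image_sum) auto
    have wmin: "T4 \<le> R * co_weight b m v r J"
    proof -
      have "T4 \<le> R * ((real b / real m)\<^sup>2 * (real b / real v) ^ 3 / real v)" by (rule T4)
      also have "\<dots> \<le> R * co_weight b m v r J"
        using par J by (intro mult_left_mono co_weight_ge_min) auto
      finally show ?thesis .
    qed
    have wtri: "T3 \<le> R * co_weight b m v r J"
      if "z \<in> {0, 1}" "e1 \<notin> {0, 1}" "e2 \<notin> {0, 1}" "J \<subseteq> {z, e1, e2}" "card J \<ge> 2" for z e1 e2
    proof -
      have "T3 \<le> R * ((real b / real m) * (real b / real v) / real v)" by (rule T3)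
      also have "\<dots> \<le> R * co_weight b m v r J"
        using par by (intro mult_left_mono co_weight_ge_triangle[OF par(2,3,4) that]) auto
      finally show ?thesis .
    qed
    have fJ: "finite J" using J(1) finite_subset by blast
    have tri: "\<exists>i\<in>J. \<exists>j\<in>J. i \<noteq> j" if "card J \<ge> 2"
      using that fJ by (metis card_2_iff' card_le_Suc0_iff_eq not_less_eq_eq numeral_2_eq_2)
    show ?thesis
    proof (cases "card J \<ge> 2")
      case False
      then obtain i where i: "J = {i}" using J(2) fJ
        by (metis card_0_eq card_1_singletonE less_2_cases not_le One_nat_def)
      then have i6: "i < 6" using J(1) by auto
      have wz: "co_weight b m v r J = 1 / r" if "i \<in> {0, 1}" using that unfolding i co_weight_def by auto
      have we: "co_weight b m v r J = 1 / real v" if "i \<notin> {0, 1}" using that unfolding i co_weight_def by auto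
      consider "i = 0" | "i = Suc 0" | "i = 2" | "i = 3" | "i = 4" | "i = 5" using six_cases[OF i6] by blast
      then show ?thesis
      proof cases
        case 1
        have "mass (fib J x Om) \<le> (\<Sum>s\<in>V. \<Sum>u\<in>V. nu ((\<lambda>(s, u). (a0, s, c0, u)) (s, u)))"
          by (rule two) (use fb[of _ _ _ _ 0] i 1 in \<open>auto simp: image_iff\<close>)
        then show ?thesis using z0[of a0 c0] wz 1 by (simp add: nu)
      next
        case 2
        have "mass (fib J x Om) \<le> (\<Sum>s\<in>V. \<Sum>u\<in>V. nu ((\<lambda>(s, u). (s, b0, u, d0)) (s, u)))"
          by (rule two) (use fb[of _ _ _ _ "Suc 0"] i 2 in \<open>auto simp: image_iff\<close>)
        then show ?thesis using z1[of b0 d0] wz 2 by (simp add: nu)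
      next
        case 3
        have "mass (fib J x Om) \<le> (\<Sum>s\<in>V. \<Sum>u\<in>V. nu ((\<lambda>(s, u). (a0, b0, s, u)) (s, u)))"
          by (rule two) (use fb[of _ _ _ _ 2] i 3 in \<open>auto simp: image_iff\<close>)
        then show ?thesis using e0[of a0 b0] we 3 by (simp add: nu)
      next
        case 4
        have "mass (fib J x Om) \<le> (\<Sum>s\<in>V. \<Sum>u\<in>V. nu ((\<lambda>(s, u). (s, b0, c0, u)) (s, u)))"
          by (rule two) (use fb[of _ _ _ _ 3] i 4 in \<open>auto simp: image_iff\<close>)
        then show ?thesis using e1[of b0 c0] we 4 by (simp add: nu)
      next
        case 5
        have "mass (fib J x Om) \<le> (\<Sum>s\<in>V. \<Sum>u\<in>V. nu ((\<lambda>(s, u). (s, u, c0, d0)) (s, u)))"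
          by (rule two) (use fb[of _ _ _ _ 4] i 5 in \<open>auto simp: image_iff\<close>)
        then show ?thesis using e2[of c0 d0] we 5 by (simp add: nu)
      next
        case 6
        have "mass (fib J x Om) \<le> (\<Sum>s\<in>V. \<Sum>u\<in>V. nu ((\<lambda>(s, u). (a0, s, u, d0)) (s, u)))"
          by (rule two) (use fb[of _ _ _ _ 5] i 6 in \<open>auto simp: image_iff\<close>)
        then show ?thesis using e3[of a0 d0] we 6 by (simp add: nu)
      qed
    next
      case True
      obtain i j where ij: "i \<in> J" "j \<in> J" "i \<noteq> j" using tri[OF True] by blast
      have co: "0 \<in> J \<or> 2 \<in> J \<or> 5 \<in> J \<Longrightarrow> a = a0" "Suc 0 \<in> J \<or> 2 \<in> J \<or> 3 \<in> J \<Longrightarrow> b = b0"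
        "0 \<in> J \<or> 3 \<in> J \<or> 4 \<in> J \<Longrightarrow> c = c0" "Suc 0 \<in> J \<or> 4 \<in> J \<or> 5 \<in> J \<Longrightarrow> d = d0"
        "a \<in> V" "b \<in> V" "c \<in> V" "d \<in> V"
        if q: "(a, b, c, d) \<in> fib J x Om" for a b c d
      proof -
        have p: "quad_pair i (a, b, c, d) = quad_pair i (a0, b0, c0, d0)" if "i \<in> J" for i
          using fb[OF q that] by blast
        show "a = a0" if "0 \<in> J \<or> 2 \<in> J \<or> 5 \<in> J" using that p[of 0] p[of 2] p[of 5] by auto
        show "b = b0" if "Suc 0 \<in> J \<or> 2 \<in> J \<or> 3 \<in> J" using that p[of "Suc 0"] p[of 2] p[of 3] by auto
        show "c = c0" if "0 \<in> J \<or> 3 \<in> J \<or> 4 \<in> J" using that p[of 0] p[of 3] p[of 4] by auto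
        show "d = d0" if "Suc 0 \<in> J \<or> 4 \<in> J \<or> 5 \<in> J" using that p[of "Suc 0"] p[of 4] p[of 5] by auto
        show "a \<in> V" "b \<in> V" "c \<in> V" "d \<in> V" using fb[OF q ij(1)] by blast+
      qed
      \<comment> \<open>The four triangles: \<open>{0, 2, 3}\<close> is abc,
        \<open>{0, 4, 5}\<close> is acd, \<open>{1, 2, 5}\<close> is abd and
        \<open>{1, 3, 4}\<close> is bcd. Two pairs inside a triangle cover its vertices, and a
        \<open>J\<close> inside no triangle touches all four vertices.\<close>
      consider "J \<subseteq> {0, 2, 3}" | "J \<subseteq> {0, 4, 5}" | "J \<subseteq> {Suc 0, 2, 5}" | "J \<subseteq> {Suc 0, 3, 4}"
        | "\<not> J \<subseteq> {0, 2, 3}" "\<not> J \<subseteq> {0, 4, 5}" "\<not> J \<subseteq> {Suc 0, 2, 5}" "\<not> J \<subseteq> {Suc 0, 3, 4}" by blast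
      then show ?thesis
      proof cases
        case 1
        have "mass (fib J x Om) \<le> (\<Sum>s\<in>V. nu ((\<lambda>s. (a0, b0, c0, s)) s))"
        proof (rule one, rule subsetI)
          fix y assume y: "y \<in> fib J x Om"
          obtain a b c d where yy: "y = (a, b, c, d)" by (cases y) auto
          have "0 \<in> J \<or> 2 \<in> J \<or> 5 \<in> J" "Suc 0 \<in> J \<or> 2 \<in> J \<or> 3 \<in> J" "0 \<in> J \<or> 3 \<in> J \<or> 4 \<in> J" using ij 1 by auto
          then have "a = a0 \<and> b = b0 \<and> c = c0" using co(1,2,3)[OF y[unfolded yy]] by blast
          then show "y \<in> (\<lambda>s. (a0, b0, c0, s)) ` V" using co(8)[OF y[unfolded yy]] unfolding yy by auto
        qed
        then show ?thesis using t(1)[of a0 b0 c0] wtri[OF _ _ _ 1 True] by (simp add: nu)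
      next
        case 2
        have "mass (fib J x Om) \<le> (\<Sum>s\<in>V. nu ((\<lambda>s. (a0, s, c0, d0)) s))"
        proof (rule one, rule subsetI)
          fix y assume y: "y \<in> fib J x Om"
          obtain a b c d where yy: "y = (a, b, c, d)" by (cases y) auto
          have "0 \<in> J \<or> 2 \<in> J \<or> 5 \<in> J" "0 \<in> J \<or> 3 \<in> J \<or> 4 \<in> J" "Suc 0 \<in> J \<or> 4 \<in> J \<or> 5 \<in> J" using ij 2 by auto
          then have "a = a0 \<and> c = c0 \<and> d = d0" using co(1,3,4)[OF y[unfolded yy]] by blast
          then show "y \<in> (\<lambda>s. (a0, s, c0, d0)) ` V" using co(6)[OF y[unfolded yy]] unfolding yy by auto
        qed
        then show ?thesis using t(3)[of a0 c0 d0] wtri[OF _ _ _ 2 True] by (simp add: nu)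
      next
        case 3
        have "mass (fib J x Om) \<le> (\<Sum>s\<in>V. nu ((\<lambda>s. (a0, b0, s, d0)) s))"
        proof (rule one, rule subsetI)
          fix y assume y: "y \<in> fib J x Om"
          obtain a b c d where yy: "y = (a, b, c, d)" by (cases y) auto
          have "0 \<in> J \<or> 2 \<in> J \<or> 5 \<in> J" "Suc 0 \<in> J \<or> 2 \<in> J \<or> 3 \<in> J" "Suc 0 \<in> J \<or> 4 \<in> J \<or> 5 \<in> J" using ij 3 by auto
          then have "a = a0 \<and> b = b0 \<and> d = d0" using co(1,2,4)[OF y[unfolded yy]] by blast
          then show "y \<in> (\<lambda>s. (a0, b0, s, d0)) ` V" using co(7)[OF y[unfolded yy]] unfolding yy by auto
        qed
        then show ?thesis using t(2)[of a0 b0 d0] wtri[OF _ _ _ 3 True] by (simp add: nu)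
      next
        case 4
        have "mass (fib J x Om) \<le> (\<Sum>s\<in>V. nu ((\<lambda>s. (s, b0, c0, d0)) s))"
        proof (rule one, rule subsetI)
          fix y assume y: "y \<in> fib J x Om"
          obtain a b c d where yy: "y = (a, b, c, d)" by (cases y) auto
          have "Suc 0 \<in> J \<or> 2 \<in> J \<or> 3 \<in> J" "0 \<in> J \<or> 3 \<in> J \<or> 4 \<in> J" "Suc 0 \<in> J \<or> 4 \<in> J \<or> 5 \<in> J" using ij 4 by auto
          then have "b = b0 \<and> c = c0 \<and> d = d0" using co(2,3,4)[OF y[unfolded yy]] by blast
          then show "y \<in> (\<lambda>s. (s, b0, c0, d0)) ` V" using co(5)[OF y[unfolded yy]] unfolding yy by auto
        qed
        then show ?thesis using t(4)[of b0 c0 d0] wtri[OF _ _ _ 4 True] by (simp add: nu)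
      next
        case 5
        have J6: "i < 6" if "i \<in> J" for i using J(1) that by auto
        obtain ja where ja: "ja \<in> J" "ja = 0 \<or> ja = 2 \<or> ja = 5" using 5(4) six_cases[OF J6] by blast
        obtain jb where jb: "jb \<in> J" "jb = Suc 0 \<or> jb = 2 \<or> jb = 3" using 5(2) six_cases[OF J6] by blast
        obtain jc where jc: "jc \<in> J" "jc = 0 \<or> jc = 3 \<or> jc = 4" using 5(3) six_cases[OF J6] by blast
        obtain jd where jd: "jd \<in> J" "jd = Suc 0 \<or> jd = 4 \<or> jd = 5" using 5(1) six_cases[OF J6] by blast
        have "(a, b, c, d) = (a0, b0, c0, d0)" if q: "(a, b, c, d) \<in> fib J x Om" for a b c d
          using co(1-4)[OF q] ja jb jc jd by blast
        then have "fib J x Om \<subseteq> {(a0, b0, c0, d0)}" by force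
        then have "mass (fib J x Om) \<le> mass {(a0, b0, c0, d0)}" using nonneg by (intro sum_mono2) auto
        then show ?thesis using f[of a0 b0 c0 d0] wmin by (simp add: nu)
      qed
    qed
  qed
  have "spread {0..<6} (\<lambda>J. R * co_weight b m v r J * mass Om) Om" unfolding spread_def
  proof (intro allI impI)
    fix J x assume J: "J \<subseteq> {0..<6::nat}" "J \<noteq> {}"
    have "mass (fib J x Om) \<le> R * co_weight b m v r J * 1" using main[OF J, of x] by simp
    also have "\<dots> \<le> R * co_weight b m v r J * mass Om"
      using mOm w0[of J] par(1) by (intro mult_left_mono) auto
    finally show "mass (fib J x Om) \<le> R * co_weight b m v r J * mass Om" .
  qed
  then show "balanced {0..<6} (co_weight b m v r) R Om" unfolding balanced_def using mOm by auto
qed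


text \<open>Certificates become refinements: a set of pairs inside the graph moves from
  \<open>M\<close> to \<open>E\<close>, a set missing the graph is deleted from \<open>M\<close>.
  The factor 2 in \<open>2 * R\<close> turns \<open>1 / (k * n)\<close> into \<open>2 / v\<close>,
  and passing from ordered to unordered pairs halves the guaranteed sizes.\<close>

lemma container_step:
  assumes M: "M \<subseteq> complete_edges n" and E: "E \<subseteq> complete_edges n" "M \<inter> E = {}"
    and rich: "spread_c4s R n k M E" and k: "k * real n = real (card M)" "k > 0" "n > 0" and R: "R \<ge> 1"
    and v: "v = 2 * card M" and R': "R' = 2 * R * 2 ^ 130"
    and b: "b > 0" "b \<le> 2 * m" "b \<le> v" and r: "r \<le> k\<^sup>2" "r \<le> real v"
    and T3: "R / k ^ 3 \<le> 2 * R * ((real b / real (2 * m)) * (real b / real v) / real v)"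
    and T4: "R / k ^ 4 \<le> 2 * R * ((real b / real (2 * m))\<^sup>2 * (real b / real v) ^ 3 / real v)"
    and br: "8 * real b * R' \<le> real v" "8 * real b * R' \<le> r" "8193 * R' * real (2 * m) \<le> r * real b"
    and c: "c = (8194 * (2 * m) + 1) * (n\<^sup>2 + 1) ^ (2 * b)"
  shows "\<exists>D. finite D \<and> card D \<le> 12 * c ^ 6 \<and>
    (\<forall>P\<in>D. fst P \<subseteq> M \<and> E \<subseteq> snd P \<and> snd P \<subseteq> E \<union> M \<and> fst P \<inter> snd P = {} \<and>
       (real (card (fst P)) \<le> real (card M) - real (card M) / (2 * R') \<or>
        real (card E) + r / (8 * R') \<le> real (card (snd P)))) \<and>
    (\<forall>G\<in>ind_C4_free_graphs n m. contained_in G (M, E) \<longrightarrow> (\<exists>P\<in>D. contained_in G P))"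
proof -
  define V where "V = {1..n}"
  obtain mu :: "nat \<Rightarrow> nat \<Rightarrow> nat \<Rightarrow> nat \<Rightarrow> real" where
    mu0: "\<forall>a b c d. 0 \<le> mu a b c d" and
    supp: "\<forall>a b c d. mu a b c d \<noteq> 0 \<longrightarrow> (a, b, c, d) \<in> c4_quads M E" and
    tot: "1 \<le> (\<Sum>a\<in>V. \<Sum>b\<in>V. \<Sum>c\<in>V. \<Sum>d\<in>V. mu a b c d)" and
    e: "\<forall>x y. (\<Sum>c\<in>V. \<Sum>d\<in>V. mu x y c d) \<le> R / (k * n)"
      "\<forall>x y. (\<Sum>a\<in>V. \<Sum>d\<in>V. mu a x y d) \<le> R / (k * n)"
      "\<forall>x y. (\<Sum>a\<in>V. \<Sum>b\<in>V. mu a b x y) \<le> R / (k * n)"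
      "\<forall>x y. (\<Sum>b\<in>V. \<Sum>c\<in>V. mu y b c x) \<le> R / (k * n)" and
    z: "\<forall>x y. (\<Sum>b\<in>V. \<Sum>d\<in>V. mu x b y d) \<le> R / k\<^sup>2"
      "\<forall>x y. (\<Sum>a\<in>V. \<Sum>c\<in>V. mu a x c y) \<le> R / k\<^sup>2" and
    t: "\<forall>x y z. (\<Sum>d\<in>V. mu x y z d) \<le> R / k ^ 3" "\<forall>x y z. (\<Sum>c\<in>V. mu x y c z) \<le> R / k ^ 3"
      "\<forall>x y z. (\<Sum>b\<in>V. mu x b y z) \<le> R / k ^ 3" "\<forall>x y z. (\<Sum>a\<in>V. mu a x y z) \<le> R / k ^ 3" and
    f: "\<forall>a b c d. mu a b c d \<le> R / k ^ 4"
    using rich unfolding spread_c4s_def V_def by (elim exE conjE)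
  define Om where "Om = {(a, b, c, d). a \<in> V \<and> b \<in> V \<and> c \<in> V \<and> d \<in> V \<and> mu a b c d \<noteq> 0}"
  define nu where "nu = (\<lambda>(a, b, c, d). mu a b c d)"
  have "0 < 8 * real b * R'" using b R unfolding R' by simp
  then have r0: "r > 0" using br(2) by linarith
  have R'0: "R' > 0" using R unfolding R' by simp
  have Rv: "R / (k * real n) = 2 * R / real v" unfolding k(1) v by simp
  have Rr: "R / k\<^sup>2 \<le> 2 * R / r" using r0 r(1) R k(2) by (intro frac_le) auto
  have v0: "v > 0" using b by linarith
  have vb: "1 \<le> 2 * R" using R by simp
  note bal = spread_c4s_balanced[of mu V n "2 * R" v r "R / k ^ 3" "R / k ^ 4" b "2 * m" Om nu,
      OF mu0[rule_format] V_def tot e(1)[rule_format, unfolded Rv] e(2)[rule_format, unfolded Rv]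
        e(3)[rule_format, unfolded Rv] e(4)[rule_format, unfolded Rv]
        order_trans[OF z(1)[rule_format] Rr] order_trans[OF z(2)[rule_format] Rr]
        t(1)[rule_format] t(2)[rule_format] t(3)[rule_format] t(4)[rule_format] f[rule_format]
        T3 T4 vb b(2,3,1) r0 r(2) Om_def nu_def]
  interpret weighted_tuples Om nu quad_pair by (rule bal(1))
  have OmQ: "x \<in> Om \<Longrightarrow> x \<in> c4_quads M E" for x unfolding Om_def using supp by auto
  have fV: "finite V" unfolding V_def by simp
  have qM: "quad_pair i ` Om \<subseteq> ordered_pairs M" if i: "2 \<le> i" "i < 6" for i
  proof
    fix y assume "y \<in> quad_pair i ` Om"
    then obtain x where x: "x \<in> Om" "y = quad_pair i x" by blast
    obtain a b' c' d where xx: "x = (a, b', c', d)" by (cases x) auto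
    have q: "(a, b', c', d) \<in> c4_quads M E" using OmQ[OF x(1)] xx by simp
    consider "i = 2" | "i = 3" | "i = 4" | "i = 5" using i by linarith
    then show "y \<in> ordered_pairs M"
      by cases (use q x(2) xx in \<open>auto simp: c4_quads_def ordered_pairs_def\<close>)
  qed
  have cv: "card (quad_pair i ` Om) \<le> v" if i: "2 \<le> i" "i < 6" for i
    using card_mono[OF finite_ordered_pairs[OF M] qM[OF i]] card_ordered_pairs_le[OF M] unfolding v by linarith
  have cN: "card (quad_pair i ` Om) \<le> n\<^sup>2" if i: "i < 2" for i
  proof -
    have "i = 0 \<or> i = Suc 0" using i by linarith
    then have "quad_pair i ` Om \<subseteq> V \<times> V" unfolding Om_def by auto
    then have "card (quad_pair i ` Om) \<le> card (V \<times> V)" using fV by (intro card_mono) auto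
    then show ?thesis unfolding V_def by (simp add: power2_eq_square)
  qed
  have vN: "v \<le> n\<^sup>2"
  proof -
    have "card M \<le> n choose 2" using card_mono[OF finite_complete_edges M] card_complete_edges by simp
    then have "v \<le> n * (n - 1)" unfolding v choose_two using k(3) by simp
    also have "\<dots> \<le> n\<^sup>2" by (simp add: power2_eq_square)
    finally show ?thesis .
  qed
  have R'': "R' = 2 * R * 2 ^ 130" by (rule R')
  have "\<exists>QE QN. finite QE \<and> finite QN \<and> card QE \<le> 6 * c ^ 6 \<and> card QN \<le> 6 * c ^ 6 \<and>
    (\<forall>Z\<in>QE. \<exists>i<2. Z \<subseteq> quad_pair i ` Om \<and> r / (4 * R') \<le> real (card Z)) \<and>
    (\<forall>Z\<in>QN. \<exists>i\<in>{2..<6}. Z \<subseteq> quad_pair i ` Om \<and> real v / (2 * R') \<le> real (card Z)) \<and>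
    (\<forall>G. finite G \<longrightarrow> card G \<le> 2 * m \<longrightarrow>
       \<not> (\<exists>x\<in>Om. quad_pair 0 x \<notin> G \<and> quad_pair 1 x \<notin> G \<and> (\<forall>i\<in>{2..<6}. quad_pair i x \<in> G)) \<longrightarrow>
       (\<exists>Z\<in>QE. Z \<subseteq> G) \<or> (\<exists>Z\<in>QN. Z \<inter> G = {}))"
    by (rule asymmetric_container[OF vb bal(2) cv v0 cN vN R'' b(1) br(1,2) b(2) br(3) c])
  then obtain QE QN where Q: "finite QE" "finite QN" "card QE \<le> 6 * c ^ 6" "card QN \<le> 6 * c ^ 6"
    "\<forall>Z\<in>QE. \<exists>i<2. Z \<subseteq> quad_pair i ` Om \<and> r / (4 * R') \<le> real (card Z)"
    "\<forall>Z\<in>QN. \<exists>i\<in>{2..<6}. Z \<subseteq> quad_pair i ` Om \<and> real v / (2 * R') \<le> real (card Z)"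
    "\<forall>G. finite G \<longrightarrow> card G \<le> 2 * m \<longrightarrow>
       \<not> (\<exists>x\<in>Om. quad_pair 0 x \<notin> G \<and> quad_pair 1 x \<notin> G \<and> (\<forall>i\<in>{2..<6}. quad_pair i x \<in> G)) \<longrightarrow>
       (\<exists>Z\<in>QE. Z \<subseteq> G) \<or> (\<exists>Z\<in>QN. Z \<inter> G = {})"
    by (elim exE conjE)
  have finM: "finite M" "finite E" using M E(1) finite_complete_edges finite_subset by blast+
  \<comment> \<open>Certificates of edges consist of diagonals, which are outside \<open>E\<close>;
    one that lies in a contained graph therefore lies in \<open>M\<close>. Those not inside
    \<open>M\<close> cannot arise from a contained graph and are dropped.\<close>
  define D where "D = (\<lambda>Z. (M - pair_sets Z, E \<union> pair_sets Z)) ` {Z\<in>QE. pair_sets Z \<subseteq> M} \<union>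
    (\<lambda>Z. (M - pair_sets Z, E)) ` QN"
  have fD: "finite D" unfolding D_def using Q(1,2) by simp
  have "card D \<le> card QE + card QN"
  proof -
    have "card ((\<lambda>Z. (M - pair_sets Z, E \<union> pair_sets Z)) ` {Z\<in>QE. pair_sets Z \<subseteq> M}) \<le> card {Z\<in>QE. pair_sets Z \<subseteq> M}"
      using Q(1) by (intro card_image_le) simp
    also have "\<dots> \<le> card QE" using Q(1) by (intro card_mono) auto
    finally have "card ((\<lambda>Z. (M - pair_sets Z, E \<union> pair_sets Z)) ` {Z\<in>QE. pair_sets Z \<subseteq> M}) \<le> card QE" .
    moreover have "card ((\<lambda>Z. (M - pair_sets Z, E)) ` QN) \<le> card QN" using Q(2) by (rule card_image_le)
    ultimately show ?thesis unfolding D_def by (intro order_trans[OF card_Un_le]) simp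
  qed
  then have cD: "card D \<le> 12 * c ^ 6" using Q(3,4) by linarith
  have finZ: "finite Z" if "Z \<subseteq> quad_pair i ` Om" for Z i
    using that fin by (meson finite_imageI finite_subset)
  have prog: "fst P \<subseteq> M \<and> E \<subseteq> snd P \<and> snd P \<subseteq> E \<union> M \<and> fst P \<inter> snd P = {} \<and>
       (real (card (fst P)) \<le> real (card M) - real (card M) / (2 * R') \<or>
        real (card E) + r / (8 * R') \<le> real (card (snd P)))" if P: "P \<in> D" for P
  proof -
    consider Z where "Z \<in> QE" "pair_sets Z \<subseteq> M" "P = (M - pair_sets Z, E \<union> pair_sets Z)"
      | Z where "Z \<in> QN" "P = (M - pair_sets Z, E)" using P unfolding D_def by blast
    then show ?thesis
    proof cases
      case 1
      obtain i where i: "Z \<subseteq> quad_pair i ` Om" "r / (4 * R') \<le> real (card Z)" using Q(5) 1(1) by blast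
      have "card Z \<le> 2 * card (pair_sets Z)" by (rule card_le_pair_sets[OF finZ[OF i(1)]])
      then have "real (card Z) \<le> 2 * real (card (pair_sets Z))" by linarith
      moreover have "r / (8 * R') = r / (4 * R') / 2" by simp
      ultimately have "r / (8 * R') \<le> real (card (pair_sets Z))" using i(2) by linarith
      moreover have "card (E \<union> pair_sets Z) = card E + card (pair_sets Z)"
        using 1(2) E(2) finM by (intro card_Un_disjoint) (auto intro: finite_subset)
      ultimately show ?thesis unfolding 1(3) using 1(2) E(2) by auto
    next
      case 2
      obtain i where i: "i \<in> {2..<6}" "Z \<subseteq> quad_pair i ` Om" "real v / (2 * R') \<le> real (card Z)"
        using Q(6) 2(1) by blast
      have "Z \<subseteq> ordered_pairs M" using qM[of i] i(1,2) by auto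
      then have pZ: "pair_sets Z \<subseteq> M" unfolding pair_sets_subset_iff .
      have "card Z \<le> 2 * card (pair_sets Z)" by (rule card_le_pair_sets[OF finZ[OF i(2)]])
      then have "real (card Z) \<le> 2 * real (card (pair_sets Z))" by linarith
      then have "real v / (2 * R') \<le> 2 * real (card (pair_sets Z))" using i(3) by (rule order_trans[rotated])
      moreover have "real v / (2 * R') = 2 * (real (card M) / (2 * R'))" unfolding v by simp
      ultimately have "2 * (real (card M) / (2 * R')) \<le> 2 * real (card (pair_sets Z))" by (simp only:)
      then have "real (card M) / (2 * R') \<le> real (card (pair_sets Z))" by linarith
      moreover have "card (M - pair_sets Z) = card M - card (pair_sets Z)"
        using pZ finM by (intro card_Diff_subset) (auto intro: finite_subset)
      moreover have "card (pair_sets Z) \<le> card M" using pZ finM by (intro card_mono)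
      ultimately have "real (card (M - pair_sets Z)) \<le> real (card M) - real (card M) / (2 * R')"
        by (simp add: of_nat_diff)
      then show ?thesis unfolding 2(2) using E(2) by auto
    qed
  qed
  have cov: "\<exists>P\<in>D. contained_in G P" if G: "G \<in> ind_C4_free_graphs n m" "contained_in G (M, E)" for G
  proof -
    have G': "G \<subseteq> complete_edges n" "card G = m" "\<not> has_induced_C4 n G"
      using G(1) unfolding ind_C4_free_graphs_def by auto
    have GP: "E \<subseteq> G" "G \<subseteq> E \<union> M" using G(2) unfolding contained_in_def by auto
    define OG where "OG = ordered_pairs G"
    have 1: "finite OG" "card OG \<le> 2 * m"
      using finite_ordered_pairs[OF G'(1)] card_ordered_pairs_le[OF G'(1)] G'(2) unfolding OG_def by auto
    have 2: "\<not> (\<exists>x\<in>Om. quad_pair 0 x \<notin> OG \<and> quad_pair 1 x \<notin> OG \<and> (\<forall>i\<in>{2..<6}. quad_pair i x \<in> OG))"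
    proof
      assume "\<exists>x\<in>Om. quad_pair 0 x \<notin> OG \<and> quad_pair 1 x \<notin> OG \<and> (\<forall>i\<in>{2..<6}. quad_pair i x \<in> OG)"
      then obtain x where x: "x \<in> Om" "quad_pair 0 x \<notin> OG" "quad_pair (Suc 0) x \<notin> OG"
        "\<And>i. i \<in> {2..<6} \<Longrightarrow> quad_pair i x \<in> OG" by auto
      obtain a b' c' d where xx: "x = (a, b', c', d)" by (cases x) auto
      have q: "(a, b', c', d) \<in> c4_quads M E" using OmQ[OF x(1)] xx by simp
      have "{a, b'} \<in> G" "{b', c'} \<in> G" "{c', d} \<in> G" "{d, a} \<in> G" "{a, c'} \<notin> G" "{b', d} \<notin> G"
        using x(2,3) x(4)[of 2] x(4)[of 3] x(4)[of 4] x(4)[of 5] unfolding xx OG_def ordered_pairs_def by auto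
      then show False using c4_quads_induced[OF q M G'(1)] G'(3) by blast
    qed
    consider Z where "Z \<in> QE" "Z \<subseteq> OG" | Z where "Z \<in> QN" "Z \<inter> OG = {}"
      using Q(7)[rule_format, OF 1 2] by blast
    then show ?thesis
    proof cases
      case 1
      then obtain i where i: "i < 2" "Z \<subseteq> quad_pair i ` Om" using Q(5) by blast
      have pG: "pair_sets Z \<subseteq> G" using 1(2) unfolding OG_def pair_sets_subset_iff .
      have "pair_sets Z \<inter> E = {}"
      proof -
        have "{x, y} \<notin> E" if "(x, y) \<in> Z" for x y
        proof -
          have "(x, y) \<in> quad_pair i ` Om" using i(2) that by blast
          then obtain w where w: "w \<in> Om" "(x, y) = quad_pair i w" by blast
          obtain a b' c' d where "w = (a, b', c', d)" by (cases w) auto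
          then have q: "(a, b', c', d) \<in> Om" "(x, y) = quad_pair i (a, b', c', d)" using w by simp_all
          have "{a, c'} \<notin> E" "{b', d} \<notin> E" using OmQ[OF q(1)] unfolding c4_quads_def by auto
          moreover have "i = 0 \<or> i = Suc 0" using i(1) by linarith
          ultimately show ?thesis using q(2) by auto
        qed
        then show ?thesis unfolding pair_sets_def by auto
      qed
      then have pM: "pair_sets Z \<subseteq> M" using pG GP by blast
      have "(M - pair_sets Z, E \<union> pair_sets Z) \<in> D" using 1(1) pM unfolding D_def by blast
      moreover have "contained_in G (M - pair_sets Z, E \<union> pair_sets Z)"
        using GP pG unfolding contained_in_def by auto
      ultimately show ?thesis by blast
    next
      case 2
      have "pair_sets Z \<inter> G = {}" using 2(2) unfolding OG_def pair_sets_def ordered_pairs_def by auto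
      then have "contained_in G (M - pair_sets Z, E)" using GP unfolding contained_in_def by auto
      moreover have "(M - pair_sets Z, E) \<in> D" using 2(1) unfolding D_def by blast
      ultimately show ?thesis by blast
    qed
  qed
  show ?thesis using fD cD prog cov by (intro exI[of _ D] conjI ballI impI) auto
qed

section \<open>Spread weightings from paths\<close>

text \<open>Pick an edge \<open>(x, y)\<close> uniformly, a second neighbour \<open>w\<close> of \<open>x\<close>, and then an independent copy
  \<open>z\<close> of \<open>x\<close> given \<open>(y, w)\<close>; capping the conditional weights at \<open>s\<^sup>2\<close> keeps the
  weighting spread out and costs at most a quarter of its total weight.\<close>

lemma path_weighting_spread:
  fixes Ga :: "nat \<Rightarrow> nat set" and X S :: "nat set" and e kap eta al be k R :: real
  assumes X: "X \<subseteq> {1..n}" and S: "S \<subseteq> {1..n}" and Ga: "\<And>x. x \<in> X \<Longrightarrow> Ga x \<subseteq> S"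
    and GM: "\<And>x y. x \<in> X \<Longrightarrow> y \<in> Ga x \<Longrightarrow> {x, y} \<in> M"
    and kap: "kap > 0" "\<And>x. x \<in> X \<Longrightarrow> kap \<le> real (card (Ga x))"
    and e: "e = (\<Sum>x\<in>X. real (card (Ga x)))" "e > 0" and s: "s = real (card S)"
    and E: "E \<subseteq> complete_edges n"
    and al: "(\<Sum>x\<in>X. real (card {(y, w). y \<in> Ga x \<and> w \<in> Ga x \<and> (y = w \<or> {y, w} \<in> E)}) / (e * real (card (Ga x)))) \<le> al"
    and be: "(2 * real (card E) + real (card X)) * s\<^sup>2 / e\<^sup>2 \<le> be"
    and eta: "eta > 0" "al + be + eta \<le> 3 / 4"
    and R1: "1 / e \<le> eta * (R / (k * n))" and R2: "s\<^sup>2 / e\<^sup>2 \<le> eta * (R / k\<^sup>2)"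
    and R3: "real (card X) / (e * kap) \<le> eta * (R / k\<^sup>2)"
    and R4: "1 / (e * kap) \<le> eta * (R / k ^ 3)" and R5: "s\<^sup>2 / (e\<^sup>2 * kap) \<le> eta * (R / k ^ 3)"
    and R6: "s\<^sup>2 / (e\<^sup>2 * kap\<^sup>2) \<le> eta * (R / k ^ 4)"
  shows "spread_c4s R n k M E"
proof -
  define V where "V = {1..n}"
  have fV: "finite V" "X \<subseteq> V" "S \<subseteq> V" unfolding V_def using X S by auto
  have fX: "finite X" "finite S" using fV finite_subset by blast+
  have fG: "x \<in> X \<Longrightarrow> finite (Ga x)" for x using Ga fX(2) finite_subset by blast
  define d where "d x = real (card (Ga x))" for x
  have d0: "x \<in> X \<Longrightarrow> d x > 0" for x unfolding d_def using kap(1) kap(2)[of x] by linarith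
  \<comment> \<open>The law of the random path: the edge \<open>(x, y)\<close> has probability
    \<open>1 / e\<close>, then \<open>w\<close> is uniform in \<open>Ga x\<close>.\<close>
  define g where "g x y w = (if x \<in> X \<and> y \<in> Ga x \<and> w \<in> Ga x then 1 / (e * d x) else 0)" for x y w
  have g0: "0 \<le> g x y w" for x y w unfolding g_def using e(2) d0[of x] by auto
  have gsym: "g x y w = g x w y" for x y w unfolding g_def by auto
  have gk: "g x y w \<le> 1 / (e * kap)" for x y w
    unfolding g_def using e(2) kap(1) kap(2)[of x] d0[of x] by (auto simp: d_def intro!: divide_left_mono mult_left_mono)
  have gS: "g x y w \<noteq> 0 \<Longrightarrow> y \<in> S \<and> w \<in> S" for x y w
    unfolding g_def using Ga[of x] by (auto split: if_splits)
  have sg: "(\<Sum>w\<in>V. g x y w) = (if x \<in> X \<and> y \<in> Ga x then 1 / e else 0)" for x y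
  proof (cases "x \<in> X \<and> y \<in> Ga x")
    case True
    have GV: "Ga x \<subseteq> V" using Ga True fV by blast
    have "(\<Sum>w\<in>V. g x y w) = (\<Sum>w\<in>V. if w \<in> Ga x then 1 / (e * d x) else 0)"
      unfolding g_def using True by simp
    also have "\<dots> = (\<Sum>w\<in>Ga x. 1 / (e * d x))" using fV GV by (simp add: sum.inter_restrict[symmetric] Int_absorb1)
    also have "\<dots> = 1 / e" using d0[of x] True unfolding d_def by simp
    finally show ?thesis using True by simp
  next
    case False
    then show ?thesis unfolding g_def by auto
  qed
  then have sg1: "(\<Sum>w\<in>V. g x y w) \<le> 1 / e" for x y using e(2) by simp
  have sg1': "(\<Sum>w\<in>V. g x w y) \<le> 1 / e" for x y using sg1[of x y] gsym[of x] by simp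
  define P where "P y w = (\<Sum>x\<in>V. g x y w)" for y w
  have P0: "0 \<le> P y w" for y w unfolding P_def by (intro sum_nonneg g0)
  have PX: "P y w \<le> real (card X) / (e * kap)" for y w
  proof -
    have "P y w = (\<Sum>x\<in>X. g x y w)" unfolding P_def using fV by (intro sum.mono_neutral_right) (auto simp: g_def)
    also have "\<dots> \<le> (\<Sum>x\<in>X. 1 / (e * kap))" by (intro sum_mono gk)
    finally show ?thesis by simp
  qed
  have X1: "X \<noteq> {}" using e by auto
  then obtain x0 where x0: "x0 \<in> X" by blast
  have s0: "s > 0"
  proof -
    have "Ga x0 \<noteq> {}" using d0[OF x0] unfolding d_def by auto
    then have "S \<noteq> {}" using Ga[OF x0] by blast
    then show ?thesis unfolding s using fX by (simp add: card_gt_0_iff)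
  qed
  \<comment> \<open>The exact conditional law divides by \<open>P y w\<close>, which may be tiny.
    Raising the divisor to at least \<open>1 / s\<^sup>2\<close>, the average of \<open>P\<close>
    over the pairs in \<open>S\<close>, bounds the weight by
    \<open>s\<^sup>2 * g x y w * g z y w\<close>.\<close>
  define mx where "mx y w = max (P y w) (1 / s\<^sup>2)" for y w
  have mx: "mx y w > 0" "P y w \<le> mx y w" "1 / s\<^sup>2 \<le> mx y w" for y w
    unfolding mx_def using s0 by (auto simp: less_max_iff_disj)
  define q where "q x y z w = g x y w * g z y w / mx y w" for x y z w
  have q0: "0 \<le> q x y z w" for x y z w unfolding q_def using g0 mx(1)[of y w] by (intro divide_nonneg_pos mult_nonneg_nonneg) auto
  have qsym: "q x y z w = q z y x w" "q x y z w = q x w z y" for x y z w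
  proof -
    have "P y w = P w y" unfolding P_def using gsym by metis
    then show "q x y z w = q z y x w" "q x y z w = q x w z y"
      unfolding q_def mx_def using gsym[of x y w] gsym[of z y w] by simp_all
  qed
  have qz: "(\<Sum>z\<in>V. q x y z w) \<le> g x y w" for x y w
  proof -
    have "(\<Sum>z\<in>V. q x y z w) = g x y w * P y w / mx y w"
      unfolding q_def P_def by (simp add: sum_distrib_left sum_divide_distrib)
    also have "\<dots> \<le> g x y w * mx y w / mx y w" using g0 mx by (intro divide_right_mono mult_left_mono) (auto intro: less_imp_le)
    finally show ?thesis using mx(1)[of y w] by simp
  qed
  have qx: "(\<Sum>x\<in>V. q x y z w) \<le> g z y w" for z y w using qz[of z y w] qsym(1)[of _ y z w] by simp
  have qs: "q x y z w \<le> s\<^sup>2 * (g x y w * g z y w)" for x y z w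
  proof -
    have "q x y z w \<le> g x y w * g z y w / (1 / s\<^sup>2)" unfolding q_def
      using g0 mx s0 by (intro divide_left_mono mult_nonneg_nonneg) auto
    then show ?thesis by (simp add: mult.commute)
  qed
  have m_ab: "(\<Sum>z\<in>V. \<Sum>w\<in>V. q x y z w) \<le> 1 / e" for x y
  proof -
    have "(\<Sum>z\<in>V. \<Sum>w\<in>V. q x y z w) = (\<Sum>w\<in>V. \<Sum>z\<in>V. q x y z w)" by (rule sum.swap)
    also have "\<dots> \<le> (\<Sum>w\<in>V. g x y w)" by (intro sum_mono qz)
    finally show ?thesis using sg1[of x y] by linarith
  qed
  have m_bc: "(\<Sum>x\<in>V. \<Sum>w\<in>V. q x y z w) \<le> 1 / e" for z y
    using m_ab[of z y] qsym(1)[of _ y z] by simp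
  have m_cd: "(\<Sum>x\<in>V. \<Sum>y\<in>V. q x y z w) \<le> 1 / e" for z w
    using m_bc[where z = z and y = w] qsym(2)[of _ w z] by simp
  have m_da: "(\<Sum>y\<in>V. \<Sum>z\<in>V. q x y z w) \<le> 1 / e" for x w
  proof -
    have "(\<Sum>y\<in>V. \<Sum>z\<in>V. q x y z w) \<le> (\<Sum>y\<in>V. g x y w)" by (intro sum_mono qz)
    then show ?thesis using sg1'[of x w] by linarith
  qed
  \<comment> \<open>The common neighbourhood is at most as large as either neighbourhood, so the
    normalisations by \<open>d x\<close> and \<open>d z\<close> cancel the choices of
    \<open>y\<close> and \<open>w\<close>.\<close>
  have gg: "(\<Sum>y\<in>V. \<Sum>w\<in>V. g x y w * g z y w) \<le> (if x \<in> X \<and> z \<in> X then 1 / e\<^sup>2 else 0)" for x z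
  proof (cases "x \<in> X \<and> z \<in> X")
    case True
    have GV: "Ga x \<inter> Ga z \<subseteq> V" using Ga True fV by blast
    define cc where "cc = real (card (Ga x \<inter> Ga z))"
    have "(\<Sum>y\<in>V. \<Sum>w\<in>V. g x y w * g z y w)
        = (\<Sum>y\<in>V. if y \<in> Ga x \<inter> Ga z then \<Sum>w\<in>V. if w \<in> Ga x \<inter> Ga z then 1 / (e * d x) * (1 / (e * d z)) else 0 else 0)"
      unfolding g_def using True by (intro sum.cong refl) (auto intro!: sum.cong sum.neutral)
    also have "\<dots> = (\<Sum>y\<in>Ga x \<inter> Ga z. \<Sum>w\<in>V. if w \<in> Ga x \<inter> Ga z then 1 / (e * d x) * (1 / (e * d z)) else 0)"
      using fV GV by (intro sum.mono_neutral_cong_right) auto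
    also have "\<dots> = (\<Sum>y\<in>Ga x \<inter> Ga z. \<Sum>w\<in>Ga x \<inter> Ga z. 1 / (e * d x) * (1 / (e * d z)))"
      using fV GV by (intro sum.cong refl sum.mono_neutral_cong_right) auto
    also have "\<dots> = (cc / d x) * (cc / d z) / e\<^sup>2" unfolding cc_def by (simp add: power2_eq_square)
    also have "\<dots> \<le> 1 * 1 / e\<^sup>2"
    proof (intro divide_right_mono mult_mono)
      show "cc / d x \<le> 1" "cc / d z \<le> 1"
        using True d0[of x] d0[of z] fG[of x] fG[of z] unfolding cc_def d_def by (auto intro!: card_mono)
    qed (use True d0[of x] d0[of z] in \<open>auto simp: cc_def d_def\<close>)
    finally show ?thesis using True by simp
  next
    case False
    then show ?thesis unfolding g_def by auto
  qed
  have m_xz: "(\<Sum>y\<in>V. \<Sum>w\<in>V. q x y z w) \<le> (if x \<in> X \<and> z \<in> X then s\<^sup>2 / e\<^sup>2 else 0)" for x z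
  proof -
    have "(\<Sum>y\<in>V. \<Sum>w\<in>V. q x y z w) \<le> (\<Sum>y\<in>V. \<Sum>w\<in>V. s\<^sup>2 * (g x y w * g z y w))" by (intro sum_mono qs)
    also have "\<dots> = s\<^sup>2 * (\<Sum>y\<in>V. \<Sum>w\<in>V. g x y w * g z y w)" by (simp add: sum_distrib_left)
    also have "\<dots> \<le> s\<^sup>2 * (if x \<in> X \<and> z \<in> X then 1 / e\<^sup>2 else 0)" by (intro mult_left_mono gg) auto
    finally show ?thesis by (auto split: if_splits)
  qed
  have m_ac: "(\<Sum>y\<in>V. \<Sum>w\<in>V. q x y z w) \<le> s\<^sup>2 / e\<^sup>2" for x z
    using m_xz[of x z] by (auto split: if_splits intro: order_trans)
  have m_xyw: "(\<Sum>x\<in>V. \<Sum>z\<in>V. q x y z w) \<le> P y w" for y w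
    unfolding P_def by (intro sum_mono qz)
  have t_abc: "(\<Sum>w\<in>V. q x y z w) \<le> s\<^sup>2 / (e\<^sup>2 * kap)" for x y z
  proof -
    have "(\<Sum>w\<in>V. q x y z w) \<le> (\<Sum>w\<in>V. s\<^sup>2 * (g x y w * (1 / (e * kap))))"
      by (intro sum_mono order_trans[OF qs] mult_left_mono gk g0) auto
    also have "\<dots> = s\<^sup>2 / (e * kap) * (\<Sum>w\<in>V. g x y w)" by (simp add: sum_distrib_left)
    also have "\<dots> \<le> s\<^sup>2 / (e * kap) * (1 / e)" using e(2) kap(1) by (intro mult_left_mono sg1) auto
    finally show ?thesis by (simp add: power2_eq_square mult_ac)
  qed
  have t_acd: "(\<Sum>y\<in>V. q x y z w) \<le> s\<^sup>2 / (e\<^sup>2 * kap)" for x w z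
    using t_abc[of x w z] qsym(2)[of x w z] by simp
  have t_abd: "(\<Sum>z\<in>V. q x y z w) \<le> 1 / (e * kap)" for x y w using qz[of x y w] gk[of x y w] by linarith
  have t_bcd: "(\<Sum>x\<in>V. q x y z w) \<le> 1 / (e * kap)" for z y w using qx[of y z w] gk[of z y w] by linarith
  have at: "q x y z w \<le> s\<^sup>2 / (e\<^sup>2 * kap\<^sup>2)" for x y z w
  proof -
    have "q x y z w \<le> s\<^sup>2 * ((1 / (e * kap)) * (1 / (e * kap)))"
      using e(2) kap(1) by (intro order_trans[OF qs] mult_left_mono mult_mono gk g0) auto
    then show ?thesis by (simp add: power2_eq_square mult_ac)
  qed
  \<comment> \<open>Pairs that cannot serve as a diagonal. Removing the weight on cycles with a bad
    diagonal leaves at least \<open>eta\<close>, whence the normalisation by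
    \<open>1 / eta\<close>.\<close>
  define bad where "bad u v \<longleftrightarrow> u = v \<or> {u, v} \<in> E" for u v :: nat
  define mu where "mu x y z w = (if bad x z \<or> bad y w then 0 else q x y z w / eta)" for x y z w
  have muq: "mu x y z w \<le> q x y z w / eta" "0 \<le> mu x y z w" for x y z w
    unfolding mu_def using q0[of x y z w] eta(1) by auto
  have tot: "1 \<le> (\<Sum>x\<in>V. \<Sum>y\<in>V. \<Sum>z\<in>V. \<Sum>w\<in>V. mu x y z w)"
  proof -
    have "q x y z w - (if bad y w then q x y z w else 0) - (if bad x z then q x y z w else 0) \<le> eta * mu x y z w" for x y z w
      unfolding mu_def using q0[of x y z w] eta(1) by auto
    then have "(\<Sum>x\<in>V. \<Sum>y\<in>V. \<Sum>z\<in>V. \<Sum>w\<in>V. q x y z w - (if bad y w then q x y z w else 0) - (if bad x z then q x y z w else 0))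
       \<le> (\<Sum>x\<in>V. \<Sum>y\<in>V. \<Sum>z\<in>V. \<Sum>w\<in>V. eta * mu x y z w)" by (intro sum_mono)
    then have lower: "(\<Sum>x\<in>V. \<Sum>y\<in>V. \<Sum>z\<in>V. \<Sum>w\<in>V. q x y z w)
       - (\<Sum>x\<in>V. \<Sum>y\<in>V. \<Sum>z\<in>V. \<Sum>w\<in>V. if bad y w then q x y z w else 0)
       - (\<Sum>x\<in>V. \<Sum>y\<in>V. \<Sum>z\<in>V. \<Sum>w\<in>V. if bad x z then q x y z w else 0)
       \<le> eta * (\<Sum>x\<in>V. \<Sum>y\<in>V. \<Sum>z\<in>V. \<Sum>w\<in>V. mu x y z w)"
      by (simp only: sum_subtractf sum_distrib_left)
    have reorder: "(\<Sum>x\<in>V. \<Sum>y\<in>V. \<Sum>z\<in>V. \<Sum>w\<in>V. f x y z w) = (\<Sum>y\<in>V. \<Sum>w\<in>V. \<Sum>x\<in>V. \<Sum>z\<in>V. f x y z w)"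
      for f :: "nat \<Rightarrow> nat \<Rightarrow> nat \<Rightarrow> nat \<Rightarrow> real"
    proof -
      have "(\<Sum>x\<in>V. \<Sum>y\<in>V. \<Sum>z\<in>V. \<Sum>w\<in>V. f x y z w) = (\<Sum>x\<in>V. \<Sum>y\<in>V. \<Sum>w\<in>V. \<Sum>z\<in>V. f x y z w)"
        by (intro sum.cong refl sum.swap)
      also have "\<dots> = (\<Sum>y\<in>V. \<Sum>x\<in>V. \<Sum>w\<in>V. \<Sum>z\<in>V. f x y z w)" by (rule sum.swap)
      also have "\<dots> = (\<Sum>y\<in>V. \<Sum>w\<in>V. \<Sum>x\<in>V. \<Sum>z\<in>V. f x y z w)" by (intro sum.cong refl sum.swap)
      finally show ?thesis .
    qed
    have reorder2: "(\<Sum>x\<in>V. \<Sum>y\<in>V. \<Sum>z\<in>V. \<Sum>w\<in>V. f x y z w) = (\<Sum>x\<in>V. \<Sum>z\<in>V. \<Sum>y\<in>V. \<Sum>w\<in>V. f x y z w)"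
      for f :: "nat \<Rightarrow> nat \<Rightarrow> nat \<Rightarrow> nat \<Rightarrow> real" by (intro sum.cong refl sum.swap)
    have sP: "(\<Sum>y\<in>S. \<Sum>w\<in>S. P y w) = 1"
    proof -
      have "(\<Sum>y\<in>S. \<Sum>w\<in>S. P y w) = (\<Sum>y\<in>V. \<Sum>w\<in>V. P y w)"
      proof -
        have PS: "P y w = 0" if "y \<notin> S \<or> w \<notin> S" for y w
          unfolding P_def using gS that by (intro sum.neutral) blast
        have "(\<Sum>y\<in>V. \<Sum>w\<in>V. P y w) = (\<Sum>y\<in>V. \<Sum>w\<in>S. P y w)"
          using fV PS by (intro sum.cong refl sum.mono_neutral_right) auto
        also have "\<dots> = (\<Sum>y\<in>S. \<Sum>w\<in>S. P y w)"
          using fV PS by (intro sum.mono_neutral_right) auto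
        finally show ?thesis by simp
      qed
      also have "\<dots> = (\<Sum>y\<in>V. \<Sum>x\<in>V. \<Sum>w\<in>V. g x y w)" unfolding P_def by (intro sum.cong refl sum.swap)
      also have "\<dots> = (\<Sum>x\<in>V. \<Sum>y\<in>V. \<Sum>w\<in>V. g x y w)" by (rule sum.swap)
      also have "\<dots> = (\<Sum>x\<in>V. \<Sum>y\<in>V. if x \<in> X \<and> y \<in> Ga x then 1 / e else 0)" by (simp only: sg)
      also have "\<dots> = (\<Sum>x\<in>X. \<Sum>y\<in>V. if y \<in> Ga x then 1 / e else 0)"
        using fV by (intro sum.mono_neutral_cong_right) auto
      also have "\<dots> = (\<Sum>x\<in>X. d x / e)"
      proof (intro sum.cong refl)
        fix x assume x: "x \<in> X"
        have GV: "Ga x \<subseteq> V" using Ga[OF x] fV by blast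
        have "(\<Sum>y\<in>V. if y \<in> Ga x then 1 / e else 0) = (\<Sum>y\<in>Ga x. 1 / e)"
          using fV GV by (intro sum.mono_neutral_cong_right) auto
        then show "(\<Sum>y\<in>V. if y \<in> Ga x then 1 / e else 0) = d x / e" unfolding d_def by simp
      qed
      also have "\<dots> = 1" using e unfolding d_def by (simp add: sum_divide_distrib[symmetric])
      finally show ?thesis .
    qed
    have "3 / 4 \<le> (\<Sum>y\<in>S. \<Sum>w\<in>S. P y w * P y w / mx y w)"
    proof -
      \<comment> \<open>Below the cap this is the square of \<open>s * P y w - 1 / (2 * s)\<close>.
        Summed over the \<open>s\<^sup>2\<close> pairs in \<open>S\<close> the loss is
        \<open>1 / 4\<close>, which is the quarter given up by capping.\<close>
      have pt: "P y w - 1 / (4 * s\<^sup>2) \<le> P y w * P y w / mx y w" for y w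
      proof (cases "1 / s\<^sup>2 \<le> P y w")
        case True
        have "0 < P y w" using True s0 by (intro less_le_trans[OF _ True]) simp
        then have "P y w * P y w / mx y w = P y w" using True unfolding mx_def by (simp add: max_def)
        then show ?thesis using s0 by simp
      next
        case False
        then have "P y w * P y w / mx y w = s\<^sup>2 * (P y w)\<^sup>2"
          unfolding mx_def by (simp add: max_def power2_eq_square)
        moreover have "0 \<le> (s * P y w - 1 / (2 * s))\<^sup>2" by simp
        moreover have "(s * P y w - 1 / (2 * s))\<^sup>2 = s\<^sup>2 * (P y w)\<^sup>2 - P y w + 1 / (4 * s\<^sup>2)"
          using s0 by (simp add: power2_diff power_mult_distrib power_divide)
        ultimately show ?thesis by linarith
      qed
      have "(\<Sum>y\<in>S. \<Sum>w\<in>S. P y w - 1 / (4 * s\<^sup>2)) \<le> (\<Sum>y\<in>S. \<Sum>w\<in>S. P y w * P y w / mx y w)"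
        by (intro sum_mono pt)
      moreover have "(\<Sum>y\<in>S. \<Sum>w\<in>S. P y w - 1 / (4 * s\<^sup>2)) = 1 - 1 / 4"
        using s0 by (simp add: sum_subtractf sP s[symmetric] power2_eq_square)
      ultimately show ?thesis by linarith
    qed
    also have "\<dots> \<le> (\<Sum>y\<in>V. \<Sum>w\<in>V. P y w * P y w / mx y w)"
    proof -
      have nn: "0 \<le> P y w * P y w / mx y w" for y w using mx(1)[of y w] by simp
      have "(\<Sum>y\<in>S. \<Sum>w\<in>S. P y w * P y w / mx y w) \<le> (\<Sum>y\<in>S. \<Sum>w\<in>V. P y w * P y w / mx y w)"
        using fV nn by (intro sum_mono sum_mono2) auto
      also have "\<dots> \<le> (\<Sum>y\<in>V. \<Sum>w\<in>V. P y w * P y w / mx y w)"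
        using fV nn by (intro sum_mono2 sum_nonneg) auto
      finally show ?thesis .
    qed
    also have "\<dots> = (\<Sum>x\<in>V. \<Sum>y\<in>V. \<Sum>z\<in>V. \<Sum>w\<in>V. q x y z w)"
    proof -
      have "(\<Sum>x\<in>V. \<Sum>z\<in>V. q x y z w) = P y w * P y w / mx y w" for y w
        unfolding q_def P_def sum_product by (simp add: sum_divide_distrib)
      then show ?thesis by (subst reorder) simp
    qed
    finally have l1: "3 / 4 \<le> (\<Sum>x\<in>V. \<Sum>y\<in>V. \<Sum>z\<in>V. \<Sum>w\<in>V. q x y z w)" .
    have l2: "(\<Sum>x\<in>V. \<Sum>y\<in>V. \<Sum>z\<in>V. \<Sum>w\<in>V. if bad y w then q x y z w else 0) \<le> al"
    proof -
      have "(\<Sum>x\<in>V. \<Sum>y\<in>V. \<Sum>z\<in>V. \<Sum>w\<in>V. if bad y w then q x y z w else 0)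
          = (\<Sum>y\<in>V. \<Sum>w\<in>V. if bad y w then \<Sum>x\<in>V. \<Sum>z\<in>V. q x y z w else 0)"
        by (rule trans[OF reorder]) (intro sum.cong refl, auto)
      also have "\<dots> \<le> (\<Sum>y\<in>V. \<Sum>w\<in>V. if bad y w then P y w else 0)"
        using m_xyw by (intro sum_mono) auto
      also have "\<dots> = (\<Sum>y\<in>V. \<Sum>w\<in>V. \<Sum>x\<in>V. if bad y w then g x y w else 0)"
        unfolding P_def by (intro sum.cong refl) auto
      also have "\<dots> = (\<Sum>y\<in>V. \<Sum>x\<in>V. \<Sum>w\<in>V. if bad y w then g x y w else 0)"
        by (intro sum.cong refl sum.swap)
      also have "\<dots> = (\<Sum>x\<in>V. \<Sum>y\<in>V. \<Sum>w\<in>V. if bad y w then g x y w else 0)" by (rule sum.swap)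
      also have "\<dots> = (\<Sum>x\<in>X. \<Sum>y\<in>V. \<Sum>w\<in>V. if bad y w then g x y w else 0)"
        using fV by (intro sum.mono_neutral_right) (auto simp: g_def intro!: sum.neutral)
      also have "\<dots> = (\<Sum>x\<in>X. real (card {(y, w). y \<in> Ga x \<and> w \<in> Ga x \<and> (y = w \<or> {y, w} \<in> E)}) / (e * d x))"
      proof (intro sum.cong refl)
        fix x assume x: "x \<in> X"
        let ?B = "{(y, w). y \<in> Ga x \<and> w \<in> Ga x \<and> (y = w \<or> {y, w} \<in> E)}"
        have BV: "?B \<subseteq> V \<times> V" using Ga[OF x] fV by auto
        have "(\<Sum>y\<in>V. \<Sum>w\<in>V. if bad y w then g x y w else 0) = (\<Sum>(y, w)\<in>V \<times> V. if bad y w then g x y w else 0)"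
          by (rule sum.cartesian_product)
        also have "\<dots> = (\<Sum>(y, w)\<in>?B. 1 / (e * d x))"
          using fV BV x by (intro sum.mono_neutral_cong_right) (auto simp: g_def bad_def split: if_splits)
        also have "\<dots> = real (card ?B) / (e * d x)" by (simp add: case_prod_beta)
        finally show "(\<Sum>y\<in>V. \<Sum>w\<in>V. if bad y w then g x y w else 0) = real (card ?B) / (e * d x)" .
      qed
      finally show ?thesis using al unfolding d_def by linarith
    qed
    have l3: "(\<Sum>x\<in>V. \<Sum>y\<in>V. \<Sum>z\<in>V. \<Sum>w\<in>V. if bad x z then q x y z w else 0) \<le> be"
    proof -
      have "(\<Sum>x\<in>V. \<Sum>y\<in>V. \<Sum>z\<in>V. \<Sum>w\<in>V. if bad x z then q x y z w else 0)
         = (\<Sum>x\<in>V. \<Sum>z\<in>V. if bad x z then \<Sum>y\<in>V. \<Sum>w\<in>V. q x y z w else 0)"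
        by (rule trans[OF reorder2]) (intro sum.cong refl, auto)
      also have "\<dots> \<le> (\<Sum>x\<in>V. \<Sum>z\<in>V. if bad x z \<and> x \<in> X \<and> z \<in> X then s\<^sup>2 / e\<^sup>2 else 0)"
      proof (intro sum_mono)
        fix x z
        show "(if bad x z then \<Sum>y\<in>V. \<Sum>w\<in>V. q x y z w else 0)
            \<le> (if bad x z \<and> x \<in> X \<and> z \<in> X then s\<^sup>2 / e\<^sup>2 else 0)"
          using m_xz[of x z] by (cases "bad x z"; cases "x \<in> X \<and> z \<in> X") auto
      qed
      also have "\<dots> = (\<Sum>(x, z)\<in>V \<times> V. if bad x z \<and> x \<in> X \<and> z \<in> X then s\<^sup>2 / e\<^sup>2 else 0)"
        by (rule sum.cartesian_product)
      also have "\<dots> = (\<Sum>(x, z)\<in>{(x, z). bad x z \<and> x \<in> X \<and> z \<in> X}. s\<^sup>2 / e\<^sup>2)"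
        using fV by (intro sum.mono_neutral_cong_right) (auto split: if_splits)
      also have "\<dots> = real (card {(x, z). bad x z \<and> x \<in> X \<and> z \<in> X}) * (s\<^sup>2 / e\<^sup>2)" by (simp add: case_prod_beta)
      also have "\<dots> \<le> (2 * real (card E) + real (card X)) * (s\<^sup>2 / e\<^sup>2)"
      proof (intro mult_right_mono)
        have sub: "{(x, z). bad x z \<and> x \<in> X \<and> z \<in> X} \<subseteq> ordered_pairs E \<union> (\<lambda>x. (x, x)) ` X"
          unfolding bad_def ordered_pairs_def by auto
        have fO: "finite (ordered_pairs E)" by (rule finite_ordered_pairs[OF E])
        have "card {(x, z). bad x z \<and> x \<in> X \<and> z \<in> X} \<le> card (ordered_pairs E \<union> (\<lambda>x. (x, x)) ` X)"
          using fO fX by (intro card_mono[OF _ sub]) auto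
        also have "\<dots> \<le> card (ordered_pairs E) + card ((\<lambda>x. (x, x)) ` X)" by (rule card_Un_le)
        also have "\<dots> \<le> 2 * card E + card X"
          using card_ordered_pairs_le[OF E] card_image_le[OF fX(1), of "\<lambda>x. (x, x)"] by linarith
        finally show "real (card {(x, z). bad x z \<and> x \<in> X \<and> z \<in> X}) \<le> 2 * real (card E) + real (card X)" by linarith
      qed auto
      finally show ?thesis using be by simp
    qed
    have "eta * 1 \<le> eta * (\<Sum>x\<in>V. \<Sum>y\<in>V. \<Sum>z\<in>V. \<Sum>w\<in>V. mu x y z w)"
      using lower l1 l2 l3 eta(2) by linarith
    then show ?thesis using eta(1) by (rule mult_left_le_imp_le)
  qed
  have supp: "(x, y, z, w) \<in> c4_quads M E" if "mu x y z w \<noteq> 0" for x y z w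
  proof -
    have nb: "\<not> bad x z" "\<not> bad y w" and "q x y z w \<noteq> 0" using that unfolding mu_def by (auto split: if_splits)
    then have "g x y w \<noteq> 0" "g z y w \<noteq> 0" unfolding q_def by auto
    then have "x \<in> X" "y \<in> Ga x" "w \<in> Ga x" "z \<in> X" "y \<in> Ga z" "w \<in> Ga z" unfolding g_def by (auto split: if_splits)
    then have "{x, y} \<in> M" "{x, w} \<in> M" "{z, y} \<in> M" "{z, w} \<in> M" using GM by blast+
    then show ?thesis using nb unfolding c4_quads_def bad_def by (auto simp: insert_commute)
  qed
  have sc1: "(\<Sum>u\<in>V. f u) \<le> B" if "\<And>u. f u \<le> h u / eta" "(\<Sum>u\<in>V. h u) \<le> C" "C \<le> eta * B" for f h :: "nat \<Rightarrow> real" and B C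
  proof -
    have "(\<Sum>u\<in>V. f u) \<le> (\<Sum>u\<in>V. h u) / eta" using that(1) by (simp add: sum_divide_distrib sum_mono)
    also have "\<dots> \<le> eta * B / eta" using that eta(1) by (intro divide_right_mono) auto
    finally show ?thesis using eta(1) by simp
  qed
  have sc2: "(\<Sum>u\<in>V. \<Sum>v\<in>V. f u v) \<le> B"
    if "\<And>u v. f u v \<le> h u v / eta" "(\<Sum>u\<in>V. \<Sum>v\<in>V. h u v) \<le> C" "C \<le> eta * B" for f h :: "nat \<Rightarrow> nat \<Rightarrow> real" and B C
    by (rule sc1[of _ "\<lambda>u. \<Sum>v\<in>V. h u v", OF _ that(2,3)]) (use that(1) in \<open>simp add: sum_divide_distrib sum_mono\<close>)
  show ?thesis unfolding spread_c4s_def V_def[symmetric]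
  proof (intro exI[of _ mu] conjI allI impI)
    show "1 \<le> (\<Sum>a\<in>V. \<Sum>b\<in>V. \<Sum>c\<in>V. \<Sum>d\<in>V. mu a b c d)" by (rule tot)
    show "0 \<le> mu a b c d" for a b c d by (rule muq)
    show "(a, b, c, d) \<in> c4_quads M E" if "mu a b c d \<noteq> 0" for a b c d by (rule supp[OF that])
    show "(\<Sum>c\<in>V. \<Sum>d\<in>V. mu x y c d) \<le> R / (k * n)" for x y by (rule sc2[OF muq(1) m_ab R1])
    show "(\<Sum>a\<in>V. \<Sum>d\<in>V. mu a x y d) \<le> R / (k * n)" for x y by (rule sc2[OF muq(1) m_bc R1])
    show "(\<Sum>a\<in>V. \<Sum>b\<in>V. mu a b x y) \<le> R / (k * n)" for x y by (rule sc2[OF muq(1) m_cd R1])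
    show "(\<Sum>b\<in>V. \<Sum>c\<in>V. mu y b c x) \<le> R / (k * n)" for x y by (rule sc2[OF muq(1) m_da R1])
    show "(\<Sum>b\<in>V. \<Sum>d\<in>V. mu x b y d) \<le> R / k\<^sup>2" for x y by (rule sc2[OF muq(1) m_ac R2])
    show "(\<Sum>a\<in>V. \<Sum>c\<in>V. mu a x c y) \<le> R / k\<^sup>2" for x y
      by (rule sc2[OF muq(1) order_trans[OF m_xyw PX] R3])
    show "(\<Sum>d\<in>V. mu x y z d) \<le> R / k ^ 3" for x y z by (rule sc1[OF muq(1) t_abc R5])
    show "(\<Sum>c\<in>V. mu x y c z) \<le> R / k ^ 3" for x y z by (rule sc1[OF muq(1) t_abd R4])
    show "(\<Sum>b\<in>V. mu x b y z) \<le> R / k ^ 3" for x y z by (rule sc1[OF muq(1) t_acd R5])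
    show "(\<Sum>a\<in>V. mu a x y z) \<le> R / k ^ 3" for x y z by (rule sc1[OF muq(1) t_bcd R4])
    show "mu a b c d \<le> R / k ^ 4" for a b c d
    proof -
      have "mu a b c d \<le> q a b c d / eta" by (rule muq)
      also have "\<dots> \<le> eta * (R / k ^ 4) / eta" using at[of a b c d] R6 eta(1) by (intro divide_right_mono) auto
      finally show ?thesis using eta(1) by simp
    qed
  qed
qed

section \<open>Uniform weightings, and path weightings inside a pregraph\<close>

lemma card_ordered_pairs:
  assumes X: "X \<subseteq> complete_edges n"
  shows "card (ordered_pairs X) = 2 * card X"
proof -
  have fO: "finite (ordered_pairs X)" by (rule finite_ordered_pairs[OF X])
  have fX: "finite X" using X finite_complete_edges finite_subset by blast
  have "card (ordered_pairs X) = (\<Sum>e\<in>X. card {z\<in>ordered_pairs X. (\<lambda>(x, y). {x, y}) z = e})"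
  proof -
    have "(\<lambda>(x, y). {x, y}) ` ordered_pairs X \<subseteq> X" by (auto simp: ordered_pairs_def)
    from sum.group[OF fO fX this, of "\<lambda>_. 1::nat"] show ?thesis by simp
  qed
  also have "\<dots> = (\<Sum>e\<in>X. 2)"
  proof (rule sum.cong[OF refl])
    fix e assume e: "e \<in> X"
    then have "card e = 2" using X unfolding complete_edges_def by auto
    then obtain a b where ab: "e = {a, b}" "a \<noteq> b" unfolding card_2_iff by blast
    have "{z\<in>ordered_pairs X. (\<lambda>(x, y). {x, y}) z = e} = {(a, b), (b, a)}"
      using e ab unfolding ordered_pairs_def by (auto simp: doubleton_eq_iff insert_commute)
    then show "card {z\<in>ordered_pairs X. (\<lambda>(x, y). {x, y}) z = e} = 2" using ab by simp
  qed
  finally show ?thesis by simp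
qed

lemma card_Sigma_le:
  fixes p q :: real
  assumes "S \<subseteq> Sigma A B" "finite A" "\<And>a. a \<in> A \<Longrightarrow> finite (B a)" "real (card A) \<le> p"
    "\<And>a. a \<in> A \<Longrightarrow> real (card (B a)) \<le> q" "0 \<le> q"
  shows "real (card S) \<le> p * q"
proof -
  have "card S \<le> card (Sigma A B)" using assms by (intro card_mono finite_SigmaI) auto
  also have "card (Sigma A B) = (\<Sum>a\<in>A. card (B a))" using assms by (simp add: card_SigmaI)
  finally have "real (card S) \<le> (\<Sum>a\<in>A. real (card (B a)))" by (metis of_nat_le_iff of_nat_sum)
  also have "\<dots> \<le> (\<Sum>a\<in>A. q)" using assms by (intro sum_mono) auto
  also have "\<dots> = real (card A) * q" by simp
  also have "\<dots> \<le> p * q" using assms by (intro mult_right_mono) auto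
  finally show ?thesis .
qed

text \<open>Every cycle in \<open>Om\<close> gets weight \<open>1 / N\<close>. As \<open>N\<close>
  is merely a lower bound for \<open>card Om\<close>, the total may exceed 1, and all conditions
  become counts of extensions compared with \<open>N\<close>.\<close>

lemma uniform_spread:
  fixes N k R :: real
  assumes Om: "Om \<subseteq> c4_quads M E" and M: "M \<subseteq> complete_edges n" and N: "N > 0" "N \<le> real (card Om)"
    and e: "\<And>x y. real (card {(c, d). (x, y, c, d) \<in> Om}) \<le> N * (R / (k * n))"
      "\<And>x y. real (card {(a, d). (a, x, y, d) \<in> Om}) \<le> N * (R / (k * n))"
      "\<And>x y. real (card {(a, b). (a, b, x, y) \<in> Om}) \<le> N * (R / (k * n))"
      "\<And>x y. real (card {(b, c). (y, b, c, x) \<in> Om}) \<le> N * (R / (k * n))"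
    and z: "\<And>x y. real (card {(b, d). (x, b, y, d) \<in> Om}) \<le> N * (R / k\<^sup>2)"
      "\<And>x y. real (card {(a, c). (a, x, c, y) \<in> Om}) \<le> N * (R / k\<^sup>2)"
    and t: "\<And>x y z. real (card {d. (x, y, z, d) \<in> Om}) \<le> N * (R / k ^ 3)"
      "\<And>x y z. real (card {c. (x, y, c, z) \<in> Om}) \<le> N * (R / k ^ 3)"
      "\<And>x y z. real (card {b. (x, b, y, z) \<in> Om}) \<le> N * (R / k ^ 3)"
      "\<And>x y z. real (card {a. (a, x, y, z) \<in> Om}) \<le> N * (R / k ^ 3)"
    and f: "1 \<le> N * (R / k ^ 4)"
  shows "spread_c4s R n k M E"
proof -
  define V where "V = {1..n}"
  have fV: "finite V" unfolding V_def by simp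
  have OV: "a \<in> V \<and> b \<in> V \<and> c \<in> V \<and> d \<in> V" if "(a, b, c, d) \<in> Om" for a b c d
    using c4_quads_vertices[OF subsetD[OF Om that] M] unfolding V_def by blast
  define mu where "mu a b c d = (if (a, b, c, d) \<in> Om then 1 / N else 0)" for a b c d
  have one: "(\<Sum>u\<in>V. if P u then 1 / N else 0) = real (card {u. P u}) / N" if "\<And>u. P u \<Longrightarrow> u \<in> V" for P :: "nat \<Rightarrow> bool"
  proof -
    have "(\<Sum>u\<in>V. if P u then 1 / N else 0) = (\<Sum>u\<in>{u. P u}. 1 / N)"
      using fV that by (intro sum.mono_neutral_cong_right) (auto split: if_splits)
    then show ?thesis by simp
  qed
  have two: "(\<Sum>u\<in>V. \<Sum>v\<in>V. if P u v then 1 / N else 0) = real (card {(u, v). P u v}) / N"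
    if "\<And>u v. P u v \<Longrightarrow> u \<in> V \<and> v \<in> V" for P :: "nat \<Rightarrow> nat \<Rightarrow> bool"
  proof -
    have "(\<Sum>u\<in>V. \<Sum>v\<in>V. if P u v then 1 / N else 0) = (\<Sum>(u, v)\<in>V \<times> V. if P u v then 1 / N else 0)"
      by (rule sum.cartesian_product)
    also have "\<dots> = (\<Sum>(u, v)\<in>{(u, v). P u v}. 1 / N)"
      using fV that by (intro sum.mono_neutral_cong_right) (auto split: if_splits)
    finally show ?thesis by (simp add: case_prod_beta)
  qed
  have dv: "x / N \<le> y" if "x \<le> N * y" for x y using that N(1) by (simp add: field_simps)
  show ?thesis unfolding spread_c4s_def V_def[symmetric]
  proof (intro exI[of _ mu] conjI allI impI)
    show "0 \<le> mu a b c d" for a b c d unfolding mu_def using N by simp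
    show "(a, b, c, d) \<in> c4_quads M E" if "mu a b c d \<noteq> 0" for a b c d
      using that Om unfolding mu_def by (auto split: if_splits)
    have "(\<Sum>a\<in>V. \<Sum>b\<in>V. \<Sum>c\<in>V. \<Sum>d\<in>V. mu a b c d) = (\<Sum>(a, b, c, d)\<in>V \<times> V \<times> V \<times> V. mu a b c d)"
      by (simp add: sum.cartesian_product)
    also have "\<dots> = (\<Sum>(a, b, c, d)\<in>Om. 1 / N)"
      using fV OV unfolding mu_def by (intro sum.mono_neutral_cong_right) (auto split: if_splits)
    also have "\<dots> = real (card Om) / N" by (simp add: case_prod_beta)
    finally show "1 \<le> (\<Sum>a\<in>V. \<Sum>b\<in>V. \<Sum>c\<in>V. \<Sum>d\<in>V. mu a b c d)" using N by simp
    show "(\<Sum>c\<in>V. \<Sum>d\<in>V. mu x y c d) \<le> R / (k * n)" for x y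
      unfolding mu_def by (subst two) (use OV in blast, rule dv[OF e(1)])
    show "(\<Sum>a\<in>V. \<Sum>d\<in>V. mu a x y d) \<le> R / (k * n)" for x y
      unfolding mu_def by (subst two) (use OV in blast, rule dv[OF e(2)])
    show "(\<Sum>a\<in>V. \<Sum>b\<in>V. mu a b x y) \<le> R / (k * n)" for x y
      unfolding mu_def by (subst two) (use OV in blast, rule dv[OF e(3)])
    show "(\<Sum>b\<in>V. \<Sum>c\<in>V. mu y b c x) \<le> R / (k * n)" for x y
      unfolding mu_def by (subst two) (use OV in blast, rule dv[OF e(4)])
    show "(\<Sum>b\<in>V. \<Sum>d\<in>V. mu x b y d) \<le> R / k\<^sup>2" for x y
      unfolding mu_def by (subst two) (use OV in blast, rule dv[OF z(1)])
    show "(\<Sum>a\<in>V. \<Sum>c\<in>V. mu a x c y) \<le> R / k\<^sup>2" for x y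
      unfolding mu_def by (subst two) (use OV in blast, rule dv[OF z(2)])
    show "(\<Sum>d\<in>V. mu x y z d) \<le> R / k ^ 3" for x y z
      unfolding mu_def by (subst one) (use OV in blast, rule dv[OF t(1)])
    show "(\<Sum>c\<in>V. mu x y c z) \<le> R / k ^ 3" for x y z
      unfolding mu_def by (subst one) (use OV in blast, rule dv[OF t(2)])
    show "(\<Sum>b\<in>V. mu x b y z) \<le> R / k ^ 3" for x y z
      unfolding mu_def by (subst one) (use OV in blast, rule dv[OF t(3)])
    show "(\<Sum>a\<in>V. mu a x y z) \<le> R / k ^ 3" for x y z
      unfolding mu_def by (subst one) (use OV in blast, rule dv[OF t(4)])
    show "mu a b c d \<le> R / k ^ 4" for a b c d
    proof -
      have "1 / N \<le> R / k ^ 4" by (rule dv[OF f])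
      then show ?thesis unfolding mu_def using N(1) by (auto intro: order_trans[rotated])
    qed
  qed
qed

text \<open>\<open>k\<close> is the number of mixed pairs per vertex, so the mean mixed degree is
  \<open>2 * k\<close>.\<close>

locale pregraph =
  fixes n :: nat and M E :: "nat set set" and k :: real
  assumes M: "M \<subseteq> complete_edges n" and E: "E \<subseteq> complete_edges n" "M \<inter> E = {}"
    and kn: "k * real n = real (card M)" and k0: "k > 0" and n0: "n > 0"
begin

abbreviation "V \<equiv> {1..n}"

definition nb :: "nat \<Rightarrow> nat set" where "nb v = {w. {v, w} \<in> M}"

lemma nb_sym: "w \<in> nb v \<longleftrightarrow> v \<in> nb w"
  unfolding nb_def by (simp add: insert_commute)

lemma nb_V: "nb v \<subseteq> V" "w \<in> nb v \<Longrightarrow> v \<in> V" "v \<notin> nb v"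
proof -
  show "nb v \<subseteq> V" unfolding nb_def using M doubleton_in_complete_edges[of v _ n] by auto
  show "w \<in> nb v \<Longrightarrow> v \<in> V" unfolding nb_def using M doubleton_in_complete_edges[of v w n] by auto
  show "v \<notin> nb v" unfolding nb_def using M doubleton_in_complete_edges[of v v n] by auto
qed

lemma finite_nb: "finite (nb v)"
  using nb_V(1) by (rule finite_subset) simp

lemma card_nb_le: "card (nb v) \<le> n"
  using card_mono[OF _ nb_V(1), of v] by simp

lemma finM: "finite M" "finite E"
  using M E(1) finite_complete_edges finite_subset by blast+

lemma sum_degrees: "(\<Sum>v\<in>V. real (card (nb v))) = 2 * k * n"
proof -
  have "ordered_pairs M = Sigma V nb"
    using nb_V(2) unfolding ordered_pairs_def nb_def by auto
  then have "(\<Sum>v\<in>V. card (nb v)) = 2 * card M"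
    using card_ordered_pairs[OF M] finite_nb by (simp add: card_SigmaI)
  then have "real (\<Sum>v\<in>V. card (nb v)) = 2 * real (card M)" by simp
  then show ?thesis using kn by simp
qed

lemma k_le_n: "k \<le> n"
proof -
  have "(\<Sum>v\<in>V. real (card (nb v))) \<le> (\<Sum>v\<in>V. real n)" by (intro sum_mono) (simp add: card_nb_le)
  then have "2 * k * n \<le> real n * real n" using sum_degrees by simp
  then have "2 * k \<le> real n" using n0 by simp
  then show ?thesis using k0 by linarith
qed

text \<open>Vertices with fewer than \<open>kap * k\<close> allowed neighbours are discarded; they
  account for at most \<open>kap * k * n\<close> of the sum, so \<open>e1\<close> survives. This is
  why \<open>al\<close> is required for every subset \<open>Y\<close> and every \<open>e\<close>
  above \<open>e1\<close>. Coinciding ends \<open>y = w\<close> cost the extra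
  \<open>1 / (eps * k)\<close>.\<close>

lemma path_spread:
  fixes Ga :: "nat \<Rightarrow> nat set" and kap eps eta al be R :: real
  assumes X: "X \<subseteq> V" and S: "S \<subseteq> V" and Ga: "\<And>x. x \<in> X \<Longrightarrow> Ga x \<subseteq> S \<inter> nb x"
    and kap: "0 < kap" "kap \<le> 1" and eps: "0 < eps" "eps \<le> 1"
    and e: "(\<Sum>x\<in>X. real (card (Ga x))) \<ge> e1 + kap * k * n" "e1 \<ge> eps * k * n"
    and al: "\<And>Y e. Y \<subseteq> X \<Longrightarrow> e1 \<le> e \<Longrightarrow> (\<And>x. x \<in> Y \<Longrightarrow> kap * k \<le> real (card (Ga x))) \<Longrightarrow>
      (\<Sum>x\<in>Y. real (card {(y, w). y \<in> Ga x \<and> w \<in> Ga x \<and> {y, w} \<in> E}) / (e * real (card (Ga x)))) \<le> al"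
    and be: "(2 * real (card E) + n) * (real (card S))\<^sup>2 / e1\<^sup>2 \<le> be"
    and eta: "eta > 0" "al + 1 / (eps * k) + be + eta \<le> 3 / 4"
    and R: "R \<ge> 1 / (eta * eps\<^sup>2 * kap\<^sup>2)"
  shows "spread_c4s R n k M E"
proof -
  define Y where "Y = {x\<in>X. kap * k \<le> real (card (Ga x))}"
  define e where "e = (\<Sum>x\<in>Y. real (card (Ga x)))"
  define s where "s = real (card S)"
  have fX: "finite X" "finite S" using X S by (auto intro: finite_subset)
  have YX: "Y \<subseteq> X" unfolding Y_def by auto
  have Yk: "x \<in> Y \<Longrightarrow> kap * k \<le> real (card (Ga x))" for x unfolding Y_def by auto
  have cX: "card X \<le> n" using card_mono[OF _ X] by simp
  have cY: "card Y \<le> n" using card_mono[OF fX(1) YX] cX by linarith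
  have cS: "s \<le> n" unfolding s_def using card_mono[OF _ S] by simp
  have "(\<Sum>x\<in>X. real (card (Ga x))) = e + (\<Sum>x\<in>X - Y. real (card (Ga x)))"
    unfolding e_def using fX YX by (metis sum.subset_diff add.commute)
  moreover have "(\<Sum>x\<in>X - Y. real (card (Ga x))) \<le> (\<Sum>x\<in>X - Y. kap * k)"
    by (intro sum_mono) (auto simp: Y_def)
  moreover have "(\<Sum>x\<in>X - Y. kap * k) \<le> kap * k * n"
  proof -
    have "real (card (X - Y)) \<le> n" using card_mono[OF fX(1), of "X - Y"] cX by auto
    then have "real (card (X - Y)) * (kap * k) \<le> real n * (kap * k)" using kap k0 by (intro mult_right_mono) auto
    then show ?thesis by (simp add: mult_ac)
  qed
  ultimately have ee1: "e1 \<le> e" using e(1) by linarith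
  have ek: "0 < eps * k * n" using eps k0 n0 by simp
  then have e10: "0 < e1" "eps * k * n \<le> e" and e0: "0 < e" using e(2) ee1 by linarith+
  have lek: "kap * k > 0" using kap k0 by simp
  let ?Q = "\<lambda>x. {(y, w). y \<in> Ga x \<and> w \<in> Ga x \<and> {y, w} \<in> E}"
  have fG: "finite (Ga x)" if "x \<in> X" for x using Ga[OF that] fX(2) by (meson finite_Int finite_subset)
  have al': "(\<Sum>x\<in>Y. real (card {(y, w). y \<in> Ga x \<and> w \<in> Ga x \<and> (y = w \<or> {y, w} \<in> E)}) / (e * real (card (Ga x))))
      \<le> al + 1 / (eps * k)"
  proof -
    have pt: "real (card {(y, w). y \<in> Ga x \<and> w \<in> Ga x \<and> (y = w \<or> {y, w} \<in> E)}) / (e * real (card (Ga x)))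
        \<le> 1 / e + real (card (?Q x)) / (e * real (card (Ga x)))" if x: "x \<in> Y" for x
    proof -
      have sub: "{(y, w). y \<in> Ga x \<and> w \<in> Ga x \<and> (y = w \<or> {y, w} \<in> E)} \<subseteq> (\<lambda>y. (y, y)) ` Ga x \<union> ?Q x" by auto
      have fx: "finite (Ga x)" using fG x YX by blast
      have fQ: "finite (?Q x)" by (rule finite_subset[of _ "Ga x \<times> Ga x"]) (use fx in auto)
      have "card {(y, w). y \<in> Ga x \<and> w \<in> Ga x \<and> (y = w \<or> {y, w} \<in> E)} \<le> card ((\<lambda>y. (y, y)) ` Ga x \<union> ?Q x)"
        using fx fQ by (intro card_mono[OF _ sub]) auto
      also have "\<dots> \<le> card ((\<lambda>y. (y, y)) ` Ga x) + card (?Q x)" by (rule card_Un_le)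
      also have "\<dots> \<le> card (Ga x) + card (?Q x)" using card_image_le[OF fx] by simp
      finally have "real (card {(y, w). y \<in> Ga x \<and> w \<in> Ga x \<and> (y = w \<or> {y, w} \<in> E)}) \<le> real (card (Ga x)) + real (card (?Q x))"
        by linarith
      then have "real (card {(y, w). y \<in> Ga x \<and> w \<in> Ga x \<and> (y = w \<or> {y, w} \<in> E)}) / (e * real (card (Ga x)))
        \<le> (real (card (Ga x)) + real (card (?Q x))) / (e * real (card (Ga x)))" using e0 by (intro divide_right_mono) auto
      also have "\<dots> = 1 / e + real (card (?Q x)) / (e * real (card (Ga x)))"
        using Yk[OF x] lek e0 by (simp add: add_divide_distrib)
      finally show ?thesis .
    qed
    have "(\<Sum>x\<in>Y. real (card {(y, w). y \<in> Ga x \<and> w \<in> Ga x \<and> (y = w \<or> {y, w} \<in> E)}) / (e * real (card (Ga x))))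
       \<le> (\<Sum>x\<in>Y. 1 / e + real (card (?Q x)) / (e * real (card (Ga x))))" by (intro sum_mono pt)
    also have "\<dots> = real (card Y) / e + (\<Sum>x\<in>Y. real (card (?Q x)) / (e * real (card (Ga x))))"
      by (simp add: sum.distrib)
    also have "\<dots> \<le> 1 / (eps * k) + al"
    proof (rule add_mono)
      have "real (card Y) / e \<le> real n / (eps * k * n)" using cY e10 ek by (intro frac_le) auto
      then show "real (card Y) / e \<le> 1 / (eps * k)" using n0 by simp
      show "(\<Sum>x\<in>Y. real (card (?Q x)) / (e * real (card (Ga x)))) \<le> al"
        by (rule al[OF YX ee1 Yk])
    qed
    finally show ?thesis by linarith
  qed
  have be': "(2 * real (card E) + real (card Y)) * s\<^sup>2 / e\<^sup>2 \<le> be"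
  proof -
    have "(2 * real (card E) + real (card Y)) * s\<^sup>2 / e\<^sup>2 \<le> (2 * real (card E) + n) * s\<^sup>2 / e1\<^sup>2"
      using cY ee1 e10 by (intro frac_le mult_right_mono power_mono) auto
    then show ?thesis using be unfolding s_def by linarith
  qed
  have kn': "k \<le> n" by (rule k_le_n)
  define R0 where "R0 = eta * R"
  have R0: "1 / (eps\<^sup>2 * kap\<^sup>2) \<le> R0"
  proof -
    have "eta * (1 / (eta * eps\<^sup>2 * kap\<^sup>2)) \<le> eta * R" using R eta(1) by (intro mult_left_mono) auto
    then show ?thesis using eta(1) unfolding R0_def by simp
  qed
  have sq: "0 < eps\<^sup>2" "eps\<^sup>2 \<le> eps" "0 < kap\<^sup>2" "kap\<^sup>2 \<le> kap" "eps\<^sup>2 \<le> 1" "kap\<^sup>2 \<le> 1"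
    using eps kap by (auto simp: power2_eq_square mult_left_le mult_le_one)
  have R0': "1 / (u * w) \<le> R0" if "eps\<^sup>2 \<le> u" "kap\<^sup>2 \<le> w" for u w
  proof -
    have "0 < u" "0 < w" using that sq(1,3) by linarith+
    then have "1 / (u * w) \<le> 1 / (eps\<^sup>2 * kap\<^sup>2)"
      by (intro divide_left_mono mult_mono mult_pos_pos that sq(1,3)) (simp_all add: less_imp_le)
    then show ?thesis using R0 by linarith
  qed
  have mul: "1 / (c * z) \<le> R0 / z" if "1 / c \<le> R0" "z > 0" for c z
    using divide_right_mono[OF that(1), of z] that(2) by simp
  have R1: "1 / e \<le> R0 / (k * n)"
  proof -
    have "1 / e \<le> 1 / (eps * k * n)" using e10 ek by (intro divide_left_mono) auto
    also have "\<dots> = 1 / ((eps * 1) * (k * n))" by (simp add: mult_ac)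
    also have "\<dots> \<le> R0 / (k * n)" by (rule mul[OF R0']) (use sq k0 n0 in auto)
    finally show ?thesis .
  qed
  have se: "s / e \<le> 1 / (eps * k)"
  proof -
    have "s / e \<le> n / (eps * k * n)" using cS e10 ek unfolding s_def by (intro frac_le) auto
    then show ?thesis using n0 by simp
  qed
  have se0: "0 \<le> s / e" unfolding s_def using e0 by simp
  have se2: "s\<^sup>2 / e\<^sup>2 \<le> 1 / (eps\<^sup>2 * k\<^sup>2)"
  proof -
    have "(s / e)\<^sup>2 \<le> (1 / (eps * k))\<^sup>2" using se se0 by (intro power_mono)
    then show ?thesis by (simp add: power_divide power_mult_distrib)
  qed
  have R2: "s\<^sup>2 / e\<^sup>2 \<le> R0 / k\<^sup>2"
  proof -
    have "s\<^sup>2 / e\<^sup>2 \<le> 1 / ((eps\<^sup>2 * 1) * k\<^sup>2)" using se2 by simp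
    also have "\<dots> \<le> R0 / k\<^sup>2" by (rule mul[OF R0']) (use sq k0 in auto)
    finally show ?thesis .
  qed
  have R3: "real (card Y) / (e * (kap * k)) \<le> R0 / k\<^sup>2"
  proof -
    have "real (card Y) / (e * (kap * k)) \<le> n / ((eps * k * n) * (kap * k))"
      using cY e10 ek lek by (intro frac_le mult_right_mono) auto
    also have "\<dots> = 1 / ((eps * kap) * k\<^sup>2)" using n0 by (simp add: power2_eq_square mult_ac)
    also have "\<dots> \<le> R0 / k\<^sup>2" by (rule mul[OF R0']) (use sq k0 in auto)
    finally show ?thesis .
  qed
  have R4: "1 / (e * (kap * k)) \<le> R0 / k ^ 3"
  proof -
    have "1 / (e * (kap * k)) \<le> 1 / ((eps * k * k) * (kap * k))"
    proof (intro divide_left_mono mult_right_mono)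
      have "eps * k * k \<le> eps * k * n" using kn' eps k0 by (intro mult_left_mono) auto
      then show "eps * k * k \<le> e" using e10(2) by linarith
      show "0 < e * (kap * k) * (eps * k * k * (kap * k))" using e0 lek eps k0 by simp
    qed (use lek in simp_all)
    also have "\<dots> = 1 / ((eps * kap) * k ^ 3)" by (simp add: power3_eq_cube mult_ac)
    also have "\<dots> \<le> R0 / k ^ 3" by (rule mul[OF R0']) (use sq k0 in auto)
    finally show ?thesis .
  qed
  have R5: "s\<^sup>2 / (e\<^sup>2 * (kap * k)) \<le> R0 / k ^ 3"
  proof -
    have "s\<^sup>2 / (e\<^sup>2 * (kap * k)) = (s\<^sup>2 / e\<^sup>2) / (kap * k)" by simp
    also have "\<dots> \<le> (1 / (eps\<^sup>2 * k\<^sup>2)) / (kap * k)" using se2 lek by (intro divide_right_mono) auto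
    also have "\<dots> = 1 / ((eps\<^sup>2 * kap) * k ^ 3)" by (simp add: power3_eq_cube power2_eq_square mult_ac)
    also have "\<dots> \<le> R0 / k ^ 3" by (rule mul[OF R0']) (use sq k0 in auto)
    finally show ?thesis .
  qed
  have R6: "s\<^sup>2 / (e\<^sup>2 * (kap * k)\<^sup>2) \<le> R0 / k ^ 4"
  proof -
    have "s\<^sup>2 / (e\<^sup>2 * (kap * k)\<^sup>2) = (s\<^sup>2 / e\<^sup>2) / (kap * k)\<^sup>2" by simp
    also have "\<dots> \<le> (1 / (eps\<^sup>2 * k\<^sup>2)) / (kap * k)\<^sup>2" using se2 by (intro divide_right_mono) auto
    also have "\<dots> = 1 / ((eps\<^sup>2 * kap\<^sup>2) * k ^ 4)" by (simp add: power_mult_distrib power4_eq_xxxx power2_eq_square mult_ac)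
    also have "\<dots> \<le> R0 / k ^ 4" by (rule mul[OF R0']) (use sq k0 in auto)
    finally show ?thesis .
  qed
  have GaM: "{x, y} \<in> M" if "x \<in> Y" "y \<in> Ga x" for x y
    using Ga[of x] that YX unfolding nb_def by auto
  have GaS: "Ga x \<subseteq> S" if "x \<in> Y" for x using Ga[of x] that YX by auto
  have YV: "Y \<subseteq> {1..n}" using YX X by blast
  have eta': "al + 1 / (eps * k) + be + eta \<le> 3 / 4" by (rule eta(2))
  have fin: "eta * (R / z) = R0 / z" for z unfolding R0_def by simp
  show ?thesis
    by (rule path_weighting_spread[OF YV S GaS GaM lek Yk e_def e0 s_def E(1) al' be' eta(1) eta'])
      (simp_all only: fin R1 R2 R3 R4 R5 R6)
qed

text \<open>With so few edges in \<open>E\<close> the full neighbourhoods can be used. Inside a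
  neighbourhood of size \<open>d\<close> there are at most \<open>d\<^sup>2\<close> and at most
  \<open>k\<^sup>2 / 4\<close> ordered pairs from \<open>E\<close>, hence at most
  \<open>k / 2 * d\<close>, which loses \<open>2 / 7\<close> of the weight in total. Pairs
  \<open>x, z\<close> that coincide or lie in \<open>E\<close> lose at most
  \<open>1 / 8\<close>.\<close>

lemma spread_dense:
  assumes E8: "8 * real (card E) \<le> k\<^sup>2" and kk: "k \<ge> 40" "k\<^sup>2 \<ge> 40 * n" and R: "R \<ge> 400"
  shows "spread_c4s R n k M E"
proof (rule path_spread[where X = V and S = V and Ga = nb and kap = "1/4" and eps = 1 and eta = "1/10"
      and ?e1.0 = "7/4 * k * n" and al = "2/7" and be = "1/8"])
  show "7 / 4 * k * real n + 1 / 4 * k * real n \<le> (\<Sum>x\<in>V. real (card (nb x)))"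
    unfolding sum_degrees by simp
  show "1 * k * real n \<le> 7 / 4 * k * real n" using k0 n0 by simp
  show "(\<Sum>x\<in>Y. real (card {(y, w). y \<in> nb x \<and> w \<in> nb x \<and> {y, w} \<in> E}) / (e * real (card (nb x)))) \<le> 2 / 7"
    if Y: "Y \<subseteq> V" "7 / 4 * k * real n \<le> e" "\<And>x. x \<in> Y \<Longrightarrow> 1 / 4 * k \<le> real (card (nb x))" for Y e
  proof -
    have e0: "0 < 7 / 4 * k * real n" using k0 n0 by simp
    then have e1: "e > 0" using Y(2) by linarith
    have pt: "real (card {(y, w). y \<in> nb x \<and> w \<in> nb x \<and> {y, w} \<in> E}) / (e * real (card (nb x))) \<le> (k / 2) / e"
      if x: "x \<in> Y" for x
    proof -
      let ?c = "real (card {(y, w). y \<in> nb x \<and> w \<in> nb x \<and> {y, w} \<in> E})" and ?d = "real (card (nb x))"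
      have d0: "?d > 0" using Y(3)[OF x] k0 by linarith
      have "{(y, w). y \<in> nb x \<and> w \<in> nb x \<and> {y, w} \<in> E} \<subseteq> ordered_pairs E" unfolding ordered_pairs_def by auto
      from card_mono[OF finite_ordered_pairs[OF E(1)] this]
      have "?c \<le> 2 * real (card E)" using card_ordered_pairs[OF E(1)] by simp
      then have c1: "?c \<le> (k / 2)\<^sup>2" using E8 by (simp add: power_divide)
      have "{(y, w). y \<in> nb x \<and> w \<in> nb x \<and> {y, w} \<in> E} \<subseteq> nb x \<times> nb x" by auto
      from card_mono[OF finite_cartesian_product[OF finite_nb finite_nb] this]
      have "card {(y, w). y \<in> nb x \<and> w \<in> nb x \<and> {y, w} \<in> E} \<le> card (nb x) * card (nb x)"
        unfolding card_cartesian_product .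
      then have c2: "?c \<le> ?d * ?d" by (simp only: of_nat_mult[symmetric] of_nat_le_iff)
      have "?c \<le> (k / 2) * ?d"
      proof (cases "?d \<le> k / 2")
        case True
        then have "?d * ?d \<le> (k / 2) * ?d" by (intro mult_right_mono) auto
        then show ?thesis using c2 by linarith
      next
        case False
        then have "(k / 2) * (k / 2) \<le> (k / 2) * ?d" using k0 by (intro mult_left_mono) auto
        then show ?thesis using c1 by (simp add: power2_eq_square)
      qed
      then have "?c / (e * ?d) \<le> (k / 2) * ?d / (e * ?d)" using e1 by (intro divide_right_mono) auto
      then show ?thesis using d0 by simp
    qed
    have cY: "real (card Y) \<le> real n" using card_mono[OF _ Y(1)] by simp
    have "(\<Sum>x\<in>Y. real (card {(y, w). y \<in> nb x \<and> w \<in> nb x \<and> {y, w} \<in> E}) / (e * real (card (nb x)))) \<le> (\<Sum>x\<in>Y. (k / 2) / e)"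
      by (intro sum_mono pt)
    also have "\<dots> = real (card Y) * (k / 2) / e" by simp
    also have "\<dots> \<le> real n * (k / 2) / (7 / 4 * k * real n)"
      by (intro frac_le mult_right_mono cY Y(2) e0) (use k0 in auto)
    also have "\<dots> = 2 / 7" using k0 n0 by (simp add: field_simps)
    finally show ?thesis .
  qed
  show "(2 * real (card E) + real n) * (real (card V))\<^sup>2 / (7 / 4 * k * real n)\<^sup>2 \<le> 1 / 8"
  proof -
    have "(2 * real (card E) + real n) * (real (card V))\<^sup>2 / (7 / 4 * k * real n)\<^sup>2
       \<le> (k\<^sup>2 / 4 + k\<^sup>2 / 40) * (real n)\<^sup>2 / (7 / 4 * k * real n)\<^sup>2"
    proof -
      have "2 * real (card E) + real n \<le> k\<^sup>2 / 4 + k\<^sup>2 / 40" using E8 kk by linarith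
      then show ?thesis by (intro divide_right_mono mult_mono) simp_all
    qed
    also have "\<dots> = (11 / 40) * (16 / 49)" using k0 n0 by (simp add: power_mult_distrib power_divide field_simps)
    also have "\<dots> \<le> 1 / 8" by simp
    finally show ?thesis .
  qed
  show "2 / 7 + 1 / (1 * k) + 1 / 8 + 1 / 10 \<le> (3 / 4 :: real)"
  proof -
    have "1 / (1 * k) \<le> 1 / 40" using kk by simp
    then show ?thesis by simp
  qed
  show "1 / (1 / 10 * 1\<^sup>2 * (1 / 4)\<^sup>2) \<le> R" using R by (simp add: power2_eq_square)
qed (auto simp: nb_V(1) subset_iff dest: nb_V(1)[THEN subsetD])

end

section \<open>Pregraphs without spread weightings\<close>

lemma sum_squared_le_card_sum:
  fixes f :: "'a \<Rightarrow> real"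
  assumes "finite A"
  shows "(\<Sum>i\<in>A. f i)\<^sup>2 \<le> real (card A) * (\<Sum>i\<in>A. (f i)\<^sup>2)"
proof (cases "A = {}")
  case False
  define c where "c = real (card A)"
  define m where "m = (\<Sum>i\<in>A. f i)"
  have c0: "c > 0" using False assms unfolding c_def by (simp add: card_gt_0_iff)
  define a where "a = m / c"
  have "0 \<le> (\<Sum>i\<in>A. (f i - a)\<^sup>2)" by (intro sum_nonneg) simp
  also have "\<dots> = (\<Sum>i\<in>A. (f i)\<^sup>2 - 2 * a * f i + a\<^sup>2)"
    by (intro sum.cong refl) (simp add: power2_diff)
  also have "\<dots> = (\<Sum>i\<in>A. (f i)\<^sup>2) - 2 * (m / c) * m + c * (m / c)\<^sup>2"
    unfolding a_def[symmetric] by (simp only: sum.distrib sum_subtractf sum_distrib_left[symmetric] sum_constant c_def m_def)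
  also have "\<dots> = (\<Sum>i\<in>A. (f i)\<^sup>2) - m\<^sup>2 / c" using c0 by (simp add: power2_eq_square field_simps)
  finally show ?thesis using c0 unfolding c_def m_def by (simp add: field_simps)
qed simp

lemma sum_card_swap:
  assumes "finite A" "finite B"
  shows "(\<Sum>x\<in>A. card {y\<in>B. P x y}) = (\<Sum>y\<in>B. card {x\<in>A. P x y})"
proof -
  have "(\<Sum>x\<in>A. card {y\<in>B. P x y}) = (\<Sum>x\<in>A. \<Sum>y\<in>B. if P x y then 1 else 0)"
    by (intro sum.cong refl) (simp only: card_eq_sum sum.inter_filter[OF assms(2)])
  also have "\<dots> = (\<Sum>y\<in>B. \<Sum>x\<in>A. if P x y then 1 else 0)" by (rule sum.swap)
  also have "\<dots> = (\<Sum>y\<in>B. card {x\<in>A. P x y})"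
    by (intro sum.cong refl) (simp only: card_eq_sum sum.inter_filter[OF assms(1)])
  finally show ?thesis .
qed

text \<open>\<open>E\<close> has hardly more edges than a clique on \<open>k\<close> vertices, and
  \<open>1\<close>, \<open>k\<close>, \<open>n\<close>, \<open>k\<^sup>2\<close> are widely
  separated. The exponent 10 leaves room for the lower powers of \<open>rho\<close> that occur in
  the error terms.\<close>

locale sparse_pregraph = pregraph +
  fixes rho :: real
  assumes rho: "0 < rho" "rho \<le> 1 / 10000"
    and E2: "2 * real (card E) \<le> (1 + rho) * k\<^sup>2"
    and big: "10 ^ 12 \<le> rho ^ 10 * k" "10 ^ 12 * k \<le> rho ^ 10 * n" "10 ^ 12 * n \<le> rho ^ 10 * k\<^sup>2"
begin

text \<open>A surplus of mixed pairs of any type other than those meeting \<open>hub\<close> yields a spread weighting.\<close>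

definition "hub = {v\<in>V. rho\<^sup>2 / 100 * n \<le> real (card (nb v))}"
definition "low = {v\<in>V - hub. real (card (nb v)) < 20 / rho * k}"
definition "mid = V - hub - low"

definition hubs_of :: "nat \<Rightarrow> nat set" where "hubs_of w = nb w \<inter> hub"

text \<open>Low vertices with too few hub neighbours to carry structure. Their contribution
  \<open>k / 10\<close> is later added to a bound \<open>7 / 10 * k\<close> per vertex, and the sum
  has to stay below \<open>k\<close>.\<close>

definition "free = {w\<in>low. real (card (hubs_of w)) < k / 10}"

section \<open>Sizes, degrees and codegrees of the vertex classes\<close>

lemma rho_pow: "j \<le> 10 \<Longrightarrow> rho ^ 10 \<le> rho ^ j"
  using rho by (intro power_decreasing) auto

lemma bigk: "c \<le> 10 ^ 12 \<Longrightarrow> j \<le> 10 \<Longrightarrow> c \<le> rho ^ j * k"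
  using big(1) mult_right_mono[OF rho_pow, of j k] k0 by linarith

lemma bign: "c \<le> 10 ^ 12 \<Longrightarrow> j \<le> 10 \<Longrightarrow> c * k \<le> rho ^ j * n"
  using big(2) mult_right_mono[OF rho_pow, of j "real n"] mult_right_mono[of c "10 ^ 12" k] k0 by linarith

lemma bigkk: "c \<le> 10 ^ 12 \<Longrightarrow> j \<le> 10 \<Longrightarrow> c * real n \<le> rho ^ j * k\<^sup>2"
  using big(3) mult_right_mono[OF rho_pow, of j "k\<^sup>2"] mult_right_mono[of c "10 ^ 12" "real n"] by simp

lemma E_le: "2 * real (card E) \<le> 2 * k\<^sup>2"
  using E2 rho mult_right_mono[of "1 + rho" 2 "k\<^sup>2"] by simp

lemma parts: "hub \<subseteq> V" "low \<subseteq> V" "mid \<subseteq> V" "free \<subseteq> low" "finite hub" "finite low" "finite mid" "finite free"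
proof -
  show s: "hub \<subseteq> V" "low \<subseteq> V" "mid \<subseteq> V" "free \<subseteq> low" unfolding hub_def low_def mid_def free_def by auto
  show "finite hub" "finite low" "finite mid" using s(1-3) by (auto intro: finite_subset)
  then show "finite free" using s(4) finite_subset by blast
qed

lemma card_threshold_le:
  assumes "A \<subseteq> V" "\<And>v. v \<in> A \<Longrightarrow> c \<le> real (card (nb v))"
  shows "real (card A) * c \<le> 2 * k * n"
proof -
  have "real (card A) * c = (\<Sum>v\<in>A. c)" by simp
  also have "\<dots> \<le> (\<Sum>v\<in>A. real (card (nb v)))" by (intro sum_mono assms)
  also have "\<dots> \<le> (\<Sum>v\<in>V. real (card (nb v)))" using assms by (intro sum_mono2) auto
  finally show ?thesis unfolding sum_degrees .
qed

lemma card_hub: "real (card hub) \<le> 200 / rho\<^sup>2 * k"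
proof -
  have "real (card hub) * (rho\<^sup>2 / 100 * n) \<le> 2 * k * n"
    using parts by (intro card_threshold_le) (auto simp: hub_def)
  then have "real n * (real (card hub) * rho\<^sup>2) \<le> real n * (200 * k)" by (simp add: mult_ac)
  then have "real (card hub) * rho\<^sup>2 \<le> 200 * k" using n0 by simp
  then show ?thesis using rho by (simp add: field_simps)
qed

lemma card_mid: "real (card mid) \<le> rho / 10 * n"
proof -
  have "real (card mid) * (20 / rho * k) \<le> 2 * k * n"
    using parts by (intro card_threshold_le) (auto simp: mid_def low_def)
  then have "k * (real (card mid) * 20) \<le> k * (2 * n * rho)" using rho by (simp add: field_simps)
  then have "real (card mid) * 20 \<le> 2 * n * rho" using k0 by (rule mult_left_le_imp_le)
  then show ?thesis by simp
qed

lemma mid_degree: "v \<in> V - hub \<Longrightarrow> real (card (nb v)) \<le> rho\<^sup>2 / 100 * n"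
  unfolding hub_def by auto

lemma low_degree: "v \<in> low \<Longrightarrow> real (card (nb v)) \<le> 20 / rho * k"
  unfolding low_def by auto

text \<open>Double counting: an ordered pair from \<open>E\<close> lies inside \<open>Ga x\<close>
  for at most \<open>D\<close> vertices \<open>x\<close>, since its first entry already
  does.\<close>

lemma codegree_sum_le:
  fixes Ga :: "nat \<Rightarrow> nat set"
  assumes Y: "Y \<subseteq> V" and dg: "\<And>y. real (card {x\<in>Y. y \<in> Ga x}) \<le> D"
  shows "(\<Sum>x\<in>Y. real (card {(y, w). y \<in> Ga x \<and> w \<in> Ga x \<and> {y, w} \<in> E})) \<le> 2 * real (card E) * D"
proof -
  have fY: "finite Y" using Y finite_subset by blast
  have fO: "finite (ordered_pairs E)" by (rule finite_ordered_pairs[OF E(1)])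
  have e: "{(y, w). y \<in> Ga x \<and> w \<in> Ga x \<and> {y, w} \<in> E} = {yw\<in>ordered_pairs E. fst yw \<in> Ga x \<and> snd yw \<in> Ga x}" for x
    unfolding ordered_pairs_def by auto
  have "(\<Sum>x\<in>Y. real (card {(y, w). y \<in> Ga x \<and> w \<in> Ga x \<and> {y, w} \<in> E}))
      = real (\<Sum>x\<in>Y. card {yw\<in>ordered_pairs E. fst yw \<in> Ga x \<and> snd yw \<in> Ga x})" unfolding e by simp
  also have "\<dots> = (\<Sum>yw\<in>ordered_pairs E. real (card {x\<in>Y. fst yw \<in> Ga x \<and> snd yw \<in> Ga x}))"
    unfolding sum_card_swap[OF fY fO] by simp
  also have "\<dots> \<le> (\<Sum>yw\<in>ordered_pairs E. D)"
  proof (rule sum_mono)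
    fix yw
    have "card {x\<in>Y. fst yw \<in> Ga x \<and> snd yw \<in> Ga x} \<le> card {x\<in>Y. fst yw \<in> Ga x}"
      using fY by (intro card_mono) auto
    then show "real (card {x\<in>Y. fst yw \<in> Ga x \<and> snd yw \<in> Ga x}) \<le> D" using dg[of "fst yw"] by linarith
  qed
  also have "\<dots> = 2 * real (card E) * D" using card_ordered_pairs[OF E(1)] by simp
  finally show ?thesis .
qed

lemma codegree_kill_le:
  fixes Ga :: "nat \<Rightarrow> nat set"
  assumes Y: "Y \<subseteq> V" and dg: "\<And>y. real (card {x\<in>Y. y \<in> Ga x}) \<le> D"
    and e: "0 < e1" "e1 \<le> e" and c: "0 < c" "\<And>x. x \<in> Y \<Longrightarrow> c \<le> real (card (Ga x))"
  shows "(\<Sum>x\<in>Y. real (card {(y, w). y \<in> Ga x \<and> w \<in> Ga x \<and> {y, w} \<in> E}) / (e * real (card (Ga x))))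
    \<le> 2 * real (card E) * D / (e1 * c)"
proof -
  have "(\<Sum>x\<in>Y. real (card {(y, w). y \<in> Ga x \<and> w \<in> Ga x \<and> {y, w} \<in> E}) / (e * real (card (Ga x))))
    \<le> (\<Sum>x\<in>Y. real (card {(y, w). y \<in> Ga x \<and> w \<in> Ga x \<and> {y, w} \<in> E}) / (e1 * c))"
  proof (rule sum_mono)
    fix x assume "x \<in> Y"
    then have cx: "c \<le> real (card (Ga x))" by (rule c(2))
    then have "0 < real (card (Ga x))" using c(1) by linarith
    moreover have "0 < e" using e by linarith
    ultimately show "real (card {(y, w). y \<in> Ga x \<and> w \<in> Ga x \<and> {y, w} \<in> E}) / (e * real (card (Ga x)))
      \<le> real (card {(y, w). y \<in> Ga x \<and> w \<in> Ga x \<and> {y, w} \<in> E}) / (e1 * c)"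
      using e c(1) cx by (intro divide_left_mono mult_mono mult_pos_pos) simp_all
  qed
  also have "\<dots> = (\<Sum>x\<in>Y. real (card {(y, w). y \<in> Ga x \<and> w \<in> Ga x \<and> {y, w} \<in> E})) / (e1 * c)"
    by (simp add: sum_divide_distrib)
  also have "\<dots> \<le> 2 * real (card E) * D / (e1 * c)"
    using codegree_sum_le[OF Y dg] e c by (intro divide_right_mono) auto
  finally show ?thesis .
qed

lemma codegree_nb:
  assumes "Y \<subseteq> V" "\<And>x. x \<in> Y \<Longrightarrow> Ga x \<subseteq> S \<inter> nb x" "\<And>y. y \<in> S \<Longrightarrow> real (card (nb y)) \<le> D" "0 \<le> D"
  shows "real (card {x\<in>Y. y \<in> Ga x}) \<le> D"
proof (cases "y \<in> S")
  case True
  have "{x\<in>Y. y \<in> Ga x} \<subseteq> nb y" using assms(2) nb_sym by blast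
  from card_mono[OF finite_nb this] show ?thesis using assms(3)[OF True] by linarith
next
  case False
  then have em: "{x\<in>Y. y \<in> Ga x} = {}" using assms(2) by blast
  show ?thesis unfolding em using assms(4) by simp
qed

text \<open>Degrees above \<open>20 / rho * k\<close> are rare, so \<open>S = mid\<close> has at
  most \<open>rho / 10 * n\<close> vertices and the cap \<open>s\<^sup>2\<close> is small enough
  against the number of edges in \<open>E\<close>. Degrees outside \<open>hub\<close> are at most
  \<open>rho\<^sup>2 / 100 * n\<close>, so a pair from \<open>E\<close> inside \<open>mid\<close>
  has few common neighbours. These two needs fix the thresholds of \<open>low\<close> and
  \<open>hub\<close>; the losses are \<open>6 / 100\<close> and \<open>8 / 100\<close>.\<close>

lemma spread_mid:
  assumes "rho * k * n \<le> (\<Sum>x\<in>V - hub. real (card (nb x \<inter> mid)))" and R: "R \<ge> 10 ^ 20 / rho ^ 20"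
  shows "spread_c4s R n k M E"
proof (rule path_spread[where X = "V - hub" and S = mid and Ga = "\<lambda>x. nb x \<inter> mid" and kap = "rho / 2" and eps = "rho / 2"
      and eta = "1 / 2" and ?e1.0 = "rho / 2 * k * n" and al = "8 / 100" and be = "6 / 100"])
  show "V - hub \<subseteq> V" "mid \<subseteq> V" "\<And>x. x \<in> V - hub \<Longrightarrow> nb x \<inter> mid \<subseteq> mid \<inter> nb x"
    "0 < rho / 2" "rho / 2 \<le> 1" "0 < rho / 2" "rho / 2 \<le> 1" "rho / 2 * k * n \<le> rho / 2 * k * n" "0 < (1 / 2 :: real)"
    using rho parts by auto
  show "rho / 2 * k * real n + rho / 2 * k * real n \<le> (\<Sum>x\<in>V - hub. real (card (nb x \<inter> mid)))"
    using assms(1) by linarith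
  show "(\<Sum>x\<in>Y. real (card {(y, w). y \<in> nb x \<inter> mid \<and> w \<in> nb x \<inter> mid \<and> {y, w} \<in> E}) / (e * real (card (nb x \<inter> mid)))) \<le> 8 / 100"
    if Y: "Y \<subseteq> V - hub" "rho / 2 * k * real n \<le> e" "\<And>x. x \<in> Y \<Longrightarrow> rho / 2 * k \<le> real (card (nb x \<inter> mid))" for Y e
  proof -
    have "(\<Sum>x\<in>Y. real (card {(y, w). y \<in> nb x \<inter> mid \<and> w \<in> nb x \<inter> mid \<and> {y, w} \<in> E}) / (e * real (card (nb x \<inter> mid))))
      \<le> 2 * real (card E) * (rho\<^sup>2 / 100 * n) / ((rho / 2 * k * n) * (rho / 2 * k))"
    proof (rule codegree_kill_le[OF _ codegree_nb[where S = mid] _ Y(2) _ Y(3)])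
      show "real (card (nb y)) \<le> rho\<^sup>2 / 100 * n" if "y \<in> mid" for y
        using that mid_degree unfolding mid_def by blast
    qed (use Y(1) rho k0 n0 in auto)
    also have "\<dots> \<le> 2 * k\<^sup>2 * (rho\<^sup>2 / 100 * n) / ((rho / 2 * k * n) * (rho / 2 * k))"
      using E_le rho k0 by (intro divide_right_mono mult_right_mono) auto
    also have "\<dots> = 8 / 100" using rho k0 n0 by (simp add: field_simps power2_eq_square)
    finally show ?thesis .
  qed
  show "(2 * real (card E) + real n) * (real (card mid))\<^sup>2 / (rho / 2 * k * real n)\<^sup>2 \<le> 6 / 100"
  proof -
    have a: "2 * real (card E) + real n \<le> 3 / 2 * k\<^sup>2"
    proof -
      have "100 * real n \<le> rho ^ 0 * k\<^sup>2" by (rule bigkk) auto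
      moreover have "(1 + rho) * k\<^sup>2 \<le> (1 + 1 / 10000) * k\<^sup>2" using rho by (intro mult_right_mono) auto
      ultimately show ?thesis using E2 by simp
    qed
    have "(2 * real (card E) + real n) * (real (card mid))\<^sup>2 / (rho / 2 * k * real n)\<^sup>2
       \<le> (3 / 2 * k\<^sup>2) * (rho / 10 * n)\<^sup>2 / (rho / 2 * k * real n)\<^sup>2"
      using a card_mid k0 by (intro divide_right_mono mult_mono power_mono) auto
    also have "\<dots> = 6 / 100" using rho k0 n0 by (simp add: field_simps power2_eq_square)
    finally show ?thesis .
  qed
  show "8 / 100 + 1 / (rho / 2 * k) + 6 / 100 + 1 / 2 \<le> (3 / 4 :: real)"
  proof -
    have "1000 \<le> rho ^ 1 * k" by (rule bigk) auto
    then have "1 / (rho / 2 * k) \<le> 1 / 500" using rho k0 by (intro divide_left_mono) auto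
    then show ?thesis by simp
  qed
  show "1 / (1 / 2 * (rho / 2)\<^sup>2 * (rho / 2)\<^sup>2) \<le> R"
  proof -
    have "1 / (1 / 2 * (rho / 2)\<^sup>2 * (rho / 2)\<^sup>2) = 32 / rho ^ 4" by (simp add: power_divide power2_eq_square power4_eq_xxxx)
    also have "\<dots> \<le> 10 ^ 20 / rho ^ 20" using rho by (intro frac_le power_decreasing) auto
    finally show ?thesis using R by linarith
  qed
qed

text \<open>With \<open>14 / 10 * k\<close> neighbours per vertex inside \<open>free\<close>, the
  loss from pairs \<open>x, z\<close> in \<open>E\<close> is about
  \<open>1 / (14 / 10)\<^sup>2\<close>, roughly 0.51 and affordable. Conversely, without this
  surplus the mixed pairs inside \<open>free\<close> number about \<open>7 / 10 * k\<close> per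
  vertex at most, strictly less than the \<open>k\<close> per vertex of the whole pregraph. This gap
  later makes \<open>free\<close> small.\<close>

lemma spread_free:
  assumes "14 / 10 * k * real (card free) + 2 * rho * k * n \<le> (\<Sum>x\<in>free. real (card (nb x \<inter> free)))"
    and R: "R \<ge> 10 ^ 20 / rho ^ 20"
  shows "spread_c4s R n k M E"
proof (rule path_spread[where X = free and S = free and Ga = "\<lambda>x. nb x \<inter> free" and kap = rho and eps = rho
      and eta = "1 / 5" and ?e1.0 = "14 / 10 * k * real (card free) + rho * k * n" and al = "1 / 100" and be = "52 / 100"])
  show "free \<subseteq> V" "free \<subseteq> V" "\<And>x. x \<in> free \<Longrightarrow> nb x \<inter> free \<subseteq> free \<inter> nb x"
    "0 < rho" "rho \<le> 1" "0 < rho" "rho \<le> 1" "0 < (1 / 5 :: real)"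
    "rho * k * real n \<le> 14 / 10 * k * real (card free) + rho * k * real n"
    using rho parts k0 by auto
  show "14 / 10 * k * real (card free) + rho * k * real n + rho * k * real n \<le> (\<Sum>x\<in>free. real (card (nb x \<inter> free)))"
    using assms(1) by linarith
  let ?e = "14 / 10 * k * real (card free) + rho * k * real n"
  have rkn: "0 < rho * k * real n" using rho k0 n0 by simp
  then have e0: "0 < ?e" "rho * k * n \<le> ?e" using k0 by (auto intro: add_nonneg_pos)
  show "(\<Sum>x\<in>Y. real (card {(y, w). y \<in> nb x \<inter> free \<and> w \<in> nb x \<inter> free \<and> {y, w} \<in> E}) / (e * real (card (nb x \<inter> free)))) \<le> 1 / 100"
    if Y: "Y \<subseteq> free" "?e \<le> e" "\<And>x. x \<in> Y \<Longrightarrow> rho * k \<le> real (card (nb x \<inter> free))" for Y e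
  proof -
    have "(\<Sum>x\<in>Y. real (card {(y, w). y \<in> nb x \<inter> free \<and> w \<in> nb x \<inter> free \<and> {y, w} \<in> E}) / (e * real (card (nb x \<inter> free))))
      \<le> 2 * real (card E) * (20 / rho * k) / (?e * (rho * k))"
    proof (rule codegree_kill_le[OF _ codegree_nb[where S = free] e0(1) Y(2) _ Y(3)])
      show "real (card (nb y)) \<le> 20 / rho * k" if "y \<in> free" for y using that low_degree parts(4) by blast
    qed (use Y(1) rho k0 n0 parts in auto)
    also have "\<dots> \<le> 2 * k\<^sup>2 * (20 / rho * k) / ((rho * k * n) * (rho * k))"
      using E_le rho k0 n0 e0 by (intro frac_le mult_right_mono) auto
    also have "\<dots> = 40 * k / (rho ^ 3 * n)" using rho k0 n0 by (simp add: field_simps power2_eq_square power3_eq_cube)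
    also have "\<dots> \<le> 1 / 100"
    proof -
      have "4000 * k \<le> rho ^ 3 * n" by (rule bign) auto
      then show ?thesis using rho n0 by (simp add: field_simps)
    qed
    finally show ?thesis .
  qed
  show "(2 * real (card E) + real n) * (real (card free))\<^sup>2 / ?e\<^sup>2 \<le> 52 / 100"
  proof -
    have a: "2 * real (card E) + real n \<le> 1002 / 1000 * k\<^sup>2"
    proof -
      have "1000 * real n \<le> rho ^ 0 * k\<^sup>2" by (rule bigkk) auto
      moreover have "(1 + rho) * k\<^sup>2 \<le> (1 + 1 / 10000) * k\<^sup>2" using rho by (intro mult_right_mono) auto
      ultimately show ?thesis using E2 by simp
    qed
    have b: "(14 / 10 * k * real (card free))\<^sup>2 \<le> ?e\<^sup>2" using rkn k0 by (intro power_mono) auto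
    have "(2 * real (card E) + real n) * (real (card free))\<^sup>2 \<le> (1002 / 1000 * k\<^sup>2) * (real (card free))\<^sup>2"
      using a by (intro mult_right_mono) auto
    also have "\<dots> \<le> 52 / 100 * (14 / 10 * k * real (card free))\<^sup>2"
      by (simp add: power_mult_distrib power_divide)
    also have "\<dots> \<le> 52 / 100 * ?e\<^sup>2" using b by (intro mult_left_mono) auto
    finally show ?thesis using e0 by (simp add: divide_le_eq)
  qed
  show "1 / 100 + 1 / (rho * k) + 52 / 100 + 1 / 5 \<le> (3 / 4 :: real)"
  proof -
    have "1000 \<le> rho ^ 1 * k" by (rule bigk) auto
    then have "1 / (rho * k) \<le> 1 / 1000" using rho k0 by (intro divide_left_mono) auto
    then show ?thesis by simp
  qed
  show "1 / (1 / 5 * rho\<^sup>2 * rho\<^sup>2) \<le> R"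
  proof -
    have "1 / (1 / 5 * rho\<^sup>2 * rho\<^sup>2) = 5 / rho ^ 4" by (simp add: power2_eq_square power4_eq_xxxx)
    also have "\<dots> \<le> 10 ^ 20 / rho ^ 20" using rho by (intro frac_le power_decreasing) auto
    finally show ?thesis using R by linarith
  qed
qed


text \<open>Pairs of hubs that obstruct cliques, being opposite corners of many potential cycles.
  There are at most \<open>4 * 10 ^ 4 / rho ^ 4 * k\<^sup>2\<close> pairs of hubs, and the factor
  \<open>rho ^ 5 / 10 ^ 5\<close> brings this down to a fraction of
  \<open>rho * k\<^sup>2\<close>.\<close>

definition "split_pairs = {(u, u'). u \<in> hub \<and> u' \<in> hub \<and> u \<noteq> u' \<and> {u, u'} \<notin> E \<and>
  rho ^ 5 / 10 ^ 5 * n \<le> real (card (nb u \<inter> nb u'))}"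

lemma card_non_E_pairs:
  assumes "finite A"
  shows "(real (card A))\<^sup>2 - real (card A) - real (card {(x, z). x \<in> A \<and> z \<in> A \<and> {x, z} \<in> E})
    \<le> real (card {(x, z). x \<in> A \<and> z \<in> A \<and> x \<noteq> z \<and> {x, z} \<notin> E})"
proof -
  let ?P = "{(x, z). x \<in> A \<and> z \<in> A \<and> x \<noteq> z \<and> {x, z} \<notin> E}" and ?Q = "{(x, z). x \<in> A \<and> z \<in> A \<and> {x, z} \<in> E}"
  have f: "finite ?P" "finite ?Q" by (rule finite_subset[of _ "A \<times> A"], use assms in auto)+
  have "A \<times> A \<subseteq> ?P \<union> ((\<lambda>x. (x, x)) ` A \<union> ?Q)" by auto
  then have "card (A \<times> A) \<le> card (?P \<union> ((\<lambda>x. (x, x)) ` A \<union> ?Q))"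
    using f assms by (intro card_mono) auto
  also have "\<dots> \<le> card ?P + (card ((\<lambda>x. (x, x)) ` A) + card ?Q)"
    by (rule order_trans[OF card_Un_le add_left_mono[OF card_Un_le]])
  also have "\<dots> \<le> card ?P + (card A + card ?Q)" using card_image_le[OF assms, of "\<lambda>x. (x, x)"] by simp
  finally have "real (card A * card A) \<le> real (card ?P) + (real (card A) + real (card ?Q))"
    unfolding card_cartesian_product by linarith
  then show ?thesis by (simp add: power2_eq_square)
qed

lemma ordered_E_le: "real (card {(x, z). x \<in> A \<and> z \<in> A \<and> {x, z} \<in> E}) \<le> 2 * real (card E)"
proof -
  have "{(x, z). x \<in> A \<and> z \<in> A \<and> {x, z} \<in> E} \<subseteq> ordered_pairs E" unfolding ordered_pairs_def by auto
  from card_mono[OF finite_ordered_pairs[OF E(1)] this] show ?thesis using card_ordered_pairs[OF E(1)] by simp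
qed

lemma card_le_times:
  fixes p q :: real
  assumes "S \<subseteq> A \<times> B" "finite A" "finite B" "real (card A) \<le> p" "real (card B) \<le> q"
  shows "real (card S) \<le> p * q"
proof (rule card_Sigma_le[OF assms(1,2) _ assms(4)])
  show "0 \<le> q" using assms(5) by linarith
qed (use assms in auto)

text \<open>The uniform weighting on the cycles \<open>u x u' z\<close> with \<open>(u, u')\<close>
  a split pair and \<open>x, z\<close> common neighbours. A common neighbourhood has size linear in
  \<open>n\<close> while \<open>E\<close> has order \<open>k\<^sup>2\<close> edges, far fewer than
  \<open>n\<^sup>2\<close>, so at least half of the pairs \<open>x, z\<close> are possible
  diagonals.\<close>

lemma spread_split_pairs:
  assumes many: "rho ^ 5 / 10 ^ 5 * k\<^sup>2 \<le> real (card split_pairs)" and R: "R \<ge> 10 ^ 20 / rho ^ 20"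
  shows "spread_c4s R n k M E"
proof -
  define et where "et = rho ^ 5 / 10 ^ 5"
  have et0: "et > 0" unfolding et_def using rho by simp
  define cm where "cm u u' = nb u \<inter> nb u'" for u u'
  define Om where "Om = {(u, x, u', z). (u, u') \<in> split_pairs \<and> x \<in> cm u u' \<and> z \<in> cm u u' \<and> x \<noteq> z \<and> {x, z} \<notin> E}"
  define Ps where "Ps u u' = {(x, z). x \<in> cm u u' \<and> z \<in> cm u u' \<and> x \<noteq> z \<and> {x, z} \<notin> E}" for u u'
  have fcm: "finite (cm u u')" "cm u u' \<subseteq> V" for u u' unfolding cm_def using finite_nb nb_V(1) by auto
  have fPs: "finite (Ps u u')" for u u'
    by (rule finite_subset[of _ "cm u u' \<times> cm u u'"]) (use fcm in \<open>auto simp: Ps_def\<close>)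
  have fsp: "finite split_pairs" "split_pairs \<subseteq> hub \<times> hub"
    by (rule finite_subset[of _ "hub \<times> hub"]) (use parts in \<open>auto simp: split_pairs_def\<close>)
  have OmQ: "Om \<subseteq> c4_quads M E"
    unfolding Om_def c4_quads_def split_pairs_def cm_def nb_def by (auto simp: insert_commute)
  have n_et: "4 \<le> et * n" "8 * k\<^sup>2 \<le> et\<^sup>2 * n\<^sup>2"
  proof -
    have h: "10 ^ 6 * k \<le> rho ^ 5 * n" by (rule bign) auto
    then have h1: "10 * k \<le> et * n" unfolding et_def by simp
    have "1 \<le> rho ^ 0 * k" by (rule bigk) auto
    then show "4 \<le> et * n" using h1 by simp
    have "(10 * k)\<^sup>2 \<le> (et * n)\<^sup>2" using h1 k0 by (intro power_mono) auto
    then have "100 * k\<^sup>2 \<le> et\<^sup>2 * n\<^sup>2" by (simp add: power_mult_distrib)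
    then show "8 * k\<^sup>2 \<le> et\<^sup>2 * n\<^sup>2" using zero_le_power2[of k] by linarith
  qed
  have cPs: "et\<^sup>2 * n\<^sup>2 / 2 \<le> real (card (Ps u u'))" if "(u, u') \<in> split_pairs" for u u'
  proof -
    define c where "c = real (card (cm u u'))"
    have c: "et * n \<le> c" using that unfolding split_pairs_def c_def cm_def et_def by auto
    have "c\<^sup>2 - c - 2 * real (card E) \<le> real (card (Ps u u'))"
      using card_non_E_pairs[OF fcm(1)[of u u']] ordered_E_le[of "cm u u'"] unfolding c_def Ps_def by linarith
    moreover have "c \<le> c\<^sup>2 / 4"
    proof -
      have "4 * c \<le> c * c" using c n_et(1) by (intro mult_right_mono) auto
      then show ?thesis by (simp add: power2_eq_square)
    qed
    moreover have "(et * n)\<^sup>2 \<le> c\<^sup>2" using c et0 by (intro power_mono) auto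
    ultimately show ?thesis using E_le n_et(2) by (simp add: power_mult_distrib)
  qed
  define N where "N = et ^ 3 * k\<^sup>2 * n\<^sup>2 / 2"
  have N0: "N > 0" unfolding N_def using et0 k0 n0 by simp
  have NOm: "N \<le> real (card Om)"
  proof -
    have inj: "inj_on (\<lambda>((u, u'), (x, z)). (u, x, u', z)) (Sigma split_pairs (\<lambda>(u, u'). Ps u u'))"
      by (auto simp: inj_on_def)
    have img: "(\<lambda>((u, u'), (x, z)). (u, x, u', z)) ` (Sigma split_pairs (\<lambda>(u, u'). Ps u u')) = Om"
    proof
      show "(\<lambda>((u, u'), (x, z)). (u, x, u', z)) ` (Sigma split_pairs (\<lambda>(u, u'). Ps u u')) \<subseteq> Om"
        unfolding Om_def Ps_def by auto
      show "Om \<subseteq> (\<lambda>((u, u'), (x, z)). (u, x, u', z)) ` (Sigma split_pairs (\<lambda>(u, u'). Ps u u'))"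
      proof
        fix q assume "q \<in> Om"
        then obtain u x u' z where q: "q = (u, x, u', z)" "(u, u') \<in> split_pairs" "(x, z) \<in> Ps u u'"
          unfolding Om_def Ps_def by auto
        then show "q \<in> (\<lambda>((u, u'), (x, z)). (u, x, u', z)) ` (Sigma split_pairs (\<lambda>(u, u'). Ps u u'))"
          by (intro image_eqI[of _ _ "((u, u'), (x, z))"]) auto
      qed
    qed
    have "card Om = card (Sigma split_pairs (\<lambda>(u, u'). Ps u u'))"
      unfolding img[symmetric] by (rule card_image[OF inj])
    also have "\<dots> = (\<Sum>(u, u')\<in>split_pairs. card (Ps u u'))"
      using fsp fPs by (subst card_SigmaI) (auto intro!: sum.cong)
    finally have "real (card Om) = (\<Sum>(u, u')\<in>split_pairs. real (card (Ps u u')))" by (simp add: case_prod_beta)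
    moreover have "(\<Sum>(u, u')\<in>split_pairs. et\<^sup>2 * n\<^sup>2 / 2) \<le> (\<Sum>(u, u')\<in>split_pairs. real (card (Ps u u')))"
      using cPs by (intro sum_mono) auto
    moreover have "(\<Sum>(u, u')\<in>split_pairs. et\<^sup>2 * n\<^sup>2 / 2) = real (card split_pairs) * (et\<^sup>2 * n\<^sup>2 / 2)"
      by (simp add: case_prod_beta)
    moreover have "(et * k\<^sup>2) * (et\<^sup>2 * n\<^sup>2 / 2) \<le> real (card split_pairs) * (et\<^sup>2 * n\<^sup>2 / 2)"
      using many unfolding et_def by (intro mult_right_mono) auto
    moreover have "N = (et * k\<^sup>2) * (et\<^sup>2 * n\<^sup>2 / 2)" unfolding N_def by (simp add: power3_eq_cube power2_eq_square)
    ultimately show ?thesis by linarith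
  qed
  define h where "h = 200 / rho\<^sup>2 * k"
  have ch: "real (card hub) \<le> h" "0 \<le> h" unfolding h_def using card_hub k0 by auto
  have cV: "real (card V) \<le> real n" by simp
  \<comment> \<open>The largest loss among the weightings and the origin of
    \<open>10 ^ 20 / rho ^ 20\<close>: \<open>et ^ 3\<close> contributes
    \<open>rho ^ 15 / 10 ^ 15\<close>, and the square of the bound on \<open>card hub\<close>
    contributes \<open>rho ^ 4\<close> and most of the constant.\<close>
  define R1 where "R1 = 8 * 10 ^ 4 / (rho ^ 4 * et ^ 3)"
  have RR: "R1 \<le> R"
  proof -
    have "R1 = 8 * 10 ^ 19 / rho ^ 19" unfolding R1_def et_def by (simp add: power_divide power_mult[symmetric] power_add[symmetric])
    also have "\<dots> \<le> 10 ^ 20 / rho ^ 20" using rho by (intro frac_le power_decreasing) auto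
    finally show ?thesis using R by linarith
  qed
  have up: "x \<le> N * (R / z)" if "x * z \<le> N * R1" "z > 0" for x z
  proof -
    have "x \<le> N * R1 / z" using that by (simp add: field_simps)
    also have "\<dots> \<le> N * R / z" using RR N0 that by (intro divide_right_mono mult_left_mono) auto
    finally show ?thesis by simp
  qed
  have NR: "N * R1 = 4 * 10 ^ 4 * k\<^sup>2 * n\<^sup>2 / rho ^ 4"
    unfolding N_def R1_def using et0 by simp
  have kn': "k \<le> n" by (rule k_le_n)
  have rr: "rho ^ 4 \<le> 1" "rho ^ 4 \<le> rho\<^sup>2" using rho by (auto simp: power_le_one intro!: power_decreasing)
  have b1: "h * n \<le> N * (R / (k * n))"
  proof (rule up)
    have "h * n * (k * n) = 200 * (k\<^sup>2 * n\<^sup>2) / rho\<^sup>2" unfolding h_def by (simp add: power2_eq_square)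
    also have "\<dots> \<le> 4 * 10 ^ 4 * (k\<^sup>2 * n\<^sup>2) / rho ^ 4" using rr rho k0 by (intro frac_le mult_right_mono) auto
    finally show "h * n * (k * n) \<le> N * R1" unfolding NR by (simp only: mult.assoc)
  qed (use k0 n0 in simp)
  have b2: "real n * real n \<le> N * (R / k\<^sup>2)"
  proof (rule up)
    have "real n * real n * k\<^sup>2 = 1 * (k\<^sup>2 * n\<^sup>2) / 1" by (simp add: power2_eq_square)
    also have "\<dots> \<le> 4 * 10 ^ 4 * (k\<^sup>2 * n\<^sup>2) / rho ^ 4" using rr rho k0 by (intro frac_le mult_right_mono) auto
    finally show "real n * real n * k\<^sup>2 \<le> N * R1" unfolding NR by (simp only: mult.assoc)
  qed (use k0 in simp)
  have b3: "h * h \<le> N * (R / k\<^sup>2)"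
  proof (rule up)
    have "h * h * k\<^sup>2 = 4 * 10 ^ 4 * (k\<^sup>2 * k\<^sup>2) / rho ^ 4" unfolding h_def by (simp add: power2_eq_square power4_eq_xxxx)
    also have "\<dots> \<le> 4 * 10 ^ 4 * (k\<^sup>2 * n\<^sup>2) / rho ^ 4"
      using rho k0 kn' by (intro divide_right_mono mult_left_mono power_mono) auto
    finally show "h * h * k\<^sup>2 \<le> N * R1" unfolding NR by (simp only: mult.assoc)
  qed (use k0 in simp)
  have kk3: "k ^ 3 \<le> k\<^sup>2 * n" unfolding power3_eq_cube power2_eq_square using k0 kn' by (intro mult_left_mono) auto
  have b4: "real n \<le> N * (R / k ^ 3)"
  proof (rule up)
    have "real n * k ^ 3 \<le> real n * (k\<^sup>2 * n)" using kk3 by (intro mult_left_mono) auto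
    also have "\<dots> = 1 * (k\<^sup>2 * n\<^sup>2) / 1" by (simp add: power2_eq_square)
    also have "\<dots> \<le> 4 * 10 ^ 4 * (k\<^sup>2 * n\<^sup>2) / rho ^ 4" using rr rho k0 by (intro frac_le mult_right_mono) auto
    finally show "real n * k ^ 3 \<le> N * R1" unfolding NR by (simp only: mult.assoc)
  qed (use k0 in simp)
  have b5: "h \<le> N * (R / k ^ 3)"
  proof (rule up)
    have "h * k ^ 3 \<le> h * (k\<^sup>2 * n)" using kk3 ch by (intro mult_left_mono) auto
    also have "\<dots> = 200 * (k\<^sup>2 * (k * n)) / rho\<^sup>2" unfolding h_def by (simp add: power2_eq_square)
    also have "\<dots> \<le> 4 * 10 ^ 4 * (k\<^sup>2 * (n * n)) / rho ^ 4"
      using rr rho k0 mult_right_mono[OF kn', of "real n"] by (intro frac_le mult_mono) auto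
    finally show "h * k ^ 3 \<le> N * R1" unfolding NR by (simp add: power2_eq_square mult_ac)
  qed (use k0 in simp)
  have b6: "1 \<le> N * (R / k ^ 4)"
  proof (rule up)
    have "1 * k ^ 4 = k\<^sup>2 * (k * k)" by (simp add: power4_eq_xxxx power2_eq_square)
    also have "\<dots> \<le> k\<^sup>2 * (n * n)" using mult_mono[OF kn' kn'] k0 by (intro mult_left_mono) auto
    also have "\<dots> = 1 * (k\<^sup>2 * n\<^sup>2) / 1" by (simp add: power2_eq_square)
    also have "\<dots> \<le> 4 * 10 ^ 4 * (k\<^sup>2 * n\<^sup>2) / rho ^ 4" using rr rho k0 by (intro frac_le mult_right_mono) auto
    finally show "1 * k ^ 4 \<le> N * R1" unfolding NR by (simp only: mult.assoc)
  qed (use k0 in simp)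
  have Omin: "a \<in> hub \<and> c \<in> hub \<and> b \<in> V \<and> d \<in> V" if "(a, b, c, d) \<in> Om" for a b c d
    using that fsp(2) fcm(2)[of a c] unfolding Om_def by auto
  have fh: "finite hub" "finite V" using parts by auto
  have c1: "real (card S) \<le> real n" if "S \<subseteq> V" for S using card_mono[OF fh(2) that] by simp
  have c2: "real (card S) \<le> h" if "S \<subseteq> hub" for S using card_mono[OF fh(1) that] ch by linarith
  show ?thesis
  proof (rule uniform_spread[OF OmQ M N0 NOm])
    show "real (card {(c, d). (x, y, c, d) \<in> Om}) \<le> N * (R / (k * n))" for x y
      by (rule order_trans[OF card_le_times[OF _ fh ch(1) cV] b1]) (use Omin in auto)
    show "real (card {(a, d). (a, x, y, d) \<in> Om}) \<le> N * (R / (k * n))" for x y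
      by (rule order_trans[OF card_le_times[OF _ fh ch(1) cV] b1]) (use Omin in auto)
    show "real (card {(a, b). (a, b, x, y) \<in> Om}) \<le> N * (R / (k * n))" for x y
      by (rule order_trans[OF card_le_times[OF _ fh ch(1) cV] b1]) (use Omin in auto)
    show "real (card {(b, c). (y, b, c, x) \<in> Om}) \<le> N * (R / (k * n))" for x y
      by (rule order_trans[OF card_le_times[OF _ fh(2,1) cV ch(1)]]) (use Omin b1 in \<open>auto simp: mult.commute\<close>)
    show "real (card {(b, d). (x, b, y, d) \<in> Om}) \<le> N * (R / k\<^sup>2)" for x y
      by (rule order_trans[OF card_le_times[OF _ fh(2,2) cV cV] b2]) (use Omin in auto)
    show "real (card {(a, c). (a, x, c, y) \<in> Om}) \<le> N * (R / k\<^sup>2)" for x y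
      by (rule order_trans[OF card_le_times[OF _ fh(1,1) ch(1) ch(1)] b3]) (use Omin in auto)
    show "real (card {d. (x, y, z, d) \<in> Om}) \<le> N * (R / k ^ 3)" for x y z
      by (rule order_trans[OF c1 b4]) (use Omin in auto)
    show "real (card {c. (x, y, c, z) \<in> Om}) \<le> N * (R / k ^ 3)" for x y z
      by (rule order_trans[OF c2 b5]) (use Omin in auto)
    show "real (card {b. (x, b, y, z) \<in> Om}) \<le> N * (R / k ^ 3)" for x y z
      by (rule order_trans[OF c1 b4]) (use Omin in auto)
    show "real (card {a. (a, x, y, z) \<in> Om}) \<le> N * (R / k ^ 3)" for x y z
      by (rule order_trans[OF c2 b5]) (use Omin in auto)
    show "1 \<le> N * (R / k ^ 4)" by (rule b6)
  qed
qed

definition "fixed = low - free"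

definition "E_deg y = card {u. {u, y} \<in> E}"

text \<open>Few low vertices are excluded, because the degrees in \<open>E\<close> sum to
  \<open>2 * card E\<close>, which is of order \<open>k\<^sup>2\<close>; their mixed pairs are
  negligible.\<close>

definition "tame = {y\<in>low. real (E_deg y) \<le> rho ^ 5 / 10 ^ 5 * k}"

lemma finite_E_nb: "finite {u. {u, y} \<in> E}"
proof (rule finite_subset)
  show "{u. {u, y} \<in> E} \<subseteq> V" using E(1) doubleton_in_complete_edges[of _ y n] by auto
qed simp

lemma parts2: "fixed \<subseteq> low" "tame \<subseteq> low" "finite fixed" "finite tame" "fixed \<subseteq> V" "tame \<subseteq> V"
proof -
  show s: "fixed \<subseteq> low" "tame \<subseteq> low" unfolding fixed_def tame_def by auto
  then show "finite fixed" "finite tame" "fixed \<subseteq> V" "tame \<subseteq> V"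
    using parts(2,6) finite_subset by (blast, blast, blast, blast)
qed

text \<open>The cycles are \<open>u w y z\<close> with \<open>u \<in> hub\<close>, \<open>w, z \<in> fixed\<close> and \<open>y \<in> tame\<close>; a vertex of \<open>tame\<close>
  has few neighbours in \<open>E\<close>, so the diagonal \<open>u y\<close> is rarely an edge.\<close>

lemma spread_cross:
  assumes many: "rho * k * n \<le> (\<Sum>y\<in>tame. real (card (nb y \<inter> fixed)))" and R: "R \<ge> 10 ^ 20 / rho ^ 20"
  shows "spread_c4s R n k M E"
proof -
  define Ga where "Ga y = nb y \<inter> fixed" for y
  define Hy where "Hy y = {u\<in>hub. {u, y} \<notin> E}" for y
  define D where "D = 20 / rho * k"
  define h where "h = 200 / rho\<^sup>2 * k"
  have ch: "real (card hub) \<le> h" "0 < h" unfolding h_def using card_hub k0 rho by auto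
  have D0: "0 < D" unfolding D_def using rho k0 by simp
  have dlow: "real (card (nb v)) \<le> D" if "v \<in> low" for v unfolding D_def by (rule low_degree[OF that])
  have fG: "finite (Ga y)" for y unfolding Ga_def using finite_nb by simp
  have fH: "finite (Hy y)" "Hy y \<subseteq> hub" for y unfolding Hy_def using parts by auto
  define Ps where "Ps u y = {(w, z). w \<in> Ga y \<inter> nb u \<and> z \<in> Ga y \<inter> nb u \<and> w \<noteq> z \<and> {w, z} \<notin> E}" for u y
  have fPs: "finite (Ps u y)" for u y
    by (rule finite_subset[of _ "Ga y \<times> Ga y"]) (use fG in \<open>auto simp: Ps_def\<close>)
  define Om where "Om = {(u, w, y, z). y \<in> tame \<and> u \<in> Hy y \<and> (w, z) \<in> Ps u y}"
  have OmQ: "Om \<subseteq> c4_quads M E"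
  proof
    fix q assume "q \<in> Om"
    then obtain u w y z where q: "q = (u, w, y, z)" "y \<in> tame" "u \<in> Hy y" "(w, z) \<in> Ps u y" unfolding Om_def by auto
    have "u \<noteq> y" using q(2,3) parts2(2) unfolding Hy_def low_def by auto
    then show "q \<in> c4_quads M E" using q unfolding c4_quads_def Ps_def Ga_def Hy_def nb_def by (auto simp: insert_commute)
  qed
  define cc where "cc u y = real (card (Ga y \<inter> nb u))" for u y
  define g where "g y = real (card (Ga y))" for y
  define N where "N = rho ^ 4 / 160000 * k ^ 3 * n"
  have N0: "N > 0" unfolding N_def using rho k0 n0 by simp
  have r7: "rho ^ 7 = rho ^ 3 * rho ^ 4" and r8: "rho ^ 8 = rho ^ 4 * rho ^ 4" by (simp_all flip: power_add)
  \<comment> \<open>Cauchy-Schwarz twice: over the hubs \<open>u\<close> for fixed \<open>y\<close>,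
    then over \<open>y\<close>. A vertex in \<open>fixed\<close> has at least \<open>k / 10\<close>
    hub neighbours, and at most \<open>k / 20\<close> hubs are joined to \<open>y\<close> in
    \<open>E\<close>, which leaves \<open>k / 20\<close> usable hubs per vertex.\<close>
  have first: "(\<Sum>y\<in>tame. \<Sum>u\<in>Hy y. (cc u y)\<^sup>2) \<ge> 2 * N"
  proof -
    have pt: "(k * g y / 20)\<^sup>2 / h \<le> (\<Sum>u\<in>Hy y. (cc u y)\<^sup>2)" if y: "y \<in> tame" for y
    proof -
      have swap: "(\<Sum>u\<in>hub. card (Ga y \<inter> nb u)) = (\<Sum>w\<in>Ga y. card (hubs_of w))"
      proof -
        have "(\<Sum>u\<in>hub. card (Ga y \<inter> nb u)) = (\<Sum>u\<in>hub. card {w\<in>Ga y. w \<in> nb u})"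
          by (intro sum.cong refl arg_cong[where f = card]) auto
        also have "\<dots> = (\<Sum>w\<in>Ga y. card {u\<in>hub. w \<in> nb u})" by (rule sum_card_swap[OF parts(5) fG])
        also have "\<dots> = (\<Sum>w\<in>Ga y. card (hubs_of w))"
          by (intro sum.cong refl arg_cong[where f = card]) (auto simp: hubs_of_def nb_sym)
        finally show ?thesis .
      qed
      have "k / 10 * g y \<le> (\<Sum>w\<in>Ga y. real (card (hubs_of w)))"
      proof -
        have "(\<Sum>w\<in>Ga y. k / 10) \<le> (\<Sum>w\<in>Ga y. real (card (hubs_of w)))"
          by (intro sum_mono) (auto simp: Ga_def fixed_def free_def)
        then show ?thesis unfolding g_def by (simp add: mult.commute)
      qed
      also have "\<dots> = (\<Sum>u\<in>hub. cc u y)" unfolding cc_def using arg_cong[OF swap, of real] by simp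
      also have "\<dots> = (\<Sum>u\<in>Hy y. cc u y) + (\<Sum>u\<in>hub - Hy y. cc u y)"
        using parts(5) fH(2)[of y] by (metis sum.subset_diff add.commute)
      also have "(\<Sum>u\<in>hub - Hy y. cc u y) \<le> k / 20 * g y"
      proof -
        have "(\<Sum>u\<in>hub - Hy y. cc u y) \<le> (\<Sum>u\<in>hub - Hy y. g y)"
          unfolding cc_def g_def using fG by (intro sum_mono) (auto intro!: card_mono)
        also have "\<dots> = real (card (hub - Hy y)) * g y" by simp
        also have "\<dots> \<le> (k / 20) * g y"
        proof (rule mult_right_mono)
          have "card (hub - Hy y) \<le> E_deg y" unfolding E_deg_def
            by (rule card_mono[OF finite_E_nb]) (auto simp: Hy_def)
          moreover have "real (E_deg y) \<le> rho ^ 5 / 10 ^ 5 * k" using y unfolding tame_def by simp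
          moreover have "rho ^ 5 / 10 ^ 5 * k \<le> 1 / 20 * k"
          proof (rule mult_right_mono)
            have "rho ^ 5 \<le> 1" using rho by (simp add: power_le_one)
            then show "rho ^ 5 / 10 ^ 5 \<le> 1 / 20" by simp
          qed (use k0 in simp)
          ultimately show "real (card (hub - Hy y)) \<le> k / 20" by linarith
        qed (simp add: g_def)
        finally show ?thesis .
      qed
      finally have lo: "k * g y / 20 \<le> (\<Sum>u\<in>Hy y. cc u y)" by linarith
      have "0 \<le> k * g y / 20" using k0 unfolding g_def by simp
      then have "(k * g y / 20)\<^sup>2 \<le> (\<Sum>u\<in>Hy y. cc u y)\<^sup>2" using lo by (intro power_mono)
      also have "\<dots> \<le> real (card (Hy y)) * (\<Sum>u\<in>Hy y. (cc u y)\<^sup>2)" by (rule sum_squared_le_card_sum[OF fH(1)])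
      also have "\<dots> \<le> h * (\<Sum>u\<in>Hy y. (cc u y)\<^sup>2)"
        using card_mono[OF parts(5) fH(2)[of y]] ch by (intro mult_right_mono sum_nonneg) auto
      finally show ?thesis using ch(2) by (simp add: divide_le_eq mult.commute)
    qed
    have sg: "(rho * k * n)\<^sup>2 / n \<le> (\<Sum>y\<in>tame. (g y)\<^sup>2)"
    proof -
      have "0 \<le> rho * k * n" using rho k0 by simp
      then have "(rho * k * n)\<^sup>2 \<le> (\<Sum>y\<in>tame. g y)\<^sup>2" using many unfolding g_def Ga_def by (intro power_mono)
      also have "\<dots> \<le> real (card tame) * (\<Sum>y\<in>tame. (g y)\<^sup>2)" by (rule sum_squared_le_card_sum[OF parts2(4)])
      also have "\<dots> \<le> real n * (\<Sum>y\<in>tame. (g y)\<^sup>2)"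
        using card_mono[OF _ parts2(6)] by (intro mult_right_mono sum_nonneg) auto
      finally show ?thesis using n0 by (simp add: divide_le_eq mult.commute)
    qed
    have "2 * N = (k\<^sup>2 / (400 * h)) * ((rho * k * n)\<^sup>2 / n)"
      unfolding N_def h_def using k0 n0 rho
      by (simp add: power2_eq_square power3_eq_cube power4_eq_xxxx field_simps)
    also have "\<dots> \<le> (k\<^sup>2 / (400 * h)) * (\<Sum>y\<in>tame. (g y)\<^sup>2)" using sg ch by (intro mult_left_mono) auto
    also have "\<dots> = (\<Sum>y\<in>tame. (k * g y / 20)\<^sup>2 / h)"
      unfolding sum_distrib_left by (intro sum.cong refl) (simp add: power_mult_distrib power_divide mult_ac)
    also have "\<dots> \<le> (\<Sum>y\<in>tame. \<Sum>u\<in>Hy y. (cc u y)\<^sup>2)" by (intro sum_mono pt)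
    finally show ?thesis .
  qed
  \<comment> \<open>The count of pairs \<open>w, z\<close> overshoots by coinciding vertices,
    bounded here, and by pairs in \<open>E\<close>, bounded in \<open>third\<close>. Each costs at
    most \<open>N / 2\<close>, so \<open>N\<close> of the \<open>2 * N\<close> remain.\<close>
  have second: "(\<Sum>y\<in>tame. \<Sum>u\<in>Hy y. cc u y) \<le> N / 2"
  proof -
    have "(\<Sum>y\<in>tame. \<Sum>u\<in>Hy y. cc u y) \<le> (\<Sum>y\<in>tame. \<Sum>u\<in>Hy y. D)"
    proof (intro sum_mono)
      fix y u assume "y \<in> tame"
      have "card (Ga y \<inter> nb u) \<le> card (nb y)" unfolding Ga_def using finite_nb by (intro card_mono) auto
      then show "cc u y \<le> D" unfolding cc_def using dlow[of y] parts2(2) \<open>y \<in> tame\<close> by fastforce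
    qed
    also have "\<dots> = (\<Sum>y\<in>tame. real (card (Hy y)) * D)" by simp
    also have "\<dots> \<le> (\<Sum>y\<in>tame. h * D)"
      using card_mono[OF parts(5) fH(2)] ch D0 by (intro sum_mono mult_right_mono) (auto intro: order_trans[of _ "real (card hub)"])
    also have "\<dots> = real (card tame) * (h * D)" by simp
    also have "\<dots> \<le> n * (h * D)" using card_mono[OF _ parts2(6)] ch D0 by (intro mult_right_mono) auto
    also have "\<dots> = 4000 / rho ^ 3 * k\<^sup>2 * n" unfolding h_def D_def by (simp add: power2_eq_square power3_eq_cube)
    also have "\<dots> \<le> N / 2"
    proof -
      have b: "4000 * 320000 \<le> rho ^ 7 * k" by (rule bigk) auto
      have "4000 / rho ^ 3 * k\<^sup>2 * n = (4000 * 320000) * (k\<^sup>2 * n / (320000 * rho ^ 3))" by simp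
      also have "\<dots> \<le> (rho ^ 7 * k) * (k\<^sup>2 * n / (320000 * rho ^ 3))" using b rho by (intro mult_right_mono) auto
      also have "\<dots> = N / 2" unfolding N_def r7 using rho
        by (simp add: power2_eq_square power3_eq_cube field_simps)
      finally show ?thesis .
    qed
    finally show ?thesis .
  qed
  have third: "(\<Sum>y\<in>tame. \<Sum>u\<in>Hy y. real (card {(w, z). w \<in> Ga y \<inter> nb u \<and> z \<in> Ga y \<inter> nb u \<and> {w, z} \<in> E})) \<le> N / 2"
  proof -
    have "(\<Sum>y\<in>tame. \<Sum>u\<in>Hy y. real (card {(w, z). w \<in> Ga y \<inter> nb u \<and> z \<in> Ga y \<inter> nb u \<and> {w, z} \<in> E}))
       \<le> (\<Sum>y\<in>tame. \<Sum>u\<in>Hy y. real (card {(w, z). w \<in> Ga y \<and> z \<in> Ga y \<and> {w, z} \<in> E}))"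
    proof (intro sum_mono)
      fix y u
      have "card {(w, z). w \<in> Ga y \<inter> nb u \<and> z \<in> Ga y \<inter> nb u \<and> {w, z} \<in> E} \<le> card {(w, z). w \<in> Ga y \<and> z \<in> Ga y \<and> {w, z} \<in> E}"
        by (rule card_mono, rule finite_subset[of _ "Ga y \<times> Ga y"]) (use fG in auto)
      then show "real (card {(w, z). w \<in> Ga y \<inter> nb u \<and> z \<in> Ga y \<inter> nb u \<and> {w, z} \<in> E})
        \<le> real (card {(w, z). w \<in> Ga y \<and> z \<in> Ga y \<and> {w, z} \<in> E})" by linarith
    qed
    also have "\<dots> = (\<Sum>y\<in>tame. real (card (Hy y)) * real (card {(w, z). w \<in> Ga y \<and> z \<in> Ga y \<and> {w, z} \<in> E}))" by simp
    also have "\<dots> \<le> (\<Sum>y\<in>tame. h * real (card {(w, z). w \<in> Ga y \<and> z \<in> Ga y \<and> {w, z} \<in> E}))"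
      using card_mono[OF parts(5) fH(2)] ch by (intro sum_mono mult_right_mono) (auto intro: order_trans[of _ "real (card hub)"])
    also have "\<dots> = h * (\<Sum>y\<in>tame. real (card {(w, z). w \<in> Ga y \<and> z \<in> Ga y \<and> {w, z} \<in> E}))"
      by (simp add: sum_distrib_left)
    also have "\<dots> \<le> h * (2 * real (card E) * D)"
    proof (intro mult_left_mono codegree_sum_le parts2)
      show "real (card {x \<in> tame. y \<in> Ga x}) \<le> D" for y
        by (rule codegree_nb[where S = fixed]) (use parts2 dlow D0 in \<open>auto simp: Ga_def\<close>)
    qed (use ch in simp)
    also have "\<dots> \<le> h * (2 * k\<^sup>2 * D)" using E_le ch D0 by (intro mult_left_mono mult_right_mono) auto
    also have "\<dots> = 8000 / rho ^ 3 * k ^ 3 * k" unfolding h_def D_def by (simp add: power2_eq_square power3_eq_cube)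
    also have "\<dots> \<le> N / 2"
    proof -
      have b: "(8000 * 320000) * k \<le> rho ^ 7 * n" by (rule bign) auto
      have "8000 / rho ^ 3 * k ^ 3 * k = ((8000 * 320000) * k) * (k ^ 3 / (320000 * rho ^ 3))" by simp
      also have "\<dots> \<le> (rho ^ 7 * n) * (k ^ 3 / (320000 * rho ^ 3))" using b rho k0 by (intro mult_right_mono) auto
      also have "\<dots> = N / 2" unfolding N_def r7 using rho by (simp add: field_simps)
      finally show ?thesis .
    qed
    finally show ?thesis .
  qed
  have NOm: "N \<le> real (card Om)"
  proof -
    have inj: "inj_on (\<lambda>(y, u, (w, z)). (u, w, y, z)) (Sigma tame (\<lambda>y. Sigma (Hy y) (\<lambda>u. Ps u y)))"
      by (auto simp: inj_on_def)
    have img: "(\<lambda>(y, u, (w, z)). (u, w, y, z)) ` (Sigma tame (\<lambda>y. Sigma (Hy y) (\<lambda>u. Ps u y))) = Om"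
    proof
      show "(\<lambda>(y, u, (w, z)). (u, w, y, z)) ` (Sigma tame (\<lambda>y. Sigma (Hy y) (\<lambda>u. Ps u y))) \<subseteq> Om"
        unfolding Om_def by auto
      show "Om \<subseteq> (\<lambda>(y, u, (w, z)). (u, w, y, z)) ` (Sigma tame (\<lambda>y. Sigma (Hy y) (\<lambda>u. Ps u y)))"
      proof
        fix q assume "q \<in> Om"
        then obtain u w y z where q: "q = (u, w, y, z)" "y \<in> tame" "u \<in> Hy y" "(w, z) \<in> Ps u y"
          unfolding Om_def by auto
        then show "q \<in> (\<lambda>(y, u, (w, z)). (u, w, y, z)) ` (Sigma tame (\<lambda>y. Sigma (Hy y) (\<lambda>u. Ps u y)))"
          by (intro image_eqI[of _ _ "(y, u, (w, z))"]) auto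
      qed
    qed
    have "card Om = card (Sigma tame (\<lambda>y. Sigma (Hy y) (\<lambda>u. Ps u y)))"
      unfolding img[symmetric] by (rule card_image[OF inj])
    also have "\<dots> = (\<Sum>y\<in>tame. \<Sum>u\<in>Hy y. card (Ps u y))"
      using parts2(4) fH(1) fPs by (subst card_SigmaI) (auto intro!: sum.cong simp: card_SigmaI)
    finally have cO: "real (card Om) = (\<Sum>y\<in>tame. \<Sum>u\<in>Hy y. real (card (Ps u y)))" by simp
    have pt: "(cc u y)\<^sup>2 - cc u y - real (card {(w, z). w \<in> Ga y \<inter> nb u \<and> z \<in> Ga y \<inter> nb u \<and> {w, z} \<in> E}) \<le> real (card (Ps u y))" for u y
      using card_non_E_pairs[of "Ga y \<inter> nb u"] fG[of y] unfolding cc_def Ps_def by auto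
    have "(\<Sum>y\<in>tame. \<Sum>u\<in>Hy y. (cc u y)\<^sup>2 - cc u y - real (card {(w, z). w \<in> Ga y \<inter> nb u \<and> z \<in> Ga y \<inter> nb u \<and> {w, z} \<in> E})) \<le> real (card Om)"
      unfolding cO by (intro sum_mono pt)
    then show ?thesis using first second third by (simp only: sum_subtractf)
  qed
  define R1 where "R1 = 10 ^ 10 / rho ^ 8"
  have RR: "R1 \<le> R"
  proof -
    have "rho ^ 20 \<le> rho ^ 8" using rho by (intro power_decreasing) auto
    then have "R1 \<le> 10 ^ 20 / rho ^ 20" unfolding R1_def using rho by (intro frac_le) auto
    then show ?thesis using R by linarith
  qed
  have up: "x \<le> N * (R / z)" if "x * z \<le> N * R1" "z > 0" for x z
  proof -
    have "x \<le> N * R1 / z" using that by (simp add: field_simps)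
    also have "\<dots> \<le> N * R / z" using RR N0 that by (intro divide_right_mono mult_left_mono) auto
    finally show ?thesis by simp
  qed
  have NR: "N * R1 = 62500 * (k ^ 3 * n) / rho ^ 4"
    unfolding N_def R1_def r8 using rho by (simp add: field_simps)
  have kn': "k \<le> n" by (rule k_le_n)
  have le: "c * X / rho ^ j \<le> N * R1" if "c \<le> 62500" "0 \<le> c" "X \<le> k ^ 3 * n" "0 \<le> X" "j \<le> 4" for c X j
    unfolding NR using that rho k0 by (intro frac_le mult_mono power_decreasing) auto
  have kkk: "k ^ 3 = k * k * k" by (simp add: power3_eq_cube)
  have e1: "D * D \<le> N * (R / (k * n))"
  proof (rule up)
    have "D * D * (k * n) = 400 * (k ^ 3 * n) / rho ^ 2" unfolding D_def kkk by (simp add: power2_eq_square)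
    also have "\<dots> \<le> N * R1" by (rule le) (use k0 in auto)
    finally show "D * D * (k * n) \<le> N * R1" .
  qed (use k0 n0 in simp)
  have e2: "h * D \<le> N * (R / (k * n))"
  proof (rule up)
    have "h * D * (k * n) = 4000 * (k ^ 3 * n) / rho ^ 3" unfolding D_def h_def kkk by (simp add: power2_eq_square power3_eq_cube)
    also have "\<dots> \<le> N * R1" by (rule le) (use k0 in auto)
    finally show "h * D * (k * n) \<le> N * R1" .
  qed (use k0 n0 in simp)
  have k4: "k ^ 3 * k \<le> k ^ 3 * n" using kn' k0 by (intro mult_left_mono) auto
  have z1: "D * D \<le> N * (R / k\<^sup>2)"
  proof (rule up)
    have "D * D * k\<^sup>2 = 400 * (k ^ 3 * k) / rho ^ 2" unfolding D_def kkk by (simp add: power2_eq_square)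
    also have "\<dots> \<le> N * R1" by (rule le) (use k0 k4 in auto)
    finally show "D * D * k\<^sup>2 \<le> N * R1" .
  qed (use k0 in simp)
  have z2: "h * D \<le> N * (R / k\<^sup>2)"
  proof (rule up)
    have "h * D * k\<^sup>2 = 4000 * (k ^ 3 * k) / rho ^ 3" unfolding D_def h_def kkk by (simp add: power2_eq_square power3_eq_cube)
    also have "\<dots> \<le> N * R1" by (rule le) (use k0 k4 in auto)
    finally show "h * D * k\<^sup>2 \<le> N * R1" .
  qed (use k0 in simp)
  have t1: "D \<le> N * (R / k ^ 3)"
  proof (rule up)
    have "D * k ^ 3 = 20 * (k ^ 3 * k) / rho ^ 1" unfolding D_def by simp
    also have "\<dots> \<le> N * R1" by (rule le) (use k0 k4 in auto)
    finally show "D * k ^ 3 \<le> N * R1" .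
  qed (use k0 in simp)
  have t2: "h \<le> N * (R / k ^ 3)"
  proof (rule up)
    have "h * k ^ 3 = 200 * (k ^ 3 * k) / rho ^ 2" unfolding h_def by simp
    also have "\<dots> \<le> N * R1" by (rule le) (use k0 k4 in auto)
    finally show "h * k ^ 3 \<le> N * R1" .
  qed (use k0 in simp)
  have f1: "1 \<le> N * (R / k ^ 4)"
  proof (rule up)
    have "1 * k ^ 4 = 1 * (k ^ 3 * k) / rho ^ 0" unfolding kkk by (simp add: power4_eq_xxxx)
    also have "\<dots> \<le> N * R1" by (rule le) (use k0 k4 in auto)
    finally show "1 * k ^ 4 \<le> N * R1" .
  qed (use k0 in simp)
  \<comment> \<open>Neighbourhoods made empty outside \<open>low\<close>, so that each has at most
    \<open>D\<close> elements and the counts of extensions hold for arbitrary fixed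
    vertices.\<close>
  define nbl where "nbl v = (if v \<in> low then nb v else {})" for v
  have nbl: "finite (nbl v)" "real (card (nbl v)) \<le> D" for v
    unfolding nbl_def using finite_nb dlow[of v] D0 by auto
  have mem: "a \<in> hub \<and> b \<in> nbl c \<and> d \<in> nbl c \<and> c \<in> nbl b \<and> c \<in> nbl d" if "(a, b, c, d) \<in> Om" for a b c d
  proof -
    have "a \<in> hub" "b \<in> nb c" "d \<in> nb c" "c \<in> low" "b \<in> low" "d \<in> low"
      using that parts2(1,2) unfolding Om_def Hy_def Ps_def Ga_def by auto
    then show ?thesis unfolding nbl_def using nb_sym by auto
  qed
  have fh: "finite hub" using parts by simp
  have c1: "real (card S) \<le> D" if "S \<subseteq> nbl v" for S v
    using card_mono[OF nbl(1) that] nbl(2)[of v] by linarith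
  have c2: "real (card S) \<le> h" if "S \<subseteq> hub" for S using card_mono[OF fh that] ch by linarith
  have s1: "real (card S) \<le> D * D" if "S \<subseteq> Sigma (nbl v) nbl" for S v
    using card_Sigma_le[OF that nbl(1) nbl(1) nbl(2) nbl(2)] D0 by simp
  have s2: "real (card S) \<le> D * D" if "prod.swap ` S \<subseteq> Sigma (nbl v) nbl" for S v
  proof -
    have "inj_on prod.swap S" by (intro inj_onI) (metis swap_swap)
    from card_image[OF this] show ?thesis using s1[OF that] by simp
  qed
  show ?thesis
  proof (rule uniform_spread[OF OmQ M N0 NOm])
    show "real (card {(c, d). (x, y, c, d) \<in> Om}) \<le> N * (R / (k * n))" for x y
      by (rule order_trans[OF s1[of _ y] e1]) (use mem in auto)
    show "real (card {(a, d). (a, x, y, d) \<in> Om}) \<le> N * (R / (k * n))" for x y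
      by (rule order_trans[OF card_le_times[OF _ fh nbl(1)[of y] ch(1) nbl(2)] e2]) (use mem in auto)
    show "real (card {(a, b). (a, b, x, y) \<in> Om}) \<le> N * (R / (k * n))" for x y
      by (rule order_trans[OF card_le_times[OF _ fh nbl(1)[of x] ch(1) nbl(2)] e2]) (use mem in auto)
    show "real (card {(b, c). (y, b, c, x) \<in> Om}) \<le> N * (R / (k * n))" for x y
      by (rule order_trans[OF s2[of _ x] e1]) (use mem in auto)
    show "real (card {(b, d). (x, b, y, d) \<in> Om}) \<le> N * (R / k\<^sup>2)" for x y
      by (rule order_trans[OF card_le_times[OF _ nbl(1)[of y] nbl(1)[of y] nbl(2) nbl(2)] z1]) (use mem in auto)
    show "real (card {(a, c). (a, x, c, y) \<in> Om}) \<le> N * (R / k\<^sup>2)" for x y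
      by (rule order_trans[OF card_le_times[OF _ fh nbl(1)[of x] ch(1) nbl(2)] z2]) (use mem in auto)
    show "real (card {d. (x, y, z, d) \<in> Om}) \<le> N * (R / k ^ 3)" for x y z
      by (rule order_trans[OF c1[of _ z] t1]) (use mem in auto)
    show "real (card {c. (x, y, c, z) \<in> Om}) \<le> N * (R / k ^ 3)" for x y z
      by (rule order_trans[OF c1[of _ y] t1]) (use mem in auto)
    show "real (card {b. (x, b, y, z) \<in> Om}) \<le> N * (R / k ^ 3)" for x y z
      by (rule order_trans[OF c1[of _ y] t1]) (use mem in auto)
    show "real (card {a. (a, x, y, z) \<in> Om}) \<le> N * (R / k ^ 3)" for x y z
      by (rule order_trans[OF c2 t2]) (use mem in auto)
    show "1 \<le> N * (R / k ^ 4)" by (rule f1)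
  qed
qed

section \<open>From absent weightings to an almost split partition\<close>

definition "E_pairs A = {(u, u'). u \<in> A \<and> u' \<in> A \<and> {u, u'} \<in> E}"

lemma finite_E_pairs: "finite A \<Longrightarrow> finite (E_pairs A)"
  by (rule finite_subset[of _ "A \<times> A"]) (auto simp: E_pairs_def)

lemma finite_hubs_of: "finite (hubs_of w)"
  unfolding hubs_of_def using finite_nb by simp

lemma card_E_pairs_le: "real (card (E_pairs A)) \<le> (1 + rho) * k\<^sup>2"
  using ordered_E_le[of A] E2 unfolding E_pairs_def by linarith

text \<open>The neighbourhoods of the vertices in \<open>V - free\<close> inside the hub are nearly cliques of \<open>E\<close>, because
  few pairs of hub vertices outside \<open>E\<close> have many common neighbours.\<close>

lemma hub_cliques:
  assumes few: "real (card split_pairs) < rho ^ 5 / 10 ^ 5 * k\<^sup>2"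
  shows "(\<Sum>w\<in>V - free. (real (card (hubs_of w)))\<^sup>2)
    \<le> (\<Sum>w\<in>V - free. real (card (E_pairs (hubs_of w)))) + (\<Sum>w\<in>V - free. real (card (hubs_of w))) + rho * k\<^sup>2 * n"
proof -
  define et where "et = rho ^ 5 / 10 ^ 5"
  have et0: "0 < et" unfolding et_def using rho by simp
  define NP where "NP = {(u, u'). u \<in> hub \<and> u' \<in> hub \<and> u \<noteq> u' \<and> {u, u'} \<notin> E}"
  have fNP: "finite NP" "NP \<subseteq> hub \<times> hub"
    by (rule finite_subset[of _ "hub \<times> hub"]) (use parts in \<open>auto simp: NP_def\<close>)
  have spNP: "split_pairs \<subseteq> NP" unfolding split_pairs_def NP_def by auto
  have fVf: "finite (V - free)" by simp
  have np_w: "{(x, z). x \<in> hubs_of w \<and> z \<in> hubs_of w \<and> x \<noteq> z \<and> {x, z} \<notin> E}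
      = {uu\<in>NP. fst uu \<in> nb w \<and> snd uu \<in> nb w}" for w
    unfolding NP_def hubs_of_def by auto
  have "(\<Sum>w\<in>V - free. real (card {(x, z). x \<in> hubs_of w \<and> z \<in> hubs_of w \<and> x \<noteq> z \<and> {x, z} \<notin> E})) \<le> rho * k\<^sup>2 * n"
  proof -
    have "(\<Sum>w\<in>V - free. card {uu\<in>NP. fst uu \<in> nb w \<and> snd uu \<in> nb w})
        = (\<Sum>uu\<in>NP. card {w\<in>V - free. fst uu \<in> nb w \<and> snd uu \<in> nb w})" by (rule sum_card_swap[OF fVf fNP(1)])
    then have "(\<Sum>w\<in>V - free. real (card {(x, z). x \<in> hubs_of w \<and> z \<in> hubs_of w \<and> x \<noteq> z \<and> {x, z} \<notin> E}))
        = (\<Sum>uu\<in>NP. real (card {w\<in>V - free. fst uu \<in> nb w \<and> snd uu \<in> nb w}))"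
      unfolding np_w of_nat_sum[symmetric] by (rule arg_cong)
    \<comment> \<open>A split pair is charged all \<open>n\<close> vertices, but such pairs are few;
      the other pairs of hubs have fewer than \<open>et * n\<close> common neighbours each.\<close>
    also have "\<dots> \<le> (\<Sum>uu\<in>NP. if uu \<in> split_pairs then real n else et * n)"
    proof (rule sum_mono)
      fix uu assume uu: "uu \<in> NP"
      obtain u u' where uu': "uu = (u, u')" by (cases uu) auto
      have sub: "{w\<in>V - free. fst uu \<in> nb w \<and> snd uu \<in> nb w} \<subseteq> nb u \<inter> nb u'"
        unfolding uu' using nb_sym by auto
      have c: "card {w\<in>V - free. fst uu \<in> nb w \<and> snd uu \<in> nb w} \<le> card (nb u \<inter> nb u')"
        using finite_nb by (intro card_mono[OF _ sub]) auto
      show "real (card {w\<in>V - free. fst uu \<in> nb w \<and> snd uu \<in> nb w}) \<le> (if uu \<in> split_pairs then real n else et * n)"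
      proof (cases "uu \<in> split_pairs")
        case True
        have "card (nb u \<inter> nb u') \<le> card (nb u)" using finite_nb by (intro card_mono) auto
        then show ?thesis using True c card_nb_le[of u] by simp
      next
        case False
        then have "real (card (nb u \<inter> nb u')) < et * n"
          using uu unfolding uu' NP_def split_pairs_def et_def by auto
        then show ?thesis using False c by simp
      qed
    qed
    also have "\<dots> = real (card split_pairs) * n + real (card (NP - split_pairs)) * (et * n)"
    proof -
      have "{uu\<in>NP. uu \<in> split_pairs} = split_pairs" "{uu\<in>NP. uu \<notin> split_pairs} = NP - split_pairs" using spNP by auto
      then show ?thesis using fNP(1) by (simp add: sum.If_cases Int_def Collect_conj_eq[symmetric])
    qed
    also have "\<dots> \<le> (et * k\<^sup>2) * n + (4 * 10 ^ 4 / rho ^ 4 * k\<^sup>2) * (et * n)"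
    proof (intro add_mono mult_right_mono)
      show "real (card split_pairs) \<le> et * k\<^sup>2" using few unfolding et_def by simp
      have "real (card NP) \<le> (200 / rho\<^sup>2 * k) * (200 / rho\<^sup>2 * k)"
        by (rule card_le_times[OF fNP(2) parts(5,5) card_hub card_hub])
      also have "\<dots> = 4 * 10 ^ 4 / rho ^ 4 * k\<^sup>2" by (simp add: power2_eq_square power4_eq_xxxx)
      finally show "real (card (NP - split_pairs)) \<le> 4 * 10 ^ 4 / rho ^ 4 * k\<^sup>2"
        using card_mono[OF fNP(1), of "NP - split_pairs"] by auto
    qed (use et0 in auto)
    also have "\<dots> = (et + 4 * 10 ^ 4 / rho ^ 4 * et) * (k\<^sup>2 * n)" by (simp add: algebra_simps)
    also have "\<dots> \<le> rho * (k\<^sup>2 * n)"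
    proof (rule mult_right_mono)
      have r5: "rho ^ 5 = rho * rho ^ 4" by (simp flip: power_Suc)
      have "4 * 10 ^ 4 / rho ^ 4 * et = 2 / 5 * rho" unfolding et_def r5 using rho by simp
      moreover have "et \<le> 1 / 10 * rho"
      proof -
        have "rho ^ 5 \<le> rho ^ 1" using rho by (intro power_decreasing) auto
        then have "rho ^ 5 \<le> 10000 * rho" using rho by simp
        then show ?thesis unfolding et_def by simp
      qed
      ultimately show "et + 4 * 10 ^ 4 / rho ^ 4 * et \<le> rho" using rho by linarith
    qed simp
    finally show ?thesis by (simp only: mult.assoc)
  qed
  moreover have "(real (card (hubs_of w)))\<^sup>2 \<le> real (card (E_pairs (hubs_of w))) + real (card (hubs_of w))
      + real (card {(x, z). x \<in> hubs_of w \<and> z \<in> hubs_of w \<and> x \<noteq> z \<and> {x, z} \<notin> E})" for w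
    using card_non_E_pairs[OF finite_hubs_of[of w]] unfolding E_pairs_def by linarith
  then have "(\<Sum>w\<in>V - free. (real (card (hubs_of w)))\<^sup>2) \<le> (\<Sum>w\<in>V - free. real (card (E_pairs (hubs_of w))) + real (card (hubs_of w))
      + real (card {(x, z). x \<in> hubs_of w \<and> z \<in> hubs_of w \<and> x \<noteq> z \<and> {x, z} \<notin> E}))" by (intro sum_mono)
  ultimately show ?thesis by (simp only: sum.distrib)
qed

lemma card_pair_sets_le: "finite Z \<Longrightarrow> card (pair_sets Z) \<le> card Z"
  unfolding pair_sets_def by (rule card_image_le)

text \<open>A mixed pair meets a hub (\<open>Z1\<close>), or has an end in \<open>mid\<close>
  (\<open>Z2\<close>), or lies inside \<open>free\<close> (\<open>M5\<close>), or joins a vertex of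
  \<open>fixed\<close> to a low vertex that is tame (\<open>Z3\<close>) or not (\<open>Z4\<close>).
  The assumed bounds control \<open>Z2\<close>, \<open>Z3\<close> and \<open>M5\<close>, and
  \<open>Z4\<close> is small since few vertices are not tame. The error \<open>4 * rho\<close> is
  one \<open>rho\<close> for each of \<open>Z2\<close>, \<open>Z3\<close>, \<open>Z4\<close> and
  half of \<open>2 * rho\<close> for \<open>M5\<close>.\<close>

lemma edge_count:
  assumes F1: "(\<Sum>x\<in>V - hub. real (card (nb x \<inter> mid))) < rho * k * n"
    and F3: "(\<Sum>y\<in>tame. real (card (nb y \<inter> fixed))) < rho * k * n"
    and F4: "(\<Sum>x\<in>free. real (card (nb x \<inter> free))) < 14 / 10 * k * real (card free) + 2 * rho * k * n"
  shows "k * n \<le> (\<Sum>w\<in>V. real (card (hubs_of w))) + 4 * rho * k * n + 7 / 10 * k * real (card free)"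
proof -
  define Z1 where "Z1 = Sigma V hubs_of"
  define Z2 where "Z2 = Sigma (V - hub) (\<lambda>x. nb x \<inter> mid)"
  define Z3 where "Z3 = Sigma tame (\<lambda>y. nb y \<inter> fixed)"
  define Z4 where "Z4 = Sigma (low - tame) nb"
  define M5 where "M5 = {e\<in>M. e \<subseteq> free}"
  have fZ: "finite Z1" "finite Z2" "finite Z3" "finite Z4"
    unfolding Z1_def Z2_def Z3_def Z4_def using finite_nb finite_hubs_of parts parts2 by auto
  have cZ1: "real (card Z1) = (\<Sum>w\<in>V. real (card (hubs_of w)))"
    unfolding Z1_def using finite_hubs_of by (simp add: card_SigmaI)
  have cZ2: "real (card Z2) = (\<Sum>x\<in>V - hub. real (card (nb x \<inter> mid)))"
    unfolding Z2_def using finite_nb by (simp add: card_SigmaI)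
  have cZ3: "real (card Z3) = (\<Sum>y\<in>tame. real (card (nb y \<inter> fixed)))"
    unfolding Z3_def using finite_nb parts2 by (simp add: card_SigmaI)
  have cZ4: "real (card Z4) \<le> rho * k * n"
  proof -
    have "real (card (low - tame)) * (rho ^ 5 / 10 ^ 5 * k) \<le> 2 * k\<^sup>2"
    proof -
      have "real (card (low - tame)) * (rho ^ 5 / 10 ^ 5 * k) = (\<Sum>y\<in>low - tame. rho ^ 5 / 10 ^ 5 * k)" by simp
      also have "\<dots> \<le> (\<Sum>y\<in>low - tame. real (E_deg y))" by (intro sum_mono) (auto simp: tame_def)
      also have "\<dots> \<le> (\<Sum>y\<in>V. real (E_deg y))" using parts by (intro sum_mono2) auto
      also have "(\<Sum>y\<in>V. real (E_deg y)) = real (card (Sigma V (\<lambda>y. {u. {u, y} \<in> E})))"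
        unfolding E_deg_def using finite_E_nb by (simp add: card_SigmaI)
      also have "\<dots> \<le> 2 * real (card E)"
      proof -
        have "Sigma V (\<lambda>y. {u. {u, y} \<in> E}) \<subseteq> ordered_pairs E"
          unfolding ordered_pairs_def by (auto simp: insert_commute)
        from card_mono[OF finite_ordered_pairs[OF E(1)] this] show ?thesis
          unfolding card_ordered_pairs[OF E(1)] by linarith
      qed
      finally show ?thesis using E_le by linarith
    qed
    then have "k * (real (card (low - tame)) * rho ^ 5) \<le> k * (2 * 10 ^ 5 * k)" by (simp add: power2_eq_square mult_ac)
    then have lt: "real (card (low - tame)) * rho ^ 5 \<le> 2 * 10 ^ 5 * k" using k0 by (rule mult_left_le_imp_le)
    have "real (card Z4) \<le> real (card (low - tame)) * (20 / rho * k)"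
      unfolding Z4_def by (rule card_Sigma_le[OF order_refl]) (use parts finite_nb low_degree rho k0 in auto)
    moreover have "real (card (low - tame)) * (20 / rho * k) \<le> rho * k * n"
    proof -
      have b: "(4 * 10 ^ 6) * k \<le> rho ^ 7 * n" by (rule bign) auto
      have r7: "rho ^ 7 = rho ^ 5 * rho * rho" by (simp flip: power_Suc2)
      have "real (card (low - tame)) * (20 / rho * k) * (rho ^ 5 * rho) = (real (card (low - tame)) * rho ^ 5) * (20 * k)"
        using rho by simp
      also have "\<dots> \<le> (2 * 10 ^ 5 * k) * (20 * k)" using lt k0 by (intro mult_right_mono) auto
      also have "\<dots> = ((4 * 10 ^ 6) * k) * k" by simp
      also have "\<dots> \<le> (rho ^ 7 * n) * k" using b k0 by (intro mult_right_mono) auto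
      also have "\<dots> = (rho * k * n) * (rho ^ 5 * rho)" unfolding r7 by simp
      finally show ?thesis by (rule mult_right_le_imp_le) (use rho in simp)
    qed
    ultimately show ?thesis by linarith
  qed
  have fM5: "finite M5" "M5 \<subseteq> complete_edges n" unfolding M5_def using finM M by auto
  have cM5: "2 * real (card M5) \<le> (\<Sum>x\<in>free. real (card (nb x \<inter> free)))"
  proof -
    have "ordered_pairs M5 = Sigma free (\<lambda>x. nb x \<inter> free)"
      unfolding ordered_pairs_def M5_def nb_def by auto
    then have "2 * card M5 = (\<Sum>x\<in>free. card (nb x \<inter> free))"
      using card_ordered_pairs[OF fM5(2)] finite_nb parts by (simp add: card_SigmaI)
    then have "real (2 * card M5) = (\<Sum>x\<in>free. real (card (nb x \<inter> free)))" by simp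
    then show ?thesis by simp
  qed
  have cover: "M \<subseteq> pair_sets (Z1 \<union> (Z2 \<union> (Z3 \<union> Z4))) \<union> M5"
  proof
    fix e assume e: "e \<in> M"
    then have "card e = 2" using M unfolding complete_edges_def by auto
    then obtain p q where pq: "e = {p, q}" unfolding card_2_iff by blast
    have mem: "p \<in> V" "q \<in> V" "q \<in> nb p" "p \<in> nb q"
      using e M doubleton_in_complete_edges[of p q n] unfolding pq nb_def by (auto simp: insert_commute)
    have ps: "{p, q} \<in> pair_sets Z" if "(p, q) \<in> Z \<or> (q, p) \<in> Z" for Z
      using that unfolding pair_sets_def by (auto simp: insert_commute intro: rev_image_eqI)
    have key: "e \<in> M5 \<or> (p, q) \<in> Z1 \<union> (Z2 \<union> (Z3 \<union> Z4)) \<or> (q, p) \<in> Z1 \<union> (Z2 \<union> (Z3 \<union> Z4))"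
    proof (cases "p \<in> hub \<or> q \<in> hub")
      case True
      then show ?thesis using mem unfolding Z1_def hubs_of_def by auto
    next
      case nh: False
      show ?thesis
      proof (cases "p \<in> mid \<or> q \<in> mid")
        case True
        then show ?thesis using mem nh unfolding Z2_def by auto
      next
        case False
        then have l: "p \<in> low" "q \<in> low" using nh mem unfolding mid_def by auto
        show ?thesis
        proof (cases "p \<in> free \<and> q \<in> free")
          case True
          then show ?thesis using e unfolding M5_def pq by auto
        next
          case False
          then have "p \<in> fixed \<or> q \<in> fixed" using l unfolding fixed_def by auto
          then show ?thesis using l mem unfolding Z3_def Z4_def by auto
        qed
      qed
    qed
    then show "e \<in> pair_sets (Z1 \<union> (Z2 \<union> (Z3 \<union> Z4))) \<union> M5"
    proof
      assume "e \<in> M5"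
      then show ?thesis by (rule UnI2)
    next
      assume "(p, q) \<in> Z1 \<union> (Z2 \<union> (Z3 \<union> Z4)) \<or> (q, p) \<in> Z1 \<union> (Z2 \<union> (Z3 \<union> Z4))"
      then show ?thesis unfolding pq by (intro UnI1 ps)
    qed
  qed
  have "card M \<le> card (pair_sets (Z1 \<union> (Z2 \<union> (Z3 \<union> Z4))) \<union> M5)"
    using fZ fM5 by (intro card_mono[OF _ cover]) (auto simp: pair_sets_def)
  also have "\<dots> \<le> card (pair_sets (Z1 \<union> (Z2 \<union> (Z3 \<union> Z4)))) + card M5" by (rule card_Un_le)
  also have "\<dots> \<le> card (Z1 \<union> (Z2 \<union> (Z3 \<union> Z4))) + card M5" using fZ by (intro add_right_mono card_pair_sets_le) auto
  also have "\<dots> \<le> card Z1 + (card Z2 + (card Z3 + card Z4)) + card M5"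
    by (intro add_mono order_trans[OF card_Un_le] order_refl)
  finally have "real (card M) \<le> real (card Z1) + (real (card Z2) + (real (card Z3) + real (card Z4))) + real (card M5)"
    by linarith
  then show ?thesis using kn cZ1 cZ2 cZ3 cZ4 cM5 F1 F3 F4 by linarith
qed

text \<open>Mixed pairs outside \<open>U\<close> and mixed pairs with exactly one end in
  \<open>U0\<close> are disjoint parts of \<open>M\<close>. Pairs inside \<open>U0\<close> are seen
  from both ends and are paid for by the square.\<close>

lemma few_touching_edges:
  assumes U0: "U0 \<subseteq> hub" and U: "U0 \<subseteq> U" and X: "X \<subseteq> V"
  shows "real (card (edges_within M (V - U))) + (\<Sum>w\<in>X. real (card (hubs_of w \<inter> U0))) \<le> k * n + (real (card U0))\<^sup>2"
proof -
  define Z where "Z = Sigma (X - U0) (\<lambda>w. hubs_of w \<inter> U0)"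
  have fX: "finite X" "finite U0" using X U0 parts finite_subset by (blast, blast)
  have "(\<Sum>w\<in>X. real (card (hubs_of w \<inter> U0)))
      = (\<Sum>w\<in>X - U0. real (card (hubs_of w \<inter> U0))) + (\<Sum>w\<in>X \<inter> U0. real (card (hubs_of w \<inter> U0)))"
    using sum.Int_Diff[OF fX(1), of "\<lambda>w. real (card (hubs_of w \<inter> U0))" U0] by linarith
  moreover have "(\<Sum>w\<in>X \<inter> U0. real (card (hubs_of w \<inter> U0))) \<le> (\<Sum>w\<in>X \<inter> U0. real (card U0))"
    using fX by (intro sum_mono) (auto intro: card_mono)
  moreover have "(\<Sum>w\<in>X \<inter> U0. real (card U0)) \<le> (real (card U0))\<^sup>2"
    using card_mono[OF fX(2), of "X \<inter> U0"] by (auto simp: power2_eq_square intro!: mult_right_mono)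
  moreover have "(\<Sum>w\<in>X - U0. real (card (hubs_of w \<inter> U0))) = real (card Z)"
    unfolding Z_def using fX finite_hubs_of by (simp add: card_SigmaI)
  moreover have "real (card (edges_within M (V - U))) + real (card Z) \<le> k * n"
  proof -
    have inj: "inj_on (\<lambda>(x, y). {x, y}) Z"
      unfolding Z_def by (rule inj_onI) (auto simp: doubleton_eq_iff)
    have cZ: "card (pair_sets Z) = card Z" unfolding pair_sets_def by (rule card_image[OF inj])
    have sub: "pair_sets Z \<subseteq> M" unfolding pair_sets_def Z_def hubs_of_def nb_def by auto
    have disj: "edges_within M (V - U) \<inter> pair_sets Z = {}"
      unfolding edges_within_def pair_sets_def Z_def using U by auto
    have sub2: "edges_within M (V - U) \<subseteq> M" unfolding edges_within_def by auto
    have "card (edges_within M (V - U)) + card (pair_sets Z) = card (edges_within M (V - U) \<union> pair_sets Z)"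
      using disj sub sub2 finM(1) by (intro card_Un_disjoint[symmetric]) (auto intro: finite_subset)
    also have "\<dots> \<le> card M" using sub sub2 finM(1) by (intro card_mono) auto
    finally show ?thesis unfolding cZ using kn by linarith
  qed
  ultimately show ?thesis by linarith
qed

text \<open>Let \<open>t w\<close> count the hub neighbours of \<open>w\<close> and
  \<open>e w\<close> the ordered pairs from \<open>E\<close> among them. Then \<open>t\<close> sums
  to about \<open>k * n\<close>, while on average \<open>(t w)\<^sup>2\<close> hardly exceeds
  \<open>e w\<close>, which is at most \<open>(1 + rho) * k\<^sup>2\<close>. Hence most
  \<open>t w\<close> are close to \<open>k\<close> and most hub neighbourhoods capture nearly all of
  \<open>E\<close>, so they nearly coincide. One of them, slightly enlarged, is the clique side, and
  almost all mixed pairs meet it.\<close>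

theorem almost_split_if_not_spread:
  assumes ns: "\<not> spread_c4s (10 ^ 20 / rho ^ 20) n k M E"
    and eps: "100 * sqrt rho \<le> \<epsilon>" "\<epsilon> \<le> 1"
  shows "almost_split n \<epsilon> (M, E)"
proof -
  \<comment> \<open>Errors of order \<open>rho\<close> in squared quantities become errors of order
    \<open>s\<close> in the quantities themselves.\<close>
  define s where "s = sqrt rho"
  have "sqrt rho \<le> 1 / 100" using rho by (intro real_le_lsqrt) (simp_all add: power_divide)
  then have s: "s\<^sup>2 = rho" "0 < s" "s \<le> 1 / 100" unfolding s_def using rho by auto
  have rs: "rho \<le> s / 100"
  proof -
    have "s * s \<le> s * (1 / 100)" using s by (intro mult_left_mono) auto
    then show ?thesis unfolding s(1)[symmetric] power2_eq_square by simp
  qed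
  define t where "t w = real (card (hubs_of w))" for w
  define e where "e w = real (card (E_pairs (hubs_of w)))" for w
  define V' where "V' = V - free"
  define n' where "n' = real (card V')"
  define n2 where "n2 = real (card free)"
  have fV': "finite V'" "V' \<subseteq> V" unfolding V'_def by auto
  have free: "free \<subseteq> V" using parts by blast
  have nn: "n' + n2 = n" "0 \<le> n2" "0 \<le> n'"
  proof -
    have "card V' = card V - card free" unfolding V'_def using free parts by (intro card_Diff_subset)
    moreover have "card free \<le> card V" using free by (intro card_mono) auto
    ultimately show "n' + n2 = n" unfolding n'_def n2_def by simp
  qed (auto simp: n'_def n2_def)
  define Tt where "Tt = (\<Sum>w\<in>V'. t w)"
  define Q where "Q = (\<Sum>w\<in>V'. (t w)\<^sup>2)"
  define Es where "Es = (\<Sum>w\<in>V'. e w)"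
  have t0: "0 \<le> t w" for w unfolding t_def by simp
  have Tt0: "0 \<le> Tt" unfolding Tt_def by (intro sum_nonneg t0)
  define K where "K = k * n"
  have K0: "0 < K" unfolding K_def using k0 n0 by simp
  have A1: "Q \<le> Es + Tt + rho * (k * K)"
  proof -
    have f: "real (card split_pairs) < rho ^ 5 / 10 ^ 5 * k\<^sup>2"
      using spread_split_pairs[OF _ order_refl] ns by (meson not_le)
    have eq: "rho * k\<^sup>2 * n = rho * (k * K)" unfolding K_def by (simp add: power2_eq_square)
    show ?thesis using hub_cliques[OF f] unfolding Q_def Es_def Tt_def V'_def t_def e_def eq .
  qed
  have EC: "K \<le> (\<Sum>w\<in>V. t w) + 4 * rho * K + 7 / 10 * (k * n2)"
  proof -
    have "(\<Sum>x\<in>V - hub. real (card (nb x \<inter> mid))) < rho * k * n"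
      using spread_mid[OF _ order_refl] ns by (meson not_le)
    moreover have "(\<Sum>y\<in>tame. real (card (nb y \<inter> fixed))) < rho * k * n"
      using spread_cross[OF _ order_refl] ns by (meson not_le)
    moreover have "(\<Sum>x\<in>free. real (card (nb x \<inter> free))) < 14 / 10 * k * real (card free) + 2 * rho * k * n"
      using spread_free[OF _ order_refl] ns by (meson not_le)
    ultimately show ?thesis using edge_count unfolding K_def t_def n2_def by (simp add: mult.assoc)
  qed
  have "(\<Sum>w\<in>V. t w) = Tt + (\<Sum>w\<in>free. t w)"
    unfolding Tt_def V'_def using free by (metis finite_atLeastAtMost sum.subset_diff)
  moreover have "(\<Sum>w\<in>free. t w) \<le> (\<Sum>w\<in>free. k / 10)" by (intro sum_mono) (auto simp: free_def t_def)
  moreover have "(\<Sum>w\<in>free. k / 10) = 1 / 10 * (k * n2)" unfolding n2_def by simp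
  \<comment> \<open>The coefficient \<open>8 / 10\<close> is \<open>7 / 10\<close> for pairs inside
    \<open>free\<close> plus \<open>1 / 10\<close> for their hub neighbours. Being below 1, it
    forces \<open>n2\<close> to be small once this is compared with
    \<open>K = k * n' + k * n2\<close>.\<close>
  ultimately have EC2: "K \<le> Tt + 4 * rho * K + 8 / 10 * (k * n2)" using EC by linarith
  have kn'2: "k * n' + k * n2 = K" unfolding K_def using nn(1) by (simp flip: distrib_left)
  have kn'0: "0 \<le> k * n'" "0 \<le> k * n2" using nn k0 by auto
  have sq: "(\<Sum>w\<in>V'. (t w - k)\<^sup>2) = Q - 2 * (k * Tt) + k * (k * n')"
  proof -
    have "(\<Sum>w\<in>V'. (t w - k)\<^sup>2) = (\<Sum>w\<in>V'. (t w)\<^sup>2 - (2 * k) * t w + k\<^sup>2)"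
      by (intro sum.cong refl) (simp add: power2_diff)
    also have "\<dots> = Q - (2 * k) * Tt + n' * k\<^sup>2"
      unfolding Q_def Tt_def n'_def by (simp only: sum.distrib sum_subtractf sum_distrib_left[symmetric] sum_constant)
    finally show ?thesis by (simp add: power2_eq_square)
  qed
  have AG: "2 * (k * Tt) \<le> Q + k * (k * n')"
    using sum_nonneg[of V' "\<lambda>w. (t w - k)\<^sup>2"] unfolding sq by simp
  have Ele: "Es \<le> (1 + rho) * (k * (k * n'))"
  proof -
    have "Es \<le> (\<Sum>w\<in>V'. (1 + rho) * k\<^sup>2)" unfolding Es_def e_def by (intro sum_mono card_E_pairs_le)
    then show ?thesis unfolding n'_def by (simp add: power2_eq_square mult_ac)
  qed
  have kK: "k * (k * n') \<le> k * K" using kn'2 kn'0 k0 by (intro mult_left_mono) auto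
  have kK0: "0 \<le> k * K" "0 \<le> k * (k * n')" using k0 K0 kn'0 by auto
  have rkK: "rho * (k * (k * n')) \<le> rho * (k * K)" by (rule mult_left_mono[OF kK]) (use rho in simp)
  \<comment> \<open>The linear term that coinciding hubs leave in the clique estimate is of lower
    order, because \<open>k\<close> is large against \<open>1 / rho\<close>.\<close>
  have TtK: "Tt \<le> rho * (k * K)"
  proof -
    have "8 \<le> rho ^ 1 * k" by (rule bigk) auto
    then have k1: "1 \<le> rho * k / 8" by simp
    have "Tt * 1 \<le> Tt * (rho * k / 8)" using k1 Tt0 by (intro mult_left_mono)
    then have Ts: "Tt \<le> rho * (k * Tt) / 8" by (simp add: mult_ac)
    have "rho * (k * Tt) \<le> 1 * (k * Tt)" using rho k0 Tt0 by (intro mult_right_mono) auto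
    moreover have "rho * (k * K) \<le> 1 / 10000 * (k * K)" using rho kK0 by (intro mult_right_mono) auto
    moreover have "(1 + rho) * (k * (k * n')) = k * (k * n') + rho * (k * (k * n'))" by (simp add: distrib_right)
    ultimately have "k * Tt \<le> 2 * (k * K)" using AG A1 Ele Ts kK rkK kK0 Tt0 by linarith
    then have "rho * (k * Tt) \<le> rho * (2 * (k * K))" using rho by (intro mult_left_mono) auto
    then show ?thesis using Ts kK0 rho mult_nonneg_nonneg[of rho "k * K"] by linarith
  qed
  have dE: "(1 + rho) * (k * (k * n')) = k * (k * n') + rho * (k * (k * n'))" by (simp add: distrib_right)
  have Tu: "Tt \<le> k * n' + 3 / 2 * (rho * K)"
  proof -
    have "k * (2 * Tt) \<le> k * (2 * (k * n') + 3 * (rho * K))"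
    proof -
      have "2 * (k * Tt) \<le> 2 * (k * (k * n')) + 3 * (rho * (k * K))"
        using AG A1 Ele TtK rkK dE by linarith
      moreover have "k * (2 * (k * n') + 3 * (rho * K)) = 2 * (k * (k * n')) + 3 * (rho * (k * K))"
        by (simp add: algebra_simps)
      ultimately show ?thesis by simp
    qed
    then have "2 * Tt \<le> 2 * (k * n') + 3 * (rho * K)" using k0 by (rule mult_left_le_imp_le)
    then show ?thesis by simp
  qed
  have n2le: "k * n2 \<le> 28 * (rho * K)" using EC2 Tu kn'2 mult_pos_pos[OF rho(1) K0] by (simp add: mult.assoc)
  have Tl: "K - 27 * (rho * K) \<le> Tt" using EC2 n2le mult_pos_pos[OF rho(1) K0] by (simp add: mult.assoc)
  have kTl: "k * K - 27 * (rho * (k * K)) \<le> k * Tt"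
    using mult_left_mono[OF Tl, of k] k0 by (simp add: algebra_simps)
  have rkK0: "0 \<le> rho * (k * K)" using rho kK0 by simp
  have Esl: "k * K - 56 * (rho * (k * K)) \<le> Es" using AG A1 kTl TtK kK rkK0 by linarith
  have S1: "(\<Sum>w\<in>V'. (t w - k)\<^sup>2) \<le> 57 * (rho * (k * K))"
    unfolding sq using A1 Ele dE TtK kTl kK rkK rkK0 by linarith
  have n'half: "n / 2 \<le> n'"
  proof -
    have "28 * (rho * K) \<le> 1 / 2 * K" using rho K0 by simp
    then have "k * (n / 2) \<le> k * n'" using n2le kn'2 unfolding K_def by (simp add: algebra_simps)
    then show ?thesis using k0 by simp
  qed
  \<comment> \<open>The two error sums total at most \<open>59 * (rho * (k * K))\<close> and
    \<open>V'\<close> has at least \<open>n / 2\<close> vertices, so some vertex has error at most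
    \<open>120 * (rho * k\<^sup>2)\<close>, which controls its hub degree and the density of
    \<open>E\<close> there at once.\<close>
  obtain w0 where w0: "w0 \<in> V'" "(t w0 - k)\<^sup>2 + ((t w0)\<^sup>2 - e w0) \<le> 120 * (rho * k\<^sup>2)"
  proof (rule ccontr)
    assume "\<not> thesis"
    then have c: "\<And>w. w \<in> V' \<Longrightarrow> 120 * (rho * k\<^sup>2) \<le> (t w - k)\<^sup>2 + ((t w)\<^sup>2 - e w)" using that by force
    have "(\<Sum>w\<in>V'. 120 * (rho * k\<^sup>2)) \<le> (\<Sum>w\<in>V'. (t w - k)\<^sup>2 + ((t w)\<^sup>2 - e w))" by (intro sum_mono c)
    also have "\<dots> = (\<Sum>w\<in>V'. (t w - k)\<^sup>2) + (Q - Es)" unfolding Q_def Es_def by (simp only: sum.distrib sum_subtractf)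
    also have "\<dots> \<le> 59 * (rho * (k * K))" using S1 A1 TtK by linarith
    finally have "n' * (120 * (rho * k\<^sup>2)) \<le> 59 * (rho * (k * K))" unfolding n'_def by simp
    moreover have "n / 2 * (120 * (rho * k\<^sup>2)) \<le> n' * (120 * (rho * k\<^sup>2))" using n'half rho by (intro mult_right_mono) auto
    moreover have "n / 2 * (120 * (rho * k\<^sup>2)) = 60 * (rho * (k * K))" unfolding K_def by (simp add: power2_eq_square)
    ultimately have "rho * (k * K) \<le> 0" by linarith
    moreover have "0 < rho * (k * K)" using rho k0 K0 by simp
    ultimately show False by linarith
  qed
  define U0 where "U0 = hubs_of w0"
  have U0: "U0 \<subseteq> hub" "finite U0" unfolding U0_def hubs_of_def using finite_nb by auto
  have tU: "t w0 = real (card U0)" unfolding t_def U0_def by simp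
  have et: "e w \<le> (t w)\<^sup>2" for w
  proof -
    have "card (E_pairs (hubs_of w)) \<le> card (hubs_of w \<times> hubs_of w)"
      using finite_hubs_of by (intro card_mono) (auto simp: E_pairs_def)
    then have "real (card (E_pairs (hubs_of w))) \<le> real (card (hubs_of w) * card (hubs_of w))"
      unfolding card_cartesian_product by (rule of_nat_mono)
    then show ?thesis unfolding e_def t_def by (simp add: power2_eq_square)
  qed
  have sk: "rho * k\<^sup>2 = (s * k)\<^sup>2" using s by (simp add: power_mult_distrib)
  have td: "\<bar>t w0 - k\<bar> \<le> 11 * (s * k)"
  proof (rule power2_le_imp_le)
    have "(t w0 - k)\<^sup>2 \<le> 120 * (s * k)\<^sup>2" using w0(2) et[of w0] unfolding sk by linarith
    also have "\<dots> \<le> (11 * (s * k))\<^sup>2" by (simp add: power_mult_distrib)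
    finally show "\<bar>t w0 - k\<bar>\<^sup>2 \<le> (11 * (s * k))\<^sup>2" by simp
    show "0 \<le> 11 * (s * k)" using s k0 by simp
  qed
  have tl: "k - 11 * (s * k) \<le> t w0" "t w0 \<le> k + 11 * (s * k)" using td by linarith+
  have ks: "11 * (s * k) \<le> k" using s k0 mult_right_mono[of "11 * s" 1 k] by simp
  have e0: "k\<^sup>2 - 22 * (s * k\<^sup>2) \<le> e w0"
  proof -
    have "(k - 11 * (s * k))\<^sup>2 \<le> (t w0)\<^sup>2" using tl ks by (intro power_mono) auto
    moreover have "(k - 11 * (s * k))\<^sup>2 = k\<^sup>2 - 22 * (s * k\<^sup>2) + 121 * (s * k)\<^sup>2"
      by (simp add: power2_eq_square algebra_simps)
    moreover have "(t w0)\<^sup>2 - e w0 \<le> 120 * (s * k)\<^sup>2" using w0(2) unfolding sk by (smt (verit) zero_le_power2)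
    moreover have "0 \<le> (s * k)\<^sup>2" by simp
    ultimately show ?thesis by linarith
  qed
  define a where "a w = real (card (hubs_of w \<inter> U0))" for w
  \<comment> \<open>Inclusion-exclusion among the ordered pairs from \<open>E\<close>: two families
    that each nearly exhaust them must overlap, and the overlap consists of pairs inside
    \<open>hubs_of w \<inter> U0\<close>.\<close>
  have aw: "e w + e w0 - (1 + rho) * k\<^sup>2 \<le> (k + 11 * (s * k)) * a w" for w
  proof -
    have i: "E_pairs (hubs_of w \<inter> U0) = E_pairs (hubs_of w) \<inter> E_pairs U0" unfolding E_pairs_def by auto
    have f: "finite (E_pairs (hubs_of w))" "finite (E_pairs U0)" using finite_E_pairs finite_hubs_of U0 by auto
    have "card (E_pairs (hubs_of w)) + card (E_pairs U0) = card (E_pairs (hubs_of w) \<union> E_pairs U0) + card (E_pairs (hubs_of w) \<inter> E_pairs U0)"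
      by (rule card_Un_Int[OF f])
    moreover have "card (E_pairs (hubs_of w) \<union> E_pairs U0) \<le> card (ordered_pairs E)"
      by (rule card_mono[OF finite_ordered_pairs[OF E(1)]]) (auto simp: E_pairs_def ordered_pairs_def)
    ultimately have "e w + e w0 - (1 + rho) * k\<^sup>2 \<le> real (card (E_pairs (hubs_of w \<inter> U0)))"
      unfolding i e_def U0_def[symmetric] using card_ordered_pairs[OF E(1)] E2 by linarith
    also have "\<dots> \<le> a w * a w"
    proof -
      have "card (E_pairs (hubs_of w \<inter> U0)) \<le> card ((hubs_of w \<inter> U0) \<times> (hubs_of w \<inter> U0))"
        using finite_hubs_of by (intro card_mono) (auto simp: E_pairs_def)
      then have "real (card (E_pairs (hubs_of w \<inter> U0))) \<le> real (card (hubs_of w \<inter> U0) * card (hubs_of w \<inter> U0))"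
        unfolding card_cartesian_product by (rule of_nat_mono)
      then show ?thesis unfolding a_def by simp
    qed
    also have "\<dots> \<le> (k + 11 * (s * k)) * a w"
    proof (rule mult_right_mono)
      have "card (hubs_of w \<inter> U0) \<le> card U0" using U0 by (intro card_mono) auto
      then show "a w \<le> k + 11 * (s * k)" using tl tU unfolding a_def by linarith
    qed (simp add: a_def)
    finally show ?thesis .
  qed
  define As where "As = (\<Sum>w\<in>V'. a w)"
  have As: "K - 34 * (s * K) \<le> As"
  proof -
    have "Es + n' * (e w0 - (1 + rho) * k\<^sup>2) = (\<Sum>w\<in>V'. e w + (e w0 - (1 + rho) * k\<^sup>2))"
      unfolding Es_def n'_def by (simp only: sum.distrib sum_constant)
    also have "\<dots> \<le> (\<Sum>w\<in>V'. (k + 11 * (s * k)) * a w)" using aw by (intro sum_mono) (simp add: algebra_simps)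
    also have "\<dots> = (k + 11 * (s * k)) * As" unfolding As_def by (simp add: sum_distrib_left)
    finally have 1: "Es + n' * (e w0 - (1 + rho) * k\<^sup>2) \<le> (k + 11 * (s * k)) * As" .
    have "- (22 * s + rho) * k\<^sup>2 \<le> e w0 - (1 + rho) * k\<^sup>2" using e0 by (simp add: algebra_simps)
    then have "n' * (- (22 * s + rho) * k\<^sup>2) \<le> n' * (e w0 - (1 + rho) * k\<^sup>2)" using nn(3) by (rule mult_left_mono)
    moreover have "n * ((22 * s + rho) * k\<^sup>2) \<ge> n' * ((22 * s + rho) * k\<^sup>2)" using nn s rho by (intro mult_right_mono) auto
    moreover have "n * ((22 * s + rho) * k\<^sup>2) = 22 * (s * (k * K)) + rho * (k * K)" unfolding K_def by (simp add: power2_eq_square algebra_simps)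
    moreover have "n' * (- (22 * s + rho) * k\<^sup>2) = - (n' * ((22 * s + rho) * k\<^sup>2))" by (simp add: algebra_simps)
    ultimately have "k * K - 57 * (rho * (k * K)) - 22 * (s * (k * K)) \<le> (k + 11 * (s * k)) * As" using 1 Esl by linarith
    moreover have "rho * (k * K) \<le> s / 100 * (k * K)" using rs kK0 by (intro mult_right_mono) auto
    moreover have "0 \<le> s * (k * K)" using s kK0 by simp
    ultimately have "k * K - 23 * (s * (k * K)) \<le> (k + 11 * (s * k)) * As" by simp
    then have "k * (K - 23 * (s * K)) \<le> k * ((1 + 11 * s) * As)" by (simp add: algebra_simps)
    then have 2: "K - 23 * (s * K) \<le> (1 + 11 * s) * As" using k0 by (rule mult_left_le_imp_le)
    have "(1 + 11 * s) * (K - 34 * (s * K)) = K - 23 * (s * K) - 374 * (s\<^sup>2 * K)"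
      by (simp add: algebra_simps power2_eq_square)
    moreover have "0 \<le> s\<^sup>2 * K" using K0 by simp
    ultimately have "(1 + 11 * s) * (K - 34 * (s * K)) \<le> (1 + 11 * s) * As" using 2 by linarith
    then show ?thesis by (rule mult_left_le_imp_le) (use s in simp)
  qed
  \<comment> \<open>The partition also demands that \<open>card E\<close> be at most
    \<open>p choose 2\<close>, so \<open>U0\<close> is padded to size at least
    \<open>(1 + rho) * k + 1\<close>; this changes the size by order \<open>s * k\<close>
    only.\<close>
  define p where "p = max (card U0) (nat \<lceil>(1 + rho) * k\<rceil> + 1)"
  have c8: "1000 \<le> rho ^ 1 * k" by (rule bigk) auto
  have rks: "rho * k \<le> s / 100 * k" using rs k0 by (intro mult_right_mono) auto
  have np: "real (nat \<lceil>(1 + rho) * k\<rceil>) \<le> (1 + rho) * k + 1" "(1 + rho) * k \<le> real (nat \<lceil>(1 + rho) * k\<rceil>)"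
  proof -
    have "0 \<le> (1 + rho) * k" using rho k0 by simp
    then show "real (nat \<lceil>(1 + rho) * k\<rceil>) \<le> (1 + rho) * k + 1" "(1 + rho) * k \<le> real (nat \<lceil>(1 + rho) * k\<rceil>)" by linarith+
  qed
  have pu: "real p \<le> k + 12 * (s * k)"
  proof -
    have sk0: "0 < s * k" using s k0 by simp
    have "real (card U0) \<le> k + 12 * (s * k)" using tl(2) tU sk0 by linarith
    moreover have "(1 + rho) * k = k + rho * k" "1000 \<le> rho * k" "rho * k \<le> s * k / 100"
      using c8 rks by (simp_all add: distrib_right)
    then have "real (nat \<lceil>(1 + rho) * k\<rceil>) + 1 \<le> k + 12 * (s * k)" using np(1) sk0 by linarith
    ultimately show ?thesis unfolding p_def by (simp add: max_def)
  qed
  have pl: "(1 + rho) * k + 1 \<le> real p" using np(2) unfolding p_def by auto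
  have pn: "p \<le> n"
  proof -
    have "100 * k \<le> n" using bign[of 100 0] by simp
    moreover have "12 * (s * k) \<le> k" using s k0 mult_right_mono[of "12 * s" 1 k] by simp
    ultimately have "real p \<le> real n" using pu k0 by linarith
    then show ?thesis by simp
  qed
  have "card U0 \<le> p" unfolding p_def by simp
  then obtain U where U: "U0 \<subseteq> U" "U \<subseteq> V" "card U = p"
    using exists_subset_between[of U0 p V] pn subset_trans[OF U0(1) parts(1)] by auto
  have ch: "real (p choose 2) = real p * (real p - 1) / 2" by (rule real_choose_two)
  have g1: "card E \<le> p choose 2"
  proof -
    have "1 * k\<^sup>2 \<le> (1 + rho) * k\<^sup>2" using rho by (intro mult_right_mono) auto
    then have "(1 + rho) * (1 * k\<^sup>2) \<le> (1 + rho) * ((1 + rho) * k\<^sup>2)" by (rule mult_left_mono) (use rho in simp)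
    then have "(1 + rho) * k\<^sup>2 \<le> ((1 + rho) * k) * ((1 + rho) * k)" by (simp add: power2_eq_square mult_ac)
    also have "\<dots> \<le> real p * (real p - 1)" using pl rho k0 by (intro mult_mono) auto
    finally have "real (card E) \<le> real (p choose 2)" unfolding ch using E2 by simp
    then show ?thesis by simp
  qed
  have g2: "(1 - \<epsilon>) * real (p choose 2) \<le> real (card (edges_within E U))"
  proof -
    have "E_pairs U0 = ordered_pairs (edges_within E U0)" unfolding E_pairs_def ordered_pairs_def edges_within_def by auto
    moreover have "edges_within E U0 \<subseteq> complete_edges n" using E(1) unfolding edges_within_def by auto
    ultimately have "card (E_pairs U0) = 2 * card (edges_within E U0)" using card_ordered_pairs by simp
    moreover have "edges_within E U0 \<subseteq> edges_within E U" using U(1) unfolding edges_within_def by auto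
    then have "card (edges_within E U0) \<le> card (edges_within E U)"
      using finM(2) by (intro card_mono) (auto simp: edges_within_def)
    ultimately have 1: "e w0 \<le> 2 * real (card (edges_within E U))" unfolding e_def U0_def[symmetric] by linarith
    have "(1 - \<epsilon>) * real (p choose 2) \<le> (1 - 100 * s) * real (p choose 2)"
      using eps(1) unfolding s_def[symmetric] by (intro mult_right_mono) auto
    also have "real (p choose 2) \<le> (k + 12 * (s * k))\<^sup>2 / 2"
    proof -
      have "real p * (real p - 1) \<le> (real p)\<^sup>2" by (simp add: power2_eq_square algebra_simps)
      also have "\<dots> \<le> (k + 12 * (s * k))\<^sup>2" using pu by (intro power_mono) auto
      finally show ?thesis unfolding ch by simp
    qed
    then have "(1 - 100 * s) * real (p choose 2) \<le> (1 - 100 * s) * ((k + 12 * (s * k))\<^sup>2 / 2)"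
      using s by (intro mult_left_mono) auto
    also have "\<dots> = (1 - 100 * s) * (1 + 12 * s)\<^sup>2 * k\<^sup>2 / 2"
    proof -
      have "k + 12 * (s * k) = (1 + 12 * s) * k" by (simp add: distrib_right)
      then show ?thesis by (simp add: power_mult_distrib)
    qed
    \<comment> \<open>The slack \<open>100 * s\<close> absorbs the missing edges,
      \<open>22 * s\<close>, and the growth from padding, about \<open>24 * s\<close>.\<close>
    also have "\<dots> \<le> (1 - 22 * s) * k\<^sup>2 / 2"
    proof (intro divide_right_mono mult_right_mono)
      have "(1 - 100 * s) * (1 + 12 * s)\<^sup>2 = 1 - 76 * s - 2256 * s\<^sup>2 - 14400 * s ^ 3"
        by (simp add: algebra_simps power2_eq_square power3_eq_cube)
      moreover have "0 \<le> s\<^sup>2" "0 \<le> s ^ 3" using s(2) by simp_all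
      ultimately show "(1 - 100 * s) * (1 + 12 * s)\<^sup>2 \<le> 1 - 22 * s" using s(2) by linarith
    qed auto
    also have "\<dots> = (k\<^sup>2 - 22 * (s * k\<^sup>2)) / 2" by (simp add: algebra_simps)
    also have "\<dots> \<le> real (card (edges_within E U))" using order_trans[OF e0 1] by simp
    finally show ?thesis .
  qed
  have g3: "real (card (edges_within M (V - U))) \<le> 7 * sqrt \<epsilon> * real p * real n"
  proof -
    have "real (card (edges_within M (V - U))) + As \<le> K + (t w0)\<^sup>2"
      using few_touching_edges[OF U0(1) U(1) fV'(2)] unfolding As_def a_def K_def tU .
    moreover have "(t w0)\<^sup>2 \<le> s * K"
    proof -
      have "(t w0)\<^sup>2 \<le> (2 * k)\<^sup>2" using tl ks t0 by (intro power_mono) auto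
      also have "\<dots> = k * (4 * k)" by (simp add: power2_eq_square)
      also have "\<dots> \<le> k * (s * n)"
      proof (rule mult_left_mono)
        have "4 * k \<le> rho ^ 1 * n" by (rule bign) auto
        also have "\<dots> \<le> s * n" using rs s by (intro mult_right_mono) auto
        finally show "4 * k \<le> s * n" .
      qed (use k0 in simp)
      finally show ?thesis unfolding K_def by (simp add: mult_ac)
    qed
    ultimately have "real (card (edges_within M (V - U))) \<le> 35 * (s * K)" using As by linarith
    \<comment> \<open>Since \<open>\<epsilon>\<close> is at most 1, \<open>100 * s\<close> is at
      most \<open>sqrt \<epsilon>\<close>, so \<open>5 * s\<close> is too, and
      \<open>35 = 7 * 5\<close>.\<close>
    also have "\<dots> \<le> 7 * sqrt \<epsilon> * real p * real n"
    proof -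
      have e01: "0 \<le> \<epsilon>" using eps(1) rho by (smt (verit) real_sqrt_ge_zero)
      have "\<epsilon> = sqrt \<epsilon> * sqrt \<epsilon>" using e01 by simp
      also have "\<dots> \<le> sqrt \<epsilon> * 1" using eps(2) e01 by (intro mult_left_mono) auto
      finally have "5 * s \<le> sqrt \<epsilon>" using eps(1) s unfolding s_def[symmetric] by linarith
      moreover have "0 < rho * k" using rho k0 by simp
      then have "k \<le> real p" using pl by (simp add: distrib_right)
      ultimately have "(5 * s) * k \<le> sqrt \<epsilon> * real p" using s k0 e01 by (intro mult_mono) auto
      then have "7 * (5 * s * k) * real n \<le> 7 * (sqrt \<epsilon> * real p) * real n"
        by (intro mult_right_mono mult_left_mono) auto
      moreover have "35 * (s * K) = 7 * (5 * s * k) * real n" unfolding K_def by simp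
      moreover have "7 * sqrt \<epsilon> * real p * real n = 7 * (sqrt \<epsilon> * real p) * real n" by simp
      ultimately show ?thesis by linarith
    qed
    finally show ?thesis .
  qed
  have pg: "is_pregraph n (M, E)" unfolding is_pregraph_def using M E by auto
  have "U \<union> (V - U) = V" "U \<inter> (V - U) = {}" using U(2) by auto
  then show ?thesis unfolding almost_split_def using pg g1 g2 g3 U(3) by blast
qed

end

section \<open>Counting graphs in a pregraph\<close>

text \<open>The graphs are complete on \<open>{1..a}\<close>, empty on the rest and arbitrary in
  between. Such a split graph has no induced 4-cycle: each diagonal is a non-edge and so has an end
  beyond \<open>a\<close>, but these two ends are consecutive on the cycle and would have to be
  adjacent.\<close>

lemma split_graphs_le:
  assumes a: "a \<le> n" "a choose 2 \<le> m"
  shows "(a * (n - a)) choose (m - (a choose 2)) \<le> card (ind_C4_free_graphs n m)"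
proof -
  define KU where "KU = {e. e \<subseteq> {1..a} \<and> card e = 2}"
  define UW where "UW = (\<lambda>(u, w). {u, w}) ` ({1..a} \<times> {a+1..n})"
  have fK: "finite KU" unfolding KU_def by (rule finite_subset[of _ "Pow {1..a}"]) auto
  have cK: "card KU = a choose 2" unfolding KU_def using n_subsets[of "{1..a}" 2] by simp
  have inj: "inj_on (\<lambda>(u, w). {u, w}) ({1..a} \<times> {a+1..n})"
  proof (rule inj_onI, clarify)
    fix u w u' w' assume "u \<in> {1..a}" "w \<in> {a+1..n}" "u' \<in> {1..a}" "w' \<in> {a+1..n}" "{u, w} = {u', w'}"
    then show "u = u' \<and> w = w'" unfolding doubleton_eq_iff by auto
  qed
  have fU: "finite UW" unfolding UW_def by simp
  have cU: "card UW = a * (n - a)"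
    unfolding UW_def card_image[OF inj] by (simp add: card_cartesian_product)
  have UWE: "\<exists>u w. e = {u, w} \<and> u \<in> {1..a} \<and> w \<in> {a+1..n}" if "e \<in> UW" for e
  proof -
    have "\<exists>z\<in>{1..a} \<times> {a+1..n}. e = (\<lambda>(u, w). {u, w}) z" using that unfolding UW_def by (simp only: image_iff)
    then obtain z where "e = (\<lambda>(u, w). {u, w}) z" "z \<in> {1..a} \<times> {a+1..n}" by (elim bexE)
    then show ?thesis by (intro exI[of _ "fst z"] exI[of _ "snd z"]) (simp add: case_prod_beta mem_Times_iff)
  qed
  have disj: "KU \<inter> UW = {}"
  proof (rule equals0I)
    fix e assume e: "e \<in> KU \<inter> UW"
    have "\<exists>u w. e = {u, w} \<and> u \<in> {1..a} \<and> w \<in> {a+1..n}" using e by (intro UWE) simp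
    then show False using e unfolding KU_def by fastforce
  qed
  define F where "F = {S. S \<subseteq> UW \<and> card S = m - (a choose 2)}"
  have cF: "card F = (a * (n - a)) choose (m - (a choose 2))"
    unfolding F_def using n_subsets[OF fU] cU by simp
  have injF: "inj_on (\<lambda>S. KU \<union> S) F"
  proof (rule inj_onI)
    fix S S' assume "S \<in> F" "S' \<in> F" "KU \<union> S = KU \<union> S'"
    then show "S = S'" using disj unfolding F_def by blast
  qed
  have mem: "KU \<union> S \<in> ind_C4_free_graphs n m" if S: "S \<in> F" for S
  proof -
    have SU: "S \<subseteq> UW" "card S = m - (a choose 2)" using S unfolding F_def by auto
    have fS: "finite S" using SU(1) fU finite_subset by blast
    have 1: "KU \<union> S \<subseteq> complete_edges n"
    proof -
      have "KU \<subseteq> complete_edges n" unfolding KU_def complete_edges_def using a(1) by auto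
      moreover have "UW \<subseteq> complete_edges n"
      proof
        fix e assume "e \<in> UW"
        from UWE[OF this] obtain u w where "e = {u, w}" "u \<in> {1..a}" "w \<in> {a+1..n}" by (elim exE conjE)
        then show "e \<in> complete_edges n" using a(1) by (simp add: doubleton_in_complete_edges)
      qed
      ultimately show ?thesis using SU(1) by blast
    qed
    have 2: "card (KU \<union> S) = m"
      using card_Un_disjoint[OF fK fS] disj SU cK a(2) by (auto simp: disjoint_iff)
    have 3: "\<not> has_induced_C4 n (KU \<union> S)"
    proof
      assume "has_induced_C4 n (KU \<union> S)"
      then obtain p q r t where d: "distinct [p, q, r, t]" "{p, q, r, t} \<subseteq> {1..n}"
        "edges_within (KU \<union> S) {p, q, r, t} = {{p, q}, {q, r}, {r, t}, {t, p}}"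
        unfolding has_induced_C4_def by (elim exE conjE)
      have out: "\<exists>z\<in>{x, y}. z > a" if "x \<noteq> y" "x \<in> {p, q, r, t}" "y \<in> {p, q, r, t}"
        "{x, y} \<notin> {{p, q}, {q, r}, {r, t}, {t, p}}" for x y
      proof (rule ccontr)
        assume "\<not> (\<exists>z\<in>{x, y}. z > a)"
        then have "x \<le> a" "y \<le> a" by auto
        moreover have "x \<in> {1..n}" "y \<in> {1..n}" using subsetD[OF d(2)] that(2,3) by blast+
        moreover have "card {x, y} = 2" using that(1) by simp
        ultimately have "{x, y} \<in> KU" unfolding KU_def by simp
        moreover have "{x, y} \<subseteq> {p, q, r, t}" using that(2,3) by blast
        ultimately have "{x, y} \<in> edges_within (KU \<union> S) {p, q, r, t}"
          unfolding edges_within_def by (intro CollectI conjI UnI1)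
        with that(4) show False unfolding d(3) by (rule notE)
      qed
      have no: "\<not> (x > a \<and> y > a)" if "{x, y} \<in> {{p, q}, {q, r}, {r, t}, {t, p}}" for x y
      proof -
        have "{x, y} \<in> KU \<union> UW" using that SU(1) unfolding d(3)[symmetric] edges_within_def by auto
        then show ?thesis
        proof
          assume "{x, y} \<in> UW"
          from UWE[OF this] obtain u w where "{x, y} = {u, w}" "u \<in> {1..a}" by (elim exE conjE)
          then show ?thesis unfolding doubleton_eq_iff by auto
        qed (simp add: KU_def)
      qed
      have "\<exists>z\<in>{p, r}. z > a" by (rule out) (use d(1) in \<open>auto simp: doubleton_eq_iff\<close>)
      moreover have "\<exists>z\<in>{q, t}. z > a" by (rule out) (use d(1) in \<open>auto simp: doubleton_eq_iff\<close>)
      moreover have "\<not> (p > a \<and> q > a)" "\<not> (q > a \<and> r > a)" "\<not> (r > a \<and> t > a)" "\<not> (t > a \<and> p > a)"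
        by (rule no, simp)+
      ultimately show False by auto
    qed
    show ?thesis unfolding ind_C4_free_graphs_def using 1 2 3 by blast
  qed
  have fG: "finite (ind_C4_free_graphs n m)"
    unfolding ind_C4_free_graphs_def by (rule finite_subset[of _ "Pow (complete_edges n)"]) (auto simp: finite_complete_edges)
  have "card F = card ((\<lambda>S. KU \<union> S) ` F)" by (rule card_image[OF injF, symmetric])
  also have "\<dots> \<le> card (ind_C4_free_graphs n m)" using fG mem by (intro card_mono) auto
  finally show ?thesis unfolding cF .
qed

lemma card_contained_le:
  assumes P: "M \<subseteq> complete_edges n" "E \<subseteq> complete_edges n" and Em: "card E \<le> m"
  shows "card {G \<in> ind_C4_free_graphs n m. contained_in G (M, E)} \<le> card M choose (m - card E)"
proof -
  let ?A = "{G \<in> ind_C4_free_graphs n m. contained_in G (M, E)}"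
  have fM: "finite M" "finite E" using P finite_complete_edges finite_subset by blast+
  have "inj_on (\<lambda>G. G - E) ?A"
  proof (rule inj_onI)
    fix G G' assume "G \<in> ?A" "G' \<in> ?A" "G - E = G' - E"
    then show "G = G'" unfolding contained_in_def by auto
  qed
  then have "card ?A = card ((\<lambda>G. G - E) ` ?A)" by (rule card_image[symmetric])
  also have "\<dots> \<le> card {S. S \<subseteq> M \<and> card S = m - card E}"
  proof (rule card_mono)
    show "finite {S. S \<subseteq> M \<and> card S = m - card E}" using fM by simp
    show "(\<lambda>G. G - E) ` ?A \<subseteq> {S. S \<subseteq> M \<and> card S = m - card E}"
    proof
      fix S assume "S \<in> (\<lambda>G. G - E) ` ?A"
      then obtain G where G: "S = G - E" "E \<subseteq> G" "G \<subseteq> E \<union> M" "card G = m"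
        unfolding contained_in_def ind_C4_free_graphs_def by auto
      then show "S \<in> {S. S \<subseteq> M \<and> card S = m - card E}" using fM by (auto simp: card_Diff_subset)
    qed
  qed
  also have "\<dots> = card M choose (m - card E)" using n_subsets[OF fM(1)] by simp
  finally show ?thesis .
qed

lemma card_contained_zero:
  assumes "m < card E"
  shows "{G \<in> ind_C4_free_graphs n m. contained_in G (M, E)} = {}"
proof -
  have "\<not> (G \<in> ind_C4_free_graphs n m \<and> E \<subseteq> G)" for G
  proof
    assume G: "G \<in> ind_C4_free_graphs n m \<and> E \<subseteq> G"
    then have "finite G" "card G = m"
      unfolding ind_C4_free_graphs_def using finite_complete_edges finite_subset by auto
    then show False using card_mono[of G E] G assms by simp
  qed
  then show ?thesis unfolding contained_in_def by auto
qed

section \<open>Comparison of binomial coefficients\<close>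

lemma binomial_Suc_real: "real (N choose Suc j) * real (Suc j) = real (N choose j) * (real N - real j)"
proof (cases "j \<le> N")
  case True
  have "Suc j * (N choose Suc j) = (N - j) * (N choose j)"
    using binomial_absorption[of j N] binomial_absorb_comp[of N j] by simp
  then have "real (Suc j) * real (N choose Suc j) = real (N - j) * real (N choose j)"
    by (metis of_nat_mult)
  then show ?thesis using True by (simp add: of_nat_diff mult.commute)
next
  case False
  then show ?thesis by (simp add: binomial_eq_0)
qed

lemma binomial_ratio_le:
  assumes "N1 \<le> N2" "N2 > 0"
  shows "real (N1 choose j) \<le> (real N1 / real N2) ^ j * real (N2 choose j)"
proof (induction j)
  case (Suc j)
  show ?case
  proof (cases "j < N1")
    case True
    have "real (N1 choose Suc j) * real (Suc j) = real (N1 choose j) * (real N1 - real j)"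
      by (rule binomial_Suc_real)
    also have "\<dots> \<le> ((real N1 / real N2) ^ j * real (N2 choose j)) * ((real N1 / real N2) * (real N2 - real j))"
    proof (intro mult_mono[OF Suc.IH])
      have "real N1 * real j \<le> real N2 * real j" using assms(1) by (intro mult_right_mono) auto
      then show "real N1 - real j \<le> real N1 / real N2 * (real N2 - real j)"
        using assms(2) by (simp add: field_simps)
    qed (use True in auto)
    also have "\<dots> = (real N1 / real N2) ^ Suc j * (real (N2 choose j) * (real N2 - real j))" by simp
    also have "\<dots> = (real N1 / real N2) ^ Suc j * (real (N2 choose Suc j) * real (Suc j))"
      by (simp only: binomial_Suc_real)
    finally have "real (N1 choose Suc j) * real (Suc j)
      \<le> ((real N1 / real N2) ^ Suc j * real (N2 choose Suc j)) * real (Suc j)" by (simp only: mult.assoc)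
    then show ?thesis by (rule mult_right_le_imp_le) simp
  next
    case False
    then show ?thesis by (simp add: binomial_eq_0)
  qed
qed simp

text \<open>For \<open>4 * s \<le> N\<close> consecutive coefficients up to \<open>s\<close> grow by
  a factor of at least 3, hence at least \<open>exp 1\<close>.\<close>

lemma binomial_below_le:
  assumes "4 * s \<le> N" "i \<le> s"
  shows "real (N choose (s - i)) \<le> exp (- real i) * real (N choose s)"
  using assms(2)
proof (induction i)
  case (Suc i)
  define j where "j = s - Suc i"
  have j: "s - i = Suc j" using Suc.prems unfolding j_def by simp
  have "real (N choose j) * (3 * real (Suc j)) \<le> real (N choose j) * (real N - real j)"
    using assms(1) Suc.prems unfolding j_def by (intro mult_left_mono) auto
  also have "\<dots> = real (N choose Suc j) * real (Suc j)" by (rule binomial_Suc_real[symmetric])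
  finally have "(3 * real (N choose j)) * real (Suc j) \<le> real (N choose Suc j) * real (Suc j)"
    by (simp only: mult_ac)
  then have 1: "3 * real (N choose j) \<le> real (N choose Suc j)" by (rule mult_right_le_imp_le) simp
  have "exp 1 * real (N choose j) \<le> 3 * real (N choose j)" by (intro mult_right_mono exp_le) auto
  also have "\<dots> \<le> exp (- real i) * real (N choose s)" using 1 Suc j by simp
  finally have "exp (- 1) * (exp 1 * real (N choose j)) \<le> exp (- 1) * (exp (- real i) * real (N choose s))"
    by (rule mult_left_mono) simp
  moreover have "exp (- 1) * (exp 1 * real (N choose j)) = real (N choose j)"
    by (simp add: mult.assoc[symmetric] exp_add[symmetric])
  moreover have "exp (- 1) * (exp (- real i) * real (N choose s)) = exp (- real (Suc i)) * real (N choose s)"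
    by (simp add: mult.assoc[symmetric] exp_add[symmetric])
  ultimately show ?case unfolding j_def by linarith
qed simp

lemma binomial_above_le:
  assumes "s > 0"
  shows "real (N choose (s + i)) \<le> (real N / real s) ^ i * real (N choose s)"
proof (induction i)
  case (Suc i)
  have "real (N choose Suc (s + i)) * real s \<le> real (N choose Suc (s + i)) * real (Suc (s + i))"
    by (intro mult_left_mono) auto
  also have "\<dots> = real (N choose (s + i)) * (real N - real (s + i))" by (rule binomial_Suc_real)
  also have "\<dots> \<le> real (N choose (s + i)) * real N" by (intro mult_left_mono) auto
  finally have "real (N choose Suc (s + i)) \<le> real N / real s * real (N choose (s + i))"
    using assms by (simp add: field_simps)
  also have "\<dots> \<le> real N / real s * ((real N / real s) ^ i * real (N choose s))"
    by (intro mult_left_mono Suc.IH) auto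
  finally show ?case by simp
qed simp

lemma finite_ind_C4_free_graphs: "finite (ind_C4_free_graphs n m)"
  unfolding ind_C4_free_graphs_def
  by (rule finite_subset[of _ "Pow (complete_edges n)"]) (auto simp: finite_complete_edges)

lemma real_choose_two_le: "real (a choose 2) \<le> (real a)\<^sup>2 / 2"
proof -
  have "real (a choose 2) = real a * (real a - 1) / 2" by (rule real_choose_two)
  then show ?thesis by (simp add: power2_eq_square algebra_simps)
qed

text \<open>Comparison with split graphs of clique size \<open>a\<close>, with \<open>N\<close> free
  pairs and \<open>s\<close> free edges. \<open>M\<close> has at most \<open>N / 100\<close> pairs,
  so choosing \<open>j\<close> edges in it loses \<open>exp (- (4 * j))\<close>. If
  \<open>j \<le> s\<close>, moving from \<open>j\<close> to \<open>s\<close> loses another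
  \<open>exp (- (s - j))\<close>. If \<open>j > s\<close>, the excess is at most
  \<open>a choose 2\<close> and each unit gains at most a factor \<open>X\<close>; the hypothesis on
  \<open>(real a)\<^sup>2 * ln X\<close> keeps that gain below \<open>exp (m / 2)\<close>.\<close>

lemma few_graphs_if_few_mixed:
  assumes P: "M \<subseteq> complete_edges n" "E \<subseteq> complete_edges n" and Em: "card E \<le> m"
    and m: "m > 0" and a: "2 * a \<le> n" "a > 0" and X: "X = (real n)\<^sup>2 / real m" "2 \<le> ln X"
    and aX: "(real a)\<^sup>2 * ln X \<le> real m" and am: "1600 * real m \<le> real a * real n"
    and M: "200 * real (card M) \<le> real a * real n"
  shows "real (card {G \<in> ind_C4_free_graphs n m. contained_in G (M, E)})
    \<le> exp (- (real m / 2)) * real (card (ind_C4_free_graphs n m))"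
proof -
  define N where "N = a * (n - a)"
  define s where "s = m - (a choose 2)"
  define j where "j = m - card E"
  have n: "n > 0" using a by simp
  have X0: "X > 0" using n m unfolding X(1) by simp
  have a2: "real (a choose 2) * ln X \<le> real m / 2"
  proof -
    have "real (a choose 2) * ln X \<le> (real a)\<^sup>2 / 2 * ln X"
      using X(2) by (intro mult_right_mono real_choose_two_le) auto
    then show ?thesis using aX by simp
  qed
  have "real (a choose 2) * 2 \<le> real (a choose 2) * ln X" using X(2) by (intro mult_left_mono) auto
  then have a4: "4 * real (a choose 2) \<le> real m" using a2 by linarith
  then have am2: "a choose 2 \<le> m" by linarith
  have s: "real s = real m - real (a choose 2)" unfolding s_def using am2 by (simp add: of_nat_diff)
  have s34: "3 * real m \<le> 4 * real s" using s a4 by linarith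
  have s0: "s > 0" using s34 m by linarith
  have Nr: "real N = real a * (real n - real a)" unfolding N_def using a by (simp add: of_nat_diff)
  have Nl: "real a * real n \<le> 2 * real N"
  proof -
    have "real a * real n \<le> real a * (2 * (real n - real a))" using a by (intro mult_left_mono) auto
    also have "\<dots> = 2 * (real a * (real n - real a))" by simp
    finally show ?thesis unfolding Nr .
  qed
  have Nu: "real N \<le> real a * real n" unfolding Nr by (intro mult_left_mono) auto
  have N0: "N > 0" unfolding N_def using a by simp
  have N4: "4 * s \<le> N" using Nl am m s by linarith
  have cM: "100 * real (card M) \<le> real N" using Nl M by linarith
  have c1: "real (card M choose j) \<le> exp (- (4 * real j)) * real (N choose j)"
  proof -
    have "real (card M choose j) \<le> (real (card M) / real N) ^ j * real (N choose j)"
      using cM N0 by (intro binomial_ratio_le) auto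
    also have "\<dots> \<le> exp (- 4) ^ j * real (N choose j)"
    proof (intro mult_right_mono power_mono)
      have "exp (4::real) = exp 1 ^ 4" using exp_of_nat_mult[of 4 "1::real"] by simp
      also have "\<dots> \<le> 3 ^ 4" by (intro power_mono exp_le) auto
      finally have "exp (4::real) \<le> 100" by simp
      then have "1 / 100 \<le> exp (- (4::real))" by (simp add: exp_minus field_simps)
      moreover have "real (card M) / real N \<le> 1 / 100" using cM N0 by (simp add: field_simps)
      ultimately show "real (card M) / real N \<le> exp (- 4)" by linarith
    qed auto
    also have "exp (- 4) ^ j = exp (- (4 * real j))" by (simp add: exp_of_nat_mult[symmetric])
    finally show ?thesis .
  qed
  have c2: "exp (- (4 * real j)) * real (N choose j) \<le> exp (- (real m / 2)) * real (N choose s)"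
  proof (cases "j \<le> s")
    case True
    have "real (N choose (s - (s - j))) \<le> exp (- real (s - j)) * real (N choose s)"
      by (rule binomial_below_le[OF N4]) simp
    then have "exp (- (4 * real j)) * real (N choose j) \<le> exp (- (4 * real j)) * (exp (- real (s - j)) * real (N choose s))"
      using True by (intro mult_left_mono) auto
    also have "\<dots> = exp (- (4 * real j) - real (s - j)) * real (N choose s)"
      by (simp add: mult.assoc[symmetric] exp_add[symmetric])
    also have "\<dots> \<le> exp (- (real m / 2)) * real (N choose s)"
      using True s34 by (intro mult_right_mono) (auto simp: of_nat_diff)
    finally show ?thesis .
  next
    case False
    define i where "i = j - s"
    have ji: "j = s + i" using False unfolding i_def by simp
    have ia: "i \<le> a choose 2" unfolding i_def j_def s_def using am2 by linarith
    have "real N / real s \<le> X"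
    proof -
      have "real N * real m \<le> (real a * real n) * real m" using Nu by (intro mult_right_mono) auto
      also have "\<dots> = (real n * real m) * real a" by simp
      also have "\<dots> \<le> (real n * real m) * (real n / 2)" using a by (intro mult_left_mono) auto
      also have "\<dots> = (real n)\<^sup>2 / 2 * real m" by (simp add: power2_eq_square)
      also have "\<dots> \<le> (real n)\<^sup>2 / 2 * (4 / 3 * real s)" using s34 by (intro mult_left_mono) auto
      also have "\<dots> \<le> (real n)\<^sup>2 * real s" using zero_le_power2[of "real n"] by (simp add: mult_right_mono)
      finally show ?thesis unfolding X(1) using m s0 by (simp add: field_simps)
    qed
    then have "(real N / real s) ^ i \<le> X ^ i" by (intro power_mono) auto
    also have "\<dots> = exp (real i * ln X)" using X0 by (simp add: exp_of_nat_mult)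
    also have "\<dots> \<le> exp (real m / 2)"
    proof -
      have "real i * ln X \<le> real (a choose 2) * ln X" using ia X(2) by (intro mult_right_mono) auto
      then show ?thesis using a2 by simp
    qed
    finally have Xi: "(real N / real s) ^ i \<le> exp (real m / 2)" .
    have "real (N choose (s + i)) \<le> (real N / real s) ^ i * real (N choose s)" by (rule binomial_above_le[OF s0])
    also have "\<dots> \<le> exp (real m / 2) * real (N choose s)" by (intro mult_right_mono Xi) simp
    finally have "exp (- (4 * real j)) * real (N choose j) \<le> exp (- (4 * real j)) * (exp (real m / 2) * real (N choose s))"
      unfolding ji by (intro mult_left_mono) auto
    also have "\<dots> = exp (- (4 * real j) + real m / 2) * real (N choose s)"
      by (simp add: mult.assoc[symmetric] exp_add[symmetric])
    also have "\<dots> \<le> exp (- (real m / 2)) * real (N choose s)"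
      using False s34 by (intro mult_right_mono) auto
    finally show ?thesis .
  qed
  have "real (card {G \<in> ind_C4_free_graphs n m. contained_in G (M, E)}) \<le> real (card M choose j)"
    unfolding j_def using card_contained_le[OF P Em] by simp
  also have "\<dots> \<le> exp (- (real m / 2)) * real (N choose s)" by (rule order_trans[OF c1 c2])
  also have "\<dots> \<le> exp (- (real m / 2)) * real (card (ind_C4_free_graphs n m))"
    unfolding N_def s_def using split_graphs_le[of a n m] am2 a by (intro mult_left_mono) auto
  finally show ?thesis .
qed

text \<open>Comparison with split graphs of clique size about \<open>(1 + rho / 8) * k\<close>. This
  is large enough for \<open>(1 + rho / 16) * k * n\<close> free pairs, more than \<open>M\<close>
  has, and small enough for the clique to use fewer edges than \<open>E\<close> by the fraction
  \<open>rho / 4\<close>. The first saves on the \<open>j\<close> chosen edges, the second on those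
  in \<open>E\<close>, and \<open>m = j + card E\<close>.\<close>

lemma few_graphs_if_many_edges:
  assumes P: "M \<subseteq> complete_edges n" "E \<subseteq> complete_edges n" and Em: "card E \<le> m"
    and k: "k * real n = real (card M)" "24 \<le> rho * k" and n: "n > 0" and rho: "0 < rho" "rho \<le> 1"
    and km: "4 * real m \<le> k * real n" and mn: "8192 * real m \<le> rho\<^sup>2 * (real n)\<^sup>2"
    and E: "(1 + rho) * k\<^sup>2 < 2 * real (card E)"
  shows "real (card {G \<in> ind_C4_free_graphs n m. contained_in G (M, E)})
    \<le> exp (- (rho / 32 * real m)) * real (card (ind_C4_free_graphs n m))"
proof -
  define a where "a = nat \<lceil>(1 + rho / 8) * k\<rceil>"
  have "0 < rho * k" using k by linarith
  then have k0: "k > 0" using rho by (simp add: zero_less_mult_iff)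
  have al: "(1 + rho / 8) * k \<le> real a" unfolding a_def by linarith
  have "real a \<le> (1 + rho / 8) * k + 1" unfolding a_def using rho k0 by (simp add: of_nat_ceiling)
  also have "\<dots> \<le> (1 + rho / 6) * k" using k(2) by (simp add: algebra_simps)
  finally have au: "real a \<le> (1 + rho / 6) * k" .
  have rk: "rho * k \<le> k" using rho k0 by simp
  have "(1 + rho / 6) * k = k + rho * k / 6" by (simp add: algebra_simps)
  then have a2k: "real a \<le> 2 * k" using au rk k0 by linarith
  have k2: "k\<^sup>2 \<le> 2 * real m"
  proof -
    have "1 * k\<^sup>2 \<le> (1 + rho) * k\<^sup>2" using rho by (intro mult_right_mono) auto
    then show ?thesis using E Em by linarith
  qed
  have kn: "64 * k \<le> rho * real n"
  proof (rule power2_le_imp_le)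
    have "(64 * k)\<^sup>2 = 4096 * k\<^sup>2" by (simp add: power_mult_distrib)
    also have "\<dots> \<le> (rho * real n)\<^sup>2" using k2 mn by (simp add: power_mult_distrib)
    finally show "(64 * k)\<^sup>2 \<le> (rho * real n)\<^sup>2" .
  qed (use rho in auto)
  have rn: "rho * real n \<le> real n" using rho by (simp add: mult_left_le_one_le)
  have an: "a \<le> n" using a2k kn rn k0 by linarith
  have aE: "real (a choose 2) \<le> (1 - rho / 4) * real (card E)"
  proof -
    have "real (a choose 2) \<le> (real a)\<^sup>2 / 2" by (rule real_choose_two_le)
    also have "\<dots> \<le> ((1 + rho / 6) * k)\<^sup>2 / 2" using au by (intro divide_right_mono power_mono) auto
    also have "\<dots> = (1 + rho / 6)\<^sup>2 * k\<^sup>2 / 2" by (simp add: power_mult_distrib)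
    also have "\<dots> \<le> ((1 - rho / 4) * (1 + rho)) * k\<^sup>2 / 2"
    proof (intro divide_right_mono mult_right_mono)
      have "rho * rho \<le> rho * 1" using rho by (intro mult_left_mono) auto
      then show "(1 + rho / 6)\<^sup>2 \<le> (1 - rho / 4) * (1 + rho)"
      proof -
        have "(1 + rho / 6)\<^sup>2 = 1 + rho / 3 + rho * rho / 36"
          "(1 - rho / 4) * (1 + rho) = 1 + 3 * rho / 4 - rho * rho / 4"
          by (simp_all add: power2_eq_square field_simps)
        then show ?thesis using \<open>rho * rho \<le> rho * 1\<close> rho(1) by linarith
      qed
    qed auto
    also have "\<dots> = (1 - rho / 4) * ((1 + rho) * k\<^sup>2 / 2)" by simp
    also have "\<dots> \<le> (1 - rho / 4) * real (card E)" using E rho by (intro mult_left_mono) auto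
    finally show ?thesis .
  qed
  have "(1 - rho / 4) * real (card E) \<le> 1 * real (card E)" using rho by (intro mult_right_mono) auto
  then have am: "a choose 2 \<le> m" using aE Em by linarith
  define N where "N = a * (n - a)"
  define s where "s = m - (a choose 2)"
  define j where "j = m - card E"
  have Nr: "real N = real a * (real n - real a)" unfolding N_def using an by (simp add: of_nat_diff)
  have Nl: "(1 + rho / 16) * (k * real n) \<le> real N"
  proof -
    have "(1 + rho / 16) * (k * real n) \<le> ((1 + rho / 8) * (1 - rho / 32)) * (k * real n)"
    proof (intro mult_right_mono)
      have "rho * rho \<le> rho * 1" using rho by (intro mult_left_mono) auto
      then show "1 + rho / 16 \<le> (1 + rho / 8) * (1 - rho / 32)"
      proof -
        have "(1 + rho / 8) * (1 - rho / 32) = 1 + 3 * rho / 32 - rho * rho / 256" by (simp add: field_simps)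
        then show ?thesis using \<open>rho * rho \<le> rho * 1\<close> rho(1) by linarith
      qed
    qed (use k0 in auto)
    also have "\<dots> = ((1 + rho / 8) * k) * ((1 - rho / 32) * real n)" by simp
    also have "\<dots> \<le> real a * (real n - real a)"
    proof (intro mult_mono al)
      show "(1 - rho / 32) * real n \<le> real n - real a" using a2k kn by (simp add: algebra_simps)
    qed (use rho in auto)
    finally show ?thesis unfolding Nr .
  qed
  have "1 * (k * real n) \<le> (1 + rho / 16) * (k * real n)" using rho k0 by (intro mult_right_mono) auto
  then have kN: "k * real n \<le> real N" using Nl by linarith
  have N0: "N > 0" using kN k0 n by (smt (verit) mult_pos_pos of_nat_0_less_iff)
  have N4: "4 * s \<le> N" using kN km unfolding s_def by linarith
  have js: "j \<le> s" using aE \<open>(1 - rho / 4) * real (card E) \<le> 1 * real (card E)\<close> unfolding j_def s_def by linarith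
  have sj: "rho / 4 * real (card E) \<le> real (s - j)"
    using aE Em am js unfolding j_def s_def by (simp add: of_nat_diff algebra_simps)
  have c1: "real (card M choose j) \<le> exp (- (rho / 32 * real j)) * real (N choose j)"
  proof -
    have "real (card M choose j) \<le> (real (card M) / real N) ^ j * real (N choose j)"
      using kN N0 unfolding k(1) by (intro binomial_ratio_le) auto
    also have "\<dots> \<le> exp (- (rho / 32)) ^ j * real (N choose j)"
    proof (intro mult_right_mono power_mono)
      have "exp (rho / 32) \<le> 1 + 2 * (rho / 32)" using rho exp_bound_lemma[of "rho / 32"] by simp
      then have "exp (rho / 32) * real (card M) \<le> (1 + rho / 16) * real (card M)" by (intro mult_right_mono) auto
      also have "\<dots> \<le> real N" using Nl unfolding k(1) .
      finally show "real (card M) / real N \<le> exp (- (rho / 32))" using N0 by (simp add: exp_minus field_simps)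
    qed auto
    also have "exp (- (rho / 32)) ^ j = exp (- (rho / 32 * real j))" by (simp add: exp_of_nat_mult[symmetric] mult.commute)
    finally show ?thesis .
  qed
  have "real (card {G \<in> ind_C4_free_graphs n m. contained_in G (M, E)}) \<le> real (card M choose j)"
    unfolding j_def using card_contained_le[OF P Em] by simp
  also have "\<dots> \<le> exp (- (rho / 32 * real j)) * real (N choose (s - (s - j)))" using c1 js by simp
  also have "\<dots> \<le> exp (- (rho / 32 * real j)) * (exp (- real (s - j)) * real (N choose s))"
    by (intro mult_left_mono binomial_below_le[OF N4]) auto
  also have "\<dots> = exp (- (rho / 32 * real j) - real (s - j)) * real (N choose s)"
    by (simp add: mult.assoc[symmetric] exp_add[symmetric])
  also have "\<dots> \<le> exp (- (rho / 32 * real m)) * real (N choose s)"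
  proof -
    have "real m = real j + real (card E)" unfolding j_def using Em by (simp add: of_nat_diff)
    then have "rho / 32 * real m = rho / 32 * real j + rho / 32 * real (card E)" by (simp only: distrib_left)
    moreover have "rho / 32 * real (card E) \<le> rho / 4 * real (card E)" using rho by (intro mult_right_mono) auto
    ultimately have "- (rho / 32 * real j) - real (s - j) \<le> - (rho / 32 * real m)" using sj by linarith
    then show ?thesis by (intro mult_right_mono) simp_all
  qed
  also have "\<dots> \<le> exp (- (rho / 32 * real m)) * real (card (ind_C4_free_graphs n m))"
    unfolding N_def s_def using split_graphs_le[OF an am] by (intro mult_left_mono) auto
  finally show ?thesis .
qed

section \<open>Iterated refinement\<close>

text \<open>This pregraph contains the complete graph only. It is put into every family of
  containers to make it nonempty, so that the logarithm of its size is nonnegative.\<close>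

lemma almost_split_complete:
  assumes "0 \<le> \<epsilon>"
  shows "almost_split n \<epsilon> ({}, complete_edges n)"
proof -
  have w: "edges_within (complete_edges n) {1..n} = complete_edges n" "edges_within {} {} = {}"
    unfolding edges_within_def complete_edges_def by auto
  have "(1 - \<epsilon>) * real (n choose 2) \<le> 1 * real (n choose 2)" using assms by (intro mult_right_mono) auto
  then have "{1..n} \<union> {} = {1..n} \<and> {1..n} \<inter> {} = {} \<and>
      card (complete_edges n) \<le> card {1..n} choose 2 \<and>
      real (card (edges_within (complete_edges n) {1..n})) \<ge> (1 - \<epsilon>) * real (card {1..n} choose 2) \<and>
      real (card (edges_within {} {})) \<le> 7 * sqrt \<epsilon> * real (card {1..n}) * real n"
    using assms by (simp add: w[simplified] card_complete_edges)
  then have "\<exists>U W. U \<union> W = {1..n} \<and> U \<inter> W = {} \<and>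
      card (complete_edges n) \<le> card U choose 2 \<and>
      real (card (edges_within (complete_edges n) U)) \<ge> (1 - \<epsilon>) * real (card U choose 2) \<and>
      real (card (edges_within {} W)) \<le> 7 * sqrt \<epsilon> * real (card U) * real n"
    by (intro exI[of _ "{1..n}"] exI[of _ "{}"])
  then show ?thesis unfolding almost_split_def is_pregraph_def by simp
qed

text \<open>\<open>a\<close> is the clique size of the split graphs used for comparison,
  \<open>a / 200\<close> the resulting lower bound on \<open>k\<close> for pregraphs that still
  matter, \<open>r\<close> the square of that bound, and \<open>b\<close> the number of hits allowed
  per query tree. \<open>b3\<close> and \<open>b4\<close> say that the weights with three and with
  four fixed vertices fit the profile, with \<open>k\<close> cancelled or replaced by its lower
  bound.\<close>

locale container_scale =
  fixes n m a b :: nat and rho X r R' :: real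
  assumes rho: "0 < rho" "rho \<le> 1 / 10000"
    and m: "m > 0" and a: "2 * a \<le> n" "a > 0"
    and X: "X = (real n)\<^sup>2 / real m" "2 \<le> ln X" "(real a)\<^sup>2 * ln X \<le> real m"
    and am: "1600 * real m \<le> real a * real n"
    and mn: "8 * 10 ^ 24 * real m \<le> rho ^ 20 * (real n)\<^sup>2"
    and a_large: "10 ^ 12 \<le> rho ^ 10 * (real a / 200)"
    and r_large: "10 ^ 12 * real n \<le> rho ^ 10 * r"
    and r: "r = (real a / 200)\<^sup>2" and R': "R' = 2 * (10 ^ 20 / rho ^ 20) * 2 ^ 130"
    and b: "b > 0" "b \<le> 2 * m"
    and b3: "4 * real m * (real n)\<^sup>2 \<le> (real b)\<^sup>2 * (real a / 200)"
    and b4: "32 * (real m)\<^sup>2 * real n ^ 4 \<le> real b ^ 5"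
    and br: "8 * real b * R' \<le> r" "8193 * R' * real (2 * m) \<le> r * real b"
begin

definition negligible :: "pregraph \<Rightarrow> bool" where
  "negligible P \<longleftrightarrow> real (card {G \<in> ind_C4_free_graphs n m. contained_in G P})
     \<le> exp (- (rho / 32 * real m)) * real (card (ind_C4_free_graphs n m))"

definition terminal :: "pregraph \<Rightarrow> bool" where
  "terminal P \<longleftrightarrow> almost_split n (100 * sqrt rho) P \<or> negligible P"

definition steps_bound :: nat where
  "steps_bound = 12 * ((8194 * (2 * m) + 1) * (n\<^sup>2 + 1) ^ (2 * b)) ^ 6"

text \<open>A refinement step lowers this by at least 1, as it either multiplies \<open>card M\<close> by at most
  \<open>1 - 1 / (2 R')\<close> or adds at least \<open>r / (8 R')\<close> edges.\<close>

definition potential :: "pregraph \<Rightarrow> real" where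
  "potential P = 2 * R' * ln (max 1 (real (card (fst P)))) + (real m - real (card (snd P))) * (8 * R' / r)"

lemma n0: "n > 0" using a by simp

lemma rho_power: "rho ^ i \<le> 1" "0 < rho ^ i"
  using rho by (auto intro: power_le_one)

lemma R_large: "400 \<le> 10 ^ 20 / rho ^ 20" "1 \<le> R'"
proof -
  have "10 ^ 20 * rho ^ 20 \<le> 10 ^ 20 * (1::real)" by (intro mult_left_mono rho_power) simp
  then have 1: "10 ^ 20 \<le> 10 ^ 20 / rho ^ 20" using rho_power(2)[of 20] by (simp add: field_simps)
  show 2: "400 \<le> 10 ^ 20 / rho ^ 20" by (rule order_trans[OF _ 1]) simp
  have "(1::real) \<le> 2 ^ 130" by simp
  then have "1 * 1 \<le> (2 * (10 ^ 20 / rho ^ 20)) * 2 ^ 130" using 2 by (intro mult_mono) linarith+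
  then show "1 \<le> R'" unfolding R' by simp
qed

lemma r_pos: "r > 0"
  unfolding r using a by simp

lemma negligible_if_few_mixed:
  assumes "is_pregraph n (M, E)" "card E \<le> m" "200 * real (card M) \<le> real a * real n"
  shows "negligible (M, E)"
proof -
  have P: "M \<subseteq> complete_edges n" "E \<subseteq> complete_edges n" using assms(1) unfolding is_pregraph_def by auto
  have "real (card {G \<in> ind_C4_free_graphs n m. contained_in G (M, E)})
    \<le> exp (- (real m / 2)) * real (card (ind_C4_free_graphs n m))"
    by (rule few_graphs_if_few_mixed[OF P assms(2) m a X am assms(3)])
  also have "\<dots> \<le> exp (- (rho / 32 * real m)) * real (card (ind_C4_free_graphs n m))"
  proof (rule mult_right_mono)
    have "rho / 32 * real m \<le> 1 / 2 * real m" using rho by (intro mult_right_mono) auto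
    then show "exp (- (real m / 2)) \<le> exp (- (rho / 32 * real m))" by simp
  qed simp
  finally show ?thesis unfolding negligible_def .
qed

lemma negligible_if_too_many_edges: "m < card E \<Longrightarrow> negligible (M, E)"
  unfolding negligible_def by (simp only: card_contained_zero card.empty) simp

text \<open>Each way of being negligible is excluded, which gives the bounds on \<open>E\<close> and
  \<open>k\<close>. The weighting has two regimes: for \<open>k\<^sup>2 \<ge> 8 * m\<close> the set
  \<open>E\<close> is small against \<open>k\<^sup>2\<close> and full neighbourhoods work; for
  smaller \<open>k\<close> one has \<open>k\<close> far below \<open>n\<close>, and a pregraph
  without a spread weighting would be almost split, hence terminal.\<close>

lemma not_terminal:
  assumes P: "is_pregraph n (M, E)" and nt: "\<not> terminal (M, E)" and k: "k = real (card M) / real n"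
  shows "card E \<le> m" "real a / 200 \<le> k" "2 * real (card E) \<le> (1 + rho) * k\<^sup>2"
    "spread_c4s (10 ^ 20 / rho ^ 20) n k M E"
proof -
  have ME: "M \<subseteq> complete_edges n" "E \<subseteq> complete_edges n" "M \<inter> E = {}" using P unfolding is_pregraph_def by auto
  have nn: "\<not> negligible (M, E)" and na: "\<not> almost_split n (100 * sqrt rho) (M, E)"
    using nt unfolding terminal_def by auto
  show Em: "card E \<le> m" using negligible_if_too_many_edges nn by (meson not_le)
  have kn: "k * real n = real (card M)" unfolding k using n0 by simp
  show ka: "real a / 200 \<le> k"
  proof (rule ccontr)
    assume "\<not> real a / 200 \<le> k"
    then have "200 * k * real n \<le> real a * real n" by (intro mult_right_mono) auto
    then have "200 * real (card M) \<le> real a * real n" using kn by simp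
    then show False using negligible_if_few_mixed[OF P Em] nn by simp
  qed
  have a12: "10 ^ 12 \<le> rho ^ 10 * k"
    by (rule order_trans[OF a_large mult_left_mono[OF ka]]) (use rho_power(2)[of 10] in simp)
  have ar: "rho ^ 10 * x \<le> x" if "0 \<le> x" for x :: real
    using mult_right_mono[OF rho_power(1)[of 10] that] by simp
  have k0: "k > 0" using ka a by (smt (verit) divide_pos_pos of_nat_0_less_iff)
  have k40: "40 \<le> k" 
  proof -
    have "40 \<le> (10::real) ^ 12" by simp
    then show ?thesis using a12 ar[OF less_imp_le[OF k0]] by linarith
  qed
  have "rho ^ 10 \<le> rho ^ 1" using rho by (intro power_decreasing) auto
  then have "rho ^ 10 * k \<le> rho * k" using k0 by (intro mult_right_mono) auto
  then have rk: "24 \<le> rho * k" using a12 by simp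
  have rk2: "r \<le> k\<^sup>2" unfolding r using ka by (intro power_mono) auto
  have kr: "10 ^ 12 * real n \<le> rho ^ 10 * k\<^sup>2"
    by (rule order_trans[OF r_large mult_left_mono[OF rk2]]) (use rho_power(2)[of 10] in simp)
  have k2n: "40 * real n \<le> k\<^sup>2" 
  proof -
    have "40 * real n \<le> 10 ^ 12 * real n" by (intro mult_right_mono) simp_all
    then show ?thesis using kr ar[OF zero_le_power2[of k]] by linarith
  qed
  have mn2: "8192 * real m \<le> rho\<^sup>2 * (real n)\<^sup>2"
  proof -
    have "rho ^ 20 \<le> rho\<^sup>2" using rho by (intro power_decreasing) auto
    then have "rho ^ 20 * (real n)\<^sup>2 \<le> rho\<^sup>2 * (real n)\<^sup>2" by (intro mult_right_mono) auto
    then show ?thesis using mn by simp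
  qed
  show Ek: "2 * real (card E) \<le> (1 + rho) * k\<^sup>2"
  proof (rule ccontr)
    assume c: "\<not> 2 * real (card E) \<le> (1 + rho) * k\<^sup>2"
    have "real a / 200 * real n \<le> k * real n" using ka by (intro mult_right_mono) auto
    then have "4 * real m \<le> k * real n" using am by simp
    then have "negligible (M, E)" unfolding negligible_def using c rho
      by (intro few_graphs_if_many_edges[OF ME(1,2) Em kn rk n0 _ _ _ mn2]) auto
    then show False using nn by simp
  qed
  show "spread_c4s (10 ^ 20 / rho ^ 20) n k M E"
  proof (cases "8 * real m \<le> k\<^sup>2")
    case True
    interpret pregraph n M E k by unfold_locales (use ME kn k0 n0 in auto)
    have "8 * real (card E) \<le> k\<^sup>2" using True Em by linarith
    then show ?thesis using k2n by (intro spread_dense k40 R_large(1)) simp_all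
  next
    case False
    have nk: "10 ^ 12 * k \<le> rho ^ 10 * real n"
    proof (rule power2_le_imp_le)
      have "(10 ^ 12 * k)\<^sup>2 = 10 ^ 24 * k\<^sup>2" by (simp add: power_mult_distrib)
      also have "\<dots> \<le> rho ^ 20 * (real n)\<^sup>2" using False mn by simp
      also have "\<dots> = (rho ^ 10 * real n)\<^sup>2" by (simp add: power_mult_distrib power_mult[symmetric])
      finally show "(10 ^ 12 * k)\<^sup>2 \<le> (rho ^ 10 * real n)\<^sup>2" .
    qed (use rho in auto)
    interpret sparse_pregraph n M E k rho
      by unfold_locales (use ME kn k0 n0 rho Ek a12 nk kr in auto)
    show ?thesis
    proof (rule ccontr)
      assume ns: "\<not> ?thesis"
      have "sqrt rho \<le> 1 / 100" using rho by (intro real_le_lsqrt) (simp_all add: power_divide)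
      then have "almost_split n (100 * sqrt rho) (M, E)" by (intro almost_split_if_not_spread[OF ns]) simp_all
      then show False using na by simp
    qed
  qed
qed

lemma refine:
  assumes P: "is_pregraph n (M, E)" and nt: "\<not> terminal (M, E)"
  shows "\<exists>D. finite D \<and> card D \<le> steps_bound \<and>
    (\<forall>Q\<in>D. is_pregraph n Q \<and> potential Q \<le> potential (M, E) - 1) \<and>
    (\<forall>G\<in>ind_C4_free_graphs n m. contained_in G (M, E) \<longrightarrow> (\<exists>Q\<in>D. contained_in G Q))"
proof -
  define k where "k = real (card M) / real n"
  define v where "v = 2 * card M"
  note nt' = not_terminal[OF P nt k_def]
  have ME: "M \<subseteq> complete_edges n" "E \<subseteq> complete_edges n" "M \<inter> E = {}" using P unfolding is_pregraph_def by auto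
  have fME: "finite M" "finite E" using ME finite_complete_edges finite_subset by blast+
  have kn: "k * real n = real (card M)" unfolding k_def using n0 by simp
  have k0: "k > 0" using nt'(2) a by (smt (verit) divide_pos_pos of_nat_0_less_iff)
  have vk: "real v = 2 * (k * real n)" unfolding v_def kn by simp
  have akn: "real a / 200 * real n \<le> k * real n" using nt'(2) by (intro mult_right_mono) auto
  have bv: "b \<le> v"
  proof -
    have "real b \<le> real v" unfolding vk using am akn b(2) by linarith
    then show ?thesis by simp
  qed
  have rk: "r \<le> k\<^sup>2" unfolding r using nt'(2) by (intro power_mono) auto
  have rv: "r \<le> real v"
  proof -
    have "r \<le> real a / 200 * real n" unfolding r power2_eq_square using a by (intro mult_left_mono) auto
    then show ?thesis unfolding vk using akn k0 by (smt (verit) mult_nonneg_nonneg of_nat_0_le_iff)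
  qed
  define R where "R = 10 ^ 20 / rho ^ 20"
  have R0: "1 \<le> R" "0 < R" using R_large unfolding R_def by auto
  have T3: "R / k ^ 3 \<le> 2 * R * ((real b / real (2 * m)) * (real b / real v) / real v)"
  proof -
    have "4 * real m * (real n)\<^sup>2 \<le> (real b)\<^sup>2 * k"
      by (rule order_trans[OF b3]) (use nt'(2) in \<open>intro mult_left_mono; simp\<close>)
    then have "(4 * real m * (real n)\<^sup>2) * (R * k\<^sup>2) \<le> ((real b)\<^sup>2 * k) * (R * k\<^sup>2)"
      using R0 by (intro mult_right_mono) auto
    then have "(4 * real m * (real n)\<^sup>2) * (R * k\<^sup>2) / ((4 * real m * (real n)\<^sup>2) * k ^ 5)
        \<le> ((real b)\<^sup>2 * k) * (R * k\<^sup>2) / ((4 * real m * (real n)\<^sup>2) * k ^ 5)"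
      using k0 by (intro divide_right_mono) auto
    moreover have "(4 * real m * (real n)\<^sup>2) * (R * k\<^sup>2) / ((4 * real m * (real n)\<^sup>2) * k ^ 5) = R / k ^ 3"
      using m n0 k0 by (simp add: eval_nat_numeral)
    moreover have "((real b)\<^sup>2 * k) * (R * k\<^sup>2) / ((4 * real m * (real n)\<^sup>2) * k ^ 5)
        = 2 * R * ((real b / real (2 * m)) * (real b / real v) / real v)"
      unfolding vk using k0 n0 m by (simp add: field_simps eval_nat_numeral)
    ultimately show ?thesis by linarith
  qed
  have T4: "R / k ^ 4 \<le> 2 * R * ((real b / real (2 * m))\<^sup>2 * (real b / real v) ^ 3 / real v)"
  proof -
    have "2 * R * ((real b / real (2 * m))\<^sup>2 * (real b / real v) ^ 3 / real v)
        = R * real b ^ 5 / ((32 * (real m)\<^sup>2 * real n ^ 4) * k ^ 4)"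
      unfolding vk using k0 n0 m by (simp add: field_simps eval_nat_numeral)
    moreover have "R * (32 * (real m)\<^sup>2 * real n ^ 4) \<le> R * real b ^ 5" using b4 R0 by (intro mult_left_mono) auto
    then have "R * (32 * (real m)\<^sup>2 * real n ^ 4) / ((32 * (real m)\<^sup>2 * real n ^ 4) * k ^ 4)
        \<le> R * real b ^ 5 / ((32 * (real m)\<^sup>2 * real n ^ 4) * k ^ 4)"
      by (intro divide_right_mono) auto
    moreover have "R * (32 * (real m)\<^sup>2 * real n ^ 4) / ((32 * (real m)\<^sup>2 * real n ^ 4) * k ^ 4) = R / k ^ 4"
      using m n0 by simp
    ultimately show ?thesis by linarith
  qed
  have bR: "8 * real b * R' \<le> real v" using br(1) rv by linarith
  have "\<exists>D. finite D \<and> card D \<le> 12 * ((8194 * (2 * m) + 1) * (n\<^sup>2 + 1) ^ (2 * b)) ^ 6 \<and>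
    (\<forall>P\<in>D. fst P \<subseteq> M \<and> E \<subseteq> snd P \<and> snd P \<subseteq> E \<union> M \<and> fst P \<inter> snd P = {} \<and>
      (real (card (fst P)) \<le> real (card M) - real (card M) / (2 * R') \<or> real (card E) + r / (8 * R') \<le> real (card (snd P)))) \<and>
    (\<forall>G\<in>ind_C4_free_graphs n m. contained_in G (M, E) \<longrightarrow> (\<exists>P\<in>D. contained_in G P))"
    by (rule container_step[OF ME nt'(4)[folded R_def] kn k0 n0 R0(1) v_def R'[folded R_def] b(1) b(2) bv rk rv
        T3 T4 bR br refl])
  then obtain D where D: "finite D" "card D \<le> 12 * ((8194 * (2 * m) + 1) * (n\<^sup>2 + 1) ^ (2 * b)) ^ 6"
    "\<forall>P\<in>D. fst P \<subseteq> M \<and> E \<subseteq> snd P \<and> snd P \<subseteq> E \<union> M \<and> fst P \<inter> snd P = {} \<and>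
      (real (card (fst P)) \<le> real (card M) - real (card M) / (2 * R') \<or> real (card E) + r / (8 * R') \<le> real (card (snd P)))"
    "\<forall>G\<in>ind_C4_free_graphs n m. contained_in G (M, E) \<longrightarrow> (\<exists>P\<in>D. contained_in G P)"
    by (elim exE conjE)
  \<comment> \<open>At least two mixed pairs remain, so after multiplication by a factor of at least
    \<open>1 / 2\<close> the bound is still at least 1 and the maximum inside
    \<open>potential\<close> does no harm.\<close>
  have M2: "2 \<le> real (card M)"
  proof -
    have "8 * real m \<le> k * real n" using am akn by simp
    then show ?thesis unfolding kn using m by linarith
  qed
  have "is_pregraph n Q \<and> potential Q \<le> potential (M, E) - 1" if Q: "Q \<in> D" for Q
  proof -
    obtain M' E' where Qe: "Q = (M', E')" by (cases Q)
    have Q': "M' \<subseteq> M" "E \<subseteq> E'" "E' \<subseteq> E \<union> M" "M' \<inter> E' = {}"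
      "real (card M') \<le> real (card M) - real (card M) / (2 * R') \<or> real (card E) + r / (8 * R') \<le> real (card E')"
      using bspec[OF D(3) Q] unfolding Qe by simp_all
    have fE': "finite E'" using Q'(3) fME finite_subset by blast
    have "M' \<subseteq> complete_edges n" "E' \<subseteq> complete_edges n" using Q'(1,3) ME by blast+
    then have "is_pregraph n Q" unfolding is_pregraph_def Qe using Q'(4) by simp
    moreover have cM: "card M' \<le> card M" by (rule card_mono[OF fME(1) Q'(1)])
    have cE: "card E \<le> card E'" by (rule card_mono[OF fE' Q'(2)])
    have q: "8 * R' / r > 0" using R_large r_pos by simp
    have "potential (M', E') \<le> potential (M, E) - 1"
      using Q'(5)
    proof
      assume 1: "real (card M') \<le> real (card M) - real (card M) / (2 * R')"
      define x where "x = 1 - 1 / (2 * R')"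
      have x: "1 / 2 \<le> x" using R_large(2) unfolding x_def by (simp add: field_simps)
      have "real (card M) - real (card M) / (2 * R') = real (card M) * x"
        unfolding x_def by (simp add: right_diff_distrib)
      moreover have "2 * (1 / 2) \<le> real (card M) * x" using M2 x by (intro mult_mono) auto
      ultimately have "max 1 (real (card M')) \<le> real (card M) * x" using 1 by simp
      then have "ln (max 1 (real (card M'))) \<le> ln (real (card M) * x)" by (subst ln_le_cancel_iff) linarith+
      also have "\<dots> = ln (real (card M)) + ln x" using M2 x by (intro ln_mult_pos) auto
      also have "ln x \<le> x - 1" using x by (intro ln_le_minus_one) auto
      also have "x - 1 = - (1 / (2 * R'))" unfolding x_def by simp
      finally have "2 * R' * ln (max 1 (real (card M'))) \<le> 2 * R' * (ln (real (card M)) + - (1 / (2 * R')))"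
        using R_large(2) by (intro mult_left_mono) auto
      also have "\<dots> = 2 * R' * ln (max 1 (real (card M))) - 1"
        using R_large(2) M2 by (simp add: right_diff_distrib)
      finally have p1: "2 * R' * ln (max 1 (real (card M'))) \<le> 2 * R' * ln (max 1 (real (card M))) - 1" .
      have "(real m - real (card E')) * (8 * R' / r) \<le> (real m - real (card E)) * (8 * R' / r)"
        using cE q by (intro mult_right_mono) auto
      then show ?thesis unfolding potential_def fst_conv snd_conv using p1 by linarith
    next
      assume 1: "real (card E) + r / (8 * R') \<le> real (card E')"
      have "2 * R' * ln (max 1 (real (card M'))) \<le> 2 * R' * ln (max 1 (real (card M)))"
        using R_large(2) cM by (intro mult_left_mono) (auto simp: ln_le_cancel_iff)
      moreover have "(real m - real (card E')) * (8 * R' / r) \<le> (real m - real (card E) - r / (8 * R')) * (8 * R' / r)"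
        using 1 q by (intro mult_right_mono) auto
      moreover have "(real m - real (card E) - r / (8 * R')) * (8 * R' / r) = (real m - real (card E)) * (8 * R' / r) - 1"
      proof -
        have "r / (8 * R') * (8 * R' / r) = 1" using R_large(2) r_pos by simp
        then show ?thesis by (simp only: left_diff_distrib)
      qed
      ultimately show ?thesis unfolding potential_def fst_conv snd_conv by linarith
    qed
    then show ?thesis using calculation unfolding Qe by simp
  qed
  then show ?thesis unfolding steps_bound_def using D by (intro exI[of _ D] conjI ballI) blast+
qed

lemma potential_pos:
  assumes P: "is_pregraph n (M, E)" and nt: "\<not> terminal (M, E)"
  shows "0 \<le> potential (M, E)"
proof -
  have "card E \<le> m" by (rule not_terminal(1)[OF P nt refl])
  then have "0 \<le> (real m - real (card E)) * (8 * R' / r)" using R_large(2) r_pos by (intro mult_nonneg_nonneg) auto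
  moreover have "0 \<le> 2 * R' * ln (max 1 (real (card M)))" using R_large(2) by (intro mult_nonneg_nonneg) auto
  ultimately show ?thesis unfolding potential_def by simp
qed

lemma steps_bound_pos: "1 \<le> steps_bound"
  unfolding steps_bound_def One_nat_def Suc_le_eq by simp

text \<open>Pregraphs that are not terminal have nonnegative potential and each refinement lowers it
  by 1, so \<open>t\<close> rounds suffice; each round multiplies the size of the family by at most
  \<open>steps_bound\<close>.\<close>

lemma terminal_family:
  assumes "is_pregraph n P" "potential P < real t"
  shows "\<exists>D. finite D \<and> card D \<le> steps_bound ^ t \<and> (\<forall>Q\<in>D. terminal Q) \<and>
    (\<forall>G\<in>ind_C4_free_graphs n m. contained_in G P \<longrightarrow> (\<exists>Q\<in>D. contained_in G Q))"
  using assms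
proof (induction t arbitrary: P)
  {
    fix P t assume "terminal P"
    then have "finite {P} \<and> card {P} \<le> steps_bound ^ t \<and> (\<forall>Q\<in>{P}. terminal Q) \<and>
    (\<forall>G\<in>ind_C4_free_graphs n m. contained_in G P \<longrightarrow> (\<exists>Q\<in>{P}. contained_in G Q))"
      using one_le_power[OF steps_bound_pos, of t] by simp
    then have "\<exists>D. finite D \<and> card D \<le> steps_bound ^ t \<and> (\<forall>Q\<in>D. terminal Q) \<and>
    (\<forall>G\<in>ind_C4_free_graphs n m. contained_in G P \<longrightarrow> (\<exists>Q\<in>D. contained_in G Q))" by (rule exI)
  } note triv = this
  case 0
  have "terminal P"
  proof (rule ccontr)
    assume "\<not> terminal P"
    then have "0 \<le> potential P" using potential_pos[of "fst P" "snd P"] 0 by simp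
    then show False using 0 by simp
  qed
  then show ?case by (rule triv)
next
  case (Suc t)
  show ?case
  proof (cases "terminal P")
    case True
    have "finite {P} \<and> card {P} \<le> steps_bound ^ Suc t \<and> (\<forall>Q\<in>{P}. terminal Q) \<and>
    (\<forall>G\<in>ind_C4_free_graphs n m. contained_in G P \<longrightarrow> (\<exists>Q\<in>{P}. contained_in G Q))"
      using True one_le_power[OF steps_bound_pos, of "Suc t"] by simp
    then show ?thesis by (rule exI)
  next
    case False
    have "\<exists>D. finite D \<and> card D \<le> steps_bound \<and>
    (\<forall>Q\<in>D. is_pregraph n Q \<and> potential Q \<le> potential P - 1) \<and>
    (\<forall>G\<in>ind_C4_free_graphs n m. contained_in G P \<longrightarrow> (\<exists>Q\<in>D. contained_in G Q))"
      using refine[of "fst P" "snd P"] Suc.prems(1) False by simp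
    then obtain D where D: "finite D" "card D \<le> steps_bound"
      "\<forall>Q\<in>D. is_pregraph n Q \<and> potential Q \<le> potential P - 1"
      "\<forall>G\<in>ind_C4_free_graphs n m. contained_in G P \<longrightarrow> (\<exists>Q\<in>D. contained_in G Q)" by (elim exE conjE)
    have "\<forall>Q\<in>D. \<exists>D'. finite D' \<and> card D' \<le> steps_bound ^ t \<and> (\<forall>Q'\<in>D'. terminal Q') \<and>
    (\<forall>G\<in>ind_C4_free_graphs n m. contained_in G Q \<longrightarrow> (\<exists>Q'\<in>D'. contained_in G Q'))"
    proof
      fix Q assume "Q \<in> D"
      then have "is_pregraph n Q" "potential Q \<le> potential P - 1" using D(3) by auto
      then show "\<exists>D'. finite D' \<and> card D' \<le> steps_bound ^ t \<and> (\<forall>Q'\<in>D'. terminal Q') \<and>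
    (\<forall>G\<in>ind_C4_free_graphs n m. contained_in G Q \<longrightarrow> (\<exists>Q'\<in>D'. contained_in G Q'))"
        using Suc.prems(2) by (intro Suc.IH) auto
    qed
    then have "\<exists>D'. \<forall>Q\<in>D. finite (D' Q) \<and> card (D' Q) \<le> steps_bound ^ t \<and> (\<forall>Q'\<in>D' Q. terminal Q') \<and>
    (\<forall>G\<in>ind_C4_free_graphs n m. contained_in G Q \<longrightarrow> (\<exists>Q'\<in>D' Q. contained_in G Q'))" by (rule bchoice)
    then obtain D' where D': "\<forall>Q\<in>D. finite (D' Q) \<and> card (D' Q) \<le> steps_bound ^ t \<and> (\<forall>Q'\<in>D' Q. terminal Q') \<and>
    (\<forall>G\<in>ind_C4_free_graphs n m. contained_in G Q \<longrightarrow> (\<exists>Q'\<in>D' Q. contained_in G Q'))" by (elim exE)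
    have 1: "card (\<Union>Q\<in>D. D' Q) \<le> steps_bound ^ Suc t"
    proof -
      have "card (\<Union>Q\<in>D. D' Q) \<le> (\<Sum>Q\<in>D. card (D' Q))" by (rule card_UN_le[OF D(1)])
      also have "\<dots> \<le> (\<Sum>Q\<in>D. steps_bound ^ t)" using D' by (intro sum_mono) simp
      also have "\<dots> \<le> steps_bound * steps_bound ^ t" using D(2) by simp
      finally show ?thesis by simp
    qed
    have 2: "finite (\<Union>Q\<in>D. D' Q)" using D(1) D' by simp
    have 3: "\<forall>Q\<in>(\<Union>Q\<in>D. D' Q). terminal Q" using D' by simp
    have 4: "\<forall>G\<in>ind_C4_free_graphs n m. contained_in G P \<longrightarrow> (\<exists>Q\<in>(\<Union>Q\<in>D. D' Q). contained_in G Q)"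
    proof (intro ballI impI)
      fix G assume G: "G \<in> ind_C4_free_graphs n m" "contained_in G P"
      then obtain Q where Q: "Q \<in> D" "contained_in G Q" using D(4) by blast
      then obtain Q' where "Q' \<in> D' Q" "contained_in G Q'" using D' G(1) by blast
      then show "\<exists>Q\<in>(\<Union>Q\<in>D. D' Q). contained_in G Q" using Q(1) by blast
    qed
    show ?thesis using 1 2 3 4 by (intro exI conjI)
  qed
qed

text \<open>The almost split leaves are the containers. A graph in none of them lies in a negligible
  leaf, and a union bound over the leaves counts these graphs.\<close>

lemma containers:
  assumes t: "potential (complete_edges n, {}) < real t"
  shows "\<exists>C. (\<forall>P\<in>C. almost_split n (100 * sqrt rho) P) \<and> 1 \<le> card C \<and> card C \<le> steps_bound ^ t + 1 \<and>
    real (card {G \<in> ind_C4_free_graphs n m. \<not> (\<exists>P\<in>C. contained_in G P)})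
      \<le> real (steps_bound ^ t) * (exp (- (rho / 32 * real m)) * real (card (ind_C4_free_graphs n m)))"
proof -
  let ?F = "ind_C4_free_graphs n m"
  have "is_pregraph n (complete_edges n, {})" unfolding is_pregraph_def by simp
  from terminal_family[OF this t] obtain D where D: "finite D" "card D \<le> steps_bound ^ t" "\<forall>Q\<in>D. terminal Q"
    "\<forall>G\<in>?F. contained_in G (complete_edges n, {}) \<longrightarrow> (\<exists>Q\<in>D. contained_in G Q)" by (elim exE conjE)
  define C where "C = insert ({}, complete_edges n) {Q \<in> D. almost_split n (100 * sqrt rho) Q}"
  have fC: "finite C" unfolding C_def using D(1) by simp
  have C1: "1 \<le> card C" using fC unfolding C_def by (simp add: card_gt_0_iff Suc_le_eq)
  have "card C \<le> Suc (card {Q \<in> D. almost_split n (100 * sqrt rho) Q})" unfolding C_def using D(1) by (intro card_insert_le_m1) simp_all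
  also have "\<dots> \<le> Suc (card D)" using D(1) by (simp add: card_mono)
  finally have C2: "card C \<le> steps_bound ^ t + 1" using D(2) by simp
  have C3: "\<forall>P\<in>C. almost_split n (100 * sqrt rho) P" unfolding C_def using almost_split_complete rho by auto
  let ?N = "{Q \<in> D. negligible Q}"
  have "{G \<in> ?F. \<not> (\<exists>P\<in>C. contained_in G P)} \<subseteq> (\<Union>Q\<in>?N. {G \<in> ?F. contained_in G Q})"
  proof
    fix G assume G: "G \<in> {G \<in> ?F. \<not> (\<exists>P\<in>C. contained_in G P)}"
    then have "contained_in G (complete_edges n, {})" unfolding contained_in_def ind_C4_free_graphs_def by auto
    then obtain Q where Q: "Q \<in> D" "contained_in G Q" using D(4) G by blast
    then have "Q \<notin> C" using G by blast
    then have "negligible Q" using Q(1) D(3) unfolding C_def terminal_def by blast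
    then show "G \<in> (\<Union>Q\<in>?N. {G \<in> ?F. contained_in G Q})" using Q G by blast
  qed
  then have "card {G \<in> ?F. \<not> (\<exists>P\<in>C. contained_in G P)} \<le> card (\<Union>Q\<in>?N. {G \<in> ?F. contained_in G Q})"
    using D(1) finite_ind_C4_free_graphs[of n m] by (intro card_mono) auto
  also have "\<dots> \<le> (\<Sum>Q\<in>?N. card {G \<in> ?F. contained_in G Q})" using D(1) by (intro card_UN_le) simp
  finally have "real (card {G \<in> ?F. \<not> (\<exists>P\<in>C. contained_in G P)}) \<le> real (\<Sum>Q\<in>?N. card {G \<in> ?F. contained_in G Q})"
    by (rule of_nat_mono)
  also have "\<dots> = (\<Sum>Q\<in>?N. real (card {G \<in> ?F. contained_in G Q}))" by simp
  also have "\<dots> \<le> (\<Sum>Q\<in>?N. exp (- (rho / 32 * real m)) * real (card ?F))"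
    by (intro sum_mono) (simp add: negligible_def)
  also have "\<dots> = real (card ?N) * (exp (- (rho / 32 * real m)) * real (card ?F))" by simp
  also have "\<dots> \<le> real (steps_bound ^ t) * (exp (- (rho / 32 * real m)) * real (card ?F))"
  proof (rule mult_right_mono)
    have "card ?N \<le> card D" using D(1) by (intro card_mono) auto
    then show "real (card ?N) \<le> real (steps_bound ^ t)" using D(2) by (intro of_nat_mono) simp
  qed simp
  finally show ?thesis using C1 C2 C3 by (intro exI[of _ C] conjI)
qed

end

section \<open>Choice of the parameters\<close>

lemma (in container_scale) steps_bound_le:
  assumes m2: "m \<le> n\<^sup>2" and n: "16389 \<le> n"
  shows "steps_bound \<le> n ^ (55 * b)"
proof -
  have "8194 * (2 * m) + 1 \<le> 16389 * m" using m by simp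
  also have "\<dots> \<le> n * n\<^sup>2" using n m2 by (intro mult_le_mono) auto
  finally have 1: "8194 * (2 * m) + 1 \<le> n ^ 3" by (simp add: power3_eq_cube power2_eq_square)
  have "n\<^sup>2 * 2 \<le> n\<^sup>2 * n" using n by (intro mult_le_mono) auto
  moreover have "1 \<le> n\<^sup>2" using n by simp
  moreover have "n\<^sup>2 * n = n ^ 3" by (simp add: power3_eq_cube power2_eq_square)
  ultimately have 2: "n\<^sup>2 + 1 \<le> n ^ 3" by linarith
  have "(8194 * (2 * m) + 1) * (n\<^sup>2 + 1) ^ (2 * b) \<le> n ^ 3 * (n ^ 3) ^ (2 * b)"
    by (intro mult_le_mono 1 power_mono 2) auto
  also have "\<dots> = n ^ (3 + 6 * b)" by (simp add: power_add power_mult[symmetric])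
  also have "\<dots> \<le> n ^ (9 * b)" using b(1) n by (intro power_increasing) auto
  finally have "12 * ((8194 * (2 * m) + 1) * (n\<^sup>2 + 1) ^ (2 * b)) ^ 6 \<le> n * (n ^ (9 * b)) ^ 6"
    using n by (intro mult_le_mono power_mono) auto
  also have "\<dots> = n ^ (1 + 54 * b)" by (simp add: power_mult[symmetric])
  also have "\<dots> \<le> n ^ (55 * b)" using b(1) n by (intro power_increasing) auto
  finally show ?thesis unfolding steps_bound_def .
qed

text \<open>With \<open>\<ell> = (ln n)\<^sup>1\<^sup>/\<^sup>4\<close> the admissible range forces \<open>m\<^sup>3 \<ge> n\<^sup>4 \<ell>\<^sup>4\<^sup>8\<close>. We take
  \<open>b \<approx> m / \<ell>\<^sup>9\<close>, so that the \<open>O(\<ell>\<^sup>4)\<close> refinement steps, each costing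
  \<open>O(b \<ell>\<^sup>4)\<close> in the logarithm of the number of containers, cost \<open>O(m / \<ell>)\<close> in total.\<close>

lemma containers_large:
  fixes n m :: nat and rho ell R' :: real
  assumes rho: "0 < rho" "rho \<le> 1 / 10000" and m: "m > 0" and n: "16389 \<le> n"
    and R': "R' = 2 * (10 ^ 20 / rho ^ 20) * 2 ^ 130"
    and ell: "ell ^ 4 = ln (real n)" "640000000000 * R' \<le> rho * ell" "160000 * 10 ^ 24 \<le> rho ^ 20 * ell"
    and m3: "real n ^ 4 * ell ^ 48 \<le> real m ^ 3" and mn: "10 ^ 16 * real m \<le> (real n)\<^sup>2"
    and mlam: "8 * 10 ^ 24 * real m \<le> rho ^ 20 * (real n)\<^sup>2"
  shows "\<exists>C. (\<forall>P\<in>C. almost_split n (100 * sqrt rho) P) \<and> 1 \<le> card C \<and>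
    real (card C) \<le> exp (10000000000 * R' * (real m / ell)) \<and>
    real (card {G \<in> ind_C4_free_graphs n m. \<not> (\<exists>P\<in>C. contained_in G P)})
      \<le> exp (- (rho / 64 * real m)) * real (card (ind_C4_free_graphs n m))"
proof -
  define X where "X = (real n)\<^sup>2 / real m"
  define y where "y = ln X"
  define z where "z = real m / y"
  \<comment> \<open>The largest clique size with \<open>a\<^sup>2 * ln X \<le> m\<close>: a larger
    clique spoils the comparison with split graphs, a smaller one weakens the lower bound on
    \<open>k\<close>.\<close>
  define a where "a = nat \<lfloor>sqrt z\<rfloor>"
  define r where "r = (real a / 200)\<^sup>2"
  define w where "w = real m / ell ^ 9"
  define b where "b = nat \<lceil>w\<rceil>"
  have n0: "real n > 0" "1 \<le> real n" using n by auto
  have m1: "1 \<le> real m" using m by simp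
  have rp: "rho ^ i \<le> 1" "0 < rho ^ i" for i using rho by (auto intro: power_le_one)
  have R1: "1 \<le> R'"
  proof -
    have "10 ^ 20 * rho ^ 20 \<le> 10 ^ 20 * (1::real)" by (intro mult_left_mono rp) simp
    then have "10 ^ 20 \<le> 10 ^ 20 / rho ^ 20" using rp(2)[of 20] by (simp add: field_simps)
    moreover have "(1::real) \<le> 10 ^ 20" by simp
    ultimately have "1 \<le> 2 * (10 ^ 20 / rho ^ 20)" by linarith
    then have "1 * 1 \<le> (2 * (10 ^ 20 / rho ^ 20)) * 2 ^ 130" by (intro mult_mono) auto
    then show ?thesis unfolding R' by simp
  qed
  have ell0: "0 < ell"
  proof -
    have "0 < rho * ell" using ell(2) R1 by linarith
    then show ?thesis using rho by (simp add: zero_less_mult_iff)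
  qed
  have ellR: "640000000000 * R' \<le> ell"
  proof -
    have "rho * ell \<le> 1 * ell" using rho ell0 by (intro mult_right_mono) auto
    then show ?thesis using ell(2) by simp
  qed
  have ell1: "1 \<le> ell" using ellR R1 by linarith
  have ellp: "ell \<le> ell ^ i" if "1 \<le> i" for i using power_increasing[OF that ell1] by simp
  have ell2: "1 \<le> ell ^ i" for i using ell1 by (rule one_le_power)
  \<comment> \<open>A cruder bound, sufficient for the lower-order conditions: \<open>n ^ 4\<close>
    is weakened to \<open>n ^ 3\<close> before taking cube roots.\<close>
  have ml: "real n * ell ^ 16 \<le> real m"
  proof (rule power_le_imp_le_base)
    have "(real n * ell ^ 16) ^ Suc 2 = real n ^ 3 * ell ^ 48" by (simp add: power_mult_distrib power_mult[symmetric])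
    also have "\<dots> \<le> real n ^ 4 * ell ^ 48" using n0 ell0 by (intro mult_right_mono power_increasing) auto
    also note m3
    finally show "(real n * ell ^ 16) ^ Suc 2 \<le> real m ^ Suc 2" by (simp only: eval_nat_numeral)
  qed simp
  have mn1: "real n \<le> real m"
  proof -
    have "real n * 1 \<le> real n * ell ^ 16" using ell2[of 16] n0 by (intro mult_left_mono) auto
    then show ?thesis using ml by simp
  qed
  have mell: "ell ^ 16 \<le> real m"
  proof -
    have "1 * ell ^ 16 \<le> real n * ell ^ 16" using n0 ell0 by (intro mult_right_mono) auto
    then show ?thesis using ml by simp
  qed
  have X16: "10 ^ 16 \<le> X" unfolding X_def using mn m by (simp add: field_simps)
  have X0: "X > 0" "100 \<le> X" using X16 by auto
  have y2: "2 \<le> y"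
  proof -
    have "exp (2::real) = exp 1 ^ 2" using exp_of_nat_mult[of 2 "1::real"] by simp
    also have "\<dots> \<le> 3 ^ 2" by (intro power_mono exp_le) auto
    finally have "exp 2 \<le> X" using X0 by simp
    then show ?thesis unfolding y_def using X0 by (simp add: ln_ge_iff)
  qed
  have yl: "y \<le> ell ^ 4"
  proof -
    have "(real n)\<^sup>2 \<le> real n * real m" unfolding power2_eq_square using mn1 by (intro mult_left_mono) auto
    then have "X \<le> real n" unfolding X_def using m by (simp add: field_simps)
    then show ?thesis unfolding y_def ell(1) using X0 n0 by simp
  qed
  \<comment> \<open>Prepares the bound \<open>am\<close> on \<open>a * n\<close>: as
    \<open>X\<close> is at least \<open>10 ^ 16\<close>, its logarithm is at most
    \<open>2 * sqrt X\<close> and hence at most \<open>X / 50000000\<close>.\<close>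
  have yX: "50000000 * y * real m \<le> (real n)\<^sup>2"
  proof -
    have "y = 2 * ln (sqrt X)" unfolding y_def using X0 by (simp add: ln_sqrt)
    moreover have "ln (sqrt X) \<le> sqrt X - 1" using X0 by (intro ln_le_minus_one) simp
    ultimately have 1: "y \<le> 2 * sqrt X" by linarith
    have "10 ^ 8 \<le> sqrt X" using X16 by (intro real_le_rsqrt) simp
    then have "10 ^ 8 * sqrt X \<le> sqrt X * sqrt X" using X0 by (intro mult_right_mono) auto
    then have "50000000 * y \<le> X" using 1 X0 by simp
    then have "50000000 * y * real m \<le> X * real m" by (intro mult_right_mono) auto
    then show ?thesis unfolding X_def using m by simp
  qed
  have zm: "z * y = real m" unfolding z_def using y2 by simp
  have z1: "1 \<le> z"
  proof -
    have "y \<le> ell ^ 16" using yl power_increasing[of 4 16 ell] ell1 by simp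
    then show ?thesis unfolding z_def using mell y2 by (simp add: field_simps)
  qed
  have a1: "1 \<le> a" unfolding a_def using z1 by (simp add: le_nat_iff le_floor_iff)
  have asq: "real a \<le> sqrt z" "sqrt z \<le> 2 * real a"
  proof -
    have "0 \<le> sqrt z" using z1 by simp
    then have "real a \<le> sqrt z \<and> sqrt z < real a + 1" unfolding a_def by linarith
    then show "real a \<le> sqrt z" "sqrt z \<le> 2 * real a" using a1 by auto
  qed
  have az: "(real a)\<^sup>2 \<le> z" "z \<le> 4 * (real a)\<^sup>2"
  proof -
    have "(real a)\<^sup>2 \<le> (sqrt z)\<^sup>2" by (rule power_mono[OF asq(1)]) simp
    moreover have "(sqrt z)\<^sup>2 \<le> (2 * real a)\<^sup>2" by (rule power_mono[OF asq(2)]) (use z1 in simp)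
    ultimately show "(real a)\<^sup>2 \<le> z" "z \<le> 4 * (real a)\<^sup>2" using z1 by (simp_all add: power_mult_distrib)
  qed
  have zle: "z * 2 \<le> real m" unfolding zm[symmetric] using y2 z1 by (intro mult_left_mono) auto
  have aX: "(real a)\<^sup>2 * ln X \<le> real m"
    unfolding y_def[symmetric] zm[symmetric] using az(1) y2 by (intro mult_right_mono) auto
  have mn': "real m * 2 \<le> (real n)\<^sup>2" using mn m1 by simp
  have an: "2 * a \<le> n"
  proof -
    have "(2 * real a)\<^sup>2 \<le> (real n)\<^sup>2" using az zle mn' by (simp add: power_mult_distrib)
    then have "2 * real a \<le> real n" by (rule power2_le_imp_le) simp
    then show ?thesis by simp
  qed
  have am: "1600 * real m \<le> real a * real n"
  proof (rule power2_le_imp_le)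
    have "(1600 * real m)\<^sup>2 = 2560000 * (real m * real m)" by (simp add: power2_eq_square)
    also have "\<dots> \<le> 12500000 * (real m * real m)" by (intro mult_right_mono) auto
    also have "\<dots> = z / 4 * (50000000 * y * real m)" using zm by (simp add: algebra_simps)
    also have "\<dots> \<le> (real a)\<^sup>2 * (real n)\<^sup>2" using az yX y2 by (intro mult_mono) auto
    finally show "(1600 * real m)\<^sup>2 \<le> (real a * real n)\<^sup>2" by (simp add: power_mult_distrib)
  qed simp
  have rz: "z \<le> 160000 * r" unfolding r_def using az by (simp add: power_divide)
  have r0: "r > 0" unfolding r_def using a1 by simp
  have mr: "real m \<le> 160000 * r * ell ^ 4"
    unfolding zm[symmetric] using rz yl y2 z1 r0 by (intro mult_mono) auto
  have r12: "real n * ell ^ 12 \<le> 160000 * r"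
  proof -
    have "(real n * ell ^ 12) * ell ^ 4 = real n * ell ^ 16" by (simp add: power_add[symmetric])
    also have "\<dots> \<le> (160000 * r) * ell ^ 4" using ml mr by linarith
    finally show ?thesis by (rule mult_right_le_imp_le) (use ell0 in simp)
  qed
  have r20: "10 ^ 24 * real n \<le> rho ^ 20 * r"
  proof -
    have "160000 * 10 ^ 24 * real n \<le> (rho ^ 20 * ell) * real n" using ell(3) by (intro mult_right_mono) auto
    also have "\<dots> = rho ^ 20 * (real n * ell)" by simp
    also have "\<dots> \<le> rho ^ 20 * (160000 * r)"
    proof (rule mult_left_mono)
      have "real n * ell \<le> real n * ell ^ 12" using ellp by (intro mult_left_mono) auto
      then show "real n * ell \<le> 160000 * r" using r12 by linarith
    qed (use rp(2)[of 20] in simp)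
    finally have "160000 * (10 ^ 24 * real n) \<le> 160000 * (rho ^ 20 * r)"
      by (simp only: mult.assoc mult.left_commute[of "rho ^ 20" 160000])
    then show ?thesis by (rule mult_left_le_imp_le) simp
  qed
  have r_large: "10 ^ 12 * real n \<le> rho ^ 10 * r"
  proof -
    have "10 ^ 12 * real n \<le> 10 ^ 24 * real n" by (intro mult_right_mono) auto
    also have "\<dots> \<le> rho ^ 20 * r" by (rule r20)
    also have "\<dots> \<le> rho ^ 10 * r" using rho r0 by (intro mult_right_mono power_decreasing) auto
    finally show ?thesis .
  qed
  have a_large: "10 ^ 12 \<le> rho ^ 10 * (real a / 200)"
  proof (rule power2_le_imp_le)
    have "10 ^ 24 * 1 \<le> 10 ^ 24 * real n" using n0 by (intro mult_left_mono) auto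
    also note r20
    also have "rho ^ 20 * r = (rho ^ 10 * (real a / 200))\<^sup>2"
      unfolding r_def power_mult_distrib by (simp add: power_mult[symmetric])
    finally show "(10 ^ 12)\<^sup>2 \<le> (rho ^ 10 * (real a / 200))\<^sup>2" by simp
  qed (use rp(2)[of 10] in simp)
  have w0: "w > 0" unfolding w_def using m ell0 by simp
  have w1: "1 \<le> w"
  proof -
    have "ell ^ 9 \<le> ell ^ 16" using ell1 by (intro power_increasing) auto
    then show ?thesis unfolding w_def using mell ell0 by (simp add: field_simps)
  qed
  have wm: "w * ell ^ 9 = real m" unfolding w_def using ell0 by simp
  have wlm: "w \<le> real m"
  proof -
    have "w * 1 \<le> w * ell ^ 9" using ell2[of 9] w0 by (intro mult_left_mono) auto
    then show ?thesis using wm by simp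
  qed
  have bw: "w \<le> real b" "real b \<le> 2 * w" unfolding b_def using w1 by linarith+
  have b0: "b > 0" using bw w0 by linarith
  have b2m: "b \<le> 2 * m"
  proof -
    have "real b \<le> real (2 * m)" using bw wlm by simp
    then show ?thesis by simp
  qed
  \<comment> \<open>Of the 48 powers of \<open>ell\<close> in \<open>m3\<close> the fifth power of
    \<open>w = m / ell ^ 9\<close> uses 45; the remaining \<open>ell ^ 3\<close> is left to absorb
    constants.\<close>
  have m5: "(real m)\<^sup>2 * real n ^ 4 * ell ^ 3 \<le> w ^ 5"
  proof -
    have "((real m)\<^sup>2 * real n ^ 4 * ell ^ 3) * ell ^ 45 = (real m)\<^sup>2 * (real n ^ 4 * ell ^ 48)"
      by (simp add: power_add[symmetric])
    also have "\<dots> \<le> (real m)\<^sup>2 * real m ^ 3" using m3 by (intro mult_left_mono) auto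
    also have "\<dots> = (w * ell ^ 9) ^ 5" unfolding wm by (simp add: power_add[symmetric])
    also have "\<dots> = w ^ 5 * ell ^ 45" by (simp add: power_mult_distrib power_mult[symmetric])
    finally show ?thesis by (rule mult_right_le_imp_le) (use ell0 in simp)
  qed
  have ell32: "32 \<le> ell ^ i" if "1 \<le> i" for i using ellp[OF that] ellR R1 by linarith
  have b4: "32 * (real m)\<^sup>2 * real n ^ 4 \<le> real b ^ 5"
  proof -
    have "32 * ((real m)\<^sup>2 * real n ^ 4) \<le> ell ^ 3 * ((real m)\<^sup>2 * real n ^ 4)"
      using ell32 by (intro mult_right_mono) auto
    also have "\<dots> \<le> w ^ 5" using m5 by (simp add: mult_ac)
    also have "\<dots> \<le> real b ^ 5" using bw w0 by (intro power_mono) auto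
    finally show ?thesis by simp
  qed
  \<comment> \<open>Proved after squaring, because the size of \<open>a\<close> is known through
    \<open>r\<close>, a multiple of its square.\<close>
  have b3: "4 * real m * (real n)\<^sup>2 \<le> (real b)\<^sup>2 * (real a / 200)"
  proof (rule power2_le_imp_le)
    have "16 * 160000 \<le> ell ^ 8" using ellp[of 8] ellR R1 by linarith
    then have "(16 * 160000) * ((real m)\<^sup>2 * real n ^ 4) \<le> ell ^ 8 * ((real m)\<^sup>2 * real n ^ 4)"
      by (intro mult_right_mono) auto
    also have "\<dots> = ((real m)\<^sup>2 * real n ^ 4 * ell ^ 3) * ell ^ 5" by (simp add: power_add[symmetric])
    also have "\<dots> \<le> w ^ 5 * ell ^ 5" using m5 ell0 by (intro mult_right_mono) auto
    also have "\<dots> \<le> w ^ 4 * (160000 * r)"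
    proof -
      have "(w * ell ^ 5) * ell ^ 4 = real m" unfolding wm[symmetric] by (simp add: power_add[symmetric])
      then have "(w * ell ^ 5) * ell ^ 4 \<le> (160000 * r) * ell ^ 4" using mr by simp
      then have "w * ell ^ 5 \<le> 160000 * r" by (rule mult_right_le_imp_le) (use ell0 in simp)
      then have "w ^ 4 * (w * ell ^ 5) \<le> w ^ 4 * (160000 * r)" using w0 by (intro mult_left_mono) auto
      moreover have "w ^ 4 * (w * ell ^ 5) = w ^ 5 * ell ^ 5" by (simp add: eval_nat_numeral)
      ultimately show ?thesis by simp
    qed
    also have "\<dots> \<le> real b ^ 4 * (160000 * r)" using bw w0 r0 by (intro mult_right_mono power_mono) auto
    finally have "16 * ((real m)\<^sup>2 * real n ^ 4) \<le> real b ^ 4 * r" by (simp add: mult.commute)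
    moreover have "(4 * real m * (real n)\<^sup>2)\<^sup>2 = 16 * ((real m)\<^sup>2 * real n ^ 4)"
      by (simp add: power_mult_distrib power_mult[symmetric])
    moreover have "((real b)\<^sup>2 * (real a / 200))\<^sup>2 = real b ^ 4 * r"
      unfolding r_def power_mult_distrib by (simp add: power_mult[symmetric])
    ultimately show "(4 * real m * (real n)\<^sup>2)\<^sup>2 \<le> ((real b)\<^sup>2 * (real a / 200))\<^sup>2" by simp
  qed simp
  have wr: "w * ell ^ 5 \<le> 160000 * r"
  proof -
    have "(w * ell ^ 5) * ell ^ 4 = real m" unfolding wm[symmetric] by (simp add: power_add[symmetric])
    then have "(w * ell ^ 5) * ell ^ 4 \<le> (160000 * r) * ell ^ 4" using mr by simp
    then show ?thesis by (rule mult_right_le_imp_le) (use ell0 in simp)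
  qed
  have br1: "8 * real b * R' \<le> r"
  proof -
    have "8 * real b * R' \<le> 8 * (2 * w) * R'" using bw R1 by (intro mult_right_mono) auto
    also have "\<dots> = w * (16 * R')" by simp
    also have "\<dots> \<le> w * (ell ^ 5 / 160000)"
      using ellp[of 5] ellR R1 w0 by (intro mult_left_mono) linarith+
    also have "\<dots> \<le> r" using wr by simp
    finally show ?thesis .
  qed
  have br2: "8193 * R' * real (2 * m) \<le> r * real b"
  proof -
    have "real n * ell ^ 12 = (real n * ell ^ 3) * ell ^ 9" by (simp add: power_add[symmetric])
    moreover have "1 * ell ^ 3 \<le> real n * ell ^ 3" using n0 ell0 by (intro mult_right_mono) auto
    then have "160000 * (16386 * R') \<le> real n * ell ^ 3" using ellp[of 3] ellR R1 by linarith
    then have "(160000 * (16386 * R')) * ell ^ 9 \<le> (real n * ell ^ 3) * ell ^ 9"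
      using ell0 by (intro mult_right_mono) auto
    ultimately have "16386 * R' * ell ^ 9 \<le> r" using r12 by linarith
    then have "(16386 * R' * ell ^ 9) * w \<le> r * real b" using bw w0 r0 by (intro mult_mono) auto
    moreover have "8193 * R' * real (2 * m) = (16386 * R' * ell ^ 9) * w" unfolding of_nat_mult wm[symmetric] by simp
    ultimately show ?thesis by linarith
  qed
  interpret container_scale n m a b rho X r R'
    by unfold_locales (use rho m an a1 X_def y2 aX am mlam a_large r_large r_def R' b0 b2m b3 b4 br1 br2 in \<open>simp_all add: y_def\<close>)
  \<comment> \<open>Rounding up and adding 1 makes the inequality for the number of rounds strict,
    at a cost of at most 2.\<close>
  define t where "t = nat \<lceil>potential (complete_edges n, {})\<rceil> + 1"
  have p: "0 \<le> potential (complete_edges n, {})" "potential (complete_edges n, {}) \<le> 1280004 * (R' * ell ^ 4)"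
  proof -
    have e: "potential (complete_edges n, {}) = 2 * R' * ln (max 1 (real (n choose 2))) + real m * (8 * R' / r)"
      unfolding potential_def by (simp add: card_complete_edges)
    show "0 \<le> potential (complete_edges n, {})" unfolding e using R1 r0 by (intro add_nonneg_nonneg mult_nonneg_nonneg) auto
    have "real (n choose 2) \<le> (real n)\<^sup>2" using real_choose_two_le[of n] zero_le_power2[of "real n"] by linarith
    then have "ln (max 1 (real (n choose 2))) \<le> ln ((real n)\<^sup>2)" using n0 by (subst ln_le_cancel_iff) auto
    also have "\<dots> = 2 * ell ^ 4" unfolding ell(1) using n0 by (simp add: ln_realpow)
    finally have "2 * R' * ln (max 1 (real (n choose 2))) \<le> 2 * R' * (2 * ell ^ 4)"
      using R1 by (intro mult_left_mono) auto
    moreover have "real m * (8 * R' / r) \<le> (160000 * r * ell ^ 4) * (8 * R' / r)"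
      using mr R1 r0 by (intro mult_right_mono) auto
    moreover have "(160000 * r * ell ^ 4) * (8 * R' / r) = 1280000 * (R' * ell ^ 4)" using r0 by simp
    ultimately show "potential (complete_edges n, {}) \<le> 1280004 * (R' * ell ^ 4)" unfolding e by simp
  qed
  have t1: "potential (complete_edges n, {}) < real t" "real t \<le> potential (complete_edges n, {}) + 2"
    unfolding t_def using p by linarith+
  have "1 * 1 \<le> R' * ell ^ 4" using R1 ell2[of 4] by (intro mult_mono) auto
  then have tu: "real t \<le> 1280006 * (R' * ell ^ 4)" using t1 p by linarith
  \<comment> \<open>The logarithm of the number of leaves is at most
    \<open>55 * b * t * ln n\<close>, where \<open>b\<close> is of order \<open>m / ell ^ 9\<close>,
    \<open>t\<close> of order \<open>R' * ell ^ 4\<close> and \<open>ln n = ell ^ 4\<close>.\<close>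
  define Q where "Q = 1000000000 * R' * (real m / ell)"
  have sbt: "real (steps_bound ^ t) \<le> exp Q"
  proof -
    have "real m \<le> (real n)\<^sup>2" using mn' m1 by linarith
    then have "m \<le> n\<^sup>2" by (metis of_nat_le_iff of_nat_power)
    then have "steps_bound ^ t \<le> (n ^ (55 * b)) ^ t" by (intro power_mono steps_bound_le n) auto
    then have "real (steps_bound ^ t) \<le> real ((n ^ (55 * b)) ^ t)" by (rule of_nat_mono)
    also have "\<dots> = real n ^ (55 * b * t)" by (simp add: power_mult)
    also have "\<dots> = exp (real (55 * b * t) * ln (real n))" by (subst exp_of_nat_mult) (use n0 in simp)
    also have "\<dots> \<le> exp Q"
    proof -
      have "real (55 * b * t) * ln (real n) = 55 * (real b * real t) * ell ^ 4" unfolding ell(1) by simp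
      also have "\<dots> \<le> 55 * ((2 * w) * (1280006 * (R' * ell ^ 4))) * ell ^ 4"
        using bw tu ell0 w0 by (intro mult_left_mono mult_right_mono mult_mono) auto
      also have "\<dots> = 140800660 * (R' * (w * ell ^ 8))" by (simp add: power_add[symmetric])
      also have "w * ell ^ 8 = real m / ell" unfolding wm[symmetric] using ell0 by (simp add: eval_nat_numeral)
      also have "140800660 * (R' * (real m / ell)) \<le> 1000000000 * (R' * (real m / ell))"
        using R1 ell0 by (intro mult_right_mono) auto
      finally show ?thesis unfolding Q_def by simp
    qed
    finally show ?thesis .
  qed
  have "\<exists>C. (\<forall>P\<in>C. almost_split n (100 * sqrt rho) P) \<and> 1 \<le> card C \<and> card C \<le> steps_bound ^ t + 1 \<and>
    real (card {G \<in> ind_C4_free_graphs n m. \<not> (\<exists>P\<in>C. contained_in G P)})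
      \<le> real (steps_bound ^ t) * (exp (- (rho / 32 * real m)) * real (card (ind_C4_free_graphs n m)))"
    by (rule containers[OF t1(1)])
  then obtain C where C: "\<forall>P\<in>C. almost_split n (100 * sqrt rho) P" "1 \<le> card C" "card C \<le> steps_bound ^ t + 1"
    "real (card {G \<in> ind_C4_free_graphs n m. \<not> (\<exists>P\<in>C. contained_in G P)})
      \<le> real (steps_bound ^ t) * (exp (- (rho / 32 * real m)) * real (card (ind_C4_free_graphs n m)))" by (elim exE conjE)
  have ml1: "1 \<le> real m / ell" using mell ellp[of 16] ell0 by (simp add: field_simps)
  have Q1: "1 \<le> Q"
  proof -
    have "1 * 1 \<le> (1000000000 * R') * (real m / ell)" using ml1 R1 by (intro mult_mono) auto
    then show ?thesis unfolding Q_def by simp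
  qed
  have c: "real (card C) \<le> exp (10000000000 * R' * (real m / ell))"
  proof -
    have "real (card C) \<le> real (steps_bound ^ t) + 1" using C(3) by (metis of_nat_1 of_nat_add of_nat_mono)
    also have "\<dots> \<le> exp Q + exp Q" using sbt Q1 by (intro add_mono) auto
    also have "\<dots> = 2 * exp Q" by simp
    also have "\<dots> \<le> exp Q * exp Q"
    proof (rule mult_right_mono)
      show "2 \<le> exp Q" using exp_ge_add_one_self[of Q] Q1 by linarith
    qed simp
    also have "\<dots> = exp (2 * Q)" by (simp add: exp_add[symmetric])
    also have "\<dots> \<le> exp (10000000000 * R' * (real m / ell))"
    proof -
      have "10000000000 * R' * (real m / ell) = 10 * Q" unfolding Q_def by simp
      then show ?thesis using Q1 by simp
    qed
    finally show ?thesis .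
  qed
  have "real (steps_bound ^ t) * (exp (- (rho / 32 * real m)) * real (card (ind_C4_free_graphs n m)))
      \<le> exp Q * (exp (- (rho / 32 * real m)) * real (card (ind_C4_free_graphs n m)))"
    using sbt by (intro mult_right_mono) auto
  also have "\<dots> = exp (Q - rho / 32 * real m) * real (card (ind_C4_free_graphs n m))"
    by (simp add: mult.assoc[symmetric] exp_add[symmetric])
  \<comment> \<open>\<open>ell\<close> is so large that \<open>Q\<close> stays below
    \<open>rho / 64 * m\<close>; the union bound costs at most half of the exponent.\<close>
  also have "\<dots> \<le> exp (- (rho / 64 * real m)) * real (card (ind_C4_free_graphs n m))"
  proof (rule mult_right_mono)
    have "(640000000000 * R') * real m \<le> (rho * ell) * real m" using ell(2) by (intro mult_right_mono) auto
    then have "640000000000 * R' * real m / ell \<le> rho * ell * real m / ell" using ell0 by (intro divide_right_mono) auto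
    moreover have "640000000000 * R' * real m / ell = 640 * Q" unfolding Q_def by simp
    moreover have "rho * ell * real m / ell = rho * real m" using ell0 by simp
    moreover have "0 < Q" using Q1 by simp
    ultimately have "Q - rho / 32 * real m \<le> - (rho / 64 * real m)" by simp
    then show "exp (Q - rho / 32 * real m) \<le> exp (- (rho / 64 * real m))" by simp
  qed simp
  finally show ?thesis using C c by (intro exI[of _ C] conjI) linarith+
qed

lemma almost_split_mono:
  assumes "almost_split n \<delta> P" "0 \<le> \<delta>" "\<delta> \<le> \<epsilon>"
  shows "almost_split n \<epsilon> P"
proof -
  obtain M E where P: "P = (M, E)" by (cases P)
  have "\<exists>U W. U \<union> W = {1..n} \<and> U \<inter> W = {} \<and> card E \<le> card U choose 2 \<and>
      real (card (edges_within E U)) \<ge> (1 - \<delta>) * real (card U choose 2) \<and>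
      real (card (edges_within M W)) \<le> 7 * sqrt \<delta> * real (card U) * real n"
    using assms(1) unfolding almost_split_def P by simp
  then obtain U W where U: "U \<union> W = {1..n}" "U \<inter> W = {}" "card E \<le> card U choose 2"
      "real (card (edges_within E U)) \<ge> (1 - \<delta>) * real (card U choose 2)"
      "real (card (edges_within M W)) \<le> 7 * sqrt \<delta> * real (card U) * real n"
    by (elim exE conjE)
  have "(1 - \<epsilon>) * real (card U choose 2) \<le> (1 - \<delta>) * real (card U choose 2)"
    using assms(3) by (intro mult_right_mono) auto
  moreover have "7 * sqrt \<delta> * real (card U) * real n \<le> 7 * sqrt \<epsilon> * real (card U) * real n"
    using assms(3) by (intro mult_right_mono mult_left_mono) auto
  ultimately have "\<exists>U W. U \<union> W = {1..n} \<and> U \<inter> W = {} \<and> card E \<le> card U choose 2 \<and>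
      real (card (edges_within E U)) \<ge> (1 - \<epsilon>) * real (card U choose 2) \<and>
      real (card (edges_within M W)) \<le> 7 * sqrt \<epsilon> * real (card U) * real n"
    using U by (intro exI[of _ U] exI[of _ W] conjI) linarith+
  then show ?thesis using assms(1) unfolding almost_split_def P by simp
qed

text \<open>Cubing removes the fractional exponent, and \<open>(ln n) ^ 12\<close> is the 48th power
  of the fourth root of \<open>ln n\<close>.\<close>

lemma admissible_cube:
  assumes "admissible lam n m" "n > 0"
  shows "real n ^ 4 * sqrt (sqrt (ln (real n))) ^ 48 \<le> real m ^ 3"
proof -
  have l: "0 \<le> ln (real n)" using assms(2) by simp
  have "sqrt (sqrt (ln (real n))) ^ 48 = ((sqrt (sqrt (ln (real n))))\<^sup>2)\<^sup>2 ^ 12"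
    by (simp add: power_mult[symmetric])
  also have "\<dots> = (ln (real n) ^ 4) ^ 3" using l by (simp add: power_mult[symmetric])
  finally have e: "sqrt (sqrt (ln (real n))) ^ 48 = (ln (real n) ^ 4) ^ 3" .
  have "(real n powr (4 / 3)) ^ 3 = (real n powr (4 / 3)) powr real 3"
    using assms(2) by (subst powr_realpow) auto
  also have "\<dots> = real n powr (4 / 3 * real 3)" by (rule powr_powr)
  also have "\<dots> = real n powr real 4" by simp
  also have "\<dots> = real n ^ 4" using assms(2) by (subst powr_realpow) auto
  finally have "real n ^ 4 * sqrt (sqrt (ln (real n))) ^ 48 = (real n powr (4 / 3) * ln (real n) ^ 4) ^ 3"
    by (simp only: e power_mult_distrib)
  also have "\<dots> \<le> real m ^ 3"
    using assms(1) unfolding admissible_def by (intro power_mono) auto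
  finally show ?thesis .
qed

theorem theorem5p1:
  "\<forall>\<epsilon>::real. \<epsilon> > 0 \<longrightarrow>
     (\<exists>lam::real. lam > 0 \<and>
       (\<exists>h :: nat \<Rightarrow> nat \<Rightarrow> real. little_o_m lam h \<and>
         (\<forall>n m :: nat. admissible lam n m \<longrightarrow>
           (\<exists>C :: pregraph set.
              (\<forall>P\<in>C. almost_split n \<epsilon> P) \<and>
              real (card C) = exp (h n m) \<and>
              real (card {G \<in> ind_C4_free_graphs n m. \<not> (\<exists>P\<in>C. contained_in G P)})
                \<le> exp (- lam * real m) * real (card (ind_C4_free_graphs n m))))))"
proof (intro allI impI)
  fix \<epsilon> :: real assume eps: "\<epsilon> > 0"
  \<comment> \<open>The structure theorem works with a parameter of at most 1, and being almost
    split is monotone in the parameter. The square in \<open>rho\<close> makes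
    \<open>100 * sqrt rho\<close> equal to \<open>\<delta>\<close>.\<close>
  define \<delta> where "\<delta> = min \<epsilon> 1"
  define rho where "rho = (\<delta> / 100)\<^sup>2"
  define R' :: real where "R' = 2 * (10 ^ 20 / rho ^ 20) * 2 ^ 130"
  define ell where "ell n = sqrt (sqrt (ln (real n)))" for n :: nat
  have \<delta>: "0 < \<delta>" "\<delta> \<le> 1" "\<delta> \<le> \<epsilon>" unfolding \<delta>_def using eps by auto
  have rho: "0 < rho" "rho \<le> 1 / 10000" "100 * sqrt rho = \<delta>"
  proof -
    show "0 < rho" "100 * sqrt rho = \<delta>" unfolding rho_def using \<delta> by (simp_all add: real_sqrt_abs)
    have "(\<delta> / 100)\<^sup>2 \<le> (1 / 100)\<^sup>2" using \<delta> by (intro power_mono) auto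
    then show "rho \<le> 1 / 10000" unfolding rho_def by (simp add: power_divide)
  qed
  have R'0: "0 < R'" unfolding R'_def using rho by simp
  have ell_lim: "filterlim ell at_top sequentially" unfolding ell_def
    by (intro filterlim_compose[OF sqrt_at_top] filterlim_compose[OF ln_at_top] filterlim_real_sequentially)
  have "eventually (\<lambda>n. 640000000000 * R' / rho \<le> ell n \<and> 160000 * 10 ^ 24 / rho ^ 20 \<le> ell n) sequentially"
    using ell_lim unfolding filterlim_at_top by (intro eventually_conj) auto
  then obtain n1 where n1: "\<And>n. n1 \<le> n \<Longrightarrow> 640000000000 * R' / rho \<le> ell n \<and> 160000 * 10 ^ 24 / rho ^ 20 \<le> ell n"
    unfolding eventually_sequentially by blast
  define n0 where "n0 = max n1 16389"
  \<comment> \<open>The last entry rules out small \<open>n\<close>: if \<open>m \<ge> 1\<close>,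
    then \<open>m \<le> lam * n\<^sup>2\<close> forces \<open>n \<ge> n0\<close>, where all
    asymptotic inequalities hold, so only \<open>m = 0\<close> needs separate treatment.\<close>
  define lam where "lam = Min {1 / 10 ^ 16, rho ^ 20 / (8 * 10 ^ 24), rho / 64, 1 / (real n0)\<^sup>2}"
  have n0: "0 < n0" unfolding n0_def by simp
  have lam0: "lam > 0" unfolding lam_def using rho n0 by simp
  have lam: "lam \<le> 1 / 10 ^ 16" "lam \<le> rho ^ 20 / (8 * 10 ^ 24)" "lam \<le> rho / 64" "lam \<le> 1 / (real n0)\<^sup>2"
    unfolding lam_def by (intro Min_le; simp)+
  define Q where "Q n m C \<longleftrightarrow> (\<forall>P\<in>C. almost_split n \<epsilon> P) \<and> 1 \<le> card C \<and>
    real (card C) \<le> exp (10000000000 * R' * (real m / ell n)) \<and>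
    real (card {G \<in> ind_C4_free_graphs n m. \<not> (\<exists>P\<in>C. contained_in G P)})
      \<le> exp (- lam * real m) * real (card (ind_C4_free_graphs n m))" for n m C
  have ex: "\<exists>C. Q n m C" if adm: "admissible lam n m" for n m
  proof (cases "m = 0")
    case True
    \<comment> \<open>For \<open>m = 0\<close> the allowed exceptional fraction is
      \<open>exp 0 = 1\<close>, and the size bound is also 1, so one almost split pregraph is
      enough.\<close>
    have "card {G \<in> ind_C4_free_graphs n m. \<not> (\<exists>P\<in>{({}, complete_edges n)}. contained_in G P)}
      \<le> card (ind_C4_free_graphs n m)"
      by (intro card_mono finite_ind_C4_free_graphs) auto
    then have "Q n m {({}, complete_edges n)}"
      unfolding Q_def using True almost_split_complete[of \<epsilon> n] eps by simp
    then show ?thesis by (rule exI)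
  next
    case False
    have mn: "real m \<le> lam * (real n)\<^sup>2" using adm unfolding admissible_def by simp
    have mc: "real m \<le> c * (real n)\<^sup>2" if "lam \<le> c" for c
      using mn mult_right_mono[OF that zero_le_power2[of "real n"]] by linarith
    have nn: "n0 \<le> n"
    proof -
      have "1 \<le> real m" using False by simp
      also have "\<dots> \<le> 1 / (real n0)\<^sup>2 * (real n)\<^sup>2" by (rule mc[OF lam(4)])
      finally have "(real n0)\<^sup>2 \<le> (real n)\<^sup>2" using n0 by (simp add: field_simps)
      then have "real n0 \<le> real n" by (rule power2_le_imp_le) simp
      then show ?thesis by simp
    qed
    then have n: "16389 \<le> n" "n1 \<le> n" "0 < n" unfolding n0_def by auto
    have l4: "ell n ^ 4 = ln (real n)"
    proof -
      have "ell n ^ 4 = ((ell n)\<^sup>2)\<^sup>2" by (simp add: power_mult[symmetric])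
      also have "\<dots> = ln (real n)" unfolding ell_def using n by simp
      finally show ?thesis .
    qed
    have l1: "640000000000 * R' \<le> rho * ell n" "160000 * 10 ^ 24 \<le> rho ^ 20 * ell n"
      using n1[OF n(2)] rho by (simp_all add: pos_divide_le_eq mult.commute)
    have m1: "10 ^ 16 * real m \<le> (real n)\<^sup>2" using mc[OF lam(1)] by simp
    have m2: "8 * 10 ^ 24 * real m \<le> rho ^ 20 * (real n)\<^sup>2" using mc[OF lam(2)] by simp
    have m3: "real n ^ 4 * ell n ^ 48 \<le> real m ^ 3" unfolding ell_def by (rule admissible_cube[OF adm n(3)])
    have "\<exists>C. (\<forall>P\<in>C. almost_split n (100 * sqrt rho) P) \<and> 1 \<le> card C \<and>
      real (card C) \<le> exp (10000000000 * R' * (real m / ell n)) \<and>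
      real (card {G \<in> ind_C4_free_graphs n m. \<not> (\<exists>P\<in>C. contained_in G P)})
        \<le> exp (- (rho / 64 * real m)) * real (card (ind_C4_free_graphs n m))"
      by (rule containers_large[OF rho(1,2) _ n(1) R'_def l4 l1 m3 m1 m2]) (use False in simp)
    then obtain C where C: "\<forall>P\<in>C. almost_split n (100 * sqrt rho) P" "1 \<le> card C"
      "real (card C) \<le> exp (10000000000 * R' * (real m / ell n))"
      "real (card {G \<in> ind_C4_free_graphs n m. \<not> (\<exists>P\<in>C. contained_in G P)})
        \<le> exp (- (rho / 64 * real m)) * real (card (ind_C4_free_graphs n m))" by (elim exE conjE)
    have "\<forall>P\<in>C. almost_split n \<epsilon> P" using C(1) \<delta> almost_split_mono[of n \<delta> _ \<epsilon>] unfolding rho(3) by auto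
    moreover have "exp (- (rho / 64 * real m)) * real (card (ind_C4_free_graphs n m))
        \<le> exp (- lam * real m) * real (card (ind_C4_free_graphs n m))"
    proof (rule mult_right_mono)
      have "lam * real m \<le> rho / 64 * real m" by (intro mult_right_mono lam(3)) simp
      then show "exp (- (rho / 64 * real m)) \<le> exp (- lam * real m)" by simp
    qed simp
    ultimately have "Q n m C" unfolding Q_def using C(2-4) by (intro conjI) linarith+
    then show ?thesis by (rule exI)
  qed
  \<comment> \<open>The size has to equal \<open>exp (h n m)\<close> for one function
    \<open>h\<close>, so a family is fixed for every admissible pair and \<open>h\<close> is the
    logarithm of its size. Nonemptiness gives \<open>h n m \<ge> 0\<close>, so the upper bound also
    bounds the absolute value.\<close>
  define Cf where "Cf n m = (SOME C. Q n m C)" for n m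
  have Cf: "Q n m (Cf n m)" if "admissible lam n m" for n m
    unfolding Cf_def by (rule someI_ex[OF ex[OF that]])
  define h where "h n m = ln (real (card (Cf n m)))" for n m
  have "little_o_m lam h" unfolding little_o_m_def
  proof (intro allI impI)
    fix c :: real assume c: "c > 0"
    have "eventually (\<lambda>n. 10000000000 * R' / c \<le> ell n) sequentially"
      using ell_lim unfolding filterlim_at_top by blast
    then show "\<forall>\<^sub>F n in sequentially. \<forall>m. admissible lam n m \<longrightarrow> \<bar>h n m\<bar> \<le> c * real m"
    proof (rule eventually_mono, intro allI impI)
      fix n m assume e: "10000000000 * R' / c \<le> ell n" and adm: "admissible lam n m"
      have "0 < 10000000000 * R' / c" using c R'0 by simp
      then have l0: "0 < ell n" using e by linarith
      have Qn: "1 \<le> card (Cf n m)" "real (card (Cf n m)) \<le> exp (10000000000 * R' * (real m / ell n))"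
        using Cf[OF adm] unfolding Q_def by simp_all
      have "h n m \<le> ln (exp (10000000000 * R' * (real m / ell n)))"
        unfolding h_def using Qn by (subst ln_le_cancel_iff) auto
      also have "\<dots> = 10000000000 * R' / ell n * real m" by simp
      also have "\<dots> \<le> c * real m"
        using e c l0 by (intro mult_right_mono) (simp_all add: field_simps)
      finally show "\<bar>h n m\<bar> \<le> c * real m" using Qn unfolding h_def by simp
    qed
  qed
  moreover have "\<exists>C. (\<forall>P\<in>C. almost_split n \<epsilon> P) \<and> real (card C) = exp (h n m) \<and>
      real (card {G \<in> ind_C4_free_graphs n m. \<not> (\<exists>P\<in>C. contained_in G P)})
        \<le> exp (- lam * real m) * real (card (ind_C4_free_graphs n m))"
    if adm: "admissible lam n m" for n m
  proof -
    have q: "Q n m (Cf n m)" by (rule Cf[OF adm])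
    then have "real (card (Cf n m)) = exp (h n m)" unfolding h_def Q_def by simp
    then show ?thesis using q unfolding Q_def by (intro exI[of _ "Cf n m"] conjI) simp_all
  qed
  ultimately show "\<exists>lam::real. lam > 0 \<and>
       (\<exists>h :: nat \<Rightarrow> nat \<Rightarrow> real. little_o_m lam h \<and>
         (\<forall>n m :: nat. admissible lam n m \<longrightarrow>
           (\<exists>C :: pregraph set.
              (\<forall>P\<in>C. almost_split n \<epsilon> P) \<and>
              real (card C) = exp (h n m) \<and>
              real (card {G \<in> ind_C4_free_graphs n m. \<not> (\<exists>P\<in>C. contained_in G P)})
                \<le> exp (- lam * real m) * real (card (ind_C4_free_graphs n m)))))"
    using lam0 by (intro exI[of _ lam] exI[of _ h] conjI allI impI)
qed

end
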